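(* Let $(\mathbf u_h,p_h,\varrho_h)$ be a discrete solution (as defined in the context), and split $\mathbf u_h=\mathbf u_h^0+\mathbf u_h^\perp$ with $\mathbf u_h^0\in\mathbf V_h^0$ and $\mathbf u_h^\perp\in\mathbf V_h^\perp$. Then for all $\mathbf v_h^0\in\mathbf V_h^0$ $$a_1(\mathbf u_h^0,\mathbf v_h^0)=F(\Pi\mathbf v_h^0)+G(\varrho_h,\Pi\mathbf v_h^0)=\big(\mathbb P(\mathbf f+\varrho_h\mathbf g),\Pi\mathbf v_h^0\big),$$ where $(\cdot,\cdot)$ is the $\mathbf L^2(\Omega)$ inner product; that is, the discretely divergence-free part $\mathbf u_h^0$ solves a pressure-robust discretization of the incompressible Stokes problem.
   Context: Setting. $\Omega\subset\mathbb R^d$, $d\in\{2,3\}$, is a bounded polyhedral Lipschitz domain; $\mathbf f\in\mathbf L^2(\Omega)$, $\mathbf g\in\mathbf L^\infty(\Omega)$; $\mu>0$ and $\lambda\in\mathbb R$ with $\lambda\ge\underline\lambda>-2\mu$; $c>0$; $M>0$ is the prescribed total mass. Bold letters denote $\mathbb R^d$-valued functions and spaces of such functions. $\boldsymbol\epsilon(\mathbf u)=\frac12(\nabla\mathbf u+(\nabla\mathbf u)^T)$. Forms: $a_1(\mathbf u,\mathbf v)=2\mu\int_\Omega\boldsymbol\epsilon(\mathbf u):\boldsymbol\epsilon(\mathbf v)\,dx$, $a_2(\mathbf u,\mathbf v)=\lambda\int_\Omega \mathrm{div}(\mathbf u)\,\mathrm{div}(\mathbf v)\,dx$, $b(p,\mathbf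 v)=-\int_\Omega p\,\mathrm{div}(\mathbf v)\,dx$, $F(\mathbf v)=\int_\Omega\mathbf f\cdot\mathbf v\,dx$, $G(\varrho,\mathbf v)=\int_\Omega\varrho\,\mathbf g\cdot\mathbf v\,dx$. Helmholtz--Hodge projector: $\mathbf L^2_\sigma=\{\mathbf v\in\mathbf L^2(\Omega):(\mathbf v,\nabla\phi)=0\ \text{for all }\phi\in H^1(\Omega)\}$ and $\mathbb P:\mathbf L^2(\Omega)\to\mathbf L^2_\sigma$ is the $\mathbf L^2$-orthogonal projector. Discrete spaces. $\mathcal T$ is a shape-regular conforming simplicial triangulation of $\Omega$ with faces $\mathcal F$ and interior faces $\mathcal F(\Omega)$; $P_k(\mathcal T)$ is the space of piecewise polynomials of degree at most $k$. The Bernardi--Raugel velocity space is $\mathbf V_h=(\mathbf P_1(\mathcal T)\cap\mathbf H^1_0(\Omega))\oplus\mathrm{span}\{b_F\mathbf n_F:F\in\mathcal F(\Omega)\}$, where $\mathbf n_F$ is a fixed unit normal of $F$ and $b_F$ is the standard face bubble (the product of the $d$ nodal $P_1$ basis functions associated with the vertices of $F$). $\mathrm{div}_h\mathbf v_h=\pi_0(\mathrm{div}\,\mathbf v_h)$ with $\pi_0$ the $L^2$ projection onto piecewise constants. $\mathbf V_h^0=\{\mathbf v_h\in\mathbf V_h:\mathrm{div}_h\mathbf v_h=0\}$ and $\mathbf V_h^\perp=\{\mathbf v_h\in\mathbf V_h:(\boldsymbol\epsilon(\mathbf v_h),\boldsymbol\epsilon(\mathbf w_h^0))=0\ \text{for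 all }\mathbf w_h^0\in\mathbf V_h^0\}$, so $\mathbf V_h=\mathbf V_h^0\oplus\mathbf V_h^\perp$. $\Pi$ is the standard $\mathrm{BDM}_1$ interpolator: $\Pi\mathbf v$ is the $\mathbf H(\mathrm{div})$-conforming, piecewise affine vector field with $\int_F q_h(\Pi\mathbf v-\mathbf v)\cdot\mathbf n_F\,ds=0$ for all $q_h\in P_1(F)$, $F\in\mathcal F$. Upwind divergence. For $\mathbf u_h\in\mathbf V_h$, $\varrho_h\in P_0(\mathcal T)$, $T\in\mathcal T$ and a face $F$ of $T$ let $u_{T,F}=\int_F\mathbf u_h\cdot\mathbf n_T\,ds$ with $\mathbf n_T$ the outer unit normal of $T$, and $u_{T,F}=u_{T,F}^+-u_{T,F}^-$ its decomposition into positive and negative parts. Then $\mathrm{div}_{\mathrm{upw}}(\varrho_h\mathbf u_h)|_T=\frac1{|T|}\sum_{F=\partial T\cap\partial L\in\mathcal F(\Omega)}\big(u_{T,F}^+\varrho_h|_T-u_{T,F}^-\varrho_h|_L\big)$, where $L$ is the neighbour of $T$ across $F$. Discrete solution: a triple $(\mathbf u_h,p_h,\varrho_h)\in\mathbf V_h\times P_0(\mathcal T)\times P_0(\mathcal T)$ with $\varrho_h\ge0$ and $\int_\Omega\varrho_h\,dx=M$ such that $a_1(\mathbf u_h,\mathbf v_h)+a_2(\Pi\mathbf u_h,\Pi\mathbf v_h)+b(p_h,\mathbf v_h)=F(\Pi\mathbf v_h)+G(\varrho_h,\Pi\mathbf v_h)$ for all $\mathbf v_h\in\mathbf V_h$,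 $\mathrm{div}_{\mathrm{upw}}(\varrho_h\mathbf u_h)=0$, and $p_h=c\varrho_h$. *)

theory Defs
  imports "HOL-Analysis.Analysis"
begin

section \<open>Domains\<close>

text \<open>Near every boundary point the set lies strictly above the graph of a Lipschitz function in
  some direction \<open>e\<close>; the graph lives over the hyperplane orthogonal to \<open>e\<close>.\<close>

definition lipschitz_boundary :: "(real^'n) set \<Rightarrow> bool" where
  "lipschitz_boundary \<Omega> \<longleftrightarrow>
     (\<forall>x\<in>frontier \<Omega>. \<exists>e r C \<psi>. norm e = 1 \<and> 0 < r \<and> C-lipschitz_on {y. e \<bullet> y = 0} \<psi> \<and>
        (\<forall>y\<in>ball x r. y \<in> \<Omega> \<longleftrightarrow> \<psi> (y - (e \<bullet> y) *\<^sub>R e) < e \<bullet> y))"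

definition polyhedral_lipschitz_domain :: "(real^'n) set \<Rightarrow> bool" where
  "polyhedral_lipschitz_domain \<Omega> \<longleftrightarrow>
     open \<Omega> \<and> connected \<Omega> \<and> \<Omega> \<noteq> {} \<and> bounded \<Omega> \<and> lipschitz_boundary \<Omega> \<and>
     (\<exists>\<P>. finite \<P> \<and> (\<forall>P\<in>\<P>. polytope P) \<and> closure \<Omega> = \<Union>\<P>)"


section \<open>Lebesgue and Sobolev spaces\<close>

text \<open>Elements of function spaces are functions on the whole space of which only the values on
  \<open>\<Omega>\<close>, up to null sets, matter. There is no passage to equivalence classes; equality of
  elements is therefore stated almost everywhere.\<close>

definition L2 :: "(real^'n) set \<Rightarrow> (real^'n \<Rightarrow> 'b::euclidean_space) set" where
  "L2 \<Omega> = {f. f \<in> borel_measurable (lebesgue_on \<Omega>) \<and>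
              integrable (lebesgue_on \<Omega>) (\<lambda>x. (norm (f x))\<^sup>2)}"

definition Linfty :: "(real^'n) set \<Rightarrow> (real^'n \<Rightarrow> 'b::euclidean_space) set" where
  "Linfty \<Omega> = {f. f \<in> borel_measurable (lebesgue_on \<Omega>) \<and>
                  (\<exists>C. AE x in lebesgue_on \<Omega>. norm (f x) \<le> C)}"

text \<open>For matrix-valued functions \<open>\<bullet>\<close> is the Frobenius product.\<close>

definition L2_inner ::
    "(real^'n) set \<Rightarrow> (real^'n \<Rightarrow> 'b::euclidean_space) \<Rightarrow> (real^'n \<Rightarrow> 'b) \<Rightarrow> real" where
  "L2_inner \<Omega> f g = (LINT x|lebesgue_on \<Omega>. f x \<bullet> g x)"

definition is_L2_projection ::
    "(real^'n) set \<Rightarrow> (real^'n \<Rightarrow> 'b::euclidean_space) set \<Rightarrow> (real^'n \<Rightarrow> 'b) \<Rightarrow> (real^'n \<Rightarrow> 'b) \<Rightarrow> bool"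
  where
  "is_L2_projection \<Omega> S w z \<longleftrightarrow> z \<in> S \<and> (\<forall>s\<in>S. L2_inner \<Omega> (\<lambda>x. w x - z x) s = 0)"

definition L2_proj ::
    "(real^'n) set \<Rightarrow> (real^'n \<Rightarrow> 'b::euclidean_space) set \<Rightarrow> (real^'n \<Rightarrow> 'b) \<Rightarrow> real^'n \<Rightarrow> 'b" where
  "L2_proj \<Omega> S w = (SOME z. is_L2_projection \<Omega> S w z)"

text \<open>\<open>D [i\<^sub>1, \<dots>, i\<^sub>k]\<close> is the iterated partial derivative of \<open>\<phi>\<close> in the directions
  \<open>i\<^sub>k, \<dots>, i\<^sub>1\<close>. Each of these is differentiable, hence continuous.\<close>

definition smooth :: "(real^'n \<Rightarrow> real) \<Rightarrow> bool" where
  "smooth \<phi> \<longleftrightarrow> (\<exists>D :: 'n list \<Rightarrow> real^'n \<Rightarrow> real. D [] = \<phi> \<and>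
     (\<forall>is x. (D is has_derivative (\<lambda>h. \<Sum>i\<in>UNIV. h $ i * D (i # is) x)) (at x)))"

definition test_function :: "(real^'n) set \<Rightarrow> (real^'n \<Rightarrow> real) \<Rightarrow> bool" where
  "test_function \<Omega> \<phi> \<longleftrightarrow>
     smooth \<phi> \<and> compact (closure {x. \<phi> x \<noteq> 0}) \<and> closure {x. \<phi> x \<noteq> 0} \<subseteq> \<Omega>"

definition grad :: "(real^'n \<Rightarrow> real) \<Rightarrow> real^'n \<Rightarrow> real^'n" where
  "grad \<phi> x = (\<chi> i. frechet_derivative \<phi> (at x) (axis i 1))"

definition has_weak_grad ::
    "(real^'n) set \<Rightarrow> (real^'n \<Rightarrow> real) \<Rightarrow> (real^'n \<Rightarrow> real^'n) \<Rightarrow> bool" where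
  "has_weak_grad \<Omega> u w \<longleftrightarrow> u \<in> L2 \<Omega> \<and> w \<in> L2 \<Omega> \<and>
     (\<forall>\<phi>. test_function \<Omega> \<phi> \<longrightarrow>
        (LINT x|lebesgue_on \<Omega>. u x *\<^sub>R grad \<phi> x) = - (LINT x|lebesgue_on \<Omega>. \<phi> x *\<^sub>R w x))"

definition has_weak_div ::
    "(real^'n) set \<Rightarrow> (real^'n \<Rightarrow> real^'n) \<Rightarrow> (real^'n \<Rightarrow> real) \<Rightarrow> bool" where
  "has_weak_div \<Omega> v q \<longleftrightarrow> v \<in> L2 \<Omega> \<and> q \<in> L2 \<Omega> \<and>
     (\<forall>\<phi>. test_function \<Omega> \<phi> \<longrightarrow> L2_inner \<Omega> v (grad \<phi>) = - L2_inner \<Omega> q \<phi>)"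

definition weak_grad :: "(real^'n) set \<Rightarrow> (real^'n \<Rightarrow> real) \<Rightarrow> real^'n \<Rightarrow> real^'n" where
  "weak_grad \<Omega> u = (SOME w. has_weak_grad \<Omega> u w)"

definition weak_div :: "(real^'n) set \<Rightarrow> (real^'n \<Rightarrow> real^'n) \<Rightarrow> real^'n \<Rightarrow> real" where
  "weak_div \<Omega> v = (SOME q. has_weak_div \<Omega> v q)"

definition H1 :: "(real^'n) set \<Rightarrow> (real^'n \<Rightarrow> real) set" where
  "H1 \<Omega> = {u. \<exists>w. has_weak_grad \<Omega> u w}"

definition H10 :: "(real^'n) set \<Rightarrow> (real^'n \<Rightarrow> real) set" where
  "H10 \<Omega> = {u \<in> H1 \<Omega>. \<exists>\<phi>. (\<forall>k::nat. test_function \<Omega> (\<phi> k)) \<and>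
     (\<lambda>k. LINT x|lebesgue_on \<Omega>. (norm (\<phi> k x - u x))\<^sup>2) \<longlonglongrightarrow> 0 \<and>
     (\<lambda>k. LINT x|lebesgue_on \<Omega>. (norm (grad (\<phi> k) x - weak_grad \<Omega> u x))\<^sup>2) \<longlonglongrightarrow> 0}"

definition Hdiv :: "(real^'n) set \<Rightarrow> (real^'n \<Rightarrow> real^'n) set" where
  "Hdiv \<Omega> = {v. \<exists>q. has_weak_div \<Omega> v q}"

definition weak_jacobian :: "(real^'n) set \<Rightarrow> (real^'n \<Rightarrow> real^'n) \<Rightarrow> real^'n \<Rightarrow> real^'n^'n" where
  "weak_jacobian \<Omega> u x = (\<chi> i. weak_grad \<Omega> (\<lambda>y. u y $ i) x)"

definition sym_grad :: "(real^'n) set \<Rightarrow> (real^'n \<Rightarrow> real^'n) \<Rightarrow> real^'n \<Rightarrow> real^'n^'n" where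
  "sym_grad \<Omega> u x = (1/2) *\<^sub>R (weak_jacobian \<Omega> u x + transpose (weak_jacobian \<Omega> u x))"

definition L2_sigma :: "(real^'n) set \<Rightarrow> (real^'n \<Rightarrow> real^'n) set" where
  "L2_sigma \<Omega> = {v \<in> L2 \<Omega>. \<forall>\<phi>\<in>H1 \<Omega>. L2_inner \<Omega> v (weak_grad \<Omega> \<phi>) = 0}"

definition helmholtz_projector :: "(real^'n) set \<Rightarrow> (real^'n \<Rightarrow> real^'n) \<Rightarrow> real^'n \<Rightarrow> real^'n" where
  "helmholtz_projector \<Omega> = L2_proj \<Omega> (L2_sigma \<Omega>)"


section \<open>Continuous forms\<close>

definition form_a1 ::
    "(real^'n) set \<Rightarrow> real \<Rightarrow> (real^'n \<Rightarrow> real^'n) \<Rightarrow> (real^'n \<Rightarrow> real^'n) \<Rightarrow> real" where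
  "form_a1 \<Omega> \<mu> u v = 2 * \<mu> * L2_inner \<Omega> (sym_grad \<Omega> u) (sym_grad \<Omega> v)"

definition form_a2 ::
    "(real^'n) set \<Rightarrow> real \<Rightarrow> (real^'n \<Rightarrow> real^'n) \<Rightarrow> (real^'n \<Rightarrow> real^'n) \<Rightarrow> real" where
  "form_a2 \<Omega> lam u v = lam * L2_inner \<Omega> (weak_div \<Omega> u) (weak_div \<Omega> v)"

definition form_b :: "(real^'n) set \<Rightarrow> (real^'n \<Rightarrow> real) \<Rightarrow> (real^'n \<Rightarrow> real^'n) \<Rightarrow> real" where
  "form_b \<Omega> p v = - L2_inner \<Omega> p (weak_div \<Omega> v)"

definition form_F :: "(real^'n) set \<Rightarrow> (real^'n \<Rightarrow> real^'n) \<Rightarrow> (real^'n \<Rightarrow> real^'n) \<Rightarrow> real" where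
  "form_F \<Omega> f v = L2_inner \<Omega> f v"

definition form_G ::
    "(real^'n) set \<Rightarrow> (real^'n \<Rightarrow> real^'n) \<Rightarrow> (real^'n \<Rightarrow> real) \<Rightarrow> (real^'n \<Rightarrow> real^'n) \<Rightarrow> real" where
  "form_G \<Omega> g \<rho> v = L2_inner \<Omega> (\<lambda>x. \<rho> x *\<^sub>R g x) v"


section \<open>Meshes\<close>

text \<open>Elements are closed simplices; conformity is part of \<^const>\<open>triangulation\<close>.\<close>

definition mesh_of :: "(real^'n) set \<Rightarrow> (real^'n) set set \<Rightarrow> bool" where
  "mesh_of \<Omega> \<T> \<longleftrightarrow> triangulation \<T> \<and> (\<forall>T\<in>\<T>. int CARD('n) simplex T) \<and> \<Union>\<T> = closure \<Omega>"

definition shape_regular :: "real \<Rightarrow> (real^'n) set set \<Rightarrow> bool" where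
  "shape_regular \<kappa> \<T> \<longleftrightarrow> (\<forall>T\<in>\<T>. \<exists>x r. 0 < r \<and> cball x r \<subseteq> T \<and> diameter T \<le> \<kappa> * r)"

definition mesh_faces :: "(real^'n) set set \<Rightarrow> (real^'n) set set" where
  "mesh_faces \<T> = {F. \<exists>T\<in>\<T>. F facet_of T}"

definition interior_faces :: "(real^'n) set \<Rightarrow> (real^'n) set set \<Rightarrow> (real^'n) set set" where
  "interior_faces \<Omega> \<T> = {F \<in> mesh_faces \<T>. \<not> F \<subseteq> frontier \<Omega>}"

definition mesh_vertices :: "(real^'n) set set \<Rightarrow> (real^'n) set" where
  "mesh_vertices \<T> = {z. \<exists>T\<in>\<T>. z extreme_point_of T}"

definition unit_face_normals :: "(real^'n) set set \<Rightarrow> ((real^'n) set \<Rightarrow> real^'n) \<Rightarrow> bool" where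
  "unit_face_normals \<T> n \<longleftrightarrow>
     (\<forall>F\<in>mesh_faces \<T>. norm (n F) = 1 \<and> (\<forall>x\<in>F. \<forall>y\<in>F. n F \<bullet> (x - y) = 0))"

definition outer_normal :: "(real^'n) set \<Rightarrow> (real^'n) set \<Rightarrow> real^'n" where
  "outer_normal T F = (THE n. norm n = 1 \<and> (\<forall>x\<in>F. \<forall>y\<in>T. n \<bullet> (y - x) \<le> 0))"

text \<open>Surface integral over a flat face \<open>F\<close> of codimension one. The domain of integration is the
  right prism of thickness one with mid-surface \<open>F\<close>, on which \<open>h\<close> is extended constantly in the
  normal direction; \<open>closest_point (affine hull F)\<close> is the orthogonal projection onto the
  hyperplane of \<open>F\<close>. By Fubini this is the integral of \<open>h\<close> over \<open>F\<close> with respect to the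
  surface measure.\<close>

definition face_integral :: "(real^'n) set \<Rightarrow> (real^'n \<Rightarrow> real) \<Rightarrow> real" where
  "face_integral F h =
     (LINT x : {x. closest_point (affine hull F) x \<in> F \<and>
                   dist x (closest_point (affine hull F) x) \<le> 1/2} | lebesgue.
        h (closest_point (affine hull F) x))"

text \<open>One-sided trace: the value at a point of \<open>T\<close> (typically on its boundary) of a function that
  is given in the interior of \<open>T\<close> only.\<close>

definition elem_trace :: "(real^'n) set \<Rightarrow> (real^'n \<Rightarrow> 'b::euclidean_space) \<Rightarrow> real^'n \<Rightarrow> 'b" where
  "elem_trace T v x = Lim (at x within interior T) v"


section \<open>Discrete spaces\<close>

text \<open>Piecewise polynomials are unconstrained on the skeleton of the mesh, which is a null set.\<close>

definition P0 :: "(real^'n) set set \<Rightarrow> (real^'n \<Rightarrow> real) set" where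
  "P0 \<T> = {q. \<forall>T\<in>\<T>. \<exists>c. \<forall>x\<in>interior T. q x = c}"

definition P1_vec :: "(real^'n) set set \<Rightarrow> (real^'n \<Rightarrow> real^'n) set" where
  "P1_vec \<T> = {v. \<forall>T\<in>\<T>. \<exists>A b. \<forall>x\<in>interior T. v x = A *v x + b}"

definition elem_value :: "(real^'n) set \<Rightarrow> (real^'n \<Rightarrow> real) \<Rightarrow> real" where
  "elem_value T q = (THE c. \<forall>x\<in>interior T. q x = c)"

definition nodal_basis :: "(real^'n) set set \<Rightarrow> real^'n \<Rightarrow> real^'n \<Rightarrow> real" where
  "nodal_basis \<T> z = (THE \<phi>. (\<forall>T\<in>\<T>. \<exists>a b. \<forall>x\<in>T. \<phi> x = a \<bullet> x + b) \<and>
     (\<forall>y\<in>mesh_vertices \<T>. \<phi> y = (if y = z then 1 else 0)) \<and> (\<forall>x. x \<notin> \<Union>\<T> \<longrightarrow> \<phi> x = 0))"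

definition face_bubble :: "(real^'n) set set \<Rightarrow> (real^'n) set \<Rightarrow> real^'n \<Rightarrow> real" where
  "face_bubble \<T> F x = (\<Prod>z\<in>{z. z extreme_point_of F}. nodal_basis \<T> z x)"

definition V_h ::
    "(real^'n) set \<Rightarrow> (real^'n) set set \<Rightarrow> ((real^'n) set \<Rightarrow> real^'n) \<Rightarrow> (real^'n \<Rightarrow> real^'n) set" where
  "V_h \<Omega> \<T> n = {\<lambda>x. w x + (\<Sum>F\<in>interior_faces \<Omega> \<T>. a F *\<^sub>R (face_bubble \<T> F x *\<^sub>R n F)) | w a.
     w \<in> P1_vec \<T> \<and> (\<forall>i. (\<lambda>x. w x $ i) \<in> H10 \<Omega>)}"

definition div_h ::
    "(real^'n) set \<Rightarrow> (real^'n) set set \<Rightarrow> (real^'n \<Rightarrow> real^'n) \<Rightarrow> real^'n \<Rightarrow> real" where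
  "div_h \<Omega> \<T> v = L2_proj \<Omega> (P0 \<T>) (weak_div \<Omega> v)"

definition V_h0 ::
    "(real^'n) set \<Rightarrow> (real^'n) set set \<Rightarrow> ((real^'n) set \<Rightarrow> real^'n) \<Rightarrow> (real^'n \<Rightarrow> real^'n) set" where
  "V_h0 \<Omega> \<T> n = {v \<in> V_h \<Omega> \<T> n. AE x in lebesgue_on \<Omega>. div_h \<Omega> \<T> v x = 0}"

definition V_h_perp ::
    "(real^'n) set \<Rightarrow> (real^'n) set set \<Rightarrow> ((real^'n) set \<Rightarrow> real^'n) \<Rightarrow> (real^'n \<Rightarrow> real^'n) set" where
  "V_h_perp \<Omega> \<T> n = {v \<in> V_h \<Omega> \<T> n.
     \<forall>w\<in>V_h0 \<Omega> \<T> n. L2_inner \<Omega> (sym_grad \<Omega> v) (sym_grad \<Omega> w) = 0}"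

text \<open>The moments are taken with the traces from every element adjacent to a face; since the
  normal components of \<open>v\<close> and \<open>w\<close> are continuous across interior faces, the choice of the
  adjacent element is immaterial.\<close>

definition is_BDM1_interpolant ::
    "(real^'n) set \<Rightarrow> (real^'n) set set \<Rightarrow> ((real^'n) set \<Rightarrow> real^'n) \<Rightarrow>
     (real^'n \<Rightarrow> real^'n) \<Rightarrow> (real^'n \<Rightarrow> real^'n) \<Rightarrow> bool" where
  "is_BDM1_interpolant \<Omega> \<T> n v w \<longleftrightarrow> w \<in> Hdiv \<Omega> \<and> w \<in> P1_vec \<T> \<and>
     (\<forall>T\<in>\<T>. \<forall>F. F facet_of T \<longrightarrow>
        (\<forall>a b. face_integral F
           (\<lambda>x. (a \<bullet> x + b) * ((elem_trace T w x - elem_trace T v x) \<bullet> n F)) = 0))"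


section \<open>The discrete compressible Stokes problem\<close>

definition face_flux :: "(real^'n \<Rightarrow> real^'n) \<Rightarrow> (real^'n) set \<Rightarrow> (real^'n) set \<Rightarrow> real" where
  "face_flux u T F = face_integral F (\<lambda>x. elem_trace T u x \<bullet> outer_normal T F)"

definition neighbour :: "(real^'n) set set \<Rightarrow> (real^'n) set \<Rightarrow> (real^'n) set \<Rightarrow> (real^'n) set" where
  "neighbour \<T> T F = (THE L. L \<in> \<T> \<and> L \<noteq> T \<and> F facet_of L)"

definition div_upw ::
    "(real^'n) set \<Rightarrow> (real^'n) set set \<Rightarrow> (real^'n \<Rightarrow> real) \<Rightarrow> (real^'n \<Rightarrow> real^'n) \<Rightarrow>
     (real^'n) set \<Rightarrow> real" where
  "div_upw \<Omega> \<T> \<rho> u T = 1 / measure lebesgue T *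
     (\<Sum>F\<in>{F \<in> interior_faces \<Omega> \<T>. F facet_of T}.
        max (face_flux u T F) 0 * elem_value T \<rho>
        - max (- face_flux u T F) 0 * elem_value (neighbour \<T> T F) \<rho>)"

definition discrete_solution ::
    "(real^'n) set \<Rightarrow> (real^'n) set set \<Rightarrow> ((real^'n) set \<Rightarrow> real^'n) \<Rightarrow>
     ((real^'n \<Rightarrow> real^'n) \<Rightarrow> (real^'n \<Rightarrow> real^'n)) \<Rightarrow> real \<Rightarrow> real \<Rightarrow> real \<Rightarrow> real \<Rightarrow>
     (real^'n \<Rightarrow> real^'n) \<Rightarrow> (real^'n \<Rightarrow> real^'n) \<Rightarrow>
     (real^'n \<Rightarrow> real^'n) \<Rightarrow> (real^'n \<Rightarrow> real) \<Rightarrow> (real^'n \<Rightarrow> real) \<Rightarrow> bool" where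
  "discrete_solution \<Omega> \<T> n Pi_h \<mu> lam c M f g u p \<rho> \<longleftrightarrow>
     u \<in> V_h \<Omega> \<T> n \<and> p \<in> P0 \<T> \<and> \<rho> \<in> P0 \<T> \<and>
     (AE x in lebesgue_on \<Omega>. 0 \<le> \<rho> x) \<and> (LINT x|lebesgue_on \<Omega>. \<rho> x) = M \<and>
     (\<forall>v\<in>V_h \<Omega> \<T> n.
        form_a1 \<Omega> \<mu> u v + form_a2 \<Omega> lam (Pi_h u) (Pi_h v) + form_b \<Omega> p v
        = form_F \<Omega> f (Pi_h v) + form_G \<Omega> g \<rho> (Pi_h v)) \<and>
     (\<forall>T\<in>\<T>. div_upw \<Omega> \<T> \<rho> u T = 0) \<and>
     (AE x in lebesgue_on \<Omega>. p x = c * \<rho> x)"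

end

(*
For v discretely divergence-free, b(p_h, v) = 0 because p_h is piecewise constant, and a_1 sees only
u_h^0. The interpolant Pi v is exactly solenoidal: testing the BDM moments with constants gives every
element the flux of v, so div (Pi v) = pi_0 (div v) = 0 and the a_2 term drops out; testing them with
the normal trace itself on a boundary facet, where v = 0, shows that this trace is zero there.

Orthogonality of X = Pi v to gradients of H^1 functions needs an argument at the boundary without trace
theory. A cutoff chi_m is built from the barycentric coordinates, zero near the boundary and one outside
a layer of width 1/m. Mollification gives (chi_m X, grad phi) = -(phi, X . grad chi_m) for phi in H^1.
The functions X . grad chi_m are bounded in L^2: along a facet the normal component of X decays linearly,
which compensates the factor m, and around faces of codimension at least two the layer has measure
O(m^-2). As they tend to zero pointwise, the right-hand side tends to zero by Cauchy-Schwarz.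
*)

theory Submission
  imports Defs "HOL-Computational_Algebra.Polynomial"
begin

section \<open>Smooth functions and mollification\<close>

text \<open>The definitions shape the proof: \<open>face_integral\<close> is a volume integral over
  a prism of thickness one, and \<open>H10\<close> is a closure of test functions. Facet terms are
  therefore reached as limits of volume integrals over thin layers. Cutting a layer off a simplex
  leaves a smaller copy of it, and differentiating in the width gives a divergence theorem with one
  weight \<open>\<kappa> a\<close> per facet. Its value is never computed; positivity is enough,
  since moments are compared facet by facet. That v vanishes on the boundary is derived as well: a
  bubble attached to one boundary facet exposes the trace of an affine piece as a square under a
  face integral.

  Elementwise integration by parts of X would produce jump terms, while \<open>Hdiv\<close> speaks
  of test functions only. Hence the cutoff times X is mollified, not \<phi>: its components become
  test functions, with which the weak gradient of any \<phi> can be tested. In the final limit the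
  flux of the cutoff is only known to be bounded, so \<phi> is restricted to the set where that flux
  is nonzero, and its norm there tends to zero.\<close>

coinductive smooth1 :: "(real \<Rightarrow> real) \<Rightarrow> bool" where
  "(\<And>x. (f has_real_derivative f' x) (at x)) \<Longrightarrow> smooth1 f' \<Longrightarrow> smooth1 f"

text \<open>Infinite differentiability is a greatest fixed point, so a membership proof only has to
  exhibit a family of functions closed under differentiation; no formula for the n-th derivative is
  needed.\<close>

lemma smooth1_coinduct:
  assumes "R f" and "\<And>f. R f \<Longrightarrow> \<exists>f'. (\<forall>x. (f has_real_derivative f' x) (at x)) \<and> R f'"
  shows "smooth1 f"
  using assms(1)
proof (coinduction arbitrary: f)
  case smooth1
  then show ?case using assms(2)[OF smooth1] by blast
qed

lemma smooth1_deriv: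
  assumes "smooth1 f"
  shows "\<exists>f'. (\<forall>x. (f has_real_derivative f' x) (at x)) \<and> smooth1 f'"
  using assms by (rule smooth1.cases) auto

text \<open>The candidate relation for the coinduction: products alone are not closed under derivatives.\<close>

inductive sum_of_products :: "(real \<Rightarrow> real) \<Rightarrow> bool" where
  prod: "smooth1 f \<Longrightarrow> smooth1 g \<Longrightarrow> sum_of_products (\<lambda>x. f x * g x)"
| add: "sum_of_products f \<Longrightarrow> sum_of_products g \<Longrightarrow> sum_of_products (\<lambda>x. f x + g x)"

lemma smooth1_mult:
  assumes "smooth1 f" "smooth1 g"
  shows "smooth1 (\<lambda>x. f x * g x)"
proof (rule smooth1_coinduct[of sum_of_products])
  show "sum_of_products (\<lambda>x. f x * g x)" using assms by (rule sum_of_products.prod)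
next
  fix h assume "sum_of_products h"
  then show "\<exists>h'. (\<forall>x. (h has_real_derivative h' x) (at x)) \<and> sum_of_products h'"
  proof induction
    case (prod f g)
    obtain f' where f': "\<And>x. (f has_real_derivative f' x) (at x)" "smooth1 f'"
      using smooth1_deriv[OF prod(1)] by blast
    obtain g' where g': "\<And>x. (g has_real_derivative g' x) (at x)" "smooth1 g'"
      using smooth1_deriv[OF prod(2)] by blast
    have "sum_of_products (\<lambda>x. f' x * g x + f x * g' x)"
      using prod f' g' by (intro sum_of_products.add sum_of_products.prod) auto
    moreover have "((\<lambda>x. f x * g x) has_real_derivative f' x * g x + f x * g' x) (at x)" for x
      using DERIV_mult[OF f'(1) g'(1), of x] by (simp add: mult.commute)
    ultimately show ?case by (intro exI[of _ "\<lambda>x. f' x * g x + f x * g' x"]) simp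
  next
    case (add f g)
    then obtain f' g' where "\<forall>x. (f has_real_derivative f' x) (at x)" "sum_of_products f'"
      "\<forall>x. (g has_real_derivative g' x) (at x)" "sum_of_products g'" by blast
    then show ?case
      by (intro exI[of _ "\<lambda>x. f' x + g' x"]) (auto intro: sum_of_products.add DERIV_add)
  qed
qed

lemma smooth1_affine:
  assumes "smooth1 f"
  shows "smooth1 (\<lambda>x. f (a * x + b))"
\<comment> \<open>The factor \<open>c\<close> collects the powers of \<open>a\<close> that the chain
  rule produces.\<close>
proof (rule smooth1_coinduct[of "\<lambda>h. \<exists>c g. smooth1 g \<and> h = (\<lambda>x. c * g (a * x + b))"])
  show "\<exists>c g. smooth1 g \<and> (\<lambda>x. f (a * x + b)) = (\<lambda>x. c * g (a * x + b))"
    using assms by (intro exI[of _ 1] exI[of _ f]) auto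
next
  fix h assume "\<exists>c g. smooth1 g \<and> h = (\<lambda>x. c * g (a * x + b))"
  then obtain c g where g: "smooth1 g" and h: "h = (\<lambda>x. c * g (a * x + b))" by blast
  obtain g' where g': "\<And>x. (g has_real_derivative g' x) (at x)" "smooth1 g'"
    using smooth1_deriv[OF g] by blast
  have "(h has_real_derivative (c * a) * g' (a * x + b)) (at x)" for x
    unfolding h by (rule derivative_eq_intros DERIV_chain2[OF g'(1)] refl | simp)+
  then show "\<exists>h'. (\<forall>x. (h has_real_derivative h' x) (at x)) \<and>
      (\<exists>c g. smooth1 g \<and> h' = (\<lambda>x. c * g (a * x + b)))"
    using g'(2) by (intro exI[of _ "\<lambda>x. (c * a) * g' (a * x + b)"]) blast
qed

text \<open>Cauchy's flat function: smooth, and positive exactly on the open half-line. The bumps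
  and mollifiers below are built from it.\<close>

definition flat_exp :: "real \<Rightarrow> real" where
  "flat_exp t = (if 0 < t then exp (- (1 / t)) else 0)"

lemma poly_exp_tendsto_0: "((\<lambda>x. poly p x * exp (- x)) \<longlongrightarrow> (0::real)) at_top"
proof -
  have "((\<lambda>x. \<Sum>i\<le>degree p. coeff p i * (x ^ i / exp x)) \<longlongrightarrow> (\<Sum>i\<le>degree p. coeff p i * 0)) at_top"
    by (intro tendsto_intros tendsto_power_div_exp_0)
  moreover have "(\<lambda>x. \<Sum>i\<le>degree p. coeff p i * (x ^ i / exp x)) = (\<lambda>x. poly p x * exp (- x))"
    by (auto simp: poly_altdef sum_distrib_right exp_minus divide_simps intro!: ext)
  ultimately show ?thesis by simp
qed

text \<open>The functions p(1/t) exp(-1/t) for t > 0, continued by 0, with p a polynomial, form a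
  family closed under differentiation.\<close>

lemma smooth1_flat_exp: "smooth1 flat_exp"
proof -
  define R where "R = (\<lambda>f::real\<Rightarrow>real. \<exists>p. f = (\<lambda>t. if 0 < t then poly p (1 / t) * exp (- (1 / t)) else 0))"
  show ?thesis
  proof (rule smooth1_coinduct[of R])
    show "R flat_exp" unfolding R_def flat_exp_def by (intro exI[of _ 1]) auto
  next
    fix f assume "R f"
    then obtain p where f: "f = (\<lambda>t. if 0 < t then poly p (1 / t) * exp (- (1 / t)) else 0)"
      unfolding R_def by blast
    \<comment> \<open>The derivative of p(1/t) exp(-1/t) is (p - p')(1/t) exp(-1/t) / t^2, and
      \<open>[:0, 0, 1:]\<close> is the polynomial X^2.\<close>
    define q where "q = [:0, 0, 1:] * (p - pderiv p)"
    define f' where "f' = (\<lambda>t. if 0 < t then poly q (1 / t) * exp (- (1 / t)) else (0::real))"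
    have "(f has_real_derivative f' x) (at x)" for x
    proof -
      consider "x > 0" | "x < 0" | "x = 0" by linarith
      then show ?thesis
      proof cases
        case 1
        have "((\<lambda>t. poly p (1 / t) * exp (- (1 / t))) has_real_derivative f' x) (at x)"
          using 1 unfolding f'_def q_def
          by (auto intro!: derivative_eq_intros DERIV_chain2[OF poly_DERIV]
              simp: field_simps power2_eq_square)
        then show ?thesis
          by (rule has_field_derivative_transform_within[of _ _ _ _ x]) (use 1 in \<open>auto simp: f dist_real_def\<close>)
      next
        case 2
        have "((\<lambda>t. 0) has_real_derivative f' x) (at x)" using 2 by (auto simp: f'_def)
        then show ?thesis
          by (rule has_field_derivative_transform_within[of _ _ _ _ "-x"]) (use 2 in \<open>auto simp: f dist_real_def\<close>)
      next
        case 3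
        \<comment> \<open>The difference quotient at 0 is of the same type, with polynomial X p; the
          exponential wins as 1/t tends to infinity.\<close>
        have r: "((\<lambda>t. f t / t) \<longlongrightarrow> 0) (at_right 0)"
        proof -
          have "((\<lambda>t. poly (pCons 0 p) (inverse t) * exp (- inverse t)) \<longlongrightarrow> 0) (at_right 0)"
            by (rule filterlim_compose[OF poly_exp_tendsto_0 filterlim_inverse_at_top_right])
          then show ?thesis
            by (rule Lim_transform_eventually)
              (auto simp: f field_simps eventually_at_right_field intro!: exI[of _ 1])
        qed
        have l: "((\<lambda>t. f t / t) \<longlongrightarrow> 0) (at_left 0)"
          by (rule Lim_transform_eventually[OF tendsto_const])
            (auto simp: f eventually_at_left_field intro!: exI[of _ "-1"])
        have "((\<lambda>t. f t / t) \<longlongrightarrow> 0) (at 0)"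
          using l r by (simp add: filterlim_split_at)
        moreover have "f' 0 = 0" "f 0 = 0" by (auto simp: f'_def f)
        ultimately show ?thesis using 3 by (simp add: has_field_derivative_iff)
      qed
    qed
    then show "\<exists>f'. (\<forall>x. (f has_real_derivative f' x) (at x)) \<and> R f'"
      by (intro exI[of _ f']) (auto simp: R_def f'_def)
  qed
qed

section \<open>Smooth functions of several variables and bump functions\<close>

lemma smooth_coinduct:
  fixes \<phi> :: "real^'n \<Rightarrow> real"
  assumes "R \<phi>"
    and step: "\<And>f. R f \<Longrightarrow> \<exists>d. \<forall>i. R (d i) \<and> (\<forall>x. (f has_derivative (\<lambda>h. \<Sum>i\<in>UNIV. h $ i * d i x)) (at x))"
  shows "smooth \<phi>"
proof -
  let ?Q = "\<lambda>f d. R f \<longrightarrow> (\<forall>i. R (d i) \<and> (\<forall>x. (f has_derivative (\<lambda>h. \<Sum>i\<in>UNIV. h $ i * d i x)) (at x)))"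
  have "\<forall>f. \<exists>d. ?Q f d" using step by blast
  then obtain d where "\<forall>f. ?Q f (d f)" using choice[of ?Q] by blast
  then have d: "\<And>f i. R f \<Longrightarrow> R (d f i)"
    "\<And>f x. R f \<Longrightarrow> (f has_derivative (\<lambda>h. \<Sum>i\<in>UNIV. h $ i * d f i x)) (at x)"
    by blast+
  \<comment> \<open>A choice of partial derivatives inside \<open>R\<close> is made once and
    iterated along the index list, which is the family that \<open>smooth\<close> asks for.\<close>
  define D where "D = (\<lambda>is. foldr (\<lambda>i f. d f i) is \<phi>)"
  have R: "R (D is)" for "is" by (induction "is") (auto simp: D_def assms(1) d(1))
  have "(D is has_derivative (\<lambda>h. \<Sum>i\<in>UNIV. h $ i * D (i # is) x)) (at x)" for "is" x
    using d(2)[OF R[of "is"], of x] by (simp add: D_def)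
  moreover have "D [] = \<phi>" by (simp add: D_def)
  ultimately show ?thesis unfolding smooth_def by blast
qed

lemma smooth_step:
  fixes \<phi> :: "real^'n \<Rightarrow> real"
  assumes "smooth \<phi>"
  shows "\<exists>d. (\<forall>i. smooth (d i)) \<and> (\<forall>x. (\<phi> has_derivative (\<lambda>h. \<Sum>i\<in>UNIV. h $ i * d i x)) (at x))"
proof -
  obtain D :: "'n list \<Rightarrow> _" where D: "D [] = \<phi>"
    "\<And>is x. (D is has_derivative (\<lambda>h. \<Sum>i\<in>UNIV. h $ i * D (i # is) x)) (at x)"
    using assms unfolding smooth_def by blast
  have "smooth (D [i])" for i
    unfolding smooth_def
  \<comment> \<open>The head of the list is the derivative taken last, so the derivatives of
    \<open>D [i]\<close> belong to the lists ending in \<open>i\<close>.\<close>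
  proof (intro exI[of _ "\<lambda>is. D (is @ [i])"] conjI allI)
    show "(D (is @ [i]) has_derivative (\<lambda>h. \<Sum>j\<in>UNIV. h $ j * D ((j # is) @ [i]) x)) (at x)" for "is" x
      using D(2)[of "is @ [i]" x] by simp
  qed simp
  moreover have "(\<phi> has_derivative (\<lambda>h. \<Sum>i\<in>UNIV. h $ i * D [i] x)) (at x)" for x
    using D(2)[of "[]" x] D(1) by simp
  ultimately show ?thesis by (intro exI[of _ "\<lambda>i. D [i]"]) simp
qed

lemma smooth_has_derivative:
  assumes "smooth \<phi>"
  shows "(\<phi> has_derivative (\<lambda>h. grad \<phi> x \<bullet> h)) (at x)"
proof -
  obtain d where d: "\<And>x. (\<phi> has_derivative (\<lambda>h. \<Sum>i\<in>UNIV. h $ i * d i x)) (at x)"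
    using smooth_step[OF assms] by blast
  have "grad \<phi> x = (\<chi> i. d i x)"
    unfolding grad_def frechet_derivative_at[OF d, symmetric]
    by (auto simp: vec_eq_iff axis_def if_distrib[of "\<lambda>x. x * _"] sum.delta cong: if_cong)
  then have "(\<lambda>h. grad \<phi> x \<bullet> h) = (\<lambda>h. \<Sum>i\<in>UNIV. h $ i * d i x)"
    by (auto simp: inner_vec_def mult.commute)
  then show ?thesis using d by simp
qed

lemma grad_eqI:
  fixes f :: "real^'n \<Rightarrow> real"
  assumes "(f has_derivative (\<lambda>h. g \<bullet> h)) (at x)"
  shows "grad f x = g"
  unfolding grad_def frechet_derivative_at[OF assms, symmetric]
  by (auto simp: vec_eq_iff inner_axis)

lemma smooth_grad:
  assumes "smooth \<phi>"
  shows "smooth (\<lambda>x. grad \<phi> x $ i)"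
proof -
  obtain d where d: "\<And>i. smooth (d i)" "\<And>x. (\<phi> has_derivative (\<lambda>h. \<Sum>i\<in>UNIV. h $ i * d i x)) (at x)"
    using smooth_step[OF assms] by blast
  have "grad \<phi> x $ i = d i x" for x
    unfolding grad_def frechet_derivative_at[OF d(2), symmetric]
    by (auto simp: vec_eq_iff axis_def if_distrib[of "\<lambda>x. x * _"] sum.delta cong: if_cong)
  then show ?thesis using d(1) by presburger
qed

lemma smooth_continuous: "smooth \<phi> \<Longrightarrow> continuous_on S \<phi>"
  by (meson continuous_at_imp_continuous_on has_derivative_continuous smooth_has_derivative)

lemma smooth_grad_continuous:
  assumes "smooth \<phi>"
  shows "continuous_on S (grad \<phi>)"
proof -
  have "continuous_on S (\<lambda>x. \<chi> i. grad \<phi> x $ i)"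
    by (intro continuous_intros smooth_continuous smooth_grad assms)
  then show ?thesis by simp
qed

lemma smooth_scale:
  assumes "smooth \<phi>"
  shows "smooth (\<lambda>x. c * \<phi> x)"
proof -
  obtain D :: "'a list \<Rightarrow> _" where D: "D [] = \<phi>"
    "\<And>is x. (D is has_derivative (\<lambda>h. \<Sum>i\<in>UNIV. h $ i * D (i # is) x)) (at x)"
    using assms unfolding smooth_def by blast
  show ?thesis unfolding smooth_def
  proof (intro exI[of _ "\<lambda>is x. c * D is x"] conjI allI)
    fix "is" x
    have "((\<lambda>x. c * D is x) has_derivative (\<lambda>h. c * (\<Sum>i\<in>UNIV. h $ i * D (i # is) x))) (at x)"
      by (intro has_derivative_mult_right D)
    then show "((\<lambda>x. c * D is x) has_derivative (\<lambda>h. \<Sum>i\<in>UNIV. h $ i * (c * D (i # is) x))) (at x)"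
      by (simp add: sum_distrib_left mult_ac)
  qed (simp add: D(1))
qed

lemma smooth_reflect:
  assumes "smooth \<phi>"
  shows "smooth (\<lambda>y. \<phi> (z - y))"
proof -
  obtain D :: "'a list \<Rightarrow> _" where D: "D [] = \<phi>"
    "\<And>is x. (D is has_derivative (\<lambda>h. \<Sum>i\<in>UNIV. h $ i * D (i # is) x)) (at x)"
    using assms unfolding smooth_def by blast
  show ?thesis unfolding smooth_def
  \<comment> \<open>Each differentiation of the reflection contributes a factor -1.\<close>
  proof (intro exI[of _ "\<lambda>is y. (-1) ^ length is * D is (z - y)"] conjI allI)
    fix "is" x
    have "((\<lambda>y. D is (z - y)) has_derivative (\<lambda>h. \<Sum>i\<in>UNIV. (- h) $ i * D (i # is) (z - x))) (at x)"
      by (rule has_derivative_compose[OF _ D(2)]) (auto intro!: derivative_eq_intros)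
    then have "((\<lambda>y. (-1) ^ length is * D is (z - y)) has_derivative
        (\<lambda>h. (-1) ^ length is * (\<Sum>i\<in>UNIV. (- h) $ i * D (i # is) (z - x)))) (at x)"
      by (intro has_derivative_mult_right)
    then show "((\<lambda>y. (-1) ^ length is * D is (z - y)) has_derivative
        (\<lambda>h. \<Sum>i\<in>UNIV. h $ i * ((-1) ^ length (i # is) * D (i # is) (z - x)))) (at x)"
      by (simp add: sum_distrib_left mult_ac)
  qed (simp add: D(1))
qed

text \<open>A partial derivative replaces one factor by its derivative, so products of functions of
  one coordinate each form a closed family.\<close>

lemma smooth_coordinate_product:
  fixes h :: "'n::finite \<Rightarrow> real \<Rightarrow> real"
  assumes "\<And>i. smooth1 (h i)"
  shows "smooth (\<lambda>x::real^'n. \<Prod>i\<in>UNIV. h i (x $ i))"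
proof (rule smooth_coinduct[of "\<lambda>f. \<exists>h. (\<forall>i. smooth1 (h i)) \<and> f = (\<lambda>x. \<Prod>i\<in>UNIV. h i (x $ i))"])
  show "\<exists>h'. (\<forall>i. smooth1 (h' i)) \<and> (\<lambda>x::real^'n. \<Prod>i\<in>UNIV. h i (x $ i)) = (\<lambda>x. \<Prod>i\<in>UNIV. h' i (x $ i))"
    using assms by blast
next
  fix f :: "real^'n \<Rightarrow> real"
  assume "\<exists>h. (\<forall>i. smooth1 (h i)) \<and> f = (\<lambda>x. \<Prod>i\<in>UNIV. h i (x $ i))"
  then obtain h where h: "\<And>i. smooth1 (h i)" and f: "f = (\<lambda>x. \<Prod>i\<in>UNIV. h i (x $ i))" by blast
  obtain h' where h': "\<And>i x. (h i has_real_derivative h' i x) (at x)" "\<And>i. smooth1 (h' i)"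
    using choice[of "\<lambda>i f'. (\<forall>x. (h i has_real_derivative f' x) (at x)) \<and> smooth1 f'"] smooth1_deriv[OF h]
    by blast
  define d where "d = (\<lambda>i (x::real^'n). \<Prod>j\<in>UNIV. (h(i := h' i)) j (x $ j))"
  have "(f has_derivative (\<lambda>y. \<Sum>i\<in>UNIV. y $ i * d i x)) (at x)" for x
  proof -
    have 1: "((\<lambda>x. h i (x $ i)) has_derivative (\<lambda>y. h' i (x $ i) * y $ i)) (at x)" for i
      by (rule has_derivative_compose[of "\<lambda>x. x $ i" "\<lambda>y. y $ i" x UNIV "h i"])
        (use h'(1) in \<open>auto simp: has_field_derivative_def intro!: bounded_linear_imp_has_derivative bounded_linear_vec_nth\<close>)
    have "(f has_derivative (\<lambda>y. \<Sum>i\<in>UNIV. (h' i (x $ i) * y $ i) * (\<Prod>j\<in>UNIV-{i}. h j (x $ j)))) (at x)"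
      unfolding f by (rule has_derivative_prod[OF 1])
    moreover have "d i x = h' i (x $ i) * (\<Prod>j\<in>UNIV-{i}. h j (x $ j))" for i
      unfolding d_def by (subst prod.remove[of _ i]) (auto intro!: prod.cong)
    ultimately show ?thesis by (simp add: mult_ac)
  qed
  then show "\<exists>d. \<forall>i. (\<exists>h. (\<forall>i. smooth1 (h i)) \<and> d i = (\<lambda>x. \<Prod>i\<in>UNIV. h i (x $ i))) \<and>
      (\<forall>x. (f has_derivative (\<lambda>y. \<Sum>i\<in>UNIV. y $ i * d i x)) (at x))"
    using h h'(2) by (intro exI[of _ d] allI conjI) (auto simp: d_def intro!: exI[of _ "h(_ := h' _)"])
qed

text \<open>The parameter \<open>k\<close> is a steepness: the set of positivity is the same for all
  k > 0, while for large \<open>k\<close> the function approaches the indicator of that box.\<close>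

definition box_bump :: "real \<Rightarrow> real^'n \<Rightarrow> real^'n \<Rightarrow> real^'n \<Rightarrow> real" where
  "box_bump k a b x = (\<Prod>i\<in>UNIV. flat_exp (k * (x $ i - a $ i)) * flat_exp (k * (b $ i - x $ i)))"

lemma smooth_box_bump: "smooth (box_bump k a b)"
proof -
  have "smooth1 (\<lambda>t. flat_exp (k * t + (- k * a $ i)) * flat_exp ((- k) * t + k * b $ i))" for i
    by (intro smooth1_mult smooth1_affine smooth1_flat_exp)
  then have "smooth (\<lambda>x::real^'a. \<Prod>i\<in>UNIV. (flat_exp (k * x $ i + (- k * a $ i)) * flat_exp ((- k) * x $ i + k * b $ i)))"
    by (rule smooth_coordinate_product)
  then show ?thesis by (simp add: box_bump_def[abs_def] algebra_simps)
qed

lemma flat_exp_bounds: "0 \<le> flat_exp t" "flat_exp t \<le> 1"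
  by (auto simp: flat_exp_def)

lemma box_bump_bounds: "0 \<le> box_bump k a b x" "box_bump k a b x \<le> 1"
  unfolding box_bump_def
  by (auto intro!: prod_nonneg prod_le_1 mult_nonneg_nonneg mult_le_one flat_exp_bounds)

lemma box_bump_pos_iff: "k > 0 \<Longrightarrow> box_bump k a b x \<noteq> 0 \<longleftrightarrow> x \<in> box a b"
  unfolding box_bump_def
  by (auto simp: flat_exp_def mem_box_cart zero_less_mult_iff split: if_splits)

lemma box_bump_tendsto: "(\<lambda>m. box_bump (real (Suc m)) a b x) \<longlonglongrightarrow> indicator (box a b) x"
proof -
  have fe: "(\<lambda>m. flat_exp (real (Suc m) * s)) \<longlonglongrightarrow> (if 0 < s then 1 else 0)" for s
  proof (cases "0 < s")
    case True
    have "(\<lambda>m. exp (- ((1 / s) * inverse (real (Suc m))))) \<longlonglongrightarrow> exp (- ((1 / s) * 0))"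
      by (intro tendsto_intros LIMSEQ_inverse_real_of_nat)
    moreover have "flat_exp (real (Suc m) * s) = exp (- ((1 / s) * inverse (real (Suc m))))" for m
      using True by (auto simp: flat_exp_def field_simps zero_less_mult_iff simp del: of_nat_Suc)
    ultimately show ?thesis using True by simp
  next
    case False
    then have "\<not> 0 < real (Suc m) * s" for m
      using zero_less_mult_pos[of "real (Suc m)" s] by auto
    then show ?thesis using False by (simp add: flat_exp_def del: of_nat_Suc)
  qed
  have "(\<lambda>m. box_bump (real (Suc m)) a b x) \<longlonglongrightarrow>
      (\<Prod>i\<in>UNIV. (if 0 < x $ i - a $ i then 1 else 0) * (if 0 < b $ i - x $ i then 1 else (0::real)))"
    unfolding box_bump_def by (intro tendsto_intros fe)
  also have "(\<Prod>i\<in>UNIV. (if 0 < x $ i - a $ i then 1 else 0) * (if 0 < b $ i - x $ i then 1 else (0::real)))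
      = indicator (box a b) x"
  proof (cases "x \<in> box a b")
    case False
    then obtain i where "\<not> (0 < x $ i - a $ i) \<or> \<not> (0 < b $ i - x $ i)" by (auto simp: mem_box_cart)
    then have "\<exists>i\<in>UNIV. (if 0 < x $ i - a $ i then 1 else 0) * (if 0 < b $ i - x $ i then 1 else (0::real)) = 0"
      by (intro bexI[of _ i]) auto
    then show ?thesis using False by (simp add: prod_zero[OF finite])
  qed (auto simp: mem_box_cart)
  finally show ?thesis .
qed

lemma test_function_box_bump:
  assumes "k > 0" "cbox a b \<subseteq> S"
  shows "test_function S (box_bump k a b)"
proof -
  have "closure {x. box_bump k a b x \<noteq> 0} \<subseteq> cbox a b"
    using assms(1) by (intro closure_minimal) (auto simp: box_bump_pos_iff box_subset_cbox intro: subsetD[OF box_subset_cbox])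
  then show ?thesis
    unfolding test_function_def using assms(2) smooth_box_bump
    by (auto simp: compact_eq_bounded_closed intro: bounded_subset[OF bounded_cbox])
qed

text \<open>Steep bumps turn the hypothesis into vanishing integrals over all boxes inside S, and
  Lebesgue differentiation along shrinking cubes recovers q almost everywhere.\<close>

lemma fundamental_lemma:
  fixes q :: "real^'n \<Rightarrow> real"
  assumes S: "open S" and q: "integrable (lebesgue_on S) q"
    and orth: "\<And>\<phi>. test_function S \<phi> \<Longrightarrow> (LINT x|lebesgue_on S. q x * \<phi> x) = 0"
  shows "AE x in lebesgue_on S. q x = 0"
proof -
  have Sm: "S \<in> sets lebesgue" using S by (intro sets_completionI_sets) simp
  define F where "F = (\<lambda>x. if x \<in> S then q x else 0)"
  have Fi: "integrable lebesgue F"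
  proof -
    have "integrable lebesgue (\<lambda>x. indicator S x *\<^sub>R q x)"
      using q Sm by (simp add: integrable_restrict_space)
    moreover have "(\<lambda>x. indicator S x *\<^sub>R q x) = F" by (auto simp: F_def indicator_def)
    ultimately show ?thesis by simp
  qed
  have qm: "q \<in> borel_measurable (lebesgue_on S)" using q by auto
  have box0: "(LINT x|lebesgue_on S. q x * indicator (box a b) x) = 0" if "cbox a b \<subseteq> S" for a b
  proof -
    have "(\<lambda>m. LINT x|lebesgue_on S. q x * box_bump (real (Suc m)) a b x) \<longlonglongrightarrow> (LINT x|lebesgue_on S. q x * indicator (box a b) x)"
    proof (rule integral_dominated_convergence[where w = "\<lambda>x. norm (q x)"])
      show "(\<lambda>x. q x * box_bump (real (Suc m)) a b x) \<in> borel_measurable (lebesgue_on S)" for m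
        by (intro borel_measurable_times qm measurable_restrict_space1
            borel_measurable_if_I continuous_imp_measurable_on_sets_lebesgue)
          (auto intro!: measurable_completion borel_measurable_continuous_onI smooth_continuous smooth_box_bump simp del: of_nat_Suc)
      show "(\<lambda>x. q x * indicator (box a b) x) \<in> borel_measurable (lebesgue_on S)"
        by (intro borel_measurable_times qm measurable_restrict_space1 borel_measurable_indicator) auto
      show "AE x in lebesgue_on S. (\<lambda>m. q x * box_bump (real (Suc m)) a b x) \<longlonglongrightarrow> q x * indicator (box a b) x"
        by (intro AE_I2 tendsto_intros box_bump_tendsto)
      show "AE x in lebesgue_on S. norm (q x * box_bump (real (Suc m)) a b x) \<le> norm (q x)" for m
        using box_bump_bounds[of "real (Suc m)" a b]
        by (intro AE_I2) (simp add: abs_mult mult_left_le abs_of_nonneg del: of_nat_Suc)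
    qed (use q in auto)
    moreover have "(LINT x|lebesgue_on S. q x * box_bump (real (Suc m)) a b x) = 0" for m
      by (intro orth test_function_box_bump that) auto
    ultimately show ?thesis by (simp add: LIMSEQ_const_iff del: of_nat_Suc)
  qed
  \<comment> \<open>The faces of a box are negligible, so the open box of \<open>box0\<close> may be
    exchanged for the closed one of the differentiation theorem.\<close>
  have int0: "integral (cbox a b) F = 0" if "cbox a b \<subseteq> S" for a b
  proof -
    have "integral (cbox a b) F = (LINT x:cbox a b|lebesgue. F x)"
      by (subst set_lebesgue_integral_eq_integral(2)) (use integrable_mult_indicator[OF _ Fi, of "cbox a b"] in \<open>auto simp: set_integrable_def\<close>)
    also have "\<dots> = (LINT x|lebesgue. indicator (box a b) x *\<^sub>R F x)"
      unfolding set_lebesgue_integral_def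
    proof (rule integral_cong_AE)
      have "negligible (cbox a b - box a b)" by (simp add: negligible_frontier_interval)
      then have "AE x in lebesgue. x \<notin> cbox a b - box a b"
        unfolding negligible_iff_null_sets by (rule AE_not_in)
      then show "AE x in lebesgue. indicator (cbox a b) x *\<^sub>R F x = indicator (box a b) x *\<^sub>R F x"
        by (rule AE_mp) (auto intro!: AE_I2 simp: indicator_def dest: subsetD[OF box_subset_cbox])
    qed (intro borel_measurable_integrable integrable_mult_indicator[OF _ Fi], simp)+
    also have "\<dots> = (LINT x|lebesgue_on S. q x * indicator (box a b) x)"
      using Sm by (subst integral_restrict_space) (auto simp: F_def indicator_def intro!: Bochner_Integration.integral_cong)
    finally show ?thesis using box0[OF that] by simp
  qed
  have "F integrable_on cbox a b" for a b
    using integrable_on_lebesgue[OF Fi] integrable_on_subcbox by blast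
  then obtain N where N: "negligible N"
    "\<And>x e. x \<notin> N \<Longrightarrow> 0 < e \<Longrightarrow> \<exists>d>0. \<forall>h. 0 < h \<and> h < d \<longrightarrow>
        norm (integral (cbox x (x + h *\<^sub>R One)) F /\<^sub>R h ^ DIM(real^'n) - F x) < e"
    using integrable_ccontinuous_explicit[of F] by metis
  have "F x = 0" if "x \<in> S" and xN: "x \<notin> N" for x
  proof (rule ccontr)
    assume nz: "F x \<noteq> 0"
    obtain d where d: "d > 0" "\<And>h. 0 < h \<Longrightarrow> h < d \<Longrightarrow>
        norm (integral (cbox x (x + h *\<^sub>R One)) F /\<^sub>R h ^ DIM(real^'n) - F x) < norm (F x)"
      using N(2)[OF xN, of "norm (F x)"] nz by auto
    obtain r where r: "r > 0" "ball x r \<subseteq> S" using S \<open>x \<in> S\<close> openE by blast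
    \<comment> \<open>Small enough for the differentiation theorem and for the cube with corner x to
      stay in the ball inside S.\<close>
    define h where "h = min (d / 2) (r / (2 * (norm (One::real^'n) + 1)))"
    have h: "0 < h" "h < d" using d r by (auto simp: h_def add_pos_nonneg intro!: divide_pos_pos)
    have "h * norm (One::real^'n) < r"
    proof -
      have "h * norm (One::real^'n) \<le> (r / (2 * (norm (One::real^'n) + 1))) * norm (One::real^'n)"
        by (intro mult_right_mono) (auto simp: h_def)
      also have "\<dots> < r" using r by (simp add: field_simps add_pos_nonneg)
      finally show ?thesis .
    qed
    have "cbox x (x + h *\<^sub>R One) \<subseteq> S"
    proof
      fix y assume y: "y \<in> cbox x (x + h *\<^sub>R One)"
      have "norm (y - x) \<le> norm (h *\<^sub>R One :: real^'n)"
      proof (rule norm_le_componentwise)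
        fix b :: "real^'n" assume b: "b \<in> Basis"
        then have "x \<bullet> b \<le> y \<bullet> b" "y \<bullet> b \<le> x \<bullet> b + h * (One \<bullet> b)"
          using y by (auto simp: mem_box inner_add_left)
        then show "\<bar>(y - x) \<bullet> b\<bar> \<le> \<bar>(h *\<^sub>R One) \<bullet> b\<bar>" by (simp add: inner_diff_left)
      qed
      also have "\<dots> < r" using \<open>h * norm One < r\<close> h by simp
      finally show "y \<in> S" using r by (auto simp: dist_norm norm_minus_commute)
    qed
    then show False using d(2)[OF h] int0 by simp
  qed
  then have "AE x in lebesgue. x \<in> S \<longrightarrow> q x = 0"
    using N(1) by (auto intro!: AE_I'[of N] simp: negligible_iff_null_sets F_def)
  then show ?thesis using Sm by (simp add: AE_restrict_space_iff)
qed

lemma mollifier_exists: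
  assumes "r > 0"
  obtains \<eta> :: "real^'n \<Rightarrow> real" where "smooth \<eta>" "\<And>x. 0 \<le> \<eta> x" "\<And>x. \<eta> x \<noteq> 0 \<Longrightarrow> norm x < r"
    "(LINT x|lebesgue. \<eta> x) = 1"
proof -
  \<comment> \<open>A point of the box has norm at most its l1-norm, which is at most r / 2.\<close>
  define s where "s = r / (2 * CARD('n))"
  define a :: "real^'n" where "a = (\<chi> i. - s)"
  define b :: "real^'n" where "b = (\<chi> i. s)"
  let ?B = "box_bump 1 a b"
  have s: "s > 0" using assms by (simp add: s_def)
  have c: "continuous_on UNIV ?B" by (rule smooth_continuous[OF smooth_box_bump])
  have small: "norm x < r" if "?B x \<noteq> 0" for x
  proof -
    have "x \<in> box a b" using that box_bump_pos_iff[of 1 a b x] by simp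
    then have "norm (x $ i) \<le> s" for i by (auto simp: mem_box_cart a_def b_def abs_le_iff less_imp_le intro!: less_imp_le) (smt (verit))
    then have "norm x \<le> (\<Sum>i\<in>(UNIV::'n set). s)"
      by (intro order_trans[OF norm_le_l1_cart] sum_mono) auto
    also have "\<dots> < r" using assms by (simp add: s_def)
    finally show ?thesis .
  qed
  have int: "integrable lebesgue ?B"
  proof -
    have "integrable lebesgue (\<lambda>x. indicator (cbox a b) x *\<^sub>R ?B x)"
      using c by (intro integrable_completion[THEN iffD2] borel_integrable_compact[unfolded set_integrable_def])
        (auto intro: continuous_on_subset borel_measurable_continuous_onI
          intro!: borel_measurable_times borel_measurable_indicator)
    moreover have "(\<lambda>x. indicator (cbox a b) x *\<^sub>R ?B x) = ?B"
      using box_bump_pos_iff[of 1 a b] subsetD[OF box_subset_cbox[of a b]] by (auto simp: indicator_def fun_eq_iff) 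
    ultimately show ?thesis by simp
  qed
  have pos: "(LINT x|lebesgue. ?B x) > 0"
  proof -
    have "(LINT x|lebesgue. ?B x) \<noteq> 0"
    proof
      assume "(LINT x|lebesgue. ?B x) = 0"
      then have "AE x in lebesgue. ?B x = 0"
        using integral_nonneg_eq_0_iff_AE[OF int] box_bump_bounds by (metis (mono_tags, lifting) AE_I2)
      then have "AE x in lebesgue. x \<notin> box a b"
        by (rule AE_mp) (use box_bump_pos_iff[of 1 a b] in \<open>auto intro!: AE_I2\<close>)
      then have "negligible (box a b)"
        using AE_iff_null_sets[of "box a b" lebesgue] by (auto simp: negligible_iff_null_sets)
      moreover have "0 \<in> box a b" using s by (auto simp: mem_box_cart a_def b_def)
      ultimately show False using open_not_negligible[of "box a b"] by auto
    qed
    moreover have "(LINT x|lebesgue. ?B x) \<ge> 0" by (intro Bochner_Integration.integral_nonneg) (use box_bump_bounds in auto)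
    ultimately show ?thesis by linarith
  qed
  define c where "c = 1 / (LINT x|lebesgue. ?B x)"
  have "c > 0" "c * (LINT x|lebesgue. ?B x) = 1" using pos by (auto simp: c_def)
  then show ?thesis
    using small box_bump_bounds[of 1 a b] smooth_scale[OF smooth_box_bump]
    by (intro that[of "\<lambda>x. c * ?B x"]) auto
qed

section \<open>Convolution with a smooth kernel of compact support\<close>

lemma integrable_bounded_support:
  fixes f :: "real^'n \<Rightarrow> 'b::euclidean_space"
  assumes "f \<in> borel_measurable lebesgue" "\<And>x. norm (f x) \<le> C" "\<And>x. f x \<noteq> 0 \<Longrightarrow> norm x \<le> R"
  shows "integrable lebesgue f"
proof (rule Bochner_Integration.integrable_bound)
  show "integrable lebesgue (\<lambda>x::real^'n. C * indicator (cball 0 R) x)"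
    by (intro integrable_mult_right integrable_real_indicator) (use emeasure_bounded_finite[of "cball (0::real^'n) R"] in \<open>auto simp: emeasure_completion\<close>)
  have "0 \<le> C" using assms(2) norm_ge_zero order_trans by blast
  then have "norm (f x) \<le> norm (C * indicator (cball 0 R) x)" for x
    using assms(2)[of x] assms(3)[of x] by (cases "f x = 0") (auto simp: indicator_def)
  then show "AE x in lebesgue. norm (f x) \<le> norm (C * indicator (cball 0 R) x)" by simp
qed fact

lemma lebesgue_measurable_continuous:
  fixes f :: "real^'n \<Rightarrow> 'b::euclidean_space"
  shows "continuous_on UNIV f \<Longrightarrow> f \<in> borel_measurable lebesgue"
  by (intro measurable_completion) (simp add: borel_measurable_continuous_onI)

lemma smooth_bounded:
  assumes "smooth \<eta>" "\<And>x. \<eta> x \<noteq> 0 \<Longrightarrow> norm x \<le> R"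
  shows "\<exists>C. \<forall>x. \<bar>\<eta> x\<bar> \<le> C"
proof -
  have "bounded (\<eta> ` cball 0 R)"
    by (intro compact_imp_bounded compact_continuous_image smooth_continuous assms) auto
  then obtain C where C: "\<And>x. x \<in> cball 0 R \<Longrightarrow> \<bar>\<eta> x\<bar> \<le> C"
    unfolding bounded_iff by (metis imageI real_norm_def)
  have "\<bar>\<eta> x\<bar> \<le> max C 0" for x
    using C[of x] assms(2)[of x] by (cases "\<eta> x = 0") (auto simp: max_def)
  then show ?thesis by blast
qed

lemma grad_zero_outside:
  assumes "smooth \<eta>" "\<And>x. \<eta> x \<noteq> 0 \<Longrightarrow> norm x \<le> R" "grad \<eta> x \<noteq> 0"
  shows "norm x \<le> R"
proof (rule ccontr)
  assume "\<not> norm x \<le> R"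
  then have x: "x \<in> - cball 0 R" by simp
  have "(\<eta> has_derivative (\<lambda>h. 0)) (at x)"
    by (rule has_derivative_transform_within_open[of "\<lambda>x. 0" _ _ _ "- cball 0 R"])
      (use x assms(2) in auto)
  then have "(\<eta> has_derivative (\<lambda>h. 0 \<bullet> h)) (at x)" by simp
  then show False using grad_eqI assms(3) by blast
qed

lemma grad_bounded:
  fixes \<eta> :: "real^'n \<Rightarrow> real"
  assumes "smooth \<eta>" "\<And>x. \<eta> x \<noteq> 0 \<Longrightarrow> norm x \<le> R"
  shows "\<exists>C. \<forall>x. norm (grad \<eta> x) \<le> C"
proof -
  have "\<exists>C. \<forall>x. \<bar>grad \<eta> x $ i\<bar> \<le> C" for i
    by (rule smooth_bounded[OF smooth_grad[OF assms(1)], of _ R])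
      (metis assms grad_zero_outside zero_index)
  then obtain C where C: "\<And>i x. \<bar>grad \<eta> x $ i\<bar> \<le> C i" by metis
  have "norm (grad \<eta> x) \<le> (\<Sum>i\<in>UNIV. C i)" for x
    by (intro order_trans[OF norm_le_l1_cart] sum_mono C)
  then show ?thesis by blast
qed

lemma smooth_lipschitz:
  fixes \<eta> :: "real^'n \<Rightarrow> real"
  assumes "smooth \<eta>" "\<And>x. norm (grad \<eta> x) \<le> C"
  shows "\<bar>\<eta> y - \<eta> x\<bar> \<le> C * norm (y - x)"
  unfolding real_norm_def[symmetric]
proof (rule differentiable_bound[of UNIV \<eta> "\<lambda>x h. grad \<eta> x \<bullet> h"])
  show "(\<eta> has_derivative (\<lambda>h. grad \<eta> x \<bullet> h)) (at x within UNIV)" for x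
    using smooth_has_derivative[OF assms(1)] by simp
  show "onorm (\<lambda>h. grad \<eta> x \<bullet> h) \<le> C" for x
    by (rule onorm_le) (metis Cauchy_Schwarz_ineq2 assms(2) mult_right_mono norm_ge_zero order_trans real_norm_def)
qed auto

text \<open>The remainder is uniform in x because the second derivatives of a compactly supported
  smooth function are bounded. This uniformity permits differentiation under the convolution
  integral.\<close>

lemma smooth_taylor:
  fixes \<eta> :: "real^'n \<Rightarrow> real"
  assumes "smooth \<eta>" "\<And>x. \<eta> x \<noteq> 0 \<Longrightarrow> norm x \<le> R"
  shows "\<exists>K. \<forall>x h. \<bar>\<eta> (x + h) - \<eta> x - grad \<eta> x \<bullet> h\<bar> \<le> K * (norm h)\<^sup>2"
proof -
  have "\<exists>C. \<forall>x. norm (grad (\<lambda>x. grad \<eta> x $ i) x) \<le> C" for i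
    by (rule grad_bounded[OF smooth_grad[OF assms(1)], of _ R])
      (metis assms grad_zero_outside zero_index)
  then obtain C where C: "\<And>i x. norm (grad (\<lambda>x. grad \<eta> x $ i) x) \<le> C i" by metis
  define K where "K = (\<Sum>i\<in>UNIV. C i)"
  have L: "norm (grad \<eta> y - grad \<eta> x) \<le> K * norm (y - x)" for x y
  proof -
    have "norm (grad \<eta> y - grad \<eta> x) \<le> (\<Sum>i\<in>UNIV. C i * norm (y - x))"
      using smooth_lipschitz[OF smooth_grad[OF assms(1)] C]
      by (intro order_trans[OF norm_le_l1_cart] sum_mono) simp
    then show ?thesis by (simp add: K_def sum_distrib_right)
  qed
  have K0: "0 \<le> K" unfolding K_def by (intro sum_nonneg) (meson C norm_ge_zero order_trans)
  have "\<bar>\<eta> (x + h) - \<eta> x - grad \<eta> x \<bullet> h\<bar> \<le> K * (norm h)\<^sup>2" for x h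
  proof -
    have "norm (\<eta> (x + h) - \<eta> x - grad \<eta> x \<bullet> ((x + h) - x)) \<le> norm ((x + h) - x) * (K * norm h)"
    proof (rule differentiable_bound_linearization[where f' = "\<lambda>y h. grad \<eta> y \<bullet> h" and S = "cball x (norm h)" and f = \<eta>])
      show "x + t *\<^sub>R (x + h - x) \<in> cball x (norm h)" if "t \<in> {0..1}" for t
        using that by (auto simp: dist_norm mult_left_le_one_le)
      show "onorm ((\<lambda>i. grad \<eta> y \<bullet> i) - (\<lambda>i. grad \<eta> x \<bullet> i)) \<le> K * norm h" if "y \<in> cball x (norm h)" for y
      proof (rule onorm_le)
        fix z
        have "norm (grad \<eta> y - grad \<eta> x) \<le> K * norm h"
          using order_trans[OF L[of y x] mult_left_mono[OF _ K0]] that by (simp add: dist_norm norm_minus_commute)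
        then show "norm (((\<lambda>i. grad \<eta> y \<bullet> i) - (\<lambda>i. grad \<eta> x \<bullet> i)) z) \<le> K * norm h * norm z"
          by (simp flip: inner_diff_left) (meson Cauchy_Schwarz_ineq2 mult_right_mono norm_ge_zero order_trans)
      qed
    qed (auto intro!: has_derivative_at_withinI smooth_has_derivative assms)
    then show ?thesis by (simp add: power2_eq_square mult_ac)
  qed
  then show ?thesis by blast
qed

definition conv :: "(real^'n \<Rightarrow> real) \<Rightarrow> (real^'n \<Rightarrow> real) \<Rightarrow> real^'n \<Rightarrow> real" where
  "conv u \<eta> x = (LINT y|lebesgue. u y * \<eta> (x - y))"

lemma integrable_conv:
  fixes u \<eta> :: "real^'n \<Rightarrow> real"
  assumes u: "u \<in> borel_measurable lebesgue" "\<And>x. \<bar>u x\<bar> \<le> U" "\<And>x. u x \<noteq> 0 \<Longrightarrow> norm x \<le> R"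
    and \<eta>: "continuous_on UNIV \<eta>" "\<And>x. \<bar>\<eta> x\<bar> \<le> C"
  shows "integrable lebesgue (\<lambda>y. u y * \<eta> (x - y))"
proof (rule integrable_bounded_support[of _ "U * C" R])
  show "(\<lambda>y. u y * \<eta> (x - y)) \<in> borel_measurable lebesgue"
    by (intro borel_measurable_times u lebesgue_measurable_continuous continuous_on_compose2[OF \<eta>(1)] continuous_intros) auto
  show "norm (u y * \<eta> (x - y)) \<le> U * C" for y
    using u(2)[of y] \<eta>(2)[of "x - y"] by (auto simp: abs_mult intro!: mult_mono order_trans[OF abs_ge_zero u(2)])
qed (use u(3) in auto)

text \<open>Integrating the Taylor remainder of \<eta> over the bounded support of u leaves an error
  of order |h|^2. The derivative falls on the kernel, so discontinuous u are allowed.\<close>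

lemma conv_has_derivative:
  fixes u \<eta> :: "real^'n \<Rightarrow> real"
  assumes u: "u \<in> borel_measurable lebesgue" "\<And>x. \<bar>u x\<bar> \<le> U" "\<And>x. u x \<noteq> 0 \<Longrightarrow> norm x \<le> R"
    and \<eta>: "smooth \<eta>" "\<And>x. \<eta> x \<noteq> 0 \<Longrightarrow> norm x \<le> r"
  shows "(conv u \<eta> has_derivative (\<lambda>h. \<Sum>i\<in>UNIV. h $ i * conv u (\<lambda>x. grad \<eta> x $ i) x)) (at x)"
proof -
  obtain K where K: "\<And>x h. \<bar>\<eta> (x + h) - \<eta> x - grad \<eta> x \<bullet> h\<bar> \<le> K * (norm h)\<^sup>2"
    using smooth_taylor[OF \<eta>] by metis
  obtain C where C: "\<And>x. \<bar>\<eta> x\<bar> \<le> C" using smooth_bounded[OF \<eta>] by metis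
  obtain C' where C': "\<And>x. norm (grad \<eta> x) \<le> C'" using grad_bounded[OF \<eta>] by metis
  have C'': "\<bar>grad \<eta> x $ i\<bar> \<le> C'" for x i
    using C'[of x] component_le_norm_cart[of "grad \<eta> x" i] by simp
  note i0 = integrable_conv[OF u smooth_continuous[OF \<eta>(1)] C]
  note i1 = integrable_conv[OF u smooth_continuous[OF smooth_grad[OF \<eta>(1)]] C'']
  \<comment> \<open>Constant of the remainder: the measure of a ball that contains the support of u,
    times the bounds for u and for the Taylor remainder.\<close>
  define V where "V = (LINT y|lebesgue. indicator (cball (0::real^'n) R) y * (U * K))"
  have Vi: "integrable lebesgue (\<lambda>y. indicator (cball (0::real^'n) R) y * (U * K))"
    by (intro integrable_mult_left integrable_real_indicator) (use emeasure_bounded_finite[of "cball (0::real^'n) R"] in \<open>auto simp: emeasure_completion\<close>)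
  have "norm (conv u \<eta> (x + h) - conv u \<eta> x - (\<Sum>i\<in>UNIV. h $ i * conv u (\<lambda>x. grad \<eta> x $ i) x)) \<le> V * (norm h)\<^sup>2" for h
  proof -
    have eq: "conv u \<eta> (x + h) - conv u \<eta> x - (\<Sum>i\<in>UNIV. h $ i * conv u (\<lambda>x. grad \<eta> x $ i) x)
        = (LINT y|lebesgue. u y * \<eta> (x + h - y) - u y * \<eta> (x - y) - (\<Sum>i\<in>UNIV. h $ i * (u y * grad \<eta> (x - y) $ i)))"
      unfolding conv_def using i0 i1
      by (simp add: Bochner_Integration.integral_diff Bochner_Integration.integral_sum Bochner_Integration.integrable_diff integrable_mult_right)
    have pt: "u y * \<eta> (x + h - y) - u y * \<eta> (x - y) - (\<Sum>i\<in>UNIV. h $ i * (u y * grad \<eta> (x - y) $ i))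
        = u y * (\<eta> ((x - y) + h) - \<eta> (x - y) - grad \<eta> (x - y) \<bullet> h)" for y
    proof -
      have "x + h - y = (x - y) + h" by simp
      then show ?thesis by (simp add: inner_vec_def algebra_simps sum_distrib_left)
    qed
    have "norm (LINT y|lebesgue. u y * (\<eta> ((x - y) + h) - \<eta> (x - y) - grad \<eta> (x - y) \<bullet> h))
        \<le> (LINT y|lebesgue. indicator (cball (0::real^'n) R) y * (U * K) * (norm h)\<^sup>2)"
    proof (rule Bochner_Integration.integral_norm_bound_integral)
      show "integrable lebesgue (\<lambda>y. u y * (\<eta> ((x - y) + h) - \<eta> (x - y) - grad \<eta> (x - y) \<bullet> h))"
        unfolding pt[symmetric] using i0 i1
        by (intro Bochner_Integration.integrable_diff Bochner_Integration.integrable_sum integrable_mult_right)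
      show "integrable lebesgue (\<lambda>y. indicator (cball (0::real^'n) R) y * (U * K) * (norm h)\<^sup>2)"
        by (rule integrable_mult_left) (rule Vi)
      fix y
      show "norm (u y * (\<eta> ((x - y) + h) - \<eta> (x - y) - grad \<eta> (x - y) \<bullet> h)) \<le> indicator (cball (0::real^'n) R) y * (U * K) * (norm h)\<^sup>2"
      proof (cases "u y = 0")
        case True
        have "0 \<le> K * (norm h)\<^sup>2" using K[of x h] by linarith
        moreover have "0 \<le> U" using u(2)[of y] by linarith
        ultimately show ?thesis using True by (auto simp: indicator_def mult.assoc)
      next
        case False
        then have "y \<in> cball 0 R" using u(3) by auto
        then show ?thesis using u(2)[of y] K[of "x - y" h]
          by (auto simp: abs_mult mult.assoc intro!: mult_mono order_trans[OF abs_ge_zero u(2)])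
      qed
    qed
    then show ?thesis unfolding eq pt V_def by simp
  qed
  then have bound: "norm (conv u \<eta> (x + h) - conv u \<eta> x - (\<Sum>i\<in>UNIV. h $ i * conv u (\<lambda>x. grad \<eta> x $ i) x)) / norm h \<le> V * norm h" for h
    by (cases "h = 0") (auto simp: divide_simps power2_eq_square mult_ac)
  have bl: "bounded_linear (\<lambda>h::real^'n. \<Sum>i\<in>UNIV. h $ i * conv u (\<lambda>x. grad \<eta> x $ i) x)"
    by (intro bounded_linear_sum bounded_linear_mult_const bounded_linear_vec_nth)
  have t0: "((\<lambda>h::real^'n. V * norm h) \<longlongrightarrow> 0) (at 0)"
    by (rule tendsto_eq_intros refl | simp)+
  show ?thesis unfolding has_derivative_at
    by (intro conjI bl) (rule Lim_null_comparison[OF _ t0], use bound in auto)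
qed

text \<open>Derivatives of \<open>conv u \<eta>\<close> are convolutions of the same u with
  derivatives of \<eta>, whose support stays in the same ball; this family is closed under
  differentiation.\<close>

lemma smooth_conv:
  fixes u \<eta> :: "real^'n \<Rightarrow> real"
  assumes u: "u \<in> borel_measurable lebesgue" "\<And>x. \<bar>u x\<bar> \<le> U" "\<And>x. u x \<noteq> 0 \<Longrightarrow> norm x \<le> R"
    and \<eta>: "smooth \<eta>" "\<And>x. \<eta> x \<noteq> 0 \<Longrightarrow> norm x \<le> r"
  shows "smooth (conv u \<eta>)"
proof (rule smooth_coinduct[of "\<lambda>f. \<exists>\<eta>. smooth \<eta> \<and> (\<forall>x. \<eta> x \<noteq> 0 \<longrightarrow> norm x \<le> r) \<and> f = conv u \<eta>"])
  show "\<exists>\<eta>'. smooth \<eta>' \<and> (\<forall>x. \<eta>' x \<noteq> 0 \<longrightarrow> norm x \<le> r) \<and> conv u \<eta> = conv u \<eta>'"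
    using \<eta> by blast
next
  fix f assume "\<exists>\<eta>. smooth \<eta> \<and> (\<forall>x. \<eta> x \<noteq> 0 \<longrightarrow> norm x \<le> r) \<and> f = conv u \<eta>"
  then obtain \<eta> where e: "smooth \<eta>" "\<And>x. \<eta> x \<noteq> 0 \<Longrightarrow> norm x \<le> r" and f: "f = conv u \<eta>" by blast
  have supp: "norm x \<le> r" if "grad \<eta> x $ i \<noteq> 0" for x i
    using grad_zero_outside[of \<eta> r x, OF e] that by (metis zero_index)
  show "\<exists>d. \<forall>i. (\<exists>\<eta>. smooth \<eta> \<and> (\<forall>x. \<eta> x \<noteq> 0 \<longrightarrow> norm x \<le> r) \<and> d i = conv u \<eta>) \<and>
      (\<forall>x. (f has_derivative (\<lambda>h. \<Sum>i\<in>UNIV. h $ i * d i x)) (at x))"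
    using conv_has_derivative[OF u e] supp smooth_grad[OF e(1)] f
    by (intro exI[of _ "\<lambda>i. conv u (\<lambda>x. grad \<eta> x $ i)"]) blast
qed

lemma grad_conv:
  fixes u \<eta> :: "real^'n \<Rightarrow> real"
  assumes u: "u \<in> borel_measurable lebesgue" "\<And>x. \<bar>u x\<bar> \<le> U" "\<And>x. u x \<noteq> 0 \<Longrightarrow> norm x \<le> R"
    and \<eta>: "smooth \<eta>" "\<And>x. \<eta> x \<noteq> 0 \<Longrightarrow> norm x \<le> r"
  shows "grad (conv u \<eta>) x $ i = conv u (\<lambda>x. grad \<eta> x $ i) x"
proof -
  have "grad (conv u \<eta>) x = (\<chi> i. conv u (\<lambda>x. grad \<eta> x $ i) x)"
    using conv_has_derivative[OF u \<eta>, of x] by (intro grad_eqI) (simp add: inner_vec_def mult.commute)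
  then show ?thesis by simp
qed

text \<open>The kernel is a probability density, so \<open>conv u \<eta> x - c\<close> is an average
  of u - c over the ball of radius r. Used with c = u x for convergence at continuity points, and
  with c = 0 for a uniform bound.\<close>

lemma conv_abs_le:
  fixes u \<eta> :: "real^'n \<Rightarrow> real"
  assumes u: "u \<in> borel_measurable lebesgue" "\<And>x. \<bar>u x\<bar> \<le> U" "\<And>x. u x \<noteq> 0 \<Longrightarrow> norm x \<le> R"
    and \<eta>: "smooth \<eta>" "\<And>x. 0 \<le> \<eta> x" "\<And>x. \<eta> x \<noteq> 0 \<Longrightarrow> norm x \<le> r" "(LINT x|lebesgue. \<eta> x) = 1"
    and near: "\<And>y. norm (y - x) \<le> r \<Longrightarrow> \<bar>u y - c\<bar> \<le> e"
  shows "\<bar>conv u \<eta> x - c\<bar> \<le> e"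
proof -
  obtain C where C: "\<And>x. \<bar>\<eta> x\<bar> \<le> C" using smooth_bounded[OF \<eta>(1,3)] by metis
  note i0 = integrable_conv[OF u smooth_continuous[OF \<eta>(1)] C]
  have "\<not> integrable lebesgue \<eta> \<Longrightarrow> (LINT x|lebesgue. \<eta> x) = 0" by (rule not_integrable_integral_eq)
  then have \<eta>i: "integrable lebesgue \<eta>" using \<eta>(4) by auto
  have refl: "integrable lebesgue (\<lambda>y. \<eta> (x - y))" "(LINT y|lebesgue. \<eta> (x - y)) = 1"
  proof -
    have m: "\<eta> \<in> borel_measurable lborel" "(\<lambda>y. \<eta> (x - y)) \<in> borel_measurable lborel"
      by (auto intro!: borel_measurable_continuous_onI smooth_continuous smooth_reflect \<eta>(1))
    have L: "integrable lborel \<eta>" "(LINT y|lborel. \<eta> y) = 1"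
      using \<eta>i \<eta>(4) m by (auto simp: integrable_completion integral_completion)
    \<comment> \<open>Reflection invariance: the affine map with factor -1 has Jacobian 1.\<close>
    have d: "(lborel :: (real^'n) measure) = distr lborel borel (\<lambda>y. x - y)"
      using lborel_affine[of "-1" x] by (simp add: density_1)
    have "integrable (distr lborel borel (\<lambda>y. x - y)) \<eta>" using L(1) d by simp
    then have a: "integrable lborel (\<lambda>y. \<eta> (x - y))" by (subst (asm) integrable_distr_eq) (use m in auto)
    have "(LINT y|distr lborel borel (\<lambda>y. x - y). \<eta> y) = 1" using L(2) d by simp
    then have b: "(LINT y|lborel. \<eta> (x - y)) = 1" by (subst (asm) integral_distr) (use m in auto)
    show "integrable lebesgue (\<lambda>y. \<eta> (x - y))" "(LINT y|lebesgue. \<eta> (x - y)) = 1"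
      using a b m by (auto simp: integrable_completion integral_completion)
  qed
  have "conv u \<eta> x - c = (LINT y|lebesgue. u y * \<eta> (x - y) - c * \<eta> (x - y))"
    unfolding conv_def using i0 refl by (simp add: Bochner_Integration.integral_diff)
  also have "\<bar>\<dots>\<bar> \<le> (LINT y|lebesgue. e * \<eta> (x - y))"
    unfolding real_norm_def[symmetric]
  proof (rule Bochner_Integration.integral_norm_bound_integral)
    fix y
    show "norm (u y * \<eta> (x - y) - c * \<eta> (x - y)) \<le> e * \<eta> (x - y)"
    proof (cases "\<eta> (x - y) = 0")
      case False
      then have "norm (y - x) \<le> r" using \<eta>(3) by (metis norm_minus_commute)
      then show ?thesis using near[of y] \<eta>(2)[of "x - y"]
        by (simp add: abs_mult mult_right_mono flip: left_diff_distrib)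
    qed simp
  qed (use i0 refl in auto)
  finally show ?thesis using refl by simp
qed

lemma conv_support:
  assumes "\<And>x. u x \<noteq> 0 \<Longrightarrow> x \<in> K" "\<And>x. \<eta> x \<noteq> 0 \<Longrightarrow> norm x \<le> r" "conv u \<eta> x \<noteq> 0"
  shows "\<exists>y\<in>K. norm (x - y) \<le> r"
proof (rule ccontr)
  assume *: "\<not> (\<exists>y\<in>K. norm (x - y) \<le> r)"
  have "(\<lambda>y. u y * \<eta> (x - y)) = (\<lambda>y. 0)" using * assms(1,2) by (metis mult_eq_0_iff)
  then show False using assms(3) by (simp only: conv_def) simp
qed

section \<open>The Hilbert space of square-integrable functions\<close>

lemma L2_iff: "f \<in> L2 \<Omega> \<longleftrightarrow> f \<in> borel_measurable (lebesgue_on \<Omega>) \<and> integrable (lebesgue_on \<Omega>) (\<lambda>x. f x \<bullet> f x)"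
  by (simp add: L2_def power2_norm_eq_inner)

lemma L2_measurable: "f \<in> L2 \<Omega> \<Longrightarrow> f \<in> borel_measurable (lebesgue_on \<Omega>)"
  by (simp add: L2_def)

lemma L2_inner_integrable:
  assumes "f \<in> L2 \<Omega>" "g \<in> L2 \<Omega>"
  shows "integrable (lebesgue_on \<Omega>) (\<lambda>x. f x \<bullet> g x)"
proof (rule Bochner_Integration.integrable_bound)
  show "integrable (lebesgue_on \<Omega>) (\<lambda>x. f x \<bullet> f x + g x \<bullet> g x)"
    using assms by (intro Bochner_Integration.integrable_add) (auto simp: L2_iff)
  show "(\<lambda>x. f x \<bullet> g x) \<in> borel_measurable (lebesgue_on \<Omega>)"
    using assms by (intro borel_measurable_inner) (auto simp: L2_iff)
  have "\<bar>f x \<bullet> g x\<bar> \<le> f x \<bullet> f x + g x \<bullet> g x" for x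
  proof -
    have "\<bar>f x \<bullet> g x\<bar> \<le> norm (f x) * norm (g x)" by (rule Cauchy_Schwarz_ineq2)
    also have "2 * (norm (f x) * norm (g x)) \<le> (norm (f x))\<^sup>2 + (norm (g x))\<^sup>2"
      using sum_squares_bound[of "norm (f x)" "norm (g x)"] by simp
    ultimately show ?thesis by (simp add: power2_norm_eq_inner)
  qed
  then show "AE x in lebesgue_on \<Omega>. norm (f x \<bullet> g x) \<le> norm (f x \<bullet> f x + g x \<bullet> g x)"
    by (intro AE_I2) (auto intro: order_trans[OF _ abs_ge_self])
qed

lemma L2_scale:
  assumes "f \<in> L2 \<Omega>" shows "(\<lambda>x. c *\<^sub>R f x) \<in> L2 \<Omega>"
  using assms by (auto simp: L2_iff)

lemma L2_add:
  assumes "f \<in> L2 \<Omega>" "g \<in> L2 \<Omega>" shows "(\<lambda>x. f x + g x) \<in> L2 \<Omega>"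
  using assms L2_inner_integrable[OF assms] L2_inner_integrable[OF assms(2,1)]
  by (auto simp: L2_iff inner_add_left inner_add_right intro!: Bochner_Integration.integrable_add)

lemma L2_diff:
  assumes "f \<in> L2 \<Omega>" "g \<in> L2 \<Omega>" shows "(\<lambda>x. f x - g x) \<in> L2 \<Omega>"
  using L2_add[OF assms(1) L2_scale[OF assms(2), of "-1"]] by simp

lemma L2_zero: "(\<lambda>x. 0) \<in> L2 \<Omega>"
  by (simp add: L2_iff)

lemma L2_inner_commute: "L2_inner \<Omega> f g = L2_inner \<Omega> g f"
  by (simp add: L2_inner_def inner_commute)

lemma L2_inner_add_left:
  "f \<in> L2 \<Omega> \<Longrightarrow> g \<in> L2 \<Omega> \<Longrightarrow> h \<in> L2 \<Omega> \<Longrightarrow>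
    L2_inner \<Omega> (\<lambda>x. f x + g x) h = L2_inner \<Omega> f h + L2_inner \<Omega> g h"
  by (simp add: L2_inner_def inner_add_left L2_inner_integrable)

lemma L2_inner_diff_left:
  "f \<in> L2 \<Omega> \<Longrightarrow> g \<in> L2 \<Omega> \<Longrightarrow> h \<in> L2 \<Omega> \<Longrightarrow>
    L2_inner \<Omega> (\<lambda>x. f x - g x) h = L2_inner \<Omega> f h - L2_inner \<Omega> g h"
  by (simp add: L2_inner_def inner_diff_left L2_inner_integrable)

lemma L2_inner_scale_left: "L2_inner \<Omega> (\<lambda>x. c *\<^sub>R f x) h = c * L2_inner \<Omega> f h"
  by (simp add: L2_inner_def)

lemma L2_inner_self_nonneg: "0 \<le> L2_inner \<Omega> f f"
  by (simp add: L2_inner_def)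

lemma L2_inner_diff_scaled:
  assumes "f \<in> L2 \<Omega>" "g \<in> L2 \<Omega>"
  shows "L2_inner \<Omega> (\<lambda>x. f x - t *\<^sub>R g x) (\<lambda>x. f x - t *\<^sub>R g x)
    = L2_inner \<Omega> f f - 2 * t * L2_inner \<Omega> f g + t\<^sup>2 * L2_inner \<Omega> g g"
proof -
  have i: "integrable (lebesgue_on \<Omega>) (\<lambda>x. f x \<bullet> f x)" "integrable (lebesgue_on \<Omega>) (\<lambda>x. f x \<bullet> g x)"
    "integrable (lebesgue_on \<Omega>) (\<lambda>x. g x \<bullet> g x)"
    using assms by (auto intro: L2_inner_integrable)
  have "(f x - t *\<^sub>R g x) \<bullet> (f x - t *\<^sub>R g x) = f x \<bullet> f x - 2 * t * (f x \<bullet> g x) + t\<^sup>2 * (g x \<bullet> g x)" for x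
    by (simp add: inner_diff_left inner_diff_right inner_commute[of "g x" "f x"] power2_eq_square algebra_simps)
  then show ?thesis unfolding L2_inner_def using i by simp
qed

text \<open>A discriminant argument. With d = 0 it yields the Cauchy-Schwarz inequality; with d an
  infimum of squared distances it bounds the inner product of an almost minimal residual with a
  direction.\<close>

lemma quadratic_lower_bound:
  fixes A B C d :: real
  assumes "\<And>t. d \<le> A - 2 * t * B + t\<^sup>2 * C" "0 \<le> C"
  shows "B\<^sup>2 \<le> (A - d) * C"
proof (cases "C = 0")
  case True
  have "B = 0"
  proof (rule ccontr)
    assume "B \<noteq> 0"
    \<comment> \<open>With C = 0 this choice of t would give d \<le> d - 1.\<close>
    then have "2 * ((A - d + 1) / (2 * B)) * B = A - d + 1" by simp
    then show False using assms(1)[of "(A - d + 1) / (2 * B)"] True by simp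
  qed
  then show ?thesis using True by simp
next
  case False
  then have C: "C > 0" using assms(2) by simp
  have "d \<le> A - B\<^sup>2 / C" using assms(1)[of "B / C"] C by (simp add: power2_eq_square field_simps)
  then show ?thesis using C by (simp add: field_simps)
qed

lemma L2_Cauchy_Schwarz:
  assumes "f \<in> L2 \<Omega>" "g \<in> L2 \<Omega>"
  shows "(L2_inner \<Omega> f g)\<^sup>2 \<le> L2_inner \<Omega> f f * L2_inner \<Omega> g g"
proof -
  have "(L2_inner \<Omega> f g)\<^sup>2 \<le> (L2_inner \<Omega> f f - 0) * L2_inner \<Omega> g g"
    by (rule quadratic_lower_bound) (simp_all only: L2_inner_diff_scaled[OF assms, symmetric] L2_inner_self_nonneg)
  then show ?thesis by simp
qed

lemma tendsto_0_if_square: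
  fixes a b :: "nat \<Rightarrow> real"
  assumes "\<And>k. (a k)\<^sup>2 \<le> b k * C" "b \<longlonglongrightarrow> 0"
  shows "a \<longlonglongrightarrow> 0"
proof -
  have "(\<lambda>k. (a k)\<^sup>2) \<longlonglongrightarrow> 0"
    by (rule tendsto_sandwich[OF _ _ tendsto_const tendsto_mult_left_zero[OF assms(2), of C]]) (use assms(1) in auto)
  then have "(\<lambda>k. sqrt ((a k)\<^sup>2)) \<longlonglongrightarrow> sqrt 0" by (intro tendsto_real_sqrt)
  then show ?thesis by (simp add: tendsto_rabs_zero_iff)
qed

lemma L2_inner_tendsto_0:
  assumes "\<And>k. f k \<in> L2 \<Omega>" "g \<in> L2 \<Omega>" "(\<lambda>k. L2_inner \<Omega> (f k) (f k)) \<longlonglongrightarrow> 0"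
  shows "(\<lambda>k. L2_inner \<Omega> (f k) g) \<longlonglongrightarrow> 0"
  by (rule tendsto_0_if_square[OF L2_Cauchy_Schwarz assms(3)]) (use assms in auto)

text \<open>Riesz-Fischer. Along a fast subsequence the squared increments, weighted by 2^k, have an
  integrable sum, so the increments decay geometrically at almost every point. Fatou's lemma then
  controls the distance of the whole sequence to the limit.\<close>

lemma L2_complete:
  fixes f :: "nat \<Rightarrow> real^'n \<Rightarrow> 'b::euclidean_space"
  assumes f: "\<And>k. f k \<in> L2 \<Omega>"
    and cauchy: "\<And>e. e > 0 \<Longrightarrow> \<exists>N. \<forall>m\<ge>N. \<forall>k\<ge>N. L2_inner \<Omega> (\<lambda>x. f m x - f k x) (\<lambda>x. f m x - f k x) < e"
  shows "\<exists>g\<in>L2 \<Omega>. (\<lambda>k. L2_inner \<Omega> (\<lambda>x. f k x - g x) (\<lambda>x. f k x - g x)) \<longlonglongrightarrow> 0"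
proof -
  let ?M = "lebesgue_on \<Omega>"
  have fm[measurable]: "f k \<in> borel_measurable ?M" for k using f by (simp add: L2_iff)
  have nn: "(\<integral>\<^sup>+x. ennreal ((norm (h x))\<^sup>2) \<partial>?M) = ennreal (L2_inner \<Omega> h h)" if "h \<in> L2 \<Omega>" for h :: "real^'n \<Rightarrow> 'b"
    unfolding L2_inner_def power2_norm_eq_inner using that by (intro nn_integral_eq_integral) (auto simp: L2_iff)
  \<comment> \<open>The bound 4^-k leaves room for the weight 2^k: the weighted integrals still form
    a geometric series.\<close>
  have "\<exists>r. \<forall>k. (\<forall>m\<ge>r k. \<forall>l\<ge>r k. L2_inner \<Omega> (\<lambda>x. f m x - f l x) (\<lambda>x. f m x - f l x) < (1/4)^k) \<and> (r (Suc k) > r k)"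
  proof (rule dependent_nat_choice)
    show "\<exists>x. \<forall>m\<ge>x. \<forall>l\<ge>x. L2_inner \<Omega> (\<lambda>x. f m x - f l x) (\<lambda>x. f m x - f l x) < (1/4)^0"
      using cauchy[of 1] by simp
    fix x :: nat and k
    obtain N where N: "\<forall>m\<ge>N. \<forall>l\<ge>N. L2_inner \<Omega> (\<lambda>x. f m x - f l x) (\<lambda>x. f m x - f l x) < (1/4)^Suc k"
      using cauchy[of "(1/4)^Suc k"] by auto
    show "\<exists>y. (\<forall>m\<ge>y. \<forall>l\<ge>y. L2_inner \<Omega> (\<lambda>x. f m x - f l x) (\<lambda>x. f m x - f l x) < (1/4)^Suc k) \<and> x < y"
      using N by (intro exI[of _ "max N (Suc x)"]) auto
  qed
  then obtain r where r: "\<And>k m l. m \<ge> r k \<Longrightarrow> l \<ge> r k \<Longrightarrow> L2_inner \<Omega> (\<lambda>x. f m x - f l x) (\<lambda>x. f m x - f l x) < (1/4)^k"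
    and rS: "\<And>k. r (Suc k) > r k" by blast
  have smr: "strict_mono r" using rS by (simp add: strict_mono_Suc_iff)
  define d where "d = (\<lambda>k x. f (r (Suc k)) x - f (r k) x)"
  have dm[measurable]: "d k \<in> borel_measurable ?M" for k unfolding d_def by measurable
  have dL2: "d k \<in> L2 \<Omega>" for k unfolding d_def by (intro L2_diff f)
  have "(\<integral>\<^sup>+x. (\<Sum>k. ennreal (2^k * (norm (d k x))\<^sup>2)) \<partial>?M) = (\<Sum>k. \<integral>\<^sup>+x. ennreal (2^k * (norm (d k x))\<^sup>2) \<partial>?M)"
    by (intro nn_integral_suminf) measurable
  also have "\<dots> \<le> (\<Sum>k. ennreal ((1/2)^k))"
  proof (intro suminf_le)
    fix k
    have "(\<integral>\<^sup>+x. ennreal (2^k * (norm (d k x))\<^sup>2) \<partial>?M) = ennreal (2^k) * (\<integral>\<^sup>+x. ennreal ((norm (d k x))\<^sup>2) \<partial>?M)"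
      by (subst nn_integral_cmult[symmetric]) (auto simp: ennreal_mult)
    also have "\<dots> = ennreal (2^k * L2_inner \<Omega> (d k) (d k))"
      by (simp add: nn[OF dL2] ennreal_mult L2_inner_self_nonneg)
    also have "\<dots> \<le> ennreal ((1/2)^k)"
    proof (rule ennreal_leI)
      have "L2_inner \<Omega> (d k) (d k) \<le> (1/4)^k"
        unfolding d_def using r[of k "r (Suc k)" "r k"] rS[of k] by simp
      then have "2^k * L2_inner \<Omega> (d k) (d k) \<le> 2^k * (1/4)^k" by (intro mult_left_mono) auto
      also have "2^k * (1/4)^k = (1/2::real)^k" by (simp flip: power_mult_distrib)
      finally show "2^k * L2_inner \<Omega> (d k) (d k) \<le> (1/2)^k" .
    qed
    finally show "(\<integral>\<^sup>+x. ennreal (2^k * (norm (d k x))\<^sup>2) \<partial>?M) \<le> ennreal ((1/2)^k)" .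
  qed auto
  also have "\<dots> < \<infinity>" by (subst suminf_ennreal2) (auto simp: summable_geometric)
  finally have "(\<integral>\<^sup>+x. (\<Sum>k. ennreal (2^k * (norm (d k x))\<^sup>2)) \<partial>?M) \<noteq> \<infinity>" by simp
  then have AEf: "AE x in ?M. (\<Sum>k. ennreal (2^k * (norm (d k x))\<^sup>2)) \<noteq> \<infinity>"
    by (intro nn_integral_noteq_infinite) measurable
  \<comment> \<open>Where the subsequence diverges, \<open>lim\<close> is an unspecified value; that
    set is null, and the function is measurable all the same.\<close>
  define g where "g = (\<lambda>x. lim (\<lambda>k. f (r k) x))"
  have gm[measurable]: "g \<in> borel_measurable ?M" unfolding g_def by (intro borel_measurable_lim_metric) measurable
  have conv: "(\<lambda>k. f (r k) x) \<longlonglongrightarrow> g x" if fin: "(\<Sum>k. ennreal (2^k * (norm (d k x))\<^sup>2)) \<noteq> \<infinity>" for x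
  proof -
    obtain C where C: "C \<ge> 0" "(\<Sum>k. ennreal (2^k * (norm (d k x))\<^sup>2)) = ennreal C"
      by (rule ennreal_cases[of "\<Sum>k. ennreal (2^k * (norm (d k x))\<^sup>2)"]) (use fin in \<open>simp_all only: infinity_ennreal_def\<close>)
    have le: "2^k * (norm (d k x))\<^sup>2 \<le> C" for k
    proof -
      have "ennreal (2^k * (norm (d k x))\<^sup>2) = (\<Sum>j\<in>{k}. ennreal (2^j * (norm (d j x))\<^sup>2))" by simp
      also have "\<dots> \<le> ennreal C" unfolding C(2)[symmetric] by (rule sum_le_suminf) auto
      finally show ?thesis using C(1) by simp
    qed
    have "norm (d k x) \<le> sqrt C * (sqrt (1/2))^k" for k
    proof -
      have "(norm (d k x))\<^sup>2 \<le> C * (1/2)^k" using le[of k] by (simp add: field_simps power_divide)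
      then have "norm (d k x) \<le> sqrt (C * (1/2)^k)" by (rule real_le_rsqrt)
      then show ?thesis by (simp add: real_sqrt_mult real_sqrt_power)
    qed
    note dle = this
    have "summable (\<lambda>k. norm (d k x))"
    proof (rule summable_comparison_test'[of "\<lambda>k. sqrt C * (sqrt (1/2))^k" 0])
      have "sqrt (1/2) < sqrt 1" by (rule real_sqrt_less_mono) simp
      then show "summable (\<lambda>k. sqrt C * (sqrt (1/2))^k)" by (intro summable_mult summable_geometric) simp
    qed (use dle in simp)
    then have "summable (\<lambda>k. d k x)" by (rule summable_norm_cancel)
    then have "convergent (\<lambda>n. \<Sum>k<n. d k x)" by (simp add: summable_iff_convergent)
    moreover have "(\<Sum>k<n. d k x) = f (r n) x - f (r 0) x" for n
      unfolding d_def using sum_lessThan_telescope[of "\<lambda>k. f (r k) x" n] by simp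
    ultimately have "convergent (\<lambda>n. f (r n) x - f (r 0) x)" by (simp only:)
    then have "convergent (\<lambda>n. (f (r n) x - f (r 0) x) + f (r 0) x)"
      by (rule convergent_add[OF _ convergent_const])
    then have "convergent (\<lambda>n. f (r n) x)" by simp
    then show ?thesis by (simp add: g_def convergent_LIMSEQ_iff)
  qed
  have AEc: "AE x in ?M. (\<lambda>k. f (r k) x) \<longlonglongrightarrow> g x" by (rule AE_mp[OF AEf]) (intro AE_I2 impI conv)
  have fatou: "(\<integral>\<^sup>+x. ennreal ((norm (f m x - g x))\<^sup>2) \<partial>?M) \<le> ennreal ((1/4)^k)" if m: "m \<ge> r k" for m k
  proof -
    have "(\<integral>\<^sup>+x. ennreal ((norm (f m x - g x))\<^sup>2) \<partial>?M) = (\<integral>\<^sup>+x. liminf (\<lambda>j. ennreal ((norm (f m x - f (r j) x))\<^sup>2)) \<partial>?M)"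
    proof (rule nn_integral_cong_AE, rule AE_mp[OF AEc], rule AE_I2, rule impI)
      fix x assume c: "(\<lambda>k. f (r k) x) \<longlonglongrightarrow> g x"
      have "(\<lambda>j. ennreal ((norm (f m x - f (r j) x))\<^sup>2)) \<longlonglongrightarrow> ennreal ((norm (f m x - g x))\<^sup>2)"
        by (intro tendsto_intros c)
      then show "ennreal ((norm (f m x - g x))\<^sup>2) = liminf (\<lambda>j. ennreal ((norm (f m x - f (r j) x))\<^sup>2))"
        by (rule lim_imp_Liminf[OF trivial_limit_sequentially, symmetric])
    qed
    also have "\<dots> \<le> liminf (\<lambda>j. \<integral>\<^sup>+x. ennreal ((norm (f m x - f (r j) x))\<^sup>2) \<partial>?M)"
      by (intro nn_integral_liminf) measurable
    also have "\<dots> \<le> ennreal ((1/4)^k)"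
    proof (rule Liminf_le)
      show "\<forall>\<^sub>F j in sequentially. (\<integral>\<^sup>+x. ennreal ((norm (f m x - f (r j) x))\<^sup>2) \<partial>?M) \<le> ennreal ((1/4)^k)"
      proof (rule eventually_sequentiallyI[of k])
        fix j assume "j \<ge> k"
        then have "r j \<ge> r k" using smr by (simp add: strict_mono_less_eq)
        then show "(\<integral>\<^sup>+x. ennreal ((norm (f m x - f (r j) x))\<^sup>2) \<partial>?M) \<le> ennreal ((1/4)^k)"
          using r[OF m, of "r j"] nn[OF L2_diff[OF f f]] by (simp add: ennreal_leI less_imp_le)
      qed
    qed simp
    finally show ?thesis .
  qed
  have diffL2: "(\<lambda>x. f m x - g x) \<in> L2 \<Omega>" if "m \<ge> r k" for m k
  proof -
    have "integrable ?M (\<lambda>x. (norm (f m x - g x))\<^sup>2)"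
    proof (rule integrableI_bounded)
      have "(\<integral>\<^sup>+x. ennreal (norm ((norm (f m x - g x))\<^sup>2)) \<partial>?M) \<le> ennreal ((1/4)^k)"
        using fatou[OF that] by simp
      then show "(\<integral>\<^sup>+x. ennreal (norm ((norm (f m x - g x))\<^sup>2)) \<partial>?M) < \<infinity>"
        by (rule le_less_trans) simp
    qed measurable
    then show ?thesis by (simp add: L2_def)
  qed
  have gL2: "g \<in> L2 \<Omega>" using L2_diff[OF f[of "r 0"] diffL2[of 0 "r 0"]] by simp
  have small: "L2_inner \<Omega> (\<lambda>x. f m x - g x) (\<lambda>x. f m x - g x) \<le> (1/4)^k" if "m \<ge> r k" for m k
    using fatou[OF that] nn[OF diffL2[OF that]] by (simp add: ennreal_le_iff)
  have "(\<lambda>k. L2_inner \<Omega> (\<lambda>x. f k x - g x) (\<lambda>x. f k x - g x)) \<longlonglongrightarrow> 0"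
  proof (rule LIMSEQ_I)
    fix e :: real assume "e > 0"
    then obtain k where k: "(1/4::real)^k < e" using real_arch_pow_inv[of e "1/4"] by auto
    show "\<exists>N. \<forall>m\<ge>N. norm (L2_inner \<Omega> (\<lambda>x. f m x - g x) (\<lambda>x. f m x - g x) - 0) < e"
      using le_less_trans[OF small k]
      by (intro exI[of _ "r k"]) (simp add: abs_of_nonneg[OF L2_inner_self_nonneg])
  qed
  then show ?thesis using gL2 by blast
qed

text \<open>A minimising sequence for the distance to S is Cauchy, and its limit is the projection.
  Elements are functions and not classes, so closedness is stated through sequences that converge in
  the seminorm given by \<open>L2_inner\<close>.\<close>

theorem L2_projection_exists:
  fixes S :: "(real^'n \<Rightarrow> 'b::euclidean_space) set"
  assumes S: "S \<subseteq> L2 \<Omega>" "(\<lambda>x. 0) \<in> S" "\<And>s t. s \<in> S \<Longrightarrow> t \<in> S \<Longrightarrow> (\<lambda>x. s x + t x) \<in> S"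
      "\<And>s c. s \<in> S \<Longrightarrow> (\<lambda>x. c *\<^sub>R s x) \<in> S"
    and closed: "\<And>s z. (\<And>k. s k \<in> S) \<Longrightarrow> z \<in> L2 \<Omega> \<Longrightarrow>
      (\<lambda>k::nat. L2_inner \<Omega> (\<lambda>x. s k x - z x) (\<lambda>x. s k x - z x)) \<longlonglongrightarrow> 0 \<Longrightarrow> z \<in> S"
    and w: "w \<in> L2 \<Omega>"
  shows "\<exists>z. is_L2_projection \<Omega> S w z"
proof -
  let ?N = "\<lambda>f. L2_inner \<Omega> f f"
  let ?D = "(\<lambda>s. ?N (\<lambda>x. w x - s x)) ` S"
  define d where "d = Inf ?D"
  have bdd: "bdd_below ?D" by (rule bdd_belowI2[of _ 0]) (rule L2_inner_self_nonneg)
  have dle: "d \<le> ?N (\<lambda>x. w x - s x)" if "s \<in> S" for s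
    unfolding d_def by (rule cInf_lower) (use that bdd in auto)
  have "\<exists>s\<in>S. ?N (\<lambda>x. w x - s x) < d + inverse (real (Suc k))" for k
  proof -
    have "Inf ?D < d + inverse (real (Suc k))" by (simp add: d_def)
    then show ?thesis using cInf_lessD[of ?D] S(2) by blast
  qed
  then obtain s where s: "\<And>k. s k \<in> S" "\<And>k. ?N (\<lambda>x. w x - s k x) < d + inverse (real (Suc k))" by metis
  have sL2: "s k \<in> L2 \<Omega>" for k using s(1) S(1) by blast
  \<comment> \<open>A perturbation of \<open>s k\<close> in direction t stays in S, so its squared
    distance to w cannot fall below d; the defect of minimality bounds the inner product.\<close>
  have orth: "(L2_inner \<Omega> (\<lambda>x. w x - s k x) t)\<^sup>2 \<le> inverse (real (Suc k)) * ?N t" if t: "t \<in> S" for k t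
  proof -
    have tL2: "t \<in> L2 \<Omega>" using t S(1) by blast
    have "d \<le> ?N (\<lambda>x. w x - s k x) - 2 * c * L2_inner \<Omega> (\<lambda>x. w x - s k x) t + c\<^sup>2 * ?N t" for c
    proof -
      have "d \<le> ?N (\<lambda>x. w x - (s k x + c *\<^sub>R t x))" by (rule dle) (intro S(3,4) s t)
      then show ?thesis using L2_inner_diff_scaled[OF L2_diff[OF w sL2[of k]] tL2, of c]
        by (simp add: diff_diff_eq)
    qed
    then have "(L2_inner \<Omega> (\<lambda>x. w x - s k x) t)\<^sup>2 \<le> (?N (\<lambda>x. w x - s k x) - d) * ?N t"
      by (rule quadratic_lower_bound) (rule L2_inner_self_nonneg)
    also have "\<dots> \<le> inverse (real (Suc k)) * ?N t"
      using s(2)[of k] by (intro mult_right_mono L2_inner_self_nonneg) simp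
    finally show ?thesis .
  qed
  \<comment> \<open>Parallelogram identity: the midpoint of \<open>s m\<close> and
    \<open>s k\<close> lies in S, so the mean of the two residuals has squared norm at least
    d.\<close>
  have par: "?N (\<lambda>x. s m x - s k x) \<le> 2 * inverse (real (Suc m)) + 2 * inverse (real (Suc k))" for m k
  proof -
    define a where "a = (\<lambda>x. w x - s m x)"
    define b where "b = (\<lambda>x. w x - s k x)"
    have ab: "a \<in> L2 \<Omega>" "b \<in> L2 \<Omega>" unfolding a_def b_def by (intro L2_diff w sL2)+
    have mid: "(\<lambda>x. (1/2) *\<^sub>R (s m x + s k x)) \<in> S" by (intro S(3,4) s)
    have h: "(\<lambda>x. (1/2) *\<^sub>R a x) \<in> L2 \<Omega>" by (intro L2_scale ab)
    have "d \<le> ?N (\<lambda>x. w x - (1/2) *\<^sub>R (s m x + s k x))" by (rule dle[OF mid])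
    also have "(\<lambda>x. w x - (1/2) *\<^sub>R (s m x + s k x)) = (\<lambda>x. (1/2) *\<^sub>R a x - (-1/2) *\<^sub>R b x)"
      by (auto simp: a_def b_def algebra_simps simp flip: scaleR_left.add)
    also have "?N \<dots> = ?N (\<lambda>x. (1/2) *\<^sub>R a x) + L2_inner \<Omega> (\<lambda>x. (1/2) *\<^sub>R a x) b + (1/4) * ?N b"
      using L2_inner_diff_scaled[OF h ab(2), of "-1/2"] by (simp add: power2_eq_square)
    also have "\<dots> = (1/4) * ?N a + (1/2) * L2_inner \<Omega> a b + (1/4) * ?N b"
      by (simp only: L2_inner_scale_left L2_inner_commute[of \<Omega> a "\<lambda>x. (1/2) *\<^sub>R a x"])
    finally have 1: "4 * d \<le> ?N a + 2 * L2_inner \<Omega> a b + ?N b" by simp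
    have "(\<lambda>x. s m x - s k x) = (\<lambda>x. b x - 1 *\<^sub>R a x)" by (auto simp: a_def b_def)
    then have 2: "?N (\<lambda>x. s m x - s k x) = ?N b - 2 * L2_inner \<Omega> b a + ?N a"
      using L2_inner_diff_scaled[OF ab(2,1), of 1] by simp
    show ?thesis using 1 2 s(2)[of m] s(2)[of k] L2_inner_commute[of \<Omega> a b] by (simp add: a_def b_def)
  qed
  have "\<exists>z\<in>L2 \<Omega>. (\<lambda>k. ?N (\<lambda>x. s k x - z x)) \<longlonglongrightarrow> 0"
  proof (rule L2_complete[OF sL2])
    fix e :: real assume "e > 0"
    then obtain N where N: "inverse (real (Suc N)) < e / 4" using reals_Archimedean[of "e/4"] by auto
    have "?N (\<lambda>x. s m x - s k x) < e" if "m \<ge> N" "k \<ge> N" for m k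
    proof -
      have "inverse (real (Suc m)) \<le> inverse (real (Suc N))" "inverse (real (Suc k)) \<le> inverse (real (Suc N))"
        using that by (auto intro!: le_imp_inverse_le)
      then show ?thesis using par[of m k] N by linarith
    qed
    then show "\<exists>N. \<forall>m\<ge>N. \<forall>k\<ge>N. ?N (\<lambda>x. s m x - s k x) < e" by blast
  qed
  then obtain z where z: "z \<in> L2 \<Omega>" "(\<lambda>k. ?N (\<lambda>x. s k x - z x)) \<longlonglongrightarrow> 0" by blast
  have zS: "z \<in> S" by (rule closed[OF s(1) z])
  moreover have "L2_inner \<Omega> (\<lambda>x. w x - z x) t = 0" if t: "t \<in> S" for t
  proof -
    have tL2: "t \<in> L2 \<Omega>" using t S(1) by blast
    have "(\<lambda>k. L2_inner \<Omega> (\<lambda>x. w x - s k x) t) \<longlonglongrightarrow> 0"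
      by (rule tendsto_0_if_square[OF orth[OF t] LIMSEQ_inverse_real_of_nat])
    moreover have "(\<lambda>k. L2_inner \<Omega> (\<lambda>x. s k x - z x) t) \<longlonglongrightarrow> 0"
      by (rule L2_inner_tendsto_0[OF _ tL2 z(2)]) (intro L2_diff sL2 z)
    ultimately have "(\<lambda>k. L2_inner \<Omega> (\<lambda>x. w x - s k x) t + L2_inner \<Omega> (\<lambda>x. s k x - z x) t) \<longlonglongrightarrow> 0 + 0"
      by (rule tendsto_add)
    moreover have "L2_inner \<Omega> (\<lambda>x. w x - s k x) t + L2_inner \<Omega> (\<lambda>x. s k x - z x) t = L2_inner \<Omega> (\<lambda>x. w x - z x) t" for k
      using L2_inner_add_left[OF L2_diff[OF w sL2] L2_diff[OF sL2 z(1)] tL2, of k k] by simp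
    ultimately show ?thesis by (simp add: LIMSEQ_const_iff)
  qed
  ultimately show ?thesis unfolding is_L2_projection_def by blast
qed

section \<open>Barycentric coordinates on a simplex\<close>

definition vert :: "(real^'n) set \<Rightarrow> (real^'n) set" where
  "vert T = {z. z extreme_point_of T}"

lemma vert_convex_hull: "\<not> affine_dependent C \<Longrightarrow> vert (convex hull C) = C"
  by (simp add: vert_def extreme_point_of_convex_hull_affine_independent)

text \<open>Gradient and constant term of the affine function with the prescribed vertex values.
  Barycentric coordinates thus live on the whole space, which is needed for points that stretchings
  and neighbourhoods take out of T.\<close>

definition bary_coeff :: "(real^'n) set \<Rightarrow> real^'n \<Rightarrow> (real^'n) \<times> real" where
  "bary_coeff T z = (SOME p. \<forall>y\<in>vert T. fst p \<bullet> y + snd p = (if y = z then 1 else 0))"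

definition bgrad :: "(real^'n) set \<Rightarrow> real^'n \<Rightarrow> real^'n" where
  "bgrad T z = fst (bary_coeff T z)"

definition bary :: "(real^'n) set \<Rightarrow> real^'n \<Rightarrow> real^'n \<Rightarrow> real" where
  "bary T z x = bgrad T z \<bullet> x + snd (bary_coeff T z)"

lemma bary_diff: "bary T z x - bary T z y = bgrad T z \<bullet> (x - y)"
  by (simp add: bary_def inner_diff_right)

lemma bary_add: "bary T z (x + h) = bary T z x + bgrad T z \<bullet> h"
  by (simp add: bary_def inner_add_right)

lemma bary_affine: "u + v = 1 \<Longrightarrow> bary T z (u *\<^sub>R x + v *\<^sub>R y) = u * bary T z x + v * bary T z y"
  by (simp add: bary_def inner_add_right algebra_simps flip: distrib_right)

lemma continuous_on_bary: "continuous_on S (bary T z)"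
  unfolding bary_def by (intro continuous_intros)

definition opp :: "(real^'n) set \<Rightarrow> real^'n \<Rightarrow> (real^'n) set" where
  "opp T a = convex hull (vert T - {a})"

text \<open>Orthogonal projection onto the zero hyperplane of the barycentric coordinate of
  \<open>a\<close>, the hyperplane of the opposite facet.\<close>

definition foot :: "(real^'n) set \<Rightarrow> real^'n \<Rightarrow> real^'n \<Rightarrow> real^'n" where
  "foot T a x = x - (bary T a x / (bgrad T a \<bullet> bgrad T a)) *\<^sub>R bgrad T a"

text \<open>Affine independence means linear independence of the differences to a base point w.
  Choosing w different from z lets the affine function vanish at w, so a dual linear functional
  suffices.\<close>

lemma dual_affine_function_exists:
  fixes C :: "(real^'n) set"
  assumes C: "\<not> affine_dependent C" and z: "z \<in> C"
  shows "\<exists>p. \<forall>y\<in>C. fst p \<bullet> y + snd p = (if y = z then 1 else (0::real))"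
proof (cases "C = {z}")
  case True
  then show ?thesis by (intro exI[of _ "(0, 1)"]) auto
next
  case False
  then obtain w where w: "w \<in> C" "w \<noteq> z" using z by blast
  define B where "B = (\<lambda>x. - w + x) ` (C - {w})"
  have "insert w (C - {w}) = C" using w by auto
  then have "independent B"
    using C affine_dependent_iff_dependent[of w "C - {w}"] by (simp add: B_def)
  then obtain h :: "real^'n \<Rightarrow> real" where h: "linear h" "\<forall>x\<in>B. h x = (if x = z - w then 1 else 0)"
    using linear_independent_extend[of B "\<lambda>x. if x = z - w then 1 else 0"] by blast
  \<comment> \<open>The vector that represents the functional h.\<close>
  define g where "g = adjoint h 1"
  have g: "g \<bullet> x = h x" for x
    using adjoint_works[OF h(1), of x 1] by (simp add: g_def inner_commute)
  have "g \<bullet> y + - (g \<bullet> w) = (if y = z then 1 else 0)" if "y \<in> C" for y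
  proof (cases "y = w")
    case False
    then have "y - w \<in> B" using that by (auto simp: B_def)
    then have "g \<bullet> (y - w) = (if y - w = z - w then 1 else 0)" using h(2) g by simp
    then show ?thesis by (simp add: inner_diff_right split: if_splits)
  qed (use w in auto)
  then show ?thesis by (intro exI[of _ "(g, - (g \<bullet> w))"]) auto
qed

locale full_simplex =
  fixes T :: "(real^'n) set"
  assumes simplex: "int CARD('n) simplex T"
begin

lemma
  shows finite_vert: "finite (vert T)" and card_vert: "card (vert T) = CARD('n) + 1"
    and hull_vert: "convex hull (vert T) = T" and indep_vert: "\<not> affine_dependent (vert T)"
proof -
  obtain C where C: "\<not> affine_dependent C" "int (card C) = int CARD('n) + 1" "T = convex hull C"
    using simplex unfolding simplex_def by blast
  have "vert T = C" using C vert_convex_hull by simp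
  then show "finite (vert T)" "card (vert T) = CARD('n) + 1"
    "convex hull (vert T) = T" "\<not> affine_dependent (vert T)"
    using C aff_independent_finite by auto
qed

lemma bary_vert:
  assumes "z \<in> vert T" "y \<in> vert T"
  shows "bary T z y = (if y = z then 1 else 0)"
  using someI_ex[OF dual_affine_function_exists[OF indep_vert assms(1)]] assms(2)
  by (simp add: bary_def bgrad_def bary_coeff_def)

lemma bary_combination:
  assumes "z \<in> vert T" "(\<Sum>y\<in>vert T. u y) = 1"
  shows "bary T z (\<Sum>y\<in>vert T. u y *\<^sub>R y) = u z"
proof -
  have "bary T z (\<Sum>y\<in>vert T. u y *\<^sub>R y) = (\<Sum>y\<in>vert T. u y * bary T z y)"
  proof -
    have "(\<Sum>y\<in>vert T. u y * bary T z y) = (\<Sum>y\<in>vert T. u y * (bgrad T z \<bullet> y)) + (\<Sum>y\<in>vert T. u y) * snd (bary_coeff T z)"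
      by (simp add: bary_def distrib_left sum.distrib sum_distrib_right)
    then show ?thesis using assms(2) by (simp add: bary_def inner_sum_right)
  qed
  also have "\<dots> = (\<Sum>y\<in>vert T. if y = z then u y else 0)"
    by (intro sum.cong) (auto simp: bary_vert assms(1))
  finally show ?thesis using assms(1) finite_vert by simp
qed

lemma affine_hull_vert: "affine hull (vert T) = UNIV"
  using affine_independent_span_eq[OF indep_vert] card_vert by simp

text \<open>The vertices are affinely independent and their number exceeds the dimension by one, so
  they span the space affinely; hence both identities hold for every x and not only inside
  T.\<close>

lemma bary_reconstruct:
  shows sum_bary: "(\<Sum>z\<in>vert T. bary T z x) = 1" and sum_bary_scale: "(\<Sum>z\<in>vert T. bary T z x *\<^sub>R z) = x"
proof -
  have "x \<in> affine hull (vert T)" by (simp add: affine_hull_vert)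
  then obtain u where u: "sum u (vert T) = 1" "(\<Sum>v\<in>vert T. u v *\<^sub>R v) = x"
    by (auto simp: affine_hull_finite[OF finite_vert])
  have "bary T z x = u z" if "z \<in> vert T" for z
    using bary_combination[OF that u(1)] u(2) by simp
  then show "(\<Sum>z\<in>vert T. bary T z x) = 1" "(\<Sum>z\<in>vert T. bary T z x *\<^sub>R z) = x"
    using u by auto
qed

lemma affine_expansion: "a \<bullet> x + b = (\<Sum>z\<in>vert T. bary T z x * (a \<bullet> z + b))"
proof -
  have "a \<bullet> x + b = a \<bullet> (\<Sum>z\<in>vert T. bary T z x *\<^sub>R z) + (\<Sum>z\<in>vert T. bary T z x) * b"
    by (simp only: sum_bary sum_bary_scale)
  then show ?thesis by (simp add: inner_sum_right sum_distrib_right distrib_left sum.distrib)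
qed

text \<open>Derivative of \<open>sum_bary\<close>; the next lemma is the derivative of
  \<open>sum_bary_scale\<close>. Together they express a constant field through the cone fields x -
  a.\<close>

lemma sum_bgrad: "(\<Sum>z\<in>vert T. bgrad T z \<bullet> e) = 0"
proof -
  have "(\<Sum>z\<in>vert T. bary T z e - bary T z 0) = 0" using sum_bary[of e] sum_bary[of 0] by (simp add: sum_subtractf)
  then show ?thesis by (simp add: bary_diff)
qed

lemma sum_bgrad_scale: "(\<Sum>z\<in>vert T. (bgrad T z \<bullet> e) *\<^sub>R z) = e"
proof -
  have "(\<Sum>z\<in>vert T. (bary T z e - bary T z 0) *\<^sub>R z) = e"
    using sum_bary_scale[of e] sum_bary_scale[of 0] by (simp add: scaleR_left_diff_distrib sum_subtractf)
  then show ?thesis by (simp add: bary_diff)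
qed

lemma mem_iff: "x \<in> T \<longleftrightarrow> (\<forall>z\<in>vert T. 0 \<le> bary T z x)"
proof
  assume "x \<in> T"
  then have "x \<in> convex hull (vert T)" by (simp add: hull_vert)
  then obtain u where u: "\<forall>y\<in>vert T. 0 \<le> u y" "sum u (vert T) = 1" "(\<Sum>v\<in>vert T. u v *\<^sub>R v) = x"
    by (auto simp: convex_hull_finite[OF finite_vert])
  then show "\<forall>z\<in>vert T. 0 \<le> bary T z x" using bary_combination by metis
next
  assume "\<forall>z\<in>vert T. 0 \<le> bary T z x"
  then have "x \<in> convex hull (vert T)"
    unfolding convex_hull_finite[OF finite_vert] using sum_bary[of x] sum_bary_scale[of x]
    by (intro CollectI exI[of _ "\<lambda>z. bary T z x"]) auto
  then show "x \<in> T" by (simp add: hull_vert)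
qed

lemma other_vert: "\<exists>y\<in>vert T. y \<noteq> z"
proof -
  have "card (vert T - {z}) \<noteq> 0"
    using card_vert card_Diff_singleton_if[of "vert T" z] zero_less_card_finite[where 'a='n] by (auto split: if_splits)
  then show ?thesis by (metis Diff_iff card.empty equals0I insertI1)
qed

lemma bgrad_nonzero:
  assumes "z \<in> vert T"
  shows "bgrad T z \<noteq> 0"
proof
  assume 0: "bgrad T z = 0"
  obtain y where "y \<in> vert T" "y \<noteq> z" using other_vert by blast
  then have "bary T z z - bary T z y = 1" using assms by (simp add: bary_vert)
  then show False using 0 by (simp add: bary_diff)
qed

lemma interior_iff: "x \<in> interior T \<longleftrightarrow> (\<forall>z\<in>vert T. 0 < bary T z x)"
proof
  assume x: "x \<in> interior T"
  show "\<forall>z\<in>vert T. 0 < bary T z x"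
  proof (rule ccontr)
    assume "\<not> (\<forall>z\<in>vert T. 0 < bary T z x)"
    then obtain z where z: "z \<in> vert T" "bary T z x \<le> 0" by force
    obtain e where e: "e > 0" "ball x e \<subseteq> T" using x mem_interior by blast
    define g where "g = bgrad T z"
    have g: "norm g > 0" using bgrad_nonzero[OF z(1)] by (simp add: g_def)
    define t where "t = e / (2 * norm g)"
    have t: "t > 0" using e g by (simp add: t_def)
    have "x + (- t) *\<^sub>R g \<in> ball x e" using e g by (simp add: dist_norm t_def)
    then have "0 \<le> bary T z (x + (- t) *\<^sub>R g)" using e mem_iff z(1) by blast
    also have "\<dots> = bary T z x - t * (g \<bullet> g)" unfolding bary_add by (simp add: g_def)
    also have "\<dots> < 0" using z(2) t g by (simp add: less_le_trans zero_less_mult_iff)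
         (smt (verit) inner_gt_zero_iff mult_pos_pos norm_zero)
    finally show False by simp
  qed
next
  assume x: "\<forall>z\<in>vert T. 0 < bary T z x"
  have "open (\<Inter>z\<in>vert T. {x. 0 < bary T z x})"
    by (intro open_INT finite_vert ballI open_Collect_less continuous_on_const continuous_on_bary)
  moreover have "(\<Inter>z\<in>vert T. {x. 0 < bary T z x}) \<subseteq> T" using mem_iff by (fastforce intro: less_imp_le)
  ultimately show "x \<in> interior T" using x by (intro interiorI[of "\<Inter>z\<in>vert T. {x. 0 < bary T z x}"]) auto
qed

lemma interior_nonempty: "interior T \<noteq> {}"
proof -
  define x where "x = (\<Sum>y\<in>vert T. (1 / real (CARD('n) + 1)) *\<^sub>R y)"
  have "bary T z x = 1 / real (CARD('n) + 1)" if "z \<in> vert T" for z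
    unfolding x_def using that by (rule bary_combination) (simp add: card_vert)
  then have "x \<in> interior T" by (simp add: interior_iff)
  then show ?thesis by blast
qed

lemma convex: "convex T" and compact: "compact T" and closed: "closed T"
  using simplex convex_simplex compact_simplex closed_simplex by auto

lemma closure_interior: "closure (interior T) = T"
  using convex_closure_interior[OF convex interior_nonempty] closed by simp

lemma vert_subset: "vert T \<subseteq> T"
  using hull_subset[of "vert T" convex] hull_vert by metis

lemma face_vert:
  assumes "G face_of T"
  shows vert_face_subset: "vert G \<subseteq> vert T" and hull_vert_face: "convex hull (vert G) = G"
proof -
  obtain c where c: "c \<subseteq> vert T" "G = convex hull c"
    using assms face_of_convex_hull_affine_independent[OF indep_vert] by (metis hull_vert)
  have "vert G = c" using c vert_convex_hull affine_independent_subset[OF indep_vert] by metis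
  then show "vert G \<subseteq> vert T" "convex hull (vert G) = G" using c by auto
qed

lemma face_mem_iff:
  assumes "G face_of T"
  shows "x \<in> G \<longleftrightarrow> x \<in> T \<and> (\<forall>z\<in>vert T - vert G. bary T z x = 0)"
proof
  assume x: "x \<in> G"
  have fin: "finite (vert G)" using finite_subset[OF vert_face_subset[OF assms] finite_vert] .
  obtain u where u: "\<forall>y\<in>vert G. 0 \<le> u y" "sum u (vert G) = 1" "(\<Sum>v\<in>vert G. u v *\<^sub>R v) = x"
    using x hull_vert_face[OF assms] unfolding convex_hull_finite[OF fin] by blast
  define u' where "u' = (\<lambda>y. if y \<in> vert G then u y else 0)"
  have "(\<Sum>y\<in>vert T. u' y) = 1" "(\<Sum>y\<in>vert T. u' y *\<^sub>R y) = x"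
    using u vert_face_subset[OF assms]
    by (auto simp: u'_def sum.If_cases finite_vert Int_absorb1 if_distrib[of "\<lambda>c. c *\<^sub>R _"] cong: if_cong)
  then have "bary T z x = u' z" if "z \<in> vert T" for z using bary_combination[OF that, of u'] by simp
  then have "\<forall>z\<in>vert T - vert G. bary T z x = 0" by (simp add: u'_def)
  moreover have "x \<in> T" using x face_of_imp_subset[OF assms] by blast
  ultimately show "x \<in> T \<and> (\<forall>z\<in>vert T - vert G. bary T z x = 0)" by blast
next
  assume x: "x \<in> T \<and> (\<forall>z\<in>vert T - vert G. bary T z x = 0)"
  have fin: "finite (vert G)" using finite_subset[OF vert_face_subset[OF assms] finite_vert] .
  have "(\<Sum>z\<in>vert G. bary T z x) = 1" "(\<Sum>z\<in>vert G. bary T z x *\<^sub>R z) = x"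
    using sum.mono_neutral_left[OF finite_vert vert_face_subset[OF assms], of "\<lambda>z. bary T z x"]
      sum.mono_neutral_left[OF finite_vert vert_face_subset[OF assms], of "\<lambda>z. bary T z x *\<^sub>R z"] x
      sum_bary[of x] sum_bary_scale[of x] by auto
  moreover have "\<forall>z\<in>vert G. 0 \<le> bary T z x" using x mem_iff vert_face_subset[OF assms] by blast
  ultimately have "x \<in> convex hull (vert G)"
    unfolding convex_hull_finite[OF fin] by (intro CollectI exI[of _ "\<lambda>z. bary T z x"]) auto
  then show "x \<in> G" by (simp add: hull_vert_face[OF assms])
qed

lemma facet_iff: "F facet_of T \<longleftrightarrow> (\<exists>a\<in>vert T. F = opp T a)"
proof -
  have "F facet_of T \<longleftrightarrow> F facet_of (convex hull (vert T))" by (simp add: hull_vert)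
  also have "\<dots> \<longleftrightarrow> F \<noteq> {} \<and> (\<exists>u. u \<in> vert T \<and> F = convex hull (vert T - {u}))"
    by (rule facet_of_convex_hull_affine_independent[OF indep_vert])
  also have "\<dots> \<longleftrightarrow> (\<exists>a\<in>vert T. F = opp T a)"
  proof -
    have "vert T - {a} \<noteq> {}" for a using other_vert[of a] by blast
    then show ?thesis unfolding opp_def by auto
  qed
  finally show ?thesis .
qed

lemma opp_facet: "a \<in> vert T \<Longrightarrow> opp T a facet_of T"
  using facet_iff by blast

lemma opp_face: "a \<in> vert T \<Longrightarrow> opp T a face_of T"
  using opp_facet facet_of_imp_face_of by blast

lemma vert_opp: "vert (opp T a) = vert T - {a}"
  unfolding opp_def by (rule vert_convex_hull) (rule affine_independent_subset[OF indep_vert], auto)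

lemma opp_mem_iff:
  assumes "a \<in> vert T"
  shows "x \<in> opp T a \<longleftrightarrow> bary T a x = 0 \<and> (\<forall>z\<in>vert T - {a}. 0 \<le> bary T z x)"
  using face_mem_iff[OF opp_face[OF assms], of x] assms by (auto simp: vert_opp mem_iff)

lemma affine_hull_opp:
  assumes "a \<in> vert T"
  shows "affine hull (opp T a) = {x. bary T a x = 0}"
proof
  have "affine {x. bary T a x = 0}"
    unfolding affine_def by (auto simp: bary_affine)
  then show "affine hull (opp T a) \<subseteq> {x. bary T a x = 0}"
    using opp_mem_iff[OF assms] by (intro hull_minimal) auto
next
  show "{x. bary T a x = 0} \<subseteq> affine hull (opp T a)"
  proof
    fix x assume "x \<in> {x. bary T a x = 0}"
    then have "(\<Sum>z\<in>vert T - {a}. bary T z x) = 1" "(\<Sum>z\<in>vert T - {a}. bary T z x *\<^sub>R z) = x"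
      using sum_bary[of x] sum_bary_scale[of x] assms by (auto simp: sum.remove[OF finite_vert assms])
    then have "x \<in> affine hull (vert T - {a})"
      using finite_vert by (subst affine_hull_finite) auto
    then show "x \<in> affine hull (opp T a)" by (simp add: opp_def affine_hull_convex_hull)
  qed
qed

lemma bary_foot:
  assumes "a \<in> vert T"
  shows "bary T a (foot T a x) = 0"
proof -
  have "bary T a (foot T a x) = bary T a x + bgrad T a \<bullet> (- (bary T a x / (bgrad T a \<bullet> bgrad T a)) *\<^sub>R bgrad T a)"
    unfolding foot_def by (subst bary_add[symmetric]) simp
  then show ?thesis using bgrad_nonzero[OF assms] by simp
qed

text \<open>Replaces the \<open>closest_point\<close> in the definition of
  \<open>face_integral\<close> by an explicit affine map.\<close>

lemma closest_point_opp:
  assumes "a \<in> vert T"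
  shows "closest_point (affine hull (opp T a)) x = foot T a x"
proof (rule closest_point_unique[symmetric])
  show "foot T a x \<in> affine hull (opp T a)" using bary_foot affine_hull_opp assms by simp
  show "\<forall>z\<in>affine hull (opp T a). dist x (foot T a x) \<le> dist x z"
  proof
    fix z assume "z \<in> affine hull (opp T a)"
    then have "bary T a z = 0" using affine_hull_opp[OF assms] by simp
    define g where "g = bgrad T a"
    have g0: "g \<bullet> g > 0" "norm g > 0" using bgrad_nonzero[OF assms] by (auto simp: g_def)
    have b: "bary T a x = g \<bullet> (x - z)" using bary_diff[of T a x z] \<open>bary T a z = 0\<close> by (simp add: g_def)
    have "dist x (foot T a x) = \<bar>g \<bullet> (x - z)\<bar> / norm g"
      unfolding foot_def g_def[symmetric] b using g0
      by (simp add: dist_norm divide_simps dot_square_norm power2_eq_square)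
    also have "\<dots> \<le> dist x z"
      using Cauchy_Schwarz_ineq2[of g "x - z"] g0 by (simp add: divide_simps dist_norm mult.commute)
    finally show "dist x (foot T a x) \<le> dist x z" .
  qed
qed (auto intro: affine_imp_convex)

lemma dist_foot:
  assumes "a \<in> vert T"
  shows "dist x (foot T a x) = \<bar>bary T a x\<bar> / norm (bgrad T a)"
  using bgrad_nonzero[OF assms] by (simp add: foot_def dist_norm divide_simps dot_square_norm power2_eq_square)

text \<open>The affine function n . (x - y), with y a vertex of the facet, vanishes at all vertices
  except a, so it is a multiple of the barycentric coordinate of a. Comparing gradients gives the
  claim.\<close>

lemma normal_parallel:
  assumes a: "a \<in> vert T" and n: "n \<noteq> 0" "\<And>x y. x \<in> opp T a \<Longrightarrow> y \<in> opp T a \<Longrightarrow> n \<bullet> (x - y) = 0"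
  shows "\<exists>\<alpha>. \<alpha> \<noteq> 0 \<and> bgrad T a = \<alpha> *\<^sub>R n"
proof -
  obtain y where y: "y \<in> vert T" "y \<noteq> a" using other_vert by blast
  have sub: "vert T - {a} \<subseteq> opp T a" unfolding opp_def by (rule hull_subset)
  define k where "k = n \<bullet> a - n \<bullet> y"
  have lin: "n \<bullet> x - n \<bullet> y = k * bary T a x" for x
  proof -
    have "n \<bullet> x + - (n \<bullet> y) = (\<Sum>z\<in>vert T. bary T z x * (n \<bullet> z + - (n \<bullet> y)))" by (rule affine_expansion)
    also have "\<dots> = bary T a x * (n \<bullet> a + - (n \<bullet> y)) + (\<Sum>z\<in>vert T - {a}. bary T z x * (n \<bullet> z + - (n \<bullet> y)))"
      by (rule sum.remove[OF finite_vert a])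
    also have "(\<Sum>z\<in>vert T - {a}. bary T z x * (n \<bullet> z + - (n \<bullet> y))) = 0"
    proof (rule sum.neutral, rule ballI)
      fix z assume "z \<in> vert T - {a}"
      then have "n \<bullet> (z - y) = 0" using n(2) sub y by blast
      then show "bary T z x * (n \<bullet> z + - (n \<bullet> y)) = 0" by (simp add: inner_diff_right)
    qed
    finally show ?thesis by (simp add: k_def mult.commute)
  qed
  have "n \<bullet> h = (k *\<^sub>R bgrad T a) \<bullet> h" for h
    using lin[of "y + h"] lin[of y] bary_add[of T a y h] by (simp add: inner_add_right distrib_left)
  then have nk: "n = k *\<^sub>R bgrad T a" using vector_eq_rdot by blast
  then have "k \<noteq> 0" using n(1) by auto
  then show ?thesis using nk by (intro exI[of _ "1 / k"]) auto
qed

end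

section \<open>Linear changes of variables in Lebesgue integrals\<close>

lemma prod_cart_Basis: "(\<Prod>b\<in>Basis. (v::real^'n) \<bullet> b) = (\<Prod>i\<in>UNIV. v $ i)"
  by (simp add: Basis_vec_def cart_eq_inner_axis axis_eq_axis prod.UNION_disjoint)

text \<open>Preimages of boxes under N are images under its inverse, whose volume is given by a
  determinant. Any positive factor common to all f serves the later limits, so its value is kept
  hidden.\<close>

lemma lborel_integral_linear_wellorder:
  fixes N :: "real^'m::{finite,wellorder} \<Rightarrow> real^'m::_"
  assumes N: "linear N" "inj N"
  shows "\<exists>c>0. \<forall>f::real^'m::_ \<Rightarrow> real. f \<in> borel_measurable borel \<longrightarrow> (LINT x|lborel. f x) = c * (LINT x|lborel. f (N x))"
proof -
  obtain N' where N': "linear N'" "N' \<circ> N = id" "N \<circ> N' = id"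
    using linear_injective_isomorphism[OF N(1) N(2)] by (metis o_def id_apply ext)
  have inv: "N' (N x) = x" "N (N' x) = x" for x
    using N'(2,3) by (auto simp: fun_eq_iff)
  have Nm[measurable]: "N \<in> borel_measurable borel"
    by (intro borel_measurable_continuous_onI linear_continuous_on linear_conv_bounded_linear[THEN iffD1] N)
  define D where "D = \<bar>det (matrix N')\<bar>"
  have D: "D > 0"
    using det_nz_iff_inj[OF N'(1)] inv by (auto simp: D_def inj_on_def) (metis)+
  have "lborel = density (distr lborel borel N) (\<lambda>_. ennreal (1 / D))"
  proof (rule lborel_eqI)
    fix l u :: "(real,'m) vec" assume lu: "\<And>b. b \<in> Basis \<Longrightarrow> l \<bullet> b \<le> u \<bullet> b"
    have vi: "N -` box l u = N' ` box l u"
  proof (intro equalityI subsetI)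
    fix x assume "x \<in> N -` box l u"
    then show "x \<in> N' ` box l u" using inv(1)[of x] by (intro image_eqI[of _ _ "N x"]) auto
  qed (auto simp: inv)
    have ms: "measure lebesgue (N' ` box l u) = D * measure lebesgue (box l u)"
      unfolding D_def by (rule measure_linear_image[OF N'(1)]) simp
    have op: "open (N -` box l u)" by (intro open_vimage linear_continuous_on linear_conv_bounded_linear[THEN iffD1] N) auto
    have bd: "bounded (N' ` box l u)"
      by (intro bounded_linear_image bounded_box linear_conv_bounded_linear[THEN iffD1] N')
    have "emeasure lborel (N -` box l u) = ennreal (measure lborel (N -` box l u))"
      using emeasure_bounded_finite[OF bd] vi by (intro emeasure_eq_ennreal_measure) auto
    also have "measure lborel (N -` box l u) = measure lebesgue (N' ` box l u)"
      using op vi by (simp add: measure_completion)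
    also have "\<dots> = D * (\<Prod>b\<in>Basis. (u - l) \<bullet> b)" unfolding ms using lu
      by (simp add: measure_completion measure_lborel_box_eq)
    finally have e: "emeasure lborel (N -` box l u) = ennreal (D * (\<Prod>b\<in>Basis. (u - l) \<bullet> b))" .
    have "emeasure (density (distr lborel borel N) (\<lambda>_. ennreal (1 / D))) (box l u) = ennreal (1 / D) * emeasure lborel (N -` box l u)"
      by (subst emeasure_density_const) (auto simp: emeasure_distr)
    also have "\<dots> = ennreal (\<Prod>b\<in>Basis. (u - l) \<bullet> b)"
      unfolding e using D by (subst ennreal_mult'[symmetric]) auto
    finally show "emeasure (density (distr lborel borel N) (\<lambda>_. ennreal (1 / D))) (box l u) = (\<Prod>b\<in>Basis. (u - l) \<bullet> b)" .
  qed simp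
  note d = this
  have "(LINT x|lborel. f x) = (1 / D) * (LINT x|lborel. f (N x))" if f[measurable]: "f \<in> borel_measurable borel" for f :: "(real,'m) vec \<Rightarrow> real"
  proof -
    have "(LINT x|lborel. f x) = (LINT x|density (distr lborel borel N) (\<lambda>_. ennreal (1 / D)). f x)" using d by simp
    also have "\<dots> = (LINT x|distr lborel borel N. (1 / D) *\<^sub>R f x)" using D by (intro integral_density) auto
    also have "\<dots> = (LINT x|lborel. (1 / D) *\<^sub>R f (N x))" by (intro integral_distr) auto
    finally show ?thesis by simp
  qed
  moreover have "1 / D > 0" using D by simp
  ultimately show ?thesis by blast
qed

lemma lborel_reindex:
  fixes \<pi> :: "'m::finite \<Rightarrow> 'n::finite"
  assumes \<pi>: "bij \<pi>"
  shows "lborel = distr lborel borel (\<lambda>x::real^'m. (\<chi> i. x $ inv \<pi> i) :: real^'n)"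
proof (rule lborel_eqI)
  let ?r = "\<lambda>x::real^'m. (\<chi> i. x $ inv \<pi> i) :: real^'n"
  fix l u :: "real^'n" assume lu: "\<And>b. b \<in> Basis \<Longrightarrow> l \<bullet> b \<le> u \<bullet> b"
  let ?l = "(\<chi> j. l $ \<pi> j) :: real^'m" and ?u = "(\<chi> j. u $ \<pi> j) :: real^'m"
  have rm: "?r \<in> borel_measurable borel"
    by (intro borel_measurable_continuous_onI continuous_intros)
  have iv: "inv \<pi> (\<pi> j) = j" "\<pi> (inv \<pi> i) = i" for i j
    using \<pi> by (auto simp: bij_is_inj bij_is_surj surj_f_inv_f)
  have vi: "?r -` box l u = box ?l ?u"
    by (auto simp: mem_box_cart) (metis iv)+
  have le: "l $ i \<le> u $ i" for i using lu[of "axis i 1"] by (simp add: inner_axis)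
  have "emeasure (distr lborel borel ?r) (box l u) = emeasure lborel (box ?l ?u)"
    using rm by (simp add: emeasure_distr vi)
  also have "\<dots> = ennreal (\<Prod>j\<in>UNIV. u $ \<pi> j - l $ \<pi> j)"
  proof (subst emeasure_lborel_box)
    show "?l \<bullet> b \<le> ?u \<bullet> b" if "b \<in> Basis" for b
      using that le by (auto simp: Basis_vec_def inner_axis)
  qed (simp add: prod_cart_Basis)
  also have "(\<Prod>j\<in>UNIV. u $ \<pi> j - l $ \<pi> j) = (\<Prod>i\<in>UNIV. u $ i - l $ i)"
    by (rule prod.reindex_bij_betw[OF \<pi>])
  also have "\<dots> = (\<Prod>b\<in>Basis. (u - l) \<bullet> b)" by (simp add: prod_cart_Basis)
  finally show "emeasure (distr lborel borel ?r) (box l u) = (\<Prod>b\<in>Basis. (u - l) \<bullet> b)" .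
qed simp

text \<open>Conjugation with a relabelling of coordinates, which preserves Lebesgue measure, carries
  the result from a well-ordered index type to any index type of the same cardinality.\<close>

lemma lborel_integral_linear_reindex:
  fixes \<pi> :: "'m::{finite,wellorder} \<Rightarrow> 'n::finite" and N :: "real^'n \<Rightarrow> real^'n"
  assumes \<pi>: "bij \<pi>" and N: "linear N" "inj N"
  shows "\<exists>c>0. \<forall>f::real^'n \<Rightarrow> real. f \<in> borel_measurable borel \<longrightarrow> (LINT x|lborel. f x) = c * (LINT x|lborel. f (N x))"
proof -
  define r where "r = (\<lambda>x::(real,'m) vec. (\<chi> i. x $ inv \<pi> i) :: real^'n)"
  define r' where "r' = (\<lambda>y::real^'n. (\<chi> j. y $ \<pi> j) :: (real,'m) vec)"
  have iv: "inv \<pi> (\<pi> j) = j" "\<pi> (inv \<pi> i) = i" for i j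
    using \<pi> by (auto simp: bij_is_inj bij_is_surj surj_f_inv_f)
  have rr: "r (r' y) = y" "r' (r x) = x" for x y by (auto simp: r_def r'_def vec_eq_iff iv)
  have lin: "linear r" "linear r'" by (auto intro!: linearI simp: r_def r'_def vec_eq_iff)
  have "linear (r' \<circ> N \<circ> r)" by (intro linear_compose lin N)
  moreover have "inj (r' \<circ> N \<circ> r)" using N(2) rr by (auto simp: inj_on_def) metis
  ultimately obtain c where c: "c > 0" "\<And>f::(real,'m) vec \<Rightarrow> real. f \<in> borel_measurable borel \<Longrightarrow>
      (LINT x|lborel. f x) = c * (LINT x|lborel. f ((r' \<circ> N \<circ> r) x))"
    using lborel_integral_linear_wellorder by blast
  have rm[measurable]: "r \<in> borel_measurable borel" and Nm[measurable]: "N \<in> borel_measurable borel"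
    by (intro borel_measurable_continuous_onI linear_continuous_on linear_conv_bounded_linear[THEN iffD1] lin N)+
  have d: "lborel = distr lborel borel r" unfolding r_def by (rule lborel_reindex[OF \<pi>])
  have tr: "(LINT x|lborel. f x) = (LINT y|lborel. f (r y))" if "f \<in> borel_measurable borel" for f :: "real^'n \<Rightarrow> real"
    using that by (subst d, intro integral_distr) auto
  have "(LINT x|lborel. f x) = c * (LINT x|lborel. f (N x))" if f[measurable]: "f \<in> borel_measurable borel" for f :: "real^'n \<Rightarrow> real"
    using c(2)[of "\<lambda>y. f (r y)"] by (simp add: tr rr)
  then show ?thesis using c(1) by blast
qed

text \<open>The types \<open>2\<close> and \<open>3\<close> supply well-ordered index sets of the
  right size.\<close>

lemma lborel_integral_linear:
  fixes N :: "real^'n \<Rightarrow> real^'n"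
  assumes dim: "CARD('n) \<in> {2, 3}" and N: "linear N" "inj N"
  shows "\<exists>c>0. \<forall>f::real^'n \<Rightarrow> real. f \<in> borel_measurable borel \<longrightarrow> (LINT x|lborel. f x) = c * (LINT x|lborel. f (N x))"
proof -
  consider "CARD('n) = CARD(2)" | "CARD('n) = CARD(3)" using dim by auto
  then show ?thesis
  proof cases
    case 1
    then obtain \<pi> :: "2 \<Rightarrow> 'n" where "bij \<pi>"
      using finite_same_card_bij[of "UNIV :: 2 set" "UNIV :: 'n set"] by auto
    then show ?thesis by (rule lborel_integral_linear_reindex[OF _ N])
  next
    case 2
    then obtain \<pi> :: "3 \<Rightarrow> 'n" where "bij \<pi>"
      using finite_same_card_bij[of "UNIV :: 3 set" "UNIV :: 'n set"] by auto
    then show ?thesis by (rule lborel_integral_linear_reindex[OF _ N])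
  qed
qed

section \<open>The divergence theorem on a simplex\<close>

text \<open>The gradient is carried along as a second function on the whole space. Piecewise fields
  have pieces that extend globally, so one-sided derivatives never occur.\<close>

definition C1 :: "(real^'n \<Rightarrow> real) \<Rightarrow> (real^'n \<Rightarrow> real^'n) \<Rightarrow> bool" where
  "C1 P D \<longleftrightarrow> (\<forall>x. (P has_derivative (\<lambda>h. D x \<bullet> h)) (at x)) \<and> continuous_on UNIV D"

lemma C1_continuous: "C1 P D \<Longrightarrow> continuous_on S P"
  unfolding C1_def by (meson continuous_at_imp_continuous_on has_derivative_continuous)

lemma C1_grad_continuous: "C1 P D \<Longrightarrow> continuous_on S D"
  unfolding C1_def using continuous_on_subset by blast

lemma C1_const: "C1 (\<lambda>x. c) (\<lambda>x. 0)"
  by (simp add: C1_def)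

lemma lborel_integral_translation:
  fixes f :: "real^'n \<Rightarrow> real"
  assumes "f \<in> borel_measurable borel"
  shows "(LINT x|lborel. f (x + v)) = (LINT x|lborel. f x)"
proof -
  have "(LINT x|lborel. f x) = (LINT x|distr lborel borel ((+) v). f x)"
    using lborel_distr_plus[of v] by simp
  also have "\<dots> = (LINT x|lborel. f (v + x))" using assms by (intro integral_distr) auto
  finally show ?thesis by (simp add: add.commute)
qed

lemma lborel_integral_homothety:
  fixes f :: "real^'n \<Rightarrow> real"
  assumes "f \<in> borel_measurable borel" "c > 0"
  shows "(LINT x|lborel. f x) = c ^ CARD('n) * (LINT x|lborel. f (t + c *\<^sub>R x))"
proof -
  have "(LINT x|lborel. f x) = (LINT x|density (distr lborel borel (\<lambda>x. t + c *\<^sub>R x)) (\<lambda>_. ennreal (\<bar>c\<bar> ^ DIM(real^'n))). f x)"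
    using lborel_affine[of c t] assms(2) by simp
  also have "\<dots> = (LINT x|distr lborel borel (\<lambda>x. t + c *\<^sub>R x). (\<bar>c\<bar> ^ DIM(real^'n)) *\<^sub>R f x)"
    using assms by (intro integral_density) auto
  also have "\<dots> = (LINT x|lborel. (\<bar>c\<bar> ^ DIM(real^'n)) *\<^sub>R f (t + c *\<^sub>R x))"
    using assms by (intro integral_distr) auto
  finally show ?thesis using assms by simp
qed

lemma integrable_continuous_compact:
  fixes f :: "real^'n \<Rightarrow> real"
  assumes "compact S" "continuous_on UNIV f"
  shows "integrable lborel (\<lambda>x. indicator S x * f x)"
  using borel_integrable_compact[of S f] assms continuous_on_subset[of UNIV f S]
  by (simp add: set_integrable_def)

lemma AE_affine_nonzero:
  fixes a :: "real^'n"
  assumes "a \<bullet> y + b \<noteq> 0"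
  shows "AE x in lborel. a \<bullet> x + b \<noteq> 0"
proof (cases "a = 0")
  case True then show ?thesis using assms by simp
next
  case False
  then have "negligible {x. a \<bullet> x = - b}" by (intro negligible_hyperplane) simp
  then have "{x. a \<bullet> x = - b} \<in> null_sets lborel"
    using closed_hyperplane[of a "- b"] by (simp add: negligible_iff_null_sets null_sets_completion_iff)
  then have "AE x in lborel. x \<notin> {x. a \<bullet> x = - b}" by (rule AE_not_in)
  then show ?thesis by (rule AE_mp) (auto intro!: AE_I2)
qed

context full_simplex
begin

lemma continuous_on_foot: "continuous_on S (foot T a)"
  unfolding foot_def divide_inverse by (intro continuous_intros continuous_on_bary)

text \<open>The distance to the facet hyperplane is the absolute value of the barycentric coordinate
  divided by the norm of its gradient, so this is the prism of thickness one from
  \<open>face_integral\<close>.\<close>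

definition prism :: "real^'n \<Rightarrow> (real^'n) set" where
  "prism a = {x. foot T a x \<in> opp T a \<and> \<bar>bary T a x\<bar> \<le> norm (bgrad T a) / 2}"

lemma face_integral_opp:
  assumes a: "a \<in> vert T"
  shows "face_integral (opp T a) \<phi> = (LINT x|lebesgue. indicator (prism a) x * \<phi> (foot T a x))"
proof -
  have "norm (bgrad T a) > 0" using bgrad_nonzero[OF a] by simp
  then have "{x. foot T a x \<in> opp T a \<and> dist x (foot T a x) \<le> 1 / 2} = prism a"
    unfolding prism_def dist_foot[OF a] by (auto simp: field_simps)
  then show ?thesis
    unfolding face_integral_def closest_point_opp[OF a] set_lebesgue_integral_def by simp
qed

lemma compact_opp: "compact (opp T a)"
  unfolding opp_def using finite_vert by (intro finite_imp_compact_convex_hull) auto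

lemma norm_minus_foot:
  assumes "a \<in> vert T" "\<bar>bary T a x\<bar> \<le> c * norm (bgrad T a)"
  shows "norm (x - foot T a x) \<le> c"
  using dist_foot[OF assms(1), of x] bgrad_nonzero[OF assms(1)] assms(2) by (simp add: dist_norm divide_le_eq)

lemma compact_prism:
  assumes a: "a \<in> vert T"
  shows "compact (prism a)"
proof -
  have "closed ((foot T a) -` opp T a)"
    by (intro continuous_closed_vimage compact_imp_closed compact_opp)
       (metis continuous_on_eq_continuous_at continuous_on_foot open_UNIV UNIV_I)
  moreover have "closed {x. \<bar>bary T a x\<bar> \<le> norm (bgrad T a) / 2}"
    by (intro closed_Collect_le continuous_intros continuous_on_bary)
  moreover have "prism a = (foot T a) -` opp T a \<inter> {x. \<bar>bary T a x\<bar> \<le> norm (bgrad T a) / 2}"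
    by (auto simp: prism_def)
  ultimately have "closed (prism a)" by auto
  moreover have "bounded (prism a)"
  proof -
    obtain B where B: "\<And>y. y \<in> opp T a \<Longrightarrow> norm y \<le> B"
      using compact_imp_bounded[OF compact_opp] unfolding bounded_iff by blast
    have "norm x \<le> B + 1 / 2" if "x \<in> prism a" for x
      using norm_minus_foot[OF a, of x "1/2"] that B[of "foot T a x"] norm_triangle_ineq[of "foot T a x" "x - foot T a x"]
      by (simp add: prism_def)
    then show ?thesis unfolding bounded_iff by blast
  qed
  ultimately show ?thesis by (simp add: compact_eq_bounded_closed)
qed

lemma face_integral_lborel:
  assumes a: "a \<in> vert T" and \<phi>: "continuous_on UNIV \<phi>"
  shows "integrable lborel (\<lambda>x. indicator (prism a) x * \<phi> (foot T a x))"
    and "face_integral (opp T a) \<phi> = (LINT x|lborel. indicator (prism a) x * \<phi> (foot T a x))"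
proof -
  have c: "continuous_on UNIV (\<lambda>x. \<phi> (foot T a x))"
    by (rule continuous_on_compose2[OF \<phi> continuous_on_foot]) auto
  show i: "integrable lborel (\<lambda>x. indicator (prism a) x * \<phi> (foot T a x))"
    by (rule integrable_continuous_compact[OF compact_prism[OF a] c])
  show "face_integral (opp T a) \<phi> = (LINT x|lborel. indicator (prism a) x * \<phi> (foot T a x))"
    unfolding face_integral_opp[OF a] by (intro integral_completion borel_measurable_integrable i)
qed

lemma foot_fixed: "bary T a x = 0 \<Longrightarrow> foot T a x = x"
  by (simp add: foot_def)

lemma opp_centroid:
  assumes a: "a \<in> vert T"
  shows "\<exists>c\<in>opp T a. \<forall>z\<in>vert T - {a}. 0 < bary T z c"
proof -
  define u where "u = (\<lambda>y. if y = a then 0 else 1 / real CARD('n))"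
  define c where "c = (\<Sum>y\<in>vert T. u y *\<^sub>R y)"
  have "sum u (vert T) = 1"
    using a card_vert finite_vert by (simp add: u_def sum.If_cases sum.remove[OF finite_vert a])
  then have "bary T z c = u z" if "z \<in> vert T" for z unfolding c_def using that by (intro bary_combination)
  then show ?thesis using opp_mem_iff[OF a, of c] a by (intro bexI[of _ c]) (auto simp: u_def)
qed

text \<open>Continuity spreads the positive value over an open part of the prism, which has positive
  measure.\<close>

lemma face_integral_pos:
  assumes a: "a \<in> vert T" and \<phi>: "continuous_on UNIV \<phi>" "\<And>x. x \<in> opp T a \<Longrightarrow> 0 \<le> \<phi> x"
    and x: "x \<in> opp T a" "\<phi> x > 0"
  shows "face_integral (opp T a) \<phi> > 0"
proof -
  obtain c where c: "c \<in> opp T a" "\<And>z. z \<in> vert T - {a} \<Longrightarrow> 0 < bary T z c"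
    using opp_centroid[OF a] by blast
  define U where "U = {x. 0 < \<phi> (foot T a x)} \<inter> {x. \<bar>bary T a x\<bar> < norm (bgrad T a) / 2} \<inter> (\<Inter>z\<in>vert T - {a}. {x. 0 < bary T z (foot T a x)})"
  have "open U"
    unfolding U_def using finite_vert
    by (intro open_Int open_INT open_Collect_less continuous_intros continuous_on_bary
        continuous_on_compose2[OF \<phi>(1) continuous_on_foot] continuous_on_compose2[OF continuous_on_bary continuous_on_foot] ballI) auto
  have UP: "U \<subseteq> prism a"
    using bary_foot[OF a] by (fastforce simp: U_def prism_def opp_mem_iff[OF a] intro: less_imp_le)
  \<comment> \<open>If x lies on the relative boundary of the facet, a small move towards the
    centroid reaches the relative interior without losing positivity.\<close>
  have "\<exists>y. y \<in> U"
  proof -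
    have "((\<lambda>t. \<phi> ((1 - t) *\<^sub>R x + t *\<^sub>R c)) \<longlongrightarrow> \<phi> ((1 - 0) *\<^sub>R x + 0 *\<^sub>R c)) (at_right 0)"
      by (rule continuous_on_tendsto_compose[OF \<phi>(1)]) (auto intro!: tendsto_eq_intros)
    then have "\<forall>\<^sub>F t in at_right 0. 0 < \<phi> ((1 - t) *\<^sub>R x + t *\<^sub>R c)"
      using x(2) by (intro order_tendstoD(1)) auto
    then obtain b where b: "b > 0" "\<And>t. 0 < t \<Longrightarrow> t < b \<Longrightarrow> 0 < \<phi> ((1 - t) *\<^sub>R x + t *\<^sub>R c)"
      unfolding eventually_at_right_field by blast
    define t where "t = min (b / 2) (1 / 2)"
    have t: "0 < t" "t < b" "t < 1" using b by (auto simp: t_def)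
    define y where "y = (1 - t) *\<^sub>R x + t *\<^sub>R c"
    have ya: "bary T a y = 0" using x(1) c(1) by (simp add: y_def bary_affine opp_mem_iff[OF a])
    have "0 < bary T z y" if "z \<in> vert T - {a}" for z
      unfolding y_def using that x(1) c t by (simp add: bary_affine opp_mem_iff[OF a] add_nonneg_pos)
    then have "y \<in> U" using ya b(2)[OF t(1,2)] bgrad_nonzero[OF a] by (simp add: U_def foot_fixed y_def)
    then show ?thesis by blast
  qed
  let ?f = "\<lambda>x. indicator (prism a) x * \<phi> (foot T a x)"
  have nn: "0 \<le> ?f x" for x using \<phi>(2) by (auto simp: indicator_def prism_def)
  have "(LINT x|lborel. ?f x) \<noteq> 0"
  proof
    assume "(LINT x|lborel. ?f x) = 0"
    then have "AE x in lborel. ?f x = 0"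
      using integral_nonneg_eq_0_iff_AE[OF face_integral_lborel(1)[OF a \<phi>(1)]] nn by auto
    then have "AE x in lborel. x \<notin> U"
      by (rule AE_mp) (use UP in \<open>auto intro!: AE_I2 simp: U_def\<close>)
    then have "U \<in> null_sets lborel"
      using \<open>open U\<close> AE_iff_null_sets[of U lborel] by simp
    then have "negligible U" by (simp add: negligible_iff_null_sets null_sets_completionI)
    then show False using \<open>\<exists>y. y \<in> U\<close> open_not_negligible[OF \<open>open U\<close>] by blast
  qed
  moreover have "(LINT x|lborel. ?f x) \<ge> 0" by (intro Bochner_Integration.integral_nonneg nn)
  ultimately show ?thesis unfolding face_integral_lborel(2)[OF a \<phi>(1)] by linarith
qed

text \<open>Stretching the layer of width proportional to \<open>d\<close> along the normal to unit width turns it, in the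
  limit, into the prism over the facet.\<close>

definition stretch :: "real^'n \<Rightarrow> real \<Rightarrow> real^'n \<Rightarrow> real^'n" where
  "stretch a d x = foot T a x + d *\<^sub>R (x - foot T a x)"

lemma bary_stretch:
  assumes "a \<in> vert T"
  shows "bary T a (stretch a d x) = d * bary T a x"
  using bary_foot[OF assms, of x] bary_diff[of T a x "foot T a x"] by (simp add: stretch_def bary_add)

text \<open>The stretching is affine with an invertible linear part, so it changes integrals by a
  positive factor that depends on d but not on f.\<close>

lemma integral_stretch:
  assumes dim: "CARD('n) \<in> {2, 3}" and a: "a \<in> vert T" and d: "d > 0"
  shows "\<exists>c>0. \<forall>f::real^'n \<Rightarrow> real. f \<in> borel_measurable borel \<longrightarrow>
    (LINT x|lborel. f x) = c * (LINT x|lborel. f (stretch a d x))"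
proof -
  define g where "g = bgrad T a"
  have g: "g \<bullet> g > 0" using bgrad_nonzero[OF a] by (simp add: g_def)
  \<comment> \<open>Chosen so that the linear part N scales the direction of \<open>g\<close> by d
    and fixes its orthogonal complement.\<close>
  define k where "k = (1 - d) / (g \<bullet> g)"
  define N where "N = (\<lambda>x. x - (k * (g \<bullet> x)) *\<^sub>R g)"
  define v where "v = - ((k * snd (bary_coeff T a)) *\<^sub>R g)"
  have st: "stretch a d x = N x + v" for x
  proof -
    have "stretch a d x = x - ((1 - d) * (bary T a x / (g \<bullet> g))) *\<^sub>R g"
    proof -
      have "(x - q *\<^sub>R g) + d *\<^sub>R (x - (x - q *\<^sub>R g)) = x - ((1 - d) * q) *\<^sub>R g" for q
        by (simp add: left_diff_distrib scaleR_left_diff_distrib)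
      then show ?thesis unfolding stretch_def foot_def g_def[symmetric] by blast
    qed
    also have "(1 - d) * (bary T a x / (g \<bullet> g)) = k * (g \<bullet> x) + k * snd (bary_coeff T a)"
      by (simp add: k_def bary_def g_def[symmetric] add_divide_distrib distrib_left)
    finally show ?thesis by (simp add: N_def v_def scaleR_left_distrib)
  qed
  have lin: "linear N"
  proof (rule linearI)
    show "N (x + y) = N x + N y" for x y
      by (simp add: N_def inner_add_right distrib_left scaleR_left_distrib)
    show "N (c *\<^sub>R x) = c *\<^sub>R N x" for c x
      by (simp add: N_def scaleR_right_diff_distrib mult.left_commute)
  qed
  have "N x = 0 \<Longrightarrow> x = 0" for x
  proof -
    assume 0: "N x = 0"
    have "k * (g \<bullet> x) * (g \<bullet> g) = (1 - d) * (g \<bullet> x)" using g by (simp add: k_def)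
    then have "g \<bullet> N x = d * (g \<bullet> x)" by (simp add: N_def inner_diff_right left_diff_distrib)
    then have "g \<bullet> x = 0" using 0 d by simp
    then show "x = 0" using 0 by (simp add: N_def)
  qed
  then have inj: "inj N" using linear_injective_0[OF lin] by blast
  obtain c where c: "c > 0" "\<And>f::real^'n \<Rightarrow> real. f \<in> borel_measurable borel \<Longrightarrow> (LINT x|lborel. f x) = c * (LINT x|lborel. f (N x))"
    using lborel_integral_linear[OF dim lin inj] by blast
  have "(LINT x|lborel. f x) = c * (LINT x|lborel. f (stretch a d x))" if f: "f \<in> borel_measurable borel" for f :: "real^'n \<Rightarrow> real"
  proof -
    have "(\<lambda>x. f (x + v)) \<in> borel_measurable borel" using f by measurable
    then show ?thesis using c(2)[of "\<lambda>x. f (x + v)"] lborel_integral_translation[OF f, of v] by (simp add: st)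
  qed
  then show ?thesis using c(1) by blast
qed

text \<open>Pulled back by \<open>stretch\<close>, the layer lies at distance less than one over the
  hyperplane, and the stretched points converge to their feet. The indicators converge except over
  the relative boundary of the facet and on the top of the slab, and both sets are null.\<close>

lemma layer_limit:
  assumes a: "a \<in> vert T" and \<phi>: "continuous_on UNIV \<phi>" and d: "d \<longlonglongrightarrow> 0" "\<And>k. 0 < d k" "\<And>k. d k \<le> 1"
  shows "(\<lambda>k. LINT x|lborel. indicator {x \<in> T. bary T a x < d k * norm (bgrad T a)} (stretch a (d k) x) * \<phi> (stretch a (d k) x))
    \<longlonglongrightarrow> face_integral (opp T a) \<phi>"
proof -
  define g where "g = bgrad T a"
  have g: "norm g > 0" using bgrad_nonzero[OF a] by (simp add: g_def)
  define J where "J = (\<lambda>k x. indicator {x \<in> T. bary T a x < d k * norm g} (stretch a (d k) x) * \<phi> (stretch a (d k) x))"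
  \<comment> \<open>One-sided slab of thickness one over the facet:
    \<open>bary T a x = norm g\<close> means distance one from the hyperplane.\<close>
  define S where "S = {x. foot T a x \<in> opp T a \<and> 0 \<le> bary T a x \<and> bary T a x \<le> norm g}"
  define L where "L = (\<lambda>x. indicator S x * \<phi> (foot T a x))"
  have Jind: "J k x = (if stretch a (d k) x \<in> T \<and> bary T a x < norm g then \<phi> (stretch a (d k) x) else 0)" for k x
    using d(2)[of k] by (simp add: J_def bary_stretch[OF a] indicator_def)
  \<comment> \<open>Half a unit normal; translation by it moves the symmetric prism of
    \<open>face_integral\<close> onto the one-sided slab.\<close>
  define v where "v = (1 / (2 * norm g)) *\<^sub>R g"
  have gv: "bgrad T a \<bullet> v = norm g / 2" using g by (simp add: v_def g_def dot_square_norm power2_eq_square)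
  have bv: "bary T a (x + v) = bary T a x + norm g / 2" for x by (simp add: bary_add gv)
  have fv: "foot T a (x + v) = foot T a x" for x
  proof -
    have "norm g / 2 / (g \<bullet> g) = 1 / (2 * norm g)" using g by (simp add: dot_square_norm power2_eq_square)
    then show ?thesis unfolding foot_def bv g_def[symmetric]
      by (simp only: v_def add_divide_distrib scaleR_left_distrib) simp
  qed
  have ct: "continuous_on UNIV (\<lambda>x. \<phi> (foot T a x))"
    by (rule continuous_on_compose2[OF \<phi> continuous_on_foot]) auto
  have Sm: "S \<in> sets borel"
  proof -
    have "closed ((foot T a) -` opp T a)"
      by (intro continuous_closed_vimage compact_imp_closed compact_opp)
        (metis continuous_on_eq_continuous_at continuous_on_foot open_UNIV UNIV_I)
    moreover have "closed {x. 0 \<le> bary T a x}" "closed {x. bary T a x \<le> norm g}"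
      by (intro closed_Collect_le continuous_intros continuous_on_bary)+
    moreover have "S = (foot T a) -` opp T a \<inter> {x. 0 \<le> bary T a x} \<inter> {x. bary T a x \<le> norm g}" by (auto simp: S_def)
    ultimately show ?thesis by (simp add: borel_closed closed_Int)
  qed
  have Lm: "L \<in> borel_measurable borel"
    unfolding L_def by (intro borel_measurable_times borel_measurable_indicator Sm borel_measurable_continuous_onI ct)
  have LP: "L (x + v) = indicator (prism a) x * \<phi> (foot T a x)" for x
    unfolding L_def S_def prism_def by (auto simp: fv bv indicator_def g_def[symmetric] abs_le_iff)
  have Lint: "(LINT x|lborel. L x) = face_integral (opp T a) \<phi>"
    using lborel_integral_translation[OF Lm, of v] face_integral_lborel(2)[OF a \<phi>] by (simp add: LP)
  have stc: "continuous_on UNIV (stretch a e)" for e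
    unfolding stretch_def by (intro continuous_intros continuous_on_foot)
  have stm: "stretch a e \<in> borel_measurable borel" for e
    by (intro borel_measurable_continuous_onI stc)
  obtain B where B: "\<And>y. y \<in> T \<Longrightarrow> norm y \<le> B"
    using compact_imp_bounded[OF compact] unfolding bounded_iff by blast
  have "bounded (\<phi> ` T)" by (intro compact_imp_bounded compact_continuous_image compact continuous_on_subset[OF \<phi>]) auto
  then obtain C where C: "\<And>y. y \<in> T \<Longrightarrow> \<bar>\<phi> y\<bar> \<le> C" unfolding bounded_iff by (metis imageI real_norm_def)
  have "(\<lambda>k. LINT x|lborel. J k x) \<longlonglongrightarrow> (LINT x|lborel. L x)"
  proof (rule integral_dominated_convergence[where w = "\<lambda>x. C * indicator (cball 0 (B + 1)) x"])
    show "L \<in> borel_measurable lborel" using Lm by simp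
    show "J k \<in> borel_measurable lborel" for k
    proof -
      have s: "{x \<in> T. bary T a x < d k * norm g} \<in> sets borel"
      proof -
        have "open {x. bary T a x < d k * norm g}" by (intro open_Collect_less continuous_intros continuous_on_bary)
        then have "T \<inter> {x. bary T a x < d k * norm g} \<in> sets borel" using closed by (intro sets.Int) auto
        moreover have "{x \<in> T. bary T a x < d k * norm g} = T \<inter> {x. bary T a x < d k * norm g}" by auto
        ultimately show ?thesis by (simp only:)
      qed
      have "(\<lambda>y. indicator {x \<in> T. bary T a x < d k * norm g} y * \<phi> y) \<in> borel_measurable borel"
        using s by (intro borel_measurable_times borel_measurable_indicator borel_measurable_continuous_onI \<phi>)
      from measurable_compose[OF stm[of "d k"] this] show ?thesis
        by (simp only: J_def measurable_lborel2)
    qed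
    show "integrable lborel (\<lambda>x. C * indicator (cball (0::real^'n) (B + 1)) x)"
      by (intro integrable_mult_right integrable_real_indicator) (use emeasure_bounded_finite[of "cball (0::real^'n) (B + 1)"] in auto)
    show "AE x in lborel. norm (J k x) \<le> C * indicator (cball 0 (B + 1)) x" for k
    proof (rule AE_I2)
      fix x
      show "norm (J k x) \<le> C * indicator (cball 0 (B + 1)) x"
      proof (cases "stretch a (d k) x \<in> T \<and> bary T a x < norm g")
        case True
        then have "0 \<le> d k * bary T a x" using mem_iff a by (metis bary_stretch[OF a])
        then have "0 \<le> bary T a x" using d(2)[of k] by (simp add: zero_le_mult_iff)
        then have n1: "norm (x - foot T a x) \<le> 1" using True by (intro norm_minus_foot[OF a]) (simp add: g_def)
        \<comment> \<open>The point x is at most one unit away from a point of T, whence the radius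
          B + 1 of the dominating function.\<close>
        have "x = stretch a (d k) x + (1 - d k) *\<^sub>R (x - foot T a x)" by (simp add: stretch_def algebra_simps)
        then have "norm x \<le> norm (stretch a (d k) x) + norm ((1 - d k) *\<^sub>R (x - foot T a x))" by (metis norm_triangle_ineq)
        also have "norm ((1 - d k) *\<^sub>R (x - foot T a x)) \<le> 1"
          using n1 d(2,3)[of k] by (simp add: mult_le_one)
        finally have "norm x \<le> B + 1" using B True by force
        then show ?thesis using C True by (simp add: Jind)
      next
        case False
        obtain c where "c \<in> opp T a" using opp_centroid[OF a] by blast
        then have "c \<in> T" using opp_mem_iff[OF a] mem_iff a by (metis DiffI insertE order_refl singletonD empty_iff)
        then have "0 \<le> C" using C abs_ge_zero order_trans by blast
        then have z: "0 \<le> C * indicator (cball 0 (B + 1)) x" by simp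
        have "J k x = 0" using False unfolding Jind by (rule if_not_P)
        then show ?thesis using z by (metis norm_zero)
      qed
    qed
    \<comment> \<open>An affine function of x with value 1 at the vertex z, so its zero set is empty
      or a hyperplane.\<close>
    have nz: "AE x in lborel. bary T z (foot T a x) \<noteq> 0" if z: "z \<in> vert T - {a}" for z
    proof -
      define m where "m = (bgrad T z \<bullet> bgrad T a) / (bgrad T a \<bullet> bgrad T a)"
      define q where "q = bgrad T z - m *\<^sub>R bgrad T a"
      define r where "r = snd (bary_coeff T z) - m * snd (bary_coeff T a)"
      have "bary T z (foot T a x) = q \<bullet> x + r" for x
      proof -
        have "bary T z (foot T a x) = bary T z x - m * bary T a x"
          using bary_diff[of T z "foot T a x" x] by (simp add: foot_def m_def algebra_simps)
        then show ?thesis by (simp add: bary_def q_def r_def inner_diff_left distrib_left)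
      qed
      moreover have "bary T z (foot T a z) = 1" using z a by (simp add: foot_fixed bary_vert)
      ultimately show ?thesis using AE_affine_nonzero[of q z r] by simp
    qed
    have "AE x in lborel. \<forall>z\<in>vert T - {a}. bary T z (foot T a x) \<noteq> 0"
      using finite_vert by (intro AE_finite_allI nz) auto
    moreover have "AE x in lborel. bary T a x \<noteq> norm g"
    proof -
      have "bgrad T a \<bullet> foot T a 0 + (snd (bary_coeff T a) - norm g) = bary T a (foot T a 0) - norm g"
        by (simp add: bary_def)
      then have "bgrad T a \<bullet> foot T a 0 + (snd (bary_coeff T a) - norm g) \<noteq> 0"
        unfolding bary_foot[OF a] using g by linarith
      then obtain y where "bgrad T a \<bullet> y + (snd (bary_coeff T a) - norm g) \<noteq> 0" by blast
      from AE_affine_nonzero[OF this] show ?thesis by (rule AE_mp) (auto intro!: AE_I2 simp: bary_def)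
    qed
    ultimately show "AE x in lborel. (\<lambda>k. J k x) \<longlonglongrightarrow> L x"
    proof eventually_elim
      case (elim x)
      have st: "(\<lambda>k. stretch a (d k) x) \<longlonglongrightarrow> foot T a x"
        unfolding stretch_def by (rule tendsto_eq_intros d refl | simp)+
      have sb: "(\<lambda>k. bary T z (stretch a (d k) x)) \<longlonglongrightarrow> bary T z (foot T a x)" for z
        by (rule continuous_on_tendsto_compose[OF continuous_on_bary[of UNIV] st]) auto
      show ?case
      proof (cases "0 \<le> bary T a x \<and> bary T a x \<le> norm g")
        case False
        then have "J k x = 0" for k
        proof (cases "bary T a x < 0")
          case True
          then have "bary T a (stretch a (d k) x) < 0" using d(2)[of k] by (simp add: bary_stretch[OF a] mult_pos_neg)
          then have "stretch a (d k) x \<notin> T" unfolding mem_iff using a by (meson not_less)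
          then show ?thesis by (simp add: Jind)
        qed (use False in \<open>auto simp: Jind\<close>)
        moreover have "L x = 0" using False by (auto simp: L_def S_def)
        ultimately show ?thesis by simp
      next
        case True
        show ?thesis
        proof (cases "\<forall>z\<in>vert T - {a}. 0 < bary T z (foot T a x)")
          case pos: True
          then have "foot T a x \<in> opp T a" using bary_foot[OF a] by (simp add: opp_mem_iff[OF a] less_imp_le)
          then have Lx: "L x = \<phi> (foot T a x)" using True by (simp add: L_def S_def)
          have ev: "\<forall>\<^sub>F k in sequentially. J k x = \<phi> (stretch a (d k) x)"
          proof -
            have "\<forall>\<^sub>F k in sequentially. \<forall>z\<in>vert T - {a}. 0 < bary T z (stretch a (d k) x)"
            proof (rule eventually_ball_finite)
              show "\<forall>z\<in>vert T - {a}. \<forall>\<^sub>F k in sequentially. 0 < bary T z (stretch a (d k) x)"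
                using pos order_tendstoD(1)[OF sb] by blast
            qed (use finite_vert in simp)
            then show ?thesis
            proof eventually_elim
              case (elim k)
              have "0 \<le> bary T a (stretch a (d k) x)" using True d(2)[of k] by (simp add: bary_stretch[OF a])
              then have "0 \<le> bary T z (stretch a (d k) x)" if "z \<in> vert T" for z
                using elim that by (cases "z = a") (auto intro: less_imp_le)
              then have "stretch a (d k) x \<in> T" unfolding mem_iff by blast
              then show ?case using True \<open>bary T a x \<noteq> norm g\<close> by (simp add: Jind)
            qed
          qed
          have "(\<lambda>k. \<phi> (stretch a (d k) x)) \<longlonglongrightarrow> \<phi> (foot T a x)"
            by (rule continuous_on_tendsto_compose[OF \<phi> st]) auto
          then show ?thesis unfolding Lx tendsto_cong[OF ev] .
        next
          case False
          then obtain z where z: "z \<in> vert T - {a}" "bary T z (foot T a x) < 0"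
            using elim(1) by (meson linorder_neqE_linordered_idom)
          then have "foot T a x \<notin> opp T a" unfolding opp_mem_iff[OF a] by (meson not_less)
          then have "L x = 0" by (simp add: L_def S_def)
          moreover have "\<forall>\<^sub>F k in sequentially. J k x = 0"
            using order_tendstoD(2)[OF sb z(2)]
          proof eventually_elim
            case (elim k)
            then have "stretch a (d k) x \<notin> T" using z(1) mem_iff by (metis DiffD1 not_less)
            then show ?case by (simp add: Jind)
          qed
          ultimately show ?thesis by (simp add: tendsto_eventually)
        qed
      qed
    qed
  qed
  then show ?thesis unfolding Lint J_def g_def .
qed


lemma bary_homothety:
  assumes "a \<in> vert T" "z \<in> vert T"
  shows "bary T z (e *\<^sub>R a + (1 - e) *\<^sub>R x) = (if z = a then e else 0) + (1 - e) * bary T z x"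
  using assms by (auto simp: bary_affine bary_vert)

lemma sets_T: "T \<in> sets borel"
  using closed by simp

text \<open>The complement of the layer in T is the image of T under the homothety with centre a and
  ratio 1 - e; substitution turns the layer integral into a difference of integrals over T.\<close>

lemma layer_integral:
  assumes a: "a \<in> vert T" and P: "continuous_on UNIV P" and e: "0 < e" "e < 1"
  shows "(LINT x|lborel. indicator {x \<in> T. bary T a x < e} x * P x)
    = (LINT x|lborel. indicator T x * (P x - (1 - e) ^ CARD('n) * P (x + e *\<^sub>R (a - x))))"
proof -
  define B where "B = {x \<in> T. e \<le> bary T a x}"
  have "B = T \<inter> {x. e \<le> bary T a x}" by (auto simp: B_def)
  moreover have "closed {x. e \<le> bary T a x}" by (intro closed_Collect_le continuous_intros continuous_on_bary)
  ultimately have Bc: "compact B" using compact by (simp add: compact_Int_closed)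
  have memB: "e *\<^sub>R a + (1 - e) *\<^sub>R x \<in> B \<longleftrightarrow> x \<in> T" for x
  proof -
    have key: "0 \<le> bary T z (e *\<^sub>R a + (1 - e) *\<^sub>R x) \<and> (z = a \<longrightarrow> e \<le> bary T a (e *\<^sub>R a + (1 - e) *\<^sub>R x)) \<longleftrightarrow> 0 \<le> bary T z x"
      if z: "z \<in> vert T" for z
    proof -
      have pos: "0 \<le> (1 - e) * t \<longleftrightarrow> 0 \<le> t" for t using e by (simp add: zero_le_mult_iff)
      show ?thesis using pos[of "bary T z x"] e by (cases "z = a") (auto simp: bary_homothety[OF a z] bary_homothety[OF a a])
    qed
    have "e *\<^sub>R a + (1 - e) *\<^sub>R x \<in> B \<longleftrightarrow> (\<forall>z\<in>vert T. 0 \<le> bary T z (e *\<^sub>R a + (1 - e) *\<^sub>R x)) \<and> e \<le> bary T a (e *\<^sub>R a + (1 - e) *\<^sub>R x)"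
      by (simp add: B_def mem_iff)
    also have "\<dots> \<longleftrightarrow> x \<in> T" unfolding mem_iff using key a by blast
    finally show ?thesis .
  qed
  have Bm: "(\<lambda>x. indicator B x * P x) \<in> borel_measurable borel"
    using Bc by (intro borel_measurable_times borel_measurable_indicator borel_measurable_continuous_onI P) (simp add: compact_imp_closed borel_closed)
  have eq: "e *\<^sub>R a + (1 - e) *\<^sub>R x = x + e *\<^sub>R (a - x)" for x by (simp add: algebra_simps)
  have iT: "integrable lborel (\<lambda>x. indicator T x * P x)" by (rule integrable_continuous_compact[OF compact P])
  have iB: "integrable lborel (\<lambda>x. indicator B x * P x)" by (rule integrable_continuous_compact[OF Bc P])
  have iS: "integrable lborel (\<lambda>x. indicator T x * P (x + e *\<^sub>R (a - x)))"
    by (intro integrable_continuous_compact[OF compact] continuous_on_compose2[OF P] continuous_intros) auto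
  have "(LINT x|lborel. indicator B x * P x) = (1 - e) ^ CARD('n) * (LINT x|lborel. indicator B (e *\<^sub>R a + (1 - e) *\<^sub>R x) * P (e *\<^sub>R a + (1 - e) *\<^sub>R x))"
    using lborel_integral_homothety[OF Bm, of "1 - e" "e *\<^sub>R a"] e by simp
  also have "(\<lambda>x. indicator B (e *\<^sub>R a + (1 - e) *\<^sub>R x) * P (e *\<^sub>R a + (1 - e) *\<^sub>R x)) = (\<lambda>x. indicator T x * P (x + e *\<^sub>R (a - x)))"
    using memB eq by (auto simp: indicator_def)
  finally have B: "(LINT x|lborel. indicator B x * P x) = (1 - e) ^ CARD('n) * (LINT x|lborel. indicator T x * P (x + e *\<^sub>R (a - x)))" .
  have "indicator {x \<in> T. bary T a x < e} x * P x = indicator T x * P x - indicator B x * P x" for x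
    by (cases "x \<in> T"; cases "bary T a x < e") (auto simp: B_def)
  then have "(LINT x|lborel. indicator {x \<in> T. bary T a x < e} x * P x) = (LINT x|lborel. indicator T x * P x) - (LINT x|lborel. indicator B x * P x)"
    using iT iB by simp
  also have "\<dots> = (LINT x|lborel. indicator T x * P x - (1 - e) ^ CARD('n) * (indicator T x * P (x + e *\<^sub>R (a - x))))"
    unfolding B using iT iS by simp
  finally show ?thesis by (simp add: right_diff_distrib mult.left_commute)
qed

text \<open>By \<open>layer_integral\<close> the quotient is, up to sign, the integral of a
  difference quotient at t = 0 of (1 - t)^n P(x + t (a - x)), where n is the dimension. The negative
  of its derivative, n P + D . (x - a), is the divergence of the field P (x - a).\<close>

lemma volume_limit:
  assumes a: "a \<in> vert T" and P: "C1 P D" and e: "e \<longlonglongrightarrow> 0" "\<And>k. 0 < e k" "\<And>k. e k < 1"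
  shows "(\<lambda>k. (LINT x|lborel. indicator {x \<in> T. bary T a x < e k} x * P x) / e k)
    \<longlonglongrightarrow> (LINT x|lborel. indicator T x * (real CARD('n) * P x + D x \<bullet> (x - a)))"
proof -
  define \<psi> where "\<psi> = (\<lambda>x t. (1 - t) ^ CARD('n) * P (x + t *\<^sub>R (a - x)))"
  define \<psi>' where "\<psi>' = (\<lambda>x t. - (real CARD('n) * (1 - t) ^ (CARD('n) - 1)) * P (x + t *\<^sub>R (a - x)) + (1 - t) ^ CARD('n) * (D (x + t *\<^sub>R (a - x)) \<bullet> (a - x)))"
  have der: "(\<psi> x has_real_derivative \<psi>' x t) (at t)" for x t
  proof -
    have "((\<lambda>t. P (x + t *\<^sub>R (a - x))) has_derivative (\<lambda>h. D (x + t *\<^sub>R (a - x)) \<bullet> (h *\<^sub>R (a - x)))) (at t)"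
      by (rule has_derivative_compose[of "\<lambda>t. x + t *\<^sub>R (a - x)" _ t UNIV P])
        (use P in \<open>auto simp: C1_def intro!: derivative_eq_intros\<close>)
    then have 1: "((\<lambda>t. P (x + t *\<^sub>R (a - x))) has_real_derivative D (x + t *\<^sub>R (a - x)) \<bullet> (a - x)) (at t)"
      by (simp add: has_field_derivative_def mult.commute[of _ "D _ \<bullet> _"] mult_commute_abs)
    have 2: "((\<lambda>t. (1 - t) ^ CARD('n)) has_real_derivative - (real CARD('n) * (1 - t) ^ (CARD('n) - 1))) (at t)"
      by (auto intro!: derivative_eq_intros)
    show ?thesis unfolding \<psi>_def \<psi>'_def using DERIV_mult[OF 2 1] by (simp add: mult.commute)
  qed
  have aT: "a \<in> T" using a vert_subset by blast
  have seg: "x + t *\<^sub>R (a - x) \<in> T" if "x \<in> T" "0 \<le> t" "t \<le> 1" for x t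
    using convexD_alt[OF convex that(1) aT that(2,3)] by (simp add: algebra_simps)
  have "bounded (P ` T)" "bounded (D ` T)"
    using P by (auto intro!: compact_imp_bounded compact_continuous_image compact C1_continuous C1_grad_continuous)
  then obtain C C' where C: "\<And>y. y \<in> T \<Longrightarrow> \<bar>P y\<bar> \<le> C" and C': "\<And>y. y \<in> T \<Longrightarrow> norm (D y) \<le> C'"
    unfolding bounded_iff by (metis imageI real_norm_def)
  obtain R where R: "\<And>y. y \<in> T \<Longrightarrow> norm (a - y) \<le> R"
    using compact_imp_bounded[OF compact] bounded_any_center[of T a] by (auto simp: dist_norm)
  have C0: "0 \<le> C" "0 \<le> C'" "0 \<le> R"
    using C[OF aT] C'[OF aT] R[OF aT] abs_ge_zero norm_ge_zero order_trans by blast+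
  \<comment> \<open>A Lipschitz constant in t, uniform over T, which dominates all difference
    quotients.\<close>
  define K where "K = real CARD('n) * C + C' * R"
  have K: "\<bar>\<psi>' x t\<bar> \<le> K" if x: "x \<in> T" and t: "0 \<le> t" "t \<le> 1" for x t
  proof -
    have p: "0 \<le> (1 - t) ^ m" "(1 - t) ^ m \<le> 1" for m using t by (auto intro: power_le_one)
    have "\<bar>- (real CARD('n) * (1 - t) ^ (CARD('n) - 1)) * P (x + t *\<^sub>R (a - x))\<bar> \<le> (real CARD('n) * 1) * C"
      unfolding abs_mult using p C[OF seg[OF x t]] by (intro mult_mono) auto
    moreover have "\<bar>(1 - t) ^ CARD('n) * (D (x + t *\<^sub>R (a - x)) \<bullet> (a - x))\<bar> \<le> 1 * (C' * R)"
    proof -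
      have "\<bar>D (x + t *\<^sub>R (a - x)) \<bullet> (a - x)\<bar> \<le> C' * R"
        by (rule order_trans[OF Cauchy_Schwarz_ineq2]) (intro mult_mono C' seg R x t C0 norm_ge_zero)
      then show ?thesis unfolding abs_mult using p by (intro mult_mono) auto
    qed
    ultimately show ?thesis unfolding \<psi>'_def K_def by linarith
  qed
  have lip: "\<bar>\<psi> x t - \<psi> x 0\<bar> \<le> K * t" if x: "x \<in> T" and t: "0 \<le> t" "t \<le> 1" for x t
    using field_differentiable_bound[of "{0..1}" "\<psi> x" "\<psi>' x" K t 0] der K[OF x] t
    by (auto intro: DERIV_subset)
  have q: "(LINT x|lborel. indicator {x \<in> T. bary T a x < e k} x * P x) / e k
      = (LINT x|lborel. indicator T x * (- ((\<psi> x (e k) - \<psi> x 0) / e k)))" for k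
    unfolding layer_integral[OF a C1_continuous[OF P] e(2,3)] integral_divide_zero[symmetric]
  proof (rule Bochner_Integration.integral_cong[OF refl])
    have alg: "i * (p - r) / s = i * (- ((r - p) / s))" for i p r s :: real
      by (simp add: algebra_simps diff_divide_distrib)
    show "indicator T x * (P x - (1 - e k) ^ CARD('n) * P (x + e k *\<^sub>R (a - x))) / e k
        = indicator T x * - ((\<psi> x (e k) - \<psi> x 0) / e k)" for x
      by (subst alg) (simp add: \<psi>_def)
  qed
  have lim: "\<psi>' x 0 = - (real CARD('n) * P x + D x \<bullet> (x - a))" for x
    by (simp add: \<psi>'_def inner_diff_right)
  have Pm: "P \<in> borel_measurable borel" by (intro borel_measurable_continuous_onI C1_continuous[OF P])
  have "(\<lambda>k. LINT x|lborel. indicator T x * (- ((\<psi> x (e k) - \<psi> x 0) / e k))) \<longlonglongrightarrow> (LINT x|lborel. indicator T x * (- \<psi>' x 0))"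
  proof (rule integral_dominated_convergence[where w = "\<lambda>x. indicator T x * K"])
    show "(\<lambda>x. indicator T x * - \<psi>' x 0) \<in> borel_measurable lborel"
      unfolding measurable_lborel2 lim
      by (intro borel_measurable_times borel_measurable_indicator sets_T borel_measurable_continuous_onI continuous_intros C1_continuous[OF P] C1_grad_continuous[OF P])
    show "(\<lambda>x. indicator T x * - ((\<psi> x (e k) - \<psi> x 0) / e k)) \<in> borel_measurable lborel" for k
      unfolding measurable_lborel2 \<psi>_def divide_inverse
      by (intro borel_measurable_times borel_measurable_indicator sets_T borel_measurable_continuous_onI continuous_intros
          continuous_on_compose2[OF C1_continuous[OF P]]) auto
    show "integrable lborel (\<lambda>x. indicator T x * K)"
      by (rule integrable_continuous_compact[OF compact]) simp
    show "AE x in lborel. norm (indicator T x * - ((\<psi> x (e k) - \<psi> x 0) / e k)) \<le> indicator T x * K" for k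
      using lip[of _ "e k"] e(2)[of k] e(3)[of k]
      by (intro AE_I2) (auto simp: indicator_def divide_le_eq less_imp_le)
    show "AE x in lborel. (\<lambda>k. indicator T x * - ((\<psi> x (e k) - \<psi> x 0) / e k)) \<longlonglongrightarrow> indicator T x * - \<psi>' x 0"
    proof (rule AE_I2)
      fix x
      have "((\<lambda>t. (\<psi> x t - \<psi> x 0) / (t - 0)) \<longlongrightarrow> \<psi>' x 0) (at 0)"
        using der[of x 0] unfolding has_field_derivative_iff .
      moreover have "filterlim e (at 0) sequentially"
        using e(2) by (intro filterlim_atI e(1) always_eventually allI) (metis less_irrefl)
      ultimately have "(\<lambda>k. (\<psi> x (e k) - \<psi> x 0) / (e k - 0)) \<longlonglongrightarrow> \<psi>' x 0" by (rule filterlim_compose)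
      then show "(\<lambda>k. indicator T x * - ((\<psi> x (e k) - \<psi> x 0) / e k)) \<longlonglongrightarrow> indicator T x * - \<psi>' x 0"
        by (intro tendsto_intros) simp
    qed
  qed
  then show ?thesis unfolding q lim minus_minus .
qed

lemma integral_T_pos: "(LINT x|lborel. indicator T x) > (0::real)"
proof -
  have i: "integrable lborel (indicator T :: _ \<Rightarrow> real)"
    using integrable_continuous_compact[OF compact continuous_on_const[of UNIV 1]] by simp
  have "(LINT x|lborel. indicator T x) \<noteq> (0::real)"
  proof
    assume "(LINT x|lborel. indicator T x) = (0::real)"
    then have "AE x in lborel. indicator T x = (0::real)"
      using integral_nonneg_eq_0_iff_AE[OF i] by auto
    then have "AE x in lborel. x \<notin> interior T"
      by (rule AE_mp) (use interior_subset in \<open>auto intro!: AE_I2 simp: indicator_def split: if_splits\<close>)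
    then have "interior T \<in> null_sets lborel" using AE_iff_null_sets[of "interior T" lborel] by simp
    then have "negligible (interior T)" by (simp add: negligible_iff_null_sets null_sets_completionI)
    then show False using interior_nonempty open_not_negligible[OF open_interior] by blast
  qed
  moreover have "(LINT x|lborel. indicator T x) \<ge> (0::real)" by simp
  ultimately show ?thesis by linarith
qed

text \<open>The field \<open>P (x - a)\<close> has flux only through the facet opposite to \<open>a\<close>.\<close>

lemma cone_divergence:
  assumes dim: "CARD('n) \<in> {2, 3}" and a: "a \<in> vert T"
  shows "\<exists>\<kappa>>0. \<forall>P D. C1 P D \<longrightarrow>
    (LINT x|lborel. indicator T x * (real CARD('n) * P x + D x \<bullet> (x - a))) = \<kappa> * face_integral (opp T a) P"
proof -
  define g where "g = norm (bgrad T a)"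
  have g: "g > 0" using bgrad_nonzero[OF a] by (simp add: g_def)
  \<comment> \<open>The factor 1 / (1 + g) keeps the width \<open>d k\<close> at most 1 and the
    barycentric width \<open>d k * g\<close> below 1, as the two limit lemmas require.\<close>
  define d where "d = (\<lambda>k. inverse (real (Suc k)) * (1 / (1 + g)))"
  have d: "d \<longlonglongrightarrow> 0" unfolding d_def
    using tendsto_mult_left_zero[OF LIMSEQ_inverse_real_of_nat] by blast
  have d0: "0 < d k" for k using g by (simp add: d_def)
  have dg: "d k * g < 1" and d1: "d k \<le> 1" for k
  proof -
    have "inverse (real (Suc k)) \<le> 1" by (simp add: inverse_le_1_iff)
    then have *: "d k \<le> 1 * (1 / (1 + g))" unfolding d_def using g by (intro mult_right_mono) auto
    also have "\<dots> \<le> 1" using g by simp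
    finally show "d k \<le> 1" .
    have "d k * g \<le> (1 * (1 / (1 + g))) * g" using g by (intro mult_right_mono *) auto
    also have "\<dots> < 1" using g by simp
    finally show "d k * g < 1" .
  qed
  define e where "e = (\<lambda>k. d k * g)"
  have e: "e \<longlonglongrightarrow> 0" "\<And>k. 0 < e k" "\<And>k. e k < 1"
    unfolding e_def using tendsto_mult_left_zero[OF d] d0 g dg by auto
  have "\<exists>c>0. \<forall>f::real^'n \<Rightarrow> real. f \<in> borel_measurable borel \<longrightarrow>
    (LINT x|lborel. f x) = c * (LINT x|lborel. f (stretch a (d k) x))" for k
    by (rule integral_stretch[OF dim a d0])
  then obtain c where c: "\<And>k (f::real^'n \<Rightarrow> real). f \<in> borel_measurable borel \<Longrightarrow>
      (LINT x|lborel. f x) = c k * (LINT x|lborel. f (stretch a (d k) x))" by metis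
  define J where "J = (\<lambda>(P::real^'n \<Rightarrow> real) k. LINT x|lborel. indicator {x \<in> T. bary T a x < d k * g} (stretch a (d k) x) * P (stretch a (d k) x))"
  define V where "V = (\<lambda>(P::real^'n \<Rightarrow> real) (D::real^'n \<Rightarrow> real^'n). LINT x|lborel. indicator T x * (real CARD('n) * P x + D x \<bullet> (x - a)))"
  have J: "J P \<longlonglongrightarrow> face_integral (opp T a) P" if "C1 P D" for P D
    unfolding J_def g_def by (rule layer_limit[OF a C1_continuous[OF that] d d0 d1])
  have VJ: "(\<lambda>k. (c k / e k) * J P k) \<longlonglongrightarrow> V P D" if P: "C1 P D" for P D
  proof -
    have eq: "(LINT x|lborel. indicator {x \<in> T. bary T a x < e k} x * P x) / e k = (c k / e k) * J P k" for k
    proof -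
      have "open {x. bary T a x < e k}" by (intro open_Collect_less continuous_intros continuous_on_bary)
      then have "T \<inter> {x. bary T a x < e k} \<in> sets borel" using sets_T by (intro sets.Int) auto
      moreover have "{x \<in> T. bary T a x < e k} = T \<inter> {x. bary T a x < e k}" by auto
      ultimately have s: "{x \<in> T. bary T a x < e k} \<in> sets borel" by (simp only:)
      have "(\<lambda>x. indicator {x \<in> T. bary T a x < e k} x * P x) \<in> borel_measurable borel"
        by (intro borel_measurable_times borel_measurable_indicator s borel_measurable_continuous_onI C1_continuous[OF P])
      from c[OF this, of k] show ?thesis by (simp add: J_def e_def)
    qed
    show ?thesis using volume_limit[OF a P e] unfolding eq V_def .
  qed
  let ?one = "\<lambda>x::real^'n. 1::real" and ?zero = "\<lambda>x::real^'n. 0::real^'n"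
  have one: "C1 ?one ?zero" by (rule C1_const)
  have F1: "face_integral (opp T a) ?one > 0"
    using opp_centroid[OF a] by (auto intro: face_integral_pos[OF a])
  have V1: "V ?one ?zero > 0"
    unfolding V_def using integral_T_pos by simp
  \<comment> \<open>The weight is read off from P = 1: the ratio \<open>c k / e k\<close> depends on
    neither P nor D, so its limit serves all of them.\<close>
  define \<kappa> where "\<kappa> = V ?one ?zero / face_integral (opp T a) ?one"
  have "(\<lambda>k. (c k / e k) * J ?one k / J ?one k) \<longlonglongrightarrow> \<kappa>"
    unfolding \<kappa>_def by (rule tendsto_divide[OF VJ[OF one] J[OF one]]) (use F1 in simp)
  moreover have "\<forall>\<^sub>F k in sequentially. (c k / e k) * J ?one k / J ?one k = c k / e k"
    using order_tendstoD(1)[OF J[OF one] F1] by eventually_elim simp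
  ultimately have ce: "(\<lambda>k. c k / e k) \<longlonglongrightarrow> \<kappa>"
    by (rule Lim_transform_eventually)
  have "V P D = \<kappa> * face_integral (opp T a) P" if P: "C1 P D" for P D
    by (rule LIMSEQ_unique[OF VJ[OF P] tendsto_mult[OF ce J[OF P]]])
  then show ?thesis using F1 V1 unfolding V_def \<kappa>_def by (intro exI[of _ \<kappa>] conjI) (auto simp: \<kappa>_def V_def)
qed

text \<open>By \<open>sum_bgrad\<close> and \<open>sum_bgrad_scale\<close>, the cone fields x - a
  weighted by \<open>bgrad T a \<bullet> e\<close> add up to the constant field -e. Each cone field
  contributes one facet. Geometrically \<open>\<kappa> a\<close> is the height of the vertex a; only
  its sign is recorded.\<close>

theorem simplex_divergence:
  assumes dim: "CARD('n) \<in> {2, 3}"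
  shows "\<exists>\<kappa>. (\<forall>a\<in>vert T. \<kappa> a > 0) \<and> (\<forall>P D e. C1 P D \<longrightarrow>
    (LINT x|lborel. indicator T x * (D x \<bullet> e)) = - (\<Sum>a\<in>vert T. (bgrad T a \<bullet> e) * (\<kappa> a * face_integral (opp T a) P)))"
proof -
  let ?V = "\<lambda>P D a. LINT x|lborel. indicator T x * (real CARD('n) * P x + D x \<bullet> (x - a))"
  have "\<exists>\<kappa>. \<forall>a\<in>vert T. \<kappa> a > 0 \<and> (\<forall>P D. C1 P D \<longrightarrow> ?V P D a = \<kappa> a * face_integral (opp T a) P)"
    by (rule bchoice) (use cone_divergence[OF dim] in blast)
  then obtain \<kappa> where \<kappa>: "\<And>a. a \<in> vert T \<Longrightarrow> \<kappa> a > 0"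
    "\<And>a P D. a \<in> vert T \<Longrightarrow> C1 P D \<Longrightarrow> ?V P D a = \<kappa> a * face_integral (opp T a) P" by blast
  have "(LINT x|lborel. indicator T x * (D x \<bullet> e)) = - (\<Sum>a\<in>vert T. (bgrad T a \<bullet> e) * (\<kappa> a * face_integral (opp T a) P))"
    if P: "C1 P D" for P D e
  proof -
    have i: "integrable lborel (\<lambda>x. indicator T x * (real CARD('n) * P x + D x \<bullet> (x - a)))" for a
      by (intro integrable_continuous_compact[OF compact] continuous_intros C1_continuous[OF P] C1_grad_continuous[OF P])
    have "(\<Sum>a\<in>vert T. (bgrad T a \<bullet> e) * (\<kappa> a * face_integral (opp T a) P)) = (\<Sum>a\<in>vert T. (bgrad T a \<bullet> e) * ?V P D a)"
      by (intro sum.cong refl) (simp add: \<kappa>(2)[OF _ P])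
    also have "\<dots> = (LINT x|lborel. (\<Sum>a\<in>vert T. (bgrad T a \<bullet> e) * (indicator T x * (real CARD('n) * P x + D x \<bullet> (x - a)))))"
      using i by (simp add: Bochner_Integration.integral_sum integrable_mult_right)
    also have "(\<lambda>x. \<Sum>a\<in>vert T. (bgrad T a \<bullet> e) * (indicator T x * (real CARD('n) * P x + D x \<bullet> (x - a))))
        = (\<lambda>x. - (indicator T x * (D x \<bullet> e)))"
    proof
      fix x
      have "(\<Sum>a\<in>vert T. (bgrad T a \<bullet> e) * (real CARD('n) * P x + D x \<bullet> (x - a)))
        = (\<Sum>a\<in>vert T. bgrad T a \<bullet> e) * (real CARD('n) * P x + D x \<bullet> x) - D x \<bullet> (\<Sum>a\<in>vert T. (bgrad T a \<bullet> e) *\<^sub>R a)"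
        by (simp add: inner_diff_right inner_sum_right sum_distrib_right right_diff_distrib distrib_left sum.distrib sum_subtractf)
      also have "\<dots> = - (D x \<bullet> e)" by (simp only: sum_bgrad sum_bgrad_scale)
      finally have *: "(\<Sum>a\<in>vert T. (bgrad T a \<bullet> e) * (real CARD('n) * P x + D x \<bullet> (x - a))) = - (D x \<bullet> e)" .
      have "(\<Sum>a\<in>vert T. (bgrad T a \<bullet> e) * (indicator T x * (real CARD('n) * P x + D x \<bullet> (x - a))))
        = indicator T x * (\<Sum>a\<in>vert T. (bgrad T a \<bullet> e) * (real CARD('n) * P x + D x \<bullet> (x - a)))"
        by (simp add: sum_distrib_left mult.left_commute)
      then show "(\<Sum>a\<in>vert T. (bgrad T a \<bullet> e) * (indicator T x * (real CARD('n) * P x + D x \<bullet> (x - a)))) = - (indicator T x * (D x \<bullet> e))"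
        unfolding * by simp
    qed
    finally show ?thesis by simp
  qed
  then show ?thesis using \<kappa>(1) by blast
qed

text \<open>Inclusion and exclusion of two homothetic copies of \<open>T\<close>.\<close>

lemma corner_measure:
  assumes dim: "CARD('n) \<in> {2, 3}" and ab: "a \<in> vert T" "b \<in> vert T" "a \<noteq> b" and e: "0 < e" "e < 1 / 2"
  shows "(LINT x|lborel. indicator {x \<in> T. bary T a x < e \<and> bary T b x < e} x) \<le> 6 * (LINT x|lborel. indicator T x) * e\<^sup>2"
proof -
  let ?I = "\<lambda>A. LINT x|lborel. indicator A x :: real"
  define A where "A = (\<lambda>a. {x \<in> T. bary T a x < e})"
  define B where "B = {x \<in> T. e \<le> bary T a x \<and> e \<le> bary T b x}"
  have i: "integrable lborel (indicator S :: _ \<Rightarrow> real)" if "S \<subseteq> T" "S \<in> sets borel" for S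
    using that compact_imp_bounded[OF compact] emeasure_bounded_finite[of S] bounded_subset
    by (intro integrable_real_indicator) auto
  have om: "T \<inter> U \<in> sets borel" if "open U \<or> closed U" for U
    using that sets_T by (intro sets.Int) auto
  have o: "open {x. bary T z x < e}" "closed {x. e \<le> bary T z x}" for z
    by (intro open_Collect_less closed_Collect_le continuous_intros continuous_on_bary)+
  have "A z = T \<inter> {x. bary T z x < e}" for z by (auto simp: A_def)
  then have Am: "A z \<in> sets borel" "A z \<subseteq> T" for z using om o by auto
  have "B = T \<inter> ({x. e \<le> bary T a x} \<inter> {x. e \<le> bary T b x})" by (auto simp: B_def)
  moreover have "closed ({x. e \<le> bary T a x} \<inter> {x. e \<le> bary T b x})" by (intro closed_Int o)
  ultimately have Bm: "B \<in> sets borel" "B \<subseteq> T" using om by auto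
  have IA: "?I (A z) = (1 - (1 - e) ^ CARD('n)) * ?I T" if z: "z \<in> vert T" for z
    using layer_integral[OF z continuous_on_const[of UNIV 1], of e] e by (simp add: A_def mult.commute)
  \<comment> \<open>B is the image of T under the homothety x \<mapsto> e a + e b + (1 - 2 e)
    x.\<close>
  have memB: "(e *\<^sub>R a + e *\<^sub>R b) + (1 - 2 * e) *\<^sub>R x \<in> B \<longleftrightarrow> x \<in> T" for x
  proof -
    have bz: "bary T z ((e *\<^sub>R a + e *\<^sub>R b) + (1 - 2 * e) *\<^sub>R x) = e * bary T z a + e * bary T z b + (1 - 2 * e) * bary T z x" for z
      by (simp add: bary_def inner_add_right algebra_simps)
    have pos: "0 \<le> (1 - 2 * e) * t \<longleftrightarrow> 0 \<le> t" for t using e by (simp add: zero_le_mult_iff)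
    have zz: "0 \<le> (1 - 2 * e) * bary T z x \<longleftrightarrow> 0 \<le> e * bary T z a + e * bary T z b + (1 - 2 * e) * bary T z x"
      if "z \<in> vert T" "z \<noteq> a" "z \<noteq> b" for z using that ab by (simp add: bary_vert)
    show ?thesis
    proof
      assume *: "(e *\<^sub>R a + e *\<^sub>R b) + (1 - 2 * e) *\<^sub>R x \<in> B"
      show "x \<in> T" unfolding mem_iff
      proof
        fix z assume z: "z \<in> vert T"
        consider "z = a" | "z = b" | "z \<noteq> a" "z \<noteq> b" by blast
        then show "0 \<le> bary T z x"
          using * z ab zz[OF z] pos[of "bary T z x"] by cases (auto simp: B_def bz bary_vert mem_iff)
      qed
    next
      assume *: "x \<in> T"
      have "0 \<le> bary T z ((e *\<^sub>R a + e *\<^sub>R b) + (1 - 2 * e) *\<^sub>R x)" if z: "z \<in> vert T" for z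
        unfolding bz using * z ab e pos[of "bary T z x"] by (simp add: bary_vert mem_iff)
      moreover have "e \<le> bary T a ((e *\<^sub>R a + e *\<^sub>R b) + (1 - 2 * e) *\<^sub>R x)" "e \<le> bary T b ((e *\<^sub>R a + e *\<^sub>R b) + (1 - 2 * e) *\<^sub>R x)"
        unfolding bz using * ab pos by (auto simp: bary_vert mem_iff)
      ultimately show "(e *\<^sub>R a + e *\<^sub>R b) + (1 - 2 * e) *\<^sub>R x \<in> B" by (simp add: B_def mem_iff)
    qed
  qed
  have "(indicator B :: _ \<Rightarrow> real) \<in> borel_measurable borel" using Bm by simp
  then have "?I B = (1 - 2 * e) ^ CARD('n) * (LINT x|lborel. indicator B ((e *\<^sub>R a + e *\<^sub>R b) + (1 - 2 * e) *\<^sub>R x))"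
    by (rule lborel_integral_homothety) (use e in simp)
  also have "(\<lambda>x. indicator B ((e *\<^sub>R a + e *\<^sub>R b) + (1 - 2 * e) *\<^sub>R x)) = (indicator T :: _ \<Rightarrow> real)"
    using memB by (auto simp: indicator_def)
  finally have IB: "?I B = (1 - 2 * e) ^ CARD('n) * ?I T" .
  have "(indicator {x \<in> T. bary T a x < e \<and> bary T b x < e} x :: real)
      = indicator (A a) x + indicator (A b) x + indicator B x - indicator T x" for x
    by (cases "x \<in> T"; cases "bary T a x < e"; cases "bary T b x < e") (auto simp: A_def B_def)
  then have "?I {x \<in> T. bary T a x < e \<and> bary T b x < e} = ?I (A a) + ?I (A b) + ?I B - ?I T"
    using i[OF Am(2,1)] i[OF Bm(2,1)] i[OF order_refl sets_T] by simp
  also have "\<dots> = (1 - 2 * (1 - e) ^ CARD('n) + (1 - 2 * e) ^ CARD('n)) * ?I T"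
    unfolding IA[OF ab(1)] IA[OF ab(2)] IB by (simp add: algebra_simps)
  also have "\<dots> \<le> (6 * e\<^sup>2) * ?I T"
  proof (rule mult_right_mono)
    \<comment> \<open>The polynomial has no constant and no linear term; in dimensions two and three
      it equals 2 e^2 and 6 e^2 - 6 e^3.\<close>
    consider "CARD('n) = 2" | "CARD('n) = 3" using dim by auto
    then show "1 - 2 * (1 - e) ^ CARD('n) + (1 - 2 * e) ^ CARD('n) \<le> 6 * e\<^sup>2"
    proof cases
      case 1
      have "1 - 2 * (1 - e)\<^sup>2 + (1 - 2 * e)\<^sup>2 = 2 * e\<^sup>2" by (simp add: power2_eq_square algebra_simps)
      then show ?thesis unfolding 1 by simp
    next
      case 2
      have "1 - 2 * (1 - e) ^ 3 + (1 - 2 * e) ^ 3 = 6 * e\<^sup>2 - 6 * e ^ 3"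
        by (simp add: power3_eq_cube power2_eq_square algebra_simps)
      moreover have "0 \<le> e ^ 3" using e by simp
      ultimately show ?thesis unfolding 2 by linarith
    qed
  qed simp
  finally show ?thesis by (simp only: mult_ac)
qed

end

section \<open>Calculus of continuously differentiable functions and integration by parts on the
  whole space\<close>

lemma C1_has_derivative: "C1 P D \<Longrightarrow> (P has_derivative (\<lambda>h. D x \<bullet> h)) (at x)"
  by (simp add: C1_def)

lemma C1_affine: "C1 (\<lambda>x. a \<bullet> x + b) (\<lambda>x. a)"
  by (auto simp: C1_def intro!: derivative_eq_intros)

lemma C1_bary: "C1 (bary T z) (\<lambda>x. bgrad T z)"
  unfolding bary_def by (rule C1_affine)

lemma C1_smooth: "smooth \<phi> \<Longrightarrow> C1 \<phi> (grad \<phi>)"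
  by (simp add: C1_def smooth_has_derivative smooth_grad_continuous)

lemma C1_add:
  assumes "C1 P D" "C1 Q E"
  shows "C1 (\<lambda>x. P x + Q x) (\<lambda>x. D x + E x)"
proof -
  have "((\<lambda>x. P x + Q x) has_derivative (\<lambda>h. (D x + E x) \<bullet> h)) (at x)" for x
    unfolding inner_add_left by (intro has_derivative_add C1_has_derivative assms)
  then show ?thesis using assms unfolding C1_def by (simp add: continuous_on_add)
qed

lemma C1_mult:
  assumes "C1 P D" "C1 Q E"
  shows "C1 (\<lambda>x. P x * Q x) (\<lambda>x. P x *\<^sub>R E x + Q x *\<^sub>R D x)"
proof -
  have "((\<lambda>x. P x * Q x) has_derivative (\<lambda>h. (P x *\<^sub>R E x + Q x *\<^sub>R D x) \<bullet> h)) (at x)" for x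
    using has_derivative_mult[OF C1_has_derivative[OF assms(1)] C1_has_derivative[OF assms(2)], of x]
    by (simp add: inner_add_left mult.commute)
  then show ?thesis unfolding C1_def
    by (auto intro!: continuous_intros C1_continuous[OF assms(1)] C1_continuous[OF assms(2)]
        C1_grad_continuous[OF assms(1)] C1_grad_continuous[OF assms(2)])
qed

lemma C1_cmult:
  assumes "C1 P D"
  shows "C1 (\<lambda>x. c * P x) (\<lambda>x. c *\<^sub>R D x)"
  using C1_mult[OF C1_const[of c] assms] by simp

lemma C1_sum:
  assumes "finite I" "\<And>i. i \<in> I \<Longrightarrow> C1 (P i) (D i)"
  shows "C1 (\<lambda>x. \<Sum>i\<in>I. P i x) (\<lambda>x. \<Sum>i\<in>I. D i x)"
  using assms by (induction I rule: finite_induct) (auto intro: C1_add C1_const)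

lemma C1_prod:
  assumes "finite I" "\<And>i. i \<in> I \<Longrightarrow> C1 (P i) (D i)"
  shows "C1 (\<lambda>x. \<Prod>i\<in>I. P i x) (\<lambda>x. \<Sum>i\<in>I. (\<Prod>j\<in>I - {i}. P j x) *\<^sub>R D i x)"
proof -
  have "((\<lambda>x. \<Prod>i\<in>I. P i x) has_derivative (\<lambda>h. (\<Sum>i\<in>I. (\<Prod>j\<in>I - {i}. P j x) *\<^sub>R D i x) \<bullet> h)) (at x)" for x
  proof -
    have "((\<lambda>x. \<Prod>i\<in>I. P i x) has_derivative (\<lambda>h. \<Sum>i\<in>I. (D i x \<bullet> h) * (\<Prod>j\<in>I - {i}. P j x))) (at x)"
      by (rule has_derivative_prod) (rule C1_has_derivative[OF assms(2)])
    then show ?thesis by (simp add: inner_sum_left mult.commute)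
  qed
  moreover have "continuous_on UNIV (\<lambda>x. \<Sum>i\<in>I. (\<Prod>j\<in>I - {i}. P j x) *\<^sub>R D i x)"
    by (intro continuous_on_sum continuous_on_scaleR continuous_on_prod
        C1_grad_continuous[OF assms(2)] C1_continuous[OF assms(2)]) auto
  ultimately show ?thesis unfolding C1_def by blast
qed

lemma C1_compose:
  assumes "C1 P D" "\<And>t. (k has_real_derivative k' t) (at t)" "continuous_on UNIV k'"
  shows "C1 (\<lambda>x. k (P x)) (\<lambda>x. k' (P x) *\<^sub>R D x)"
proof -
  have "((\<lambda>x. k (P x)) has_derivative (\<lambda>h. (k' (P x) *\<^sub>R D x) \<bullet> h)) (at x)" for x
    using has_derivative_compose[OF C1_has_derivative[OF assms(1)] assms(2)[unfolded has_field_derivative_def], of x]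
    by simp
  moreover have "continuous_on UNIV (\<lambda>x. k' (P x) *\<^sub>R D x)"
    by (intro continuous_on_scaleR continuous_on_compose2[OF assms(3)] C1_continuous[OF assms(1)]
        C1_grad_continuous[OF assms(1)]) auto
  ultimately show ?thesis unfolding C1_def by blast
qed

lemma C1_lipschitz:
  assumes "C1 P D" "convex S" "\<And>x. x \<in> S \<Longrightarrow> norm (D x) \<le> M" "x \<in> S" "y \<in> S"
  shows "\<bar>P y - P x\<bar> \<le> M * norm (y - x)"
  unfolding real_norm_def[symmetric]
proof (rule differentiable_bound[of S P "\<lambda>x h. D x \<bullet> h"])
  show "(P has_derivative (\<lambda>h. D x \<bullet> h)) (at x within S)" for x
    using C1_has_derivative[OF assms(1)] by (rule has_derivative_at_withinI)
  show "onorm (\<lambda>h. D x \<bullet> h) \<le> M" if "x \<in> S" for x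
    using assms(3)[OF that]
    by (intro onorm_le) (metis Cauchy_Schwarz_ineq2 mult_right_mono norm_ge_zero order_trans real_norm_def)
qed (use assms in auto)

lemma difference_quotient:
  assumes "(P has_derivative (\<lambda>h. g \<bullet> h)) (at x)"
  shows "((\<lambda>t. (P (x + t *\<^sub>R e) - P x) / t) \<longlongrightarrow> g \<bullet> e) (at 0)"
proof -
  have "((\<lambda>t. P (x + t *\<^sub>R e)) has_derivative (\<lambda>t. g \<bullet> (t *\<^sub>R e))) (at 0)"
    by (rule has_derivative_compose[of "\<lambda>t. x + t *\<^sub>R e" _ 0 UNIV P])
      (use assms in \<open>auto intro!: derivative_eq_intros\<close>)
  then have "((\<lambda>t. P (x + t *\<^sub>R e)) has_real_derivative (g \<bullet> e)) (at 0)"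
    by (simp add: has_field_derivative_def mult_commute_abs)
  then show ?thesis by (simp add: has_field_derivative_iff)
qed

text \<open>Translation invariance annihilates the integrals of difference quotients.\<close>

lemma lipschitz_integral_derivative:
  fixes \<zeta> :: "real^'n \<Rightarrow> real"
  assumes L: "\<And>x y. \<bar>\<zeta> y - \<zeta> x\<bar> \<le> L * norm (y - x)" and R: "\<And>x. \<zeta> x \<noteq> 0 \<Longrightarrow> norm x \<le> R"
    and G: "G \<in> borel_measurable lebesgue"
    and lim: "AE x in lebesgue. ((\<lambda>t. (\<zeta> (x + t *\<^sub>R e) - \<zeta> x) / t) \<longlongrightarrow> G x) (at 0)"
  shows "(LINT x|lebesgue. G x) = 0"
proof -
  have "continuous_on UNIV \<zeta>"
  proof (rule lipschitz_on_continuous_on)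
    have "0 \<le> L" using L[of 0 "axis undefined 1"] order_trans[OF abs_ge_zero] by (force simp: zero_le_mult_iff)
    then show "L-lipschitz_on UNIV \<zeta>" using L by (auto intro!: lipschitz_onI simp: dist_real_def dist_norm)
  qed
  then have m: "\<zeta> \<in> borel_measurable borel" by (rule borel_measurable_continuous_onI)
  have C: "\<bar>\<zeta> x\<bar> \<le> L * (2 * \<bar>R\<bar> + 1)" for x
  proof (cases "\<zeta> x = 0")
    case True
    have "0 \<le> L * norm (axis undefined 1 :: real^'n)" using L[of 0 "axis undefined 1"] order_trans[OF abs_ge_zero] by force
    then show ?thesis using True by simp
  next
    case False
    \<comment> \<open>A point beyond the support; the Lipschitz bound starting from there controls
      the size of \<zeta>.\<close>
    define y :: "real^'n" where "y = (\<bar>R\<bar> + 1) *\<^sub>R axis undefined 1"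
    have y: "norm y = \<bar>R\<bar> + 1" by (simp add: y_def)
    then have "\<zeta> y = 0" using R[of y] by force
    then have "\<bar>\<zeta> x\<bar> \<le> L * norm (x - y)" using L[of x y] by simp
    also have "\<dots> \<le> L * (2 * \<bar>R\<bar> + 1)"
    proof (rule mult_left_mono)
      show "norm (x - y) \<le> 2 * \<bar>R\<bar> + 1" using R[OF False] y norm_triangle_ineq4[of x y] by simp
      show "0 \<le> L" using L[of 0 "axis undefined 1"] order_trans[OF abs_ge_zero] by (force simp: zero_le_mult_iff)
    qed
    finally show ?thesis .
  qed
  have zi: "integrable lborel \<zeta>"
  proof (rule Bochner_Integration.integrable_bound)
    show "integrable lborel (\<lambda>x::real^'n. L * (2 * \<bar>R\<bar> + 1) * indicator (cball 0 R) x)"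
      using emeasure_bounded_finite[of "cball (0::real^'n) R"] by (intro integrable_mult_right integrable_real_indicator) auto
    show "AE x in lborel. norm (\<zeta> x) \<le> norm (L * (2 * \<bar>R\<bar> + 1) * indicator (cball 0 R) x)"
    proof (rule AE_I2)
      fix x show "norm (\<zeta> x) \<le> norm (L * (2 * \<bar>R\<bar> + 1) * indicator (cball 0 R) x)"
        using C[of x] R[of x] by (cases "\<zeta> x = 0") (auto simp: indicator_def)
    qed
  qed (use m in simp)
  define t where "t = (\<lambda>k. inverse (real (Suc k)))"
  have t: "t \<longlonglongrightarrow> 0" "\<And>k. 0 < t k" "\<And>k. t k \<le> 1"
    unfolding t_def using LIMSEQ_inverse_real_of_nat by (auto simp: inverse_le_1_iff)
  have ms: "(\<lambda>x. \<zeta> (x + v)) \<in> borel_measurable borel" for v using m by measurable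
  have int0: "(LINT x|lebesgue. (\<zeta> (x + t k *\<^sub>R e) - \<zeta> x) / t k) = 0" for k
  proof -
    have i: "integrable lborel (\<lambda>x. \<zeta> (x + v))" for v
    proof -
      have "integrable (distr lborel borel ((+) v)) \<zeta>" using zi lborel_distr_plus[of v] by simp
      then have "integrable lborel (\<lambda>x. \<zeta> (v + x))" by (subst (asm) integrable_distr_eq) (use m in auto)
      then show ?thesis by (simp add: add.commute)
    qed
    have "(LINT x|lebesgue. (\<zeta> (x + t k *\<^sub>R e) - \<zeta> x) / t k) = (LINT x|lborel. (\<zeta> (x + t k *\<^sub>R e) - \<zeta> x) / t k)"
      by (rule integral_completion) (use m ms in measurable)
    also have "\<dots> = 0"
      using i zi lborel_integral_translation[OF m] by simp
    finally show ?thesis .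
  qed
  have "(\<lambda>k. LINT x|lebesgue. (\<zeta> (x + t k *\<^sub>R e) - \<zeta> x) / t k) \<longlonglongrightarrow> (LINT x|lebesgue. G x)"
  \<comment> \<open>The steps \<open>t k\<close> are at most 1, so all difference quotients live in
    the ball enlarged by \<open>norm e\<close>.\<close>
  proof (rule integral_dominated_convergence[where w = "\<lambda>x. L * norm e * indicator (cball 0 (R + norm e)) x"])
    show "(\<lambda>x. (\<zeta> (x + t k *\<^sub>R e) - \<zeta> x) / t k) \<in> borel_measurable lebesgue" for k
      by (rule measurable_completion) (use m ms in measurable)
    show "integrable lebesgue (\<lambda>x::real^'n. L * norm e * indicator (cball 0 (R + norm e)) x)"
      using emeasure_bounded_finite[of "cball (0::real^'n) (R + norm e)"]
      by (intro integrable_mult_right integrable_real_indicator) (auto simp: emeasure_completion)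
    show "AE x in lebesgue. (\<lambda>k. (\<zeta> (x + t k *\<^sub>R e) - \<zeta> x) / t k) \<longlonglongrightarrow> G x"
      using lim
    proof eventually_elim
      case (elim x)
      have "filterlim t (at 0) sequentially"
        using t(2) by (intro filterlim_atI t(1) always_eventually allI) (metis less_irrefl)
      then show ?case by (rule filterlim_compose[OF elim])
    qed
    show "AE x in lebesgue. norm ((\<zeta> (x + t k *\<^sub>R e) - \<zeta> x) / t k) \<le> L * norm e * indicator (cball 0 (R + norm e)) x" for k
    proof (rule AE_I2)
      fix x
      show "norm ((\<zeta> (x + t k *\<^sub>R e) - \<zeta> x) / t k) \<le> L * norm e * indicator (cball 0 (R + norm e)) x"
      proof (cases "norm x \<le> R + norm e")
        case True
        have "\<bar>\<zeta> (x + t k *\<^sub>R e) - \<zeta> x\<bar> \<le> L * (t k * norm e)" using L[of "x + t k *\<^sub>R e" x] t(2)[of k] by simp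
        then show ?thesis using True t(2)[of k] by (simp add: divide_le_eq mult_ac)
      next
        case False
        have "norm (t k *\<^sub>R e) \<le> norm e" using t(2,3)[of k] by (simp add: mult_left_le_one_le)
        moreover have "norm x \<le> norm (x + t k *\<^sub>R e) + norm (t k *\<^sub>R e)"
          using norm_triangle_ineq4[of "x + t k *\<^sub>R e" "t k *\<^sub>R e"] by simp
        ultimately have "\<not> norm (x + t k *\<^sub>R e) \<le> R" "\<not> norm x \<le> R"
          using False norm_ge_zero[of e] by linarith+
        then have "\<zeta> (x + t k *\<^sub>R e) = 0" "\<zeta> x = 0" using R by blast+
        then show ?thesis using False by simp
      qed
    qed
  qed fact
  then show ?thesis unfolding int0 by (simp add: LIMSEQ_const_iff)
qed

lemma test_function_support:
  assumes "test_function S \<phi>" "x \<notin> S"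
  shows "\<phi> x = 0" "grad \<phi> x = 0"
proof -
  let ?K = "closure {x. \<phi> x \<noteq> 0}"
  have x: "x \<notin> ?K" using assms by (auto simp: test_function_def)
  then show "\<phi> x = 0" using closure_subset[of "{x. \<phi> x \<noteq> 0}"] by blast
  have "(\<phi> has_derivative (\<lambda>h. 0)) (at x)"
    by (rule has_derivative_transform_within_open[of "\<lambda>x. 0" _ _ _ "- ?K"])
      (use x closure_subset[of "{x. \<phi> x \<noteq> 0}"] in auto)
  then have "(\<phi> has_derivative (\<lambda>h. 0 \<bullet> h)) (at x)" by simp
  then show "grad \<phi> x = 0" by (rule grad_eqI)
qed

lemma test_function_bounded_support:
  assumes "test_function S \<phi>"
  shows "\<exists>R. \<forall>x. \<phi> x \<noteq> 0 \<longrightarrow> norm x \<le> R"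
proof -
  have "bounded (closure {x. \<phi> x \<noteq> 0})" using assms by (simp add: test_function_def compact_imp_bounded)
  then show ?thesis unfolding bounded_iff using closure_subset[of "{x. \<phi> x \<noteq> 0}"] by blast
qed

lemma test_function_bounded:
  assumes "test_function S \<phi>"
  shows "\<exists>C. \<forall>x. \<bar>\<phi> x\<bar> \<le> C \<and> norm (grad \<phi> x) \<le> C"
proof -
  obtain R where R: "\<And>x. \<phi> x \<noteq> 0 \<Longrightarrow> norm x \<le> R" using test_function_bounded_support[OF assms] by blast
  have s: "smooth \<phi>" using assms by (simp add: test_function_def)
  obtain C where "\<forall>x. \<bar>\<phi> x\<bar> \<le> C" using smooth_bounded[OF s R] by blast
  moreover obtain C' where "\<forall>x. norm (grad \<phi> x) \<le> C'" using grad_bounded[OF s R] by blast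
  ultimately show ?thesis by (intro exI[of _ "max C C'"]) (meson max.coboundedI1 max.coboundedI2)
qed

lemma test_function_mono: "test_function S \<phi> \<Longrightarrow> S \<subseteq> S' \<Longrightarrow> test_function S' \<phi>"
  by (auto simp: test_function_def)

text \<open>The product P \<phi> is Lipschitz with bounded support, so its gradient integrates to
  zero by translation invariance.\<close>

lemma C1_integration_by_parts:
  fixes P :: "real^'n \<Rightarrow> real"
  assumes P: "C1 P D" and \<phi>: "test_function S \<phi>"
  shows "(LINT x|lebesgue. P x * grad \<phi> x $ i) = - (LINT x|lebesgue. \<phi> x * D x $ i)"
proof -
  have s: "smooth \<phi>" using \<phi> by (simp add: test_function_def)
  obtain R where R: "\<And>x. \<phi> x \<noteq> 0 \<Longrightarrow> norm x \<le> R" using test_function_bounded_support[OF \<phi>] by blast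
  define E where "E = (\<lambda>x. P x *\<^sub>R grad \<phi> x + \<phi> x *\<^sub>R D x)"
  have Q: "C1 (\<lambda>x. P x * \<phi> x) E" unfolding E_def by (rule C1_mult[OF P C1_smooth[OF s]])
  have E0: "norm x \<le> R" if "E x \<noteq> 0" for x
    using that R grad_zero_outside[OF s R] by (force simp: E_def)
  have "bounded (E ` cball 0 R)"
    by (intro compact_imp_bounded compact_continuous_image C1_grad_continuous[OF Q]) auto
  then obtain M where M: "\<And>x. norm x \<le> R \<Longrightarrow> norm (E x) \<le> M" unfolding bounded_iff by (force simp: dist_norm)
  have M': "norm (E x) \<le> max M 0" for x
    using M[of x] E0[of x] by (cases "E x = 0") auto
  have "(LINT x|lebesgue. E x \<bullet> axis i 1) = 0"
  proof (rule lipschitz_integral_derivative[where \<zeta> = "\<lambda>x. P x * \<phi> x" and e = "axis i 1" and L = "max M 0" and R = R])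
    show "\<bar>P y * \<phi> y - P x * \<phi> x\<bar> \<le> max M 0 * norm (y - x)" for x y
      by (rule C1_lipschitz[OF Q convex_UNIV M']) auto
    show "(\<lambda>x. E x \<bullet> axis i 1) \<in> borel_measurable lebesgue"
      by (intro lebesgue_measurable_continuous continuous_intros C1_grad_continuous[OF Q])
    show "AE x in lebesgue. ((\<lambda>t. (P (x + t *\<^sub>R axis i 1) * \<phi> (x + t *\<^sub>R axis i 1) - P x * \<phi> x) / t) \<longlongrightarrow> E x \<bullet> axis i 1) (at 0)"
      using difference_quotient[OF C1_has_derivative[OF Q]] by (intro AE_I2) auto
  qed (use R in auto)
  moreover have "E x \<bullet> axis i 1 = P x * grad \<phi> x $ i + \<phi> x * D x $ i" for x
    by (simp add: E_def inner_axis)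
  moreover have "integrable lebesgue (\<lambda>x. f x)" if "continuous_on UNIV f" "\<And>x. f x \<noteq> 0 \<Longrightarrow> norm x \<le> R" for f :: "real^'n \<Rightarrow> real"
  proof -
    have "bounded (f ` cball 0 R)" by (intro compact_imp_bounded compact_continuous_image continuous_on_subset[OF that(1)]) auto
    then obtain M where M: "\<And>x. norm x \<le> R \<Longrightarrow> norm (f x) \<le> M" unfolding bounded_iff by (force simp: dist_norm)
    have "norm (f x) \<le> max M 0" for x using M[of x] that(2)[of x] by (cases "f x = 0") auto
    then show ?thesis by (intro integrable_bounded_support[OF lebesgue_measurable_continuous[OF that(1)] _ that(2)]) auto
  qed
  note i = this
  have "integrable lebesgue (\<lambda>x. P x * grad \<phi> x $ i)"
    using grad_zero_outside[OF s R]
    by (intro i continuous_intros C1_continuous[OF P] smooth_grad_continuous[OF s]) force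
  moreover have "integrable lebesgue (\<lambda>x. \<phi> x * D x $ i)"
    using R by (intro i continuous_intros C1_grad_continuous[OF P] smooth_continuous[OF s]) auto
  ultimately show ?thesis by simp
qed

section \<open>Square-integrable functions on bounded sets\<close>

lemma AE_lebesgue_on_iff: "S \<in> sets lebesgue \<Longrightarrow> (AE x in lebesgue_on S. P x) \<longleftrightarrow> (AE x in lebesgue. x \<in> S \<longrightarrow> P x)"
  by (simp add: AE_restrict_space_iff)

text \<open>Completeness of Lebesgue measure. It spares a separate measurability proof whenever a
  function is replaced by one that agrees with it almost everywhere.\<close>

lemma lebesgue_on_measurable_AE:
  fixes f :: "real^'n \<Rightarrow> 'b::euclidean_space"
  assumes "f \<in> borel_measurable (lebesgue_on S)" "AE x in lebesgue_on S. f x = g x" "S \<in> sets lebesgue"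
  shows "g \<in> borel_measurable (lebesgue_on S)"
proof -
  have "(\<lambda>x. if x \<in> S then f x else 0) \<in> borel_measurable lebesgue"
    using assms(1,3) by (simp add: borel_measurable_if)
  moreover have "AE x in lebesgue. (if x \<in> S then f x else 0) = (if x \<in> S then g x else 0)"
    using assms(2) unfolding AE_lebesgue_on_iff[OF assms(3)] by eventually_elim auto
  ultimately have "(\<lambda>x. if x \<in> S then g x else 0) \<in> borel_measurable lebesgue"
    by (rule borel_measurable_AE)
  then show ?thesis using assms(3) by (simp add: borel_measurable_if)
qed

lemma integral_lebesgue_on:
  fixes f :: "real^'n \<Rightarrow> real"
  assumes "S \<in> sets lebesgue"
  shows "(LINT x|lebesgue_on S. f x) = (LINT x|lebesgue. indicator S x * f x)"
    and "integrable (lebesgue_on S) f \<longleftrightarrow> integrable lebesgue (\<lambda>x. indicator S x * f x)"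
  using assms by (simp_all add: integral_restrict_space integrable_restrict_space)

lemma lebesgue_on_continuous:
  fixes f :: "real^'n \<Rightarrow> 'b::euclidean_space"
  assumes "continuous_on UNIV f"
  shows "f \<in> borel_measurable (lebesgue_on S)"
  by (intro measurable_restrict_space1 lebesgue_measurable_continuous assms)

lemma integral_cong_AE_lebesgue_on:
  fixes f g :: "real^'n \<Rightarrow> real"
  assumes "S \<in> sets lebesgue" "f \<in> borel_measurable (lebesgue_on S)" "AE x in lebesgue_on S. f x = g x"
  shows "(LINT x|lebesgue_on S. f x) = (LINT x|lebesgue_on S. g x)"
  by (rule integral_cong_AE[OF assms(2) lebesgue_on_measurable_AE[OF assms(2,3,1)] assms(3)])

lemma L2_cong_AE:
  assumes "S \<in> sets lebesgue" "f \<in> L2 S" "AE x in lebesgue_on S. f x = g x"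
  shows "g \<in> L2 S"
proof -
  have g: "g \<in> borel_measurable (lebesgue_on S)"
    by (rule lebesgue_on_measurable_AE[OF L2_measurable[OF assms(2)] assms(3,1)])
  have "integrable (lebesgue_on S) (\<lambda>x. g x \<bullet> g x)"
  proof (subst integrable_cong_AE[of _ _ "\<lambda>x. f x \<bullet> f x"])
    show "AE x in lebesgue_on S. g x \<bullet> g x = f x \<bullet> f x" using assms(3) by eventually_elim simp
  qed (use g assms(2) in \<open>auto simp: L2_iff\<close>)
  then show ?thesis using g by (simp add: L2_iff)
qed

lemma L2_inner_cong_AE:
  assumes "S \<in> sets lebesgue" "f \<in> L2 S" "h \<in> L2 S" "AE x in lebesgue_on S. f x = g x"
  shows "L2_inner S f h = L2_inner S g h"
  unfolding L2_inner_def
proof (rule integral_cong_AE_lebesgue_on[OF assms(1)])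
  show "(\<lambda>x. f x \<bullet> h x) \<in> borel_measurable (lebesgue_on S)"
    using assms L2_measurable by (intro borel_measurable_inner) auto
  show "AE x in lebesgue_on S. f x \<bullet> h x = g x \<bullet> h x" using assms(4) by eventually_elim simp
qed

lemma finite_measure_lebesgue_on:
  fixes S :: "(real^'n) set"
  assumes "bounded S" "S \<in> sets lebesgue"
  shows "finite_measure (lebesgue_on S)"
proof
  have "S \<in> lmeasurable" using assms bounded_set_imp_lmeasurable by blast
  then show "emeasure (lebesgue_on S) (space (lebesgue_on S)) \<noteq> \<infinity>"
    using assms(2) by (simp add: emeasure_restrict_space fmeasurable_def top.not_eq_extremum)
qed

lemma bounded_integrable:
  fixes f :: "real^'n \<Rightarrow> 'b::euclidean_space"
  assumes "bounded S" "S \<in> sets lebesgue" "f \<in> borel_measurable (lebesgue_on S)" "\<And>x. x \<in> S \<Longrightarrow> norm (f x) \<le> C"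
  shows "integrable (lebesgue_on S) f"
proof -
  interpret finite_measure "lebesgue_on S" by (rule finite_measure_lebesgue_on[OF assms(1,2)])
  show ?thesis by (rule integrable_const_bound[of _ C]) (use assms in \<open>auto intro!: AE_I2\<close>)
qed

lemma bounded_L2:
  assumes "bounded S" "S \<in> sets lebesgue" "f \<in> borel_measurable (lebesgue_on S)" "\<And>x. x \<in> S \<Longrightarrow> norm (f x) \<le> C"
  shows "f \<in> L2 S"
proof -
  have "integrable (lebesgue_on S) (\<lambda>x. f x \<bullet> f x)"
  proof (rule bounded_integrable[OF assms(1,2)])
    show "norm (f x \<bullet> f x) \<le> C * C" if "x \<in> S" for x
      using assms(4)[OF that] by (simp add: power2_norm_eq_inner[symmetric] power2_eq_square mult_mono')
  qed (use assms(3) in auto)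
  then show ?thesis using assms(3) by (simp add: L2_iff)
qed

lemma L2_integrable:
  assumes "bounded S" "S \<in> sets lebesgue" "f \<in> L2 S"
  shows "integrable (lebesgue_on S) f"
proof -
  interpret finite_measure "lebesgue_on S" by (rule finite_measure_lebesgue_on[OF assms(1,2)])
  show ?thesis
  proof (rule Bochner_Integration.integrable_bound)
    show "integrable (lebesgue_on S) (\<lambda>x. 1 + f x \<bullet> f x)"
      using assms(3) by (auto simp: L2_iff)
    have "norm (f x) \<le> 1 + f x \<bullet> f x" for x
    proof -
      have "2 * norm (f x) \<le> 1 + (norm (f x))\<^sup>2" using sum_squares_bound[of 1 "norm (f x)"] by simp
      then show ?thesis using norm_ge_zero[of "f x"] unfolding power2_norm_eq_inner by linarith
    qed
    then show "AE x in lebesgue_on S. norm (f x) \<le> norm (1 + f x \<bullet> f x)"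
      by (intro AE_I2) (auto intro: order_trans[OF _ abs_ge_self])
  qed (use assms(3) L2_measurable in auto)
qed

lemma L2_mult_bounded:
  fixes f :: "real^'n \<Rightarrow> 'b::euclidean_space"
  assumes f: "f \<in> L2 S" and c: "c \<in> borel_measurable (lebesgue_on S)" "AE x in lebesgue_on S. \<bar>c x\<bar> \<le> C"
  shows "(\<lambda>x. c x *\<^sub>R f x) \<in> L2 S"
proof -
  have m: "(\<lambda>x. c x *\<^sub>R f x) \<in> borel_measurable (lebesgue_on S)" using c L2_measurable[OF f] by simp
  have "integrable (lebesgue_on S) (\<lambda>x. (c x *\<^sub>R f x) \<bullet> (c x *\<^sub>R f x))"
  proof (rule Bochner_Integration.integrable_bound)
    show "integrable (lebesgue_on S) (\<lambda>x. C\<^sup>2 * (f x \<bullet> f x))" using f by (auto simp: L2_iff)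
    show "AE x in lebesgue_on S. norm ((c x *\<^sub>R f x) \<bullet> (c x *\<^sub>R f x)) \<le> norm (C\<^sup>2 * (f x \<bullet> f x))"
      using c(2)
    proof eventually_elim
      case (elim x)
      have "(c x)\<^sup>2 \<le> C\<^sup>2" using elim by (metis abs_ge_zero abs_le_square_iff abs_of_nonneg order_trans)
      then have "(c x)\<^sup>2 * (f x \<bullet> f x) \<le> C\<^sup>2 * (f x \<bullet> f x)" by (intro mult_right_mono) auto
      moreover have "(c x *\<^sub>R f x) \<bullet> (c x *\<^sub>R f x) = (c x)\<^sup>2 * (f x \<bullet> f x)" by (simp add: power2_eq_square)
      moreover have "0 \<le> (c x)\<^sup>2 * (f x \<bullet> f x)" "0 \<le> C\<^sup>2 * (f x \<bullet> f x)" by simp_all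
      ultimately show ?case by (simp only: real_norm_def abs_of_nonneg)
    qed
  qed (rule borel_measurable_inner[OF m m])
  then show ?thesis using m by (simp add: L2_iff)
qed

lemma L2_component:
  fixes w :: "real^'n \<Rightarrow> real^'n"
  assumes "w \<in> L2 S"
  shows "(\<lambda>x. w x $ i) \<in> L2 S"
proof -
  have m: "(\<lambda>x. w x $ i) \<in> borel_measurable (lebesgue_on S)"
    using borel_measurable_inner[OF L2_measurable[OF assms] borel_measurable_const[of "axis i 1"]] by (simp add: inner_axis)
  have "integrable (lebesgue_on S) (\<lambda>x. w x $ i \<bullet> w x $ i)"
  proof (rule Bochner_Integration.integrable_bound)
    show "integrable (lebesgue_on S) (\<lambda>x. w x \<bullet> w x)" using assms by (simp add: L2_iff)
    have "w x $ i * w x $ i \<le> w x \<bullet> w x" for x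
      unfolding inner_vec_def inner_real_def by (rule member_le_sum) auto
    then show "AE x in lebesgue_on S. norm (w x $ i \<bullet> w x $ i) \<le> norm (w x \<bullet> w x)" by (intro AE_I2) simp
  qed (use m in auto)
  then show ?thesis using m by (simp add: L2_iff)
qed

lemma L2_vec:
  fixes f :: "'n::finite \<Rightarrow> real^'n \<Rightarrow> 'b::euclidean_space"
  assumes "\<And>i. f i \<in> L2 S"
  shows "(\<lambda>x. \<chi> i. f i x) \<in> L2 S"
proof -
  have ax: "(\<lambda>x. axis i (f i x) :: 'b^'n) \<in> borel_measurable (lebesgue_on S)" for i
  proof -
    have "linear (axis i :: 'b \<Rightarrow> 'b^'n)" by (intro linearI) (auto simp: vec_eq_iff axis_def)
    then have "(axis i :: 'b \<Rightarrow> 'b^'n) \<in> borel_measurable borel"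
      by (intro borel_measurable_continuous_onI linear_continuous_on) (simp add: linear_conv_bounded_linear)
    then show ?thesis using measurable_compose[OF L2_measurable[OF assms[of i]]] by blast
  qed
  have "(\<lambda>x. \<Sum>i\<in>UNIV. axis i (f i x) :: 'b^'n) \<in> borel_measurable (lebesgue_on S)"
    by (intro borel_measurable_sum ax)
  moreover have "(\<Sum>i\<in>UNIV. axis i (f i x) :: 'b^'n) = (\<chi> i. f i x)" for x
    by (simp add: vec_eq_iff axis_def if_distrib cong: if_cong)
  ultimately have "(\<lambda>x. \<chi> i. f i x) \<in> borel_measurable (lebesgue_on S)" by simp
  then show ?thesis using assms by (auto simp: L2_iff inner_vec_def)
qed

section \<open>Weak derivatives\<close>

text \<open>Splits the vector-valued integrals of the definition into coordinates. The required
  integrability comes from boundedness of S and of test functions with their gradients.\<close>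

lemma has_weak_grad_iff:
  fixes S :: "(real^'n) set"
  assumes S: "bounded S" "S \<in> sets lebesgue"
  shows "has_weak_grad S u w \<longleftrightarrow> u \<in> L2 S \<and> w \<in> L2 S \<and>
    (\<forall>\<phi> i. test_function S \<phi> \<longrightarrow> (LINT x|lebesgue_on S. u x * grad \<phi> x $ i) = - (LINT x|lebesgue_on S. \<phi> x * w x $ i))"
proof -
  have "(LINT x|lebesgue_on S. u x *\<^sub>R grad \<phi> x) = - (LINT x|lebesgue_on S. \<phi> x *\<^sub>R w x) \<longleftrightarrow>
    (\<forall>i. (LINT x|lebesgue_on S. u x * grad \<phi> x $ i) = - (LINT x|lebesgue_on S. \<phi> x * w x $ i))"
    if u: "u \<in> L2 S" and w: "w \<in> L2 S" and \<phi>: "test_function S \<phi>" for \<phi>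
  proof -
    obtain C where C: "\<And>x. \<bar>\<phi> x\<bar> \<le> C" "\<And>x. norm (grad \<phi> x) \<le> C" using test_function_bounded[OF \<phi>] by blast
    have s: "smooth \<phi>" using \<phi> by (simp add: test_function_def)
    note m = lebesgue_on_continuous[OF smooth_continuous[OF s], of S] lebesgue_on_continuous[OF smooth_grad_continuous[OF s], of S]
    have 1: "integrable (lebesgue_on S) (\<lambda>x. \<phi> x *\<^sub>R w x)"
      by (rule L2_integrable[OF S]) (rule L2_mult_bounded[OF w m(1)], use C in \<open>auto intro!: AE_I2\<close>)
    have 2: "integrable (lebesgue_on S) (\<lambda>x. u x *\<^sub>R grad \<phi> x)"
    proof (rule Bochner_Integration.integrable_bound)
      show "integrable (lebesgue_on S) (\<lambda>x. C * u x)" by (intro integrable_mult_right L2_integrable[OF S u])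
      show "AE x in lebesgue_on S. norm (u x *\<^sub>R grad \<phi> x) \<le> norm (C * u x)"
      proof (rule AE_I2)
        fix x
        have "norm (grad \<phi> x) \<le> \<bar>C\<bar>" using C(2)[of x] by linarith
        then show "norm (u x *\<^sub>R grad \<phi> x) \<le> norm (C * u x)"
          using mult_right_mono[of "norm (grad \<phi> x)" "\<bar>C\<bar>" "\<bar>u x\<bar>"] by (simp add: abs_mult mult.commute)
      qed
    qed (use m L2_measurable[OF u] in auto)
    have "(LINT x|lebesgue_on S. u x *\<^sub>R grad \<phi> x) $ i = (LINT x|lebesgue_on S. u x * grad \<phi> x $ i)" for i
      using integral_inner_left[of "axis i 1" "lebesgue_on S" "\<lambda>x. u x *\<^sub>R grad \<phi> x"] 2 by (simp add: inner_axis)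
    moreover have "(LINT x|lebesgue_on S. \<phi> x *\<^sub>R w x) $ i = (LINT x|lebesgue_on S. \<phi> x * w x $ i)" for i
      using integral_inner_left[of "axis i 1" "lebesgue_on S" "\<lambda>x. \<phi> x *\<^sub>R w x"] 1 by (simp add: inner_axis)
    ultimately show ?thesis by (simp add: vec_eq_iff)
  qed
  then show ?thesis unfolding has_weak_grad_def by blast
qed

lemma L2_fundamental_lemma:
  fixes q r :: "real^'n \<Rightarrow> real"
  assumes S: "open S" "bounded S" and q: "q \<in> L2 S" and r: "r \<in> L2 S"
    and eq: "\<And>\<phi>. test_function S \<phi> \<Longrightarrow> (LINT x|lebesgue_on S. \<phi> x * q x) = (LINT x|lebesgue_on S. \<phi> x * r x)"
  shows "AE x in lebesgue_on S. q x = r x"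
proof -
  have Sm: "S \<in> sets lebesgue" using S(1) by (intro sets_completionI_sets) simp
  have "AE x in lebesgue_on S. q x - r x = 0"
  proof (rule fundamental_lemma[OF S(1)])
    show "integrable (lebesgue_on S) (\<lambda>x. q x - r x)"
      by (intro Bochner_Integration.integrable_diff L2_integrable[OF S(2) Sm] q r)
    fix \<phi> assume \<phi>: "test_function S \<phi>"
    obtain C where C: "\<And>x. \<bar>\<phi> x\<bar> \<le> C" using test_function_bounded[OF \<phi>] by blast
    have s: "smooth \<phi>" using \<phi> by (simp add: test_function_def)
    have i: "integrable (lebesgue_on S) (\<lambda>x. \<phi> x * h x)" if "h \<in> L2 S" for h :: "real^'n \<Rightarrow> real"
      using L2_integrable[OF S(2) Sm L2_mult_bounded[OF that lebesgue_on_continuous[OF smooth_continuous[OF s]], of C]] C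
      by (auto intro!: AE_I2)
    have "(LINT x|lebesgue_on S. (q x - r x) * \<phi> x) = (LINT x|lebesgue_on S. \<phi> x * q x - \<phi> x * r x)"
      by (intro Bochner_Integration.integral_cong) (auto simp: algebra_simps)
    then show "(LINT x|lebesgue_on S. (q x - r x) * \<phi> x) = 0" using i[OF q] i[OF r] eq[OF \<phi>] by simp
  qed
  then show ?thesis by simp
qed

text \<open>Since \<open>weak_grad\<close> is an arbitrary choice, every computation with it has to
  go through uniqueness almost everywhere.\<close>

lemma weak_grad_unique:
  assumes S: "open S" "bounded S" and "has_weak_grad S u w" "has_weak_grad S u' w'"
    and u: "AE x in lebesgue_on S. u x = u' x"
  shows "AE x in lebesgue_on S. w x = w' x"
proof -
  have Sm: "S \<in> sets lebesgue" using S(1) by (intro sets_completionI_sets) simp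
  note h = assms(3,4)[unfolded has_weak_grad_iff[OF S(2) Sm]]
  have "AE x in lebesgue_on S. w x $ i = w' x $ i" for i
  proof (rule L2_fundamental_lemma[OF S])
    fix \<phi> assume \<phi>: "test_function S \<phi>"
    then have s: "smooth \<phi>" by (simp add: test_function_def)
    have "(LINT x|lebesgue_on S. u x * grad \<phi> x $ i) = (LINT x|lebesgue_on S. u' x * grad \<phi> x $ i)"
    proof (rule integral_cong_AE_lebesgue_on[OF Sm])
      show "AE x in lebesgue_on S. u x * grad \<phi> x $ i = u' x * grad \<phi> x $ i" using u by eventually_elim simp
      show "(\<lambda>x. u x * grad \<phi> x $ i) \<in> borel_measurable (lebesgue_on S)"
      proof (rule borel_measurable_times)
        show "u \<in> borel_measurable (lebesgue_on S)" using h by (intro L2_measurable) blast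
        show "(\<lambda>x. grad \<phi> x $ i) \<in> borel_measurable (lebesgue_on S)"
          by (intro lebesgue_on_continuous continuous_intros smooth_grad_continuous[OF s])
      qed
    qed
    then show "(LINT x|lebesgue_on S. \<phi> x * w x $ i) = (LINT x|lebesgue_on S. \<phi> x * w' x $ i)" using h \<phi> by simp
  qed (use h in \<open>auto intro: L2_component\<close>)
  then have "AE x in lebesgue_on S. \<forall>i. w x $ i = w' x $ i" by (simp add: AE_all_countable)
  then show ?thesis by eventually_elim (simp add: vec_eq_iff)
qed

lemma integral_test_restrict:
  fixes h \<phi> :: "real^'n \<Rightarrow> real"
  assumes "\<And>x. x \<notin> S \<Longrightarrow> h x = 0" "S \<subseteq> S'" "S \<in> sets lebesgue" "S' \<in> sets lebesgue"
  shows "(LINT x|lebesgue_on S'. h x) = (LINT x|lebesgue_on S. h x)"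
proof -
  have "(\<lambda>x. indicator S x * h x) = (\<lambda>x. indicator S' x * h x)"
    using assms(1,2) by (auto simp: indicator_def fun_eq_iff)
  then show ?thesis using assms(3,4) by (simp add: integral_lebesgue_on)
qed

lemma L2_restrict:
  assumes "f \<in> L2 S'" "S \<subseteq> S'" "S \<in> sets lebesgue" "S' \<in> sets lebesgue"
  shows "f \<in> L2 S"
proof -
  have m: "f \<in> borel_measurable (lebesgue_on S)"
    using measurable_restrict_mono[OF L2_measurable[OF assms(1)] assms(2)] .
  have "integrable lebesgue (\<lambda>x. indicator S x *\<^sub>R (indicator S' x *\<^sub>R (f x \<bullet> f x)))"
    by (rule integrable_mult_indicator) (use assms in \<open>auto simp: L2_iff integrable_restrict_space\<close>)
  moreover have "(\<lambda>x. indicator S x *\<^sub>R (indicator S' x *\<^sub>R (f x \<bullet> f x))) = (\<lambda>x. indicator S x *\<^sub>R (f x \<bullet> f x))"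
    using assms(2) by (auto simp: indicator_def fun_eq_iff)
  ultimately show ?thesis using m assms(3) by (simp add: L2_iff integrable_restrict_space)
qed

lemma continuous_L2:
  fixes f :: "real^'n \<Rightarrow> 'b::euclidean_space"
  assumes "continuous_on UNIV f" "bounded S" "S \<in> sets lebesgue"
  shows "f \<in> L2 S"
proof -
  have "bounded (f ` closure S)"
    using assms by (intro compact_imp_bounded compact_continuous_image continuous_on_subset[OF assms(1)]) auto
  then obtain C where "\<And>x. x \<in> S \<Longrightarrow> norm (f x) \<le> C"
    unfolding bounded_iff using closure_subset by blast
  then show ?thesis by (rule bounded_L2[OF assms(2,3) lebesgue_on_continuous[OF assms(1)]])
qed

text \<open>A test function supported in S sees only P, and for P integration by parts on the whole
  space is available. So the chosen weak gradient is the classical one wherever u is smooth.\<close>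

lemma weak_grad_local:
  assumes \<Omega>: "open \<Omega>" "bounded \<Omega>" and w: "has_weak_grad \<Omega> u w" and S: "open S" "S \<subseteq> \<Omega>"
    and P: "C1 P D" "\<And>x. x \<in> S \<Longrightarrow> u x = P x"
  shows "AE x in lebesgue_on S. w x = D x"
proof -
  have bS: "bounded S" using \<Omega> S bounded_subset by blast
  have Sm: "S \<in> sets lebesgue" "\<Omega> \<in> sets lebesgue" using S(1) \<Omega>(1) by (auto intro!: sets_completionI_sets)
  note h = w[unfolded has_weak_grad_iff[OF \<Omega>(2) Sm(2)]]
  have "AE x in lebesgue_on S. w x $ i = D x $ i" for i
  proof (rule L2_fundamental_lemma[OF S(1) bS])
    show "(\<lambda>x. w x $ i) \<in> L2 S" using h by (intro L2_component L2_restrict[OF _ S(2) Sm]) auto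
    show "(\<lambda>x. D x $ i) \<in> L2 S" by (intro L2_component continuous_L2[OF C1_grad_continuous[OF P(1)] bS Sm(1)])
    fix \<phi> assume \<phi>: "test_function S \<phi>"
    note z = test_function_support[OF \<phi>]
    have "(LINT x|lebesgue_on S. \<phi> x * w x $ i) = (LINT x|lebesgue_on \<Omega>. \<phi> x * w x $ i)"
      by (rule integral_test_restrict[symmetric]) (use z S Sm in auto)
    also have "\<dots> = - (LINT x|lebesgue_on \<Omega>. u x * grad \<phi> x $ i)"
      using h test_function_mono[OF \<phi> S(2)] by simp
    also have "(LINT x|lebesgue_on \<Omega>. u x * grad \<phi> x $ i) = (LINT x|lebesgue_on S. u x * grad \<phi> x $ i)"
      by (rule integral_test_restrict) (use z S Sm in auto)
    also have "\<dots> = (LINT x|lebesgue_on S. P x * grad \<phi> x $ i)"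
      by (intro Bochner_Integration.integral_cong) (auto simp: P(2))
    also have "\<dots> = (LINT x|lebesgue_on UNIV. P x * grad \<phi> x $ i)"
      by (rule integral_test_restrict[symmetric]) (use z Sm in auto)
    also have "\<dots> = - (LINT x|lebesgue_on UNIV. \<phi> x * D x $ i)"
      using C1_integration_by_parts[OF P(1) \<phi>] by (simp add: lebesgue_on_UNIV_eq)
    also have "(LINT x|lebesgue_on UNIV. \<phi> x * D x $ i) = (LINT x|lebesgue_on S. \<phi> x * D x $ i)"
      by (rule integral_test_restrict) (use z Sm in auto)
    finally show "(LINT x|lebesgue_on S. \<phi> x * w x $ i) = (LINT x|lebesgue_on S. \<phi> x * D x $ i)" by simp
  qed
  then have "AE x in lebesgue_on S. \<forall>i. w x $ i = D x $ i" by (simp add: AE_all_countable)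
  then show ?thesis by eventually_elim (simp add: vec_eq_iff)
qed

lemma weak_div_local:
  fixes v :: "real^'n \<Rightarrow> real^'n"
  assumes \<Omega>: "open \<Omega>" "bounded \<Omega>" and q: "has_weak_div \<Omega> v q" and S: "open S" "S \<subseteq> \<Omega>"
    and P: "\<And>i. C1 (P i) (D i)" "\<And>x i. x \<in> S \<Longrightarrow> v x $ i = P i x"
  shows "AE x in lebesgue_on S. q x = (\<Sum>i\<in>UNIV. D i x $ i)"
proof -
  have bS: "bounded S" using \<Omega> S bounded_subset by blast
  have Sm: "S \<in> sets lebesgue" "\<Omega> \<in> sets lebesgue" using S(1) \<Omega>(1) by (auto intro!: sets_completionI_sets)
  show ?thesis
  proof (rule L2_fundamental_lemma[OF S(1) bS])
    show "q \<in> L2 S" using q by (intro L2_restrict[OF _ S(2) Sm]) (auto simp: has_weak_div_def)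
    show "(\<lambda>x. \<Sum>i\<in>UNIV. D i x $ i) \<in> L2 S"
      by (intro continuous_L2 bS Sm continuous_intros C1_grad_continuous[OF P(1)])
    fix \<phi> assume \<phi>: "test_function S \<phi>"
    then have s: "smooth \<phi>" by (simp add: test_function_def)
    note z = test_function_support[OF \<phi>]
    have i: "integrable (lebesgue_on S) f" if "continuous_on UNIV f" for f :: "real^'n \<Rightarrow> real"
      by (rule L2_integrable[OF bS Sm(1) continuous_L2[OF that bS Sm(1)]])
    have "(LINT x|lebesgue_on S. \<phi> x * q x) = (LINT x|lebesgue_on \<Omega>. \<phi> x * q x)"
      by (rule integral_test_restrict[symmetric]) (use z S Sm in auto)
    also have "\<dots> = - (LINT x|lebesgue_on \<Omega>. v x \<bullet> grad \<phi> x)"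
      using q test_function_mono[OF \<phi> S(2)] by (simp add: has_weak_div_def L2_inner_def mult.commute)
    also have "(LINT x|lebesgue_on \<Omega>. v x \<bullet> grad \<phi> x) = (LINT x|lebesgue_on S. v x \<bullet> grad \<phi> x)"
      by (rule integral_test_restrict) (use z S Sm in auto)
    also have "\<dots> = (LINT x|lebesgue_on S. (\<Sum>i\<in>UNIV. P i x * grad \<phi> x $ i))"
      by (intro Bochner_Integration.integral_cong) (auto simp: P(2) inner_vec_def)
    also have "\<dots> = (\<Sum>i\<in>UNIV. LINT x|lebesgue_on S. P i x * grad \<phi> x $ i)"
      by (intro Bochner_Integration.integral_sum i continuous_intros C1_continuous[OF P(1)] smooth_grad_continuous[OF s])
    also have "\<dots> = (\<Sum>i\<in>UNIV. - (LINT x|lebesgue_on S. \<phi> x * D i x $ i))"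
    proof (rule sum.cong[OF refl])
      fix j
      have "(LINT x|lebesgue_on S. P j x * grad \<phi> x $ j) = (LINT x|lebesgue_on UNIV. P j x * grad \<phi> x $ j)"
        by (rule integral_test_restrict[symmetric]) (use z Sm in auto)
      also have "\<dots> = - (LINT x|lebesgue_on UNIV. \<phi> x * D j x $ j)"
        using C1_integration_by_parts[OF P(1) \<phi>] by (simp add: lebesgue_on_UNIV_eq)
      also have "(LINT x|lebesgue_on UNIV. \<phi> x * D j x $ j) = (LINT x|lebesgue_on S. \<phi> x * D j x $ j)"
        by (rule integral_test_restrict) (use z Sm in auto)
      finally show "(LINT x|lebesgue_on S. P j x * grad \<phi> x $ j) = - (LINT x|lebesgue_on S. \<phi> x * D j x $ j)" .
    qed
    also have "\<dots> = - (LINT x|lebesgue_on S. (\<Sum>i\<in>UNIV. \<phi> x * D i x $ i))"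
      by (subst Bochner_Integration.integral_sum)
        (auto intro!: i continuous_intros C1_grad_continuous[OF P(1)] smooth_continuous[OF s] simp: sum_negf)
    finally show "(LINT x|lebesgue_on S. \<phi> x * q x) = (LINT x|lebesgue_on S. \<phi> x * (\<Sum>i\<in>UNIV. D i x $ i))"
      by (simp add: sum_distrib_left)
  qed
qed

lemma has_weak_grad_weak_grad: "u \<in> H1 \<Omega> \<Longrightarrow> has_weak_grad \<Omega> u (weak_grad \<Omega> u)"
  unfolding H1_def weak_grad_def by (drule CollectD) (rule someI_ex[of "has_weak_grad \<Omega> u"])

lemma has_weak_div_weak_div: "v \<in> Hdiv \<Omega> \<Longrightarrow> has_weak_div \<Omega> v (weak_div \<Omega> v)"
  unfolding Hdiv_def weak_div_def by (drule CollectD) (rule someI_ex[of "has_weak_div \<Omega> v"])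

lemma has_weak_grad_add:
  assumes "bounded S" "S \<in> sets lebesgue" "has_weak_grad S u w" "has_weak_grad S u' w'"
  shows "has_weak_grad S (\<lambda>x. u x + u' x) (\<lambda>x. w x + w' x)"
proof -
  note h = assms(3,4)[unfolded has_weak_grad_iff[OF assms(1,2)]]
  have "(LINT x|lebesgue_on S. (u x + u' x) * grad \<phi> x $ i) = - (LINT x|lebesgue_on S. \<phi> x * (w x + w' x) $ i)"
    if \<phi>: "test_function S \<phi>" for \<phi> i
  proof -
    have s: "smooth \<phi>" using \<phi> by (simp add: test_function_def)
    have c: "\<phi> \<in> L2 S" "(\<lambda>x. grad \<phi> x $ i) \<in> L2 S"
      by (intro continuous_L2 assms smooth_continuous smooth_grad s)+
    have 1: "integrable (lebesgue_on S) (\<lambda>x. f x * grad \<phi> x $ i)" if "f \<in> L2 S" for f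
      using L2_inner_integrable[OF that c(2)] by simp
    have 2: "integrable (lebesgue_on S) (\<lambda>x. \<phi> x * f x $ i)" if "f \<in> L2 S" for f :: "_ \<Rightarrow> real^'a"
      using L2_inner_integrable[OF c(1) L2_component[OF that, of i]] by simp
    show ?thesis using h \<phi> 1 2 by (simp add: distrib_right distrib_left)
  qed
  then show ?thesis unfolding has_weak_grad_iff[OF assms(1,2)] using h by (auto intro: L2_add)
qed

lemma has_weak_grad_scale:
  assumes "bounded S" "S \<in> sets lebesgue" "has_weak_grad S u w"
  shows "has_weak_grad S (\<lambda>x. c * u x) (\<lambda>x. c *\<^sub>R w x)"
proof -
  note h = assms(3)[unfolded has_weak_grad_iff[OF assms(1,2)]]
  show ?thesis unfolding has_weak_grad_iff[OF assms(1,2)]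
    using h L2_scale[of u S c] L2_scale[of w S c] by (simp add: mult.assoc mult.left_commute)
qed

lemma has_weak_grad_sum:
  assumes "bounded S" "S \<in> sets lebesgue" "finite I" "\<And>i. i \<in> I \<Longrightarrow> has_weak_grad S (u i) (w i)"
  shows "has_weak_grad S (\<lambda>x. \<Sum>i\<in>I. u i x) (\<lambda>x. \<Sum>i\<in>I. w i x)"
  using assms(3,4)
proof (induction I rule: finite_induct)
  case empty
  then show ?case unfolding has_weak_grad_iff[OF assms(1,2)] by (simp add: L2_zero)
next
  case (insert i I)
  then show ?case by (simp add: has_weak_grad_add[OF assms(1,2)])
qed

text \<open>The trace of the weak Jacobian; this is how members of \<open>V_h\<close> acquire a weak
  divergence.\<close>

lemma has_weak_div_of_weak_grads:
  fixes v :: "real^'n \<Rightarrow> real^'n"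
  assumes S: "bounded S" "S \<in> sets lebesgue" and w: "\<And>i. has_weak_grad S (\<lambda>x. v x $ i) (w i)"
  shows "has_weak_div S v (\<lambda>x. \<Sum>i\<in>UNIV. w i x $ i)"
proof -
  note h = w[unfolded has_weak_grad_iff[OF S]]
  have v: "v \<in> L2 S" using L2_vec[of "\<lambda>i x. v x $ i" S] h by simp
  have c: "(\<lambda>x. w i x $ i) \<in> L2 S" for i using h by (intro L2_component) auto
  have q: "(\<lambda>x. \<Sum>i\<in>UNIV. w i x $ i) \<in> L2 S"
  proof -
    have "(\<lambda>x. \<Sum>i\<in>I. w i x $ i) \<in> L2 S" if "finite I" for I :: "'n set"
      using that by (induction I rule: finite_induct) (auto intro: L2_add c L2_zero)
    then show ?thesis by simp
  qed
  have "L2_inner S v (grad \<phi>) = - L2_inner S (\<lambda>x. \<Sum>i\<in>UNIV. w i x $ i) \<phi>" if \<phi>: "test_function S \<phi>" for \<phi>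
  proof -
    have s: "smooth \<phi>" using \<phi> by (simp add: test_function_def)
    have L: "\<phi> \<in> L2 S" "(\<lambda>x. grad \<phi> x $ i) \<in> L2 S" for i
      by (intro continuous_L2 S smooth_continuous smooth_grad s)+
    have i1: "integrable (lebesgue_on S) (\<lambda>x. v x $ i * grad \<phi> x $ i)" for i
      using L2_inner_integrable[OF L2_component[OF v, of i] L(2)] by simp
    have i2: "integrable (lebesgue_on S) (\<lambda>x. \<phi> x * w i x $ i)" for i
      using L2_inner_integrable[OF L(1) c] by simp
    have "L2_inner S v (grad \<phi>) = (\<Sum>i\<in>UNIV. LINT x|lebesgue_on S. v x $ i * grad \<phi> x $ i)"
      unfolding L2_inner_def inner_vec_def using i1 by (simp add: Bochner_Integration.integral_sum)
    also have "\<dots> = (\<Sum>i\<in>UNIV. - (LINT x|lebesgue_on S. \<phi> x * w i x $ i))"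
      using h \<phi> by simp
    also have "\<dots> = - (LINT x|lebesgue_on S. (\<Sum>i\<in>UNIV. \<phi> x * w i x $ i))"
      using i2 by (simp add: Bochner_Integration.integral_sum sum_negf)
    also have "\<dots> = - L2_inner S (\<lambda>x. \<Sum>i\<in>UNIV. w i x $ i) \<phi>"
      by (simp add: L2_inner_def sum_distrib_left mult.commute)
    finally show ?thesis .
  qed
  then show ?thesis unfolding has_weak_div_def using v q by blast
qed

section \<open>Piecewise smooth functions on a mesh\<close>

text \<open>Agreement is demanded on the closed elements, which forces continuity across common
  faces; values off the mesh stay free.\<close>

definition pw :: "(real^'n) set set \<Rightarrow> (real^'n \<Rightarrow> real) \<Rightarrow> ((real^'n) set \<Rightarrow> real^'n \<Rightarrow> real) \<Rightarrow>
    ((real^'n) set \<Rightarrow> real^'n \<Rightarrow> real^'n) \<Rightarrow> bool" where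
  "pw \<T> \<zeta> P D \<longleftrightarrow> (\<forall>T\<in>\<T>. C1 (P T) (D T) \<and> (\<forall>x\<in>T. \<zeta> x = P T x))"

text \<open>The value 0 on the skeleton and off the mesh gives one representative defined on the
  whole space.\<close>

definition pg :: "(real^'n) set set \<Rightarrow> ((real^'n) set \<Rightarrow> real^'n \<Rightarrow> real^'n) \<Rightarrow> real^'n \<Rightarrow> real^'n" where
  "pg \<T> D x = (\<Sum>T\<in>\<T>. indicator (interior T) x *\<^sub>R D T x)"

lemma pw_C1: "C1 P D \<Longrightarrow> pw \<T> P (\<lambda>T. P) (\<lambda>T. D)"
  by (simp add: pw_def)

lemma pw_eq: "pw \<T> \<zeta> P D \<Longrightarrow> T \<in> \<T> \<Longrightarrow> x \<in> T \<Longrightarrow> \<zeta> x = P T x"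
  by (simp add: pw_def)

lemma pw_mult:
  "pw \<T> \<zeta> P D \<Longrightarrow> pw \<T> \<xi> Q E \<Longrightarrow>
    pw \<T> (\<lambda>x. \<zeta> x * \<xi> x) (\<lambda>T x. P T x * Q T x) (\<lambda>T x. P T x *\<^sub>R E T x + Q T x *\<^sub>R D T x)"
  by (simp add: pw_def C1_mult)

lemma pw_prod:
  "finite I \<Longrightarrow> (\<And>i. i \<in> I \<Longrightarrow> pw \<T> (\<zeta> i) (P i) (D i)) \<Longrightarrow>
    pw \<T> (\<lambda>x. \<Prod>i\<in>I. \<zeta> i x) (\<lambda>T x. \<Prod>i\<in>I. P i T x) (\<lambda>T x. \<Sum>i\<in>I. (\<Prod>j\<in>I - {i}. P j T x) *\<^sub>R D i T x)"
  by (auto simp: pw_def intro!: C1_prod prod.cong)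

section \<open>Geometry of the mesh and elementwise calculus\<close>

locale mesh_domain =
  fixes \<Omega> :: "(real^'n) set" and \<T> :: "(real^'n) set set"
  assumes dim: "CARD('n) \<in> {2, 3}" and domain: "polyhedral_lipschitz_domain \<Omega>" and mesh: "mesh_of \<Omega> \<T>"
begin

lemma open_\<Omega>: "open \<Omega>" and bounded_\<Omega>: "bounded \<Omega>"
  using domain by (auto simp: polyhedral_lipschitz_domain_def)

lemma \<Omega>_sets: "\<Omega> \<in> sets lebesgue"
  using open_\<Omega> by (intro sets_completionI_sets) simp

lemma finite_mesh: "finite \<T>" and Union_mesh: "\<Union>\<T> = closure \<Omega>"
  using mesh by (auto simp: mesh_of_def triangulation_def)

lemma element: "T \<in> \<T> \<Longrightarrow> full_simplex T"
  using mesh by (simp add: mesh_of_def full_simplex_def)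

lemma inter_face:
  assumes "T \<in> \<T>" "T' \<in> \<T>"
  shows "(T \<inter> T') face_of T" "(T \<inter> T') face_of T'"
proof -
  have "\<And>T T'. T \<in> \<T> \<Longrightarrow> T' \<in> \<T> \<Longrightarrow> (T \<inter> T') face_of T"
    using mesh by (simp add: mesh_of_def triangulation_def)
  from this[OF assms] this[OF assms(2,1)] show "(T \<inter> T') face_of T" "(T \<inter> T') face_of T'"
    by (simp_all add: Int_commute)
qed

lemma element_subset: "T \<in> \<T> \<Longrightarrow> T \<subseteq> closure \<Omega>"
  using Union_mesh by blast

lemma closed_element: "T \<in> \<T> \<Longrightarrow> closed T"
  using full_simplex.closed[OF element] .

text \<open>The Lipschitz boundary excludes slits: arbitrarily close to a boundary point, below the
  graph, there is an open set that misses \<open>\<Omega>\<close>.\<close>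

lemma interior_closure_\<Omega>: "interior (closure \<Omega>) = \<Omega>"
proof
  show "interior (closure \<Omega>) \<subseteq> \<Omega>"
  proof
    fix x assume x: "x \<in> interior (closure \<Omega>)"
    show "x \<in> \<Omega>"
    proof (rule ccontr)
      assume nx: "x \<notin> \<Omega>"
      then have "x \<in> frontier \<Omega>" using x interior_subset open_\<Omega> by (auto simp: frontier_def interior_open)
      then obtain e r C \<psi> where e: "norm e = 1" and r: "0 < r" and lip: "C-lipschitz_on {y. e \<bullet> y = 0} \<psi>"
        and graph: "\<And>y. y \<in> ball x r \<Longrightarrow> y \<in> \<Omega> \<longleftrightarrow> \<psi> (y - (e \<bullet> y) *\<^sub>R e) < e \<bullet> y"
        using domain unfolding polyhedral_lipschitz_domain_def lipschitz_boundary_def by blast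
      have ee: "e \<bullet> e = 1" using e by (simp add: norm_eq_1)
      define pr where "pr = (\<lambda>y. y - (e \<bullet> y) *\<^sub>R e)"
      have pr0: "e \<bullet> pr y = 0" for y by (simp add: pr_def inner_diff_right ee)
      have cont: "continuous_on UNIV (\<lambda>y. \<psi> (pr y))"
      proof (rule continuous_on_compose2[OF lipschitz_on_continuous_on[OF lip], of UNIV pr])
        show "continuous_on UNIV pr" unfolding pr_def by (intro continuous_intros)
      qed (use pr0 in blast)
      have xe: "e \<bullet> x \<le> \<psi> (pr x)" using graph[of x] r nx by (simp add: pr_def)
      define B where "B = ball x r \<inter> interior (closure \<Omega>)"
      have "open B" "x \<in> B" using x r by (auto simp: B_def)
      then obtain t where t: "t > 0" "ball x t \<subseteq> B" using openE by blast
      \<comment> \<open>Moving against \<open>e\<close> keeps the projection and lowers the height,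
        so y lies strictly below the graph.\<close>
      define y where "y = x - (t / 2) *\<^sub>R e"
      have yB: "y \<in> B" using t e by (auto simp: y_def dist_norm)
      have "pr y = pr x" by (simp add: y_def pr_def inner_diff_right ee algebra_simps)
      then have "e \<bullet> y < \<psi> (pr y)" using xe t by (simp add: y_def inner_diff_right ee)
      define U where "U = B \<inter> {y. e \<bullet> y < \<psi> (pr y)}"
      have "open U" unfolding U_def using \<open>open B\<close>
        by (intro open_Int open_Collect_less cont continuous_intros)
      moreover have "y \<in> U" using yB \<open>e \<bullet> y < \<psi> (pr y)\<close> by (simp add: U_def)
      moreover have "U \<inter> \<Omega> = {}" using graph by (force simp: U_def B_def pr_def)
      ultimately have "y \<notin> closure \<Omega>" using open_Int_closure_eq_empty by blast
      then show False using yB interior_subset by (auto simp: B_def)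
    qed
  qed
qed (rule interior_maximal[OF closure_subset open_\<Omega>])

lemma frontier_\<Omega>: "frontier \<Omega> = closure \<Omega> - \<Omega>"
  using open_\<Omega> by (simp add: frontier_def interior_open)

lemma interior_element: "T \<in> \<T> \<Longrightarrow> interior T \<subseteq> \<Omega>"
  using interior_mono[OF element_subset] interior_closure_\<Omega> by blast

text \<open>The common part is a face of both elements, and a face that meets the interior is the
  whole element; applied twice, this identifies the two.\<close>

lemma disjoint_interiors:
  assumes "T \<in> \<T>" "T' \<in> \<T>" "T \<noteq> T'"
  shows "interior T \<inter> T' = {}"
proof (rule ccontr)
  assume "interior T \<inter> T' \<noteq> {}"
  then obtain x where x: "x \<in> interior T" "x \<in> T'" by blast
  have "T \<inter> T' = T"
    using face_of_disjoint_interior[OF inter_face(1)[OF assms(1,2)]] x interior_subset by blast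
  then have sub: "T \<subseteq> T'" by blast
  then have "T face_of T'" using inter_face(2)[OF assms(1,2)] by (simp add: Int_absorb2)
  moreover have "interior T \<subseteq> interior T'" using sub by (rule interior_mono)
  ultimately have "T = T'" using face_of_disjoint_interior[of T T'] x interior_subset by blast
  then show False using assms(3) by blast
qed

lemma AE_interior: "AE x in lebesgue. x \<in> closure \<Omega> \<longrightarrow> (\<exists>T\<in>\<T>. x \<in> interior T)"
proof -
  have "negligible (\<Union>T\<in>\<T>. frontier T)"
    using finite_mesh full_simplex.convex[OF element] by (intro negligible_Union) (auto intro: negligible_convex_frontier)
  then have "AE x in lebesgue. x \<notin> (\<Union>T\<in>\<T>. frontier T)"
    unfolding negligible_iff_null_sets by (rule AE_not_in)
  then show ?thesis
  proof eventually_elim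
    case (elim x)
    show ?case
    proof
      assume "x \<in> closure \<Omega>"
      then obtain T where T: "T \<in> \<T>" "x \<in> T" using Union_mesh by blast
      then have "x \<in> interior T" using elim closed_element[OF T(1)] by (auto simp: frontier_def)
      then show "\<exists>T\<in>\<T>. x \<in> interior T" using T(1) by blast
    qed
  qed
qed

lemma AE_interior_\<Omega>: "AE x in lebesgue_on \<Omega>. \<exists>T\<in>\<T>. x \<in> interior T"
  unfolding AE_lebesgue_on_iff[OF \<Omega>_sets] using AE_interior closure_subset by (auto elim!: eventually_mono)

lemma pg_interior:
  assumes "T \<in> \<T>" "x \<in> interior T"
  shows "pg \<T> D x = D T x"
proof -
  have "indicator (interior T') x *\<^sub>R D T' x = 0" if "T' \<in> \<T> - {T}" for T'
    using disjoint_interiors[of T T'] assms that interior_subset by (auto simp: indicator_def)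
  then have "(\<Sum>T'\<in>\<T> - {T}. indicator (interior T') x *\<^sub>R D T' x) = 0" by (rule sum.neutral[OF ballI])
  then show ?thesis unfolding pg_def using assms(2) by (simp add: sum.remove[OF finite_mesh assms(1)])
qed

lemma pg_outside: "x \<notin> closure \<Omega> \<Longrightarrow> pg \<T> D x = 0"
  unfolding pg_def using element_subset interior_subset by (intro sum.neutral) (auto simp: indicator_def)

lemma pg_measurable_continuous:
  "(\<And>T. T \<in> \<T> \<Longrightarrow> continuous_on UNIV (D T)) \<Longrightarrow> pg \<T> D \<in> borel_measurable borel"
  unfolding pg_def
  by (intro borel_measurable_sum borel_measurable_scaleR borel_measurable_indicator borel_measurable_continuous_onI) auto

lemma continuous_elementwise_bounded:
  fixes D :: "(real^'n) set \<Rightarrow> real^'n \<Rightarrow> real^'n"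
  assumes "\<And>T. T \<in> \<T> \<Longrightarrow> continuous_on UNIV (D T)"
  shows "\<exists>M\<ge>0. \<forall>T\<in>\<T>. \<forall>x\<in>T. norm (D T x) \<le> M"
proof -
  have "\<exists>M. \<forall>x\<in>T. norm (D T x) \<le> M" if "T \<in> \<T>" for T
  proof -
    have "bounded (D T ` T)"
      using assms[OF that] full_simplex.compact[OF element[OF that]] continuous_on_subset
      by (intro compact_imp_bounded compact_continuous_image) auto
    then show ?thesis unfolding bounded_iff by blast
  qed
  then obtain M where M: "\<And>T x. T \<in> \<T> \<Longrightarrow> x \<in> T \<Longrightarrow> norm (D T x) \<le> M T" by metis
  have "norm (D T x) \<le> (\<Sum>T\<in>\<T>. \<bar>M T\<bar>)" if "T \<in> \<T>" "x \<in> T" for T x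
    using M[OF that] member_le_sum[of T \<T> "\<lambda>T. \<bar>M T\<bar>"] finite_mesh that by force
  then show ?thesis by (intro exI[of _ "\<Sum>T\<in>\<T>. \<bar>M T\<bar>"]) (auto intro: sum_nonneg)
qed

lemma pg_bounded_continuous:
  assumes "\<And>T. T \<in> \<T> \<Longrightarrow> continuous_on UNIV (D T)"
  shows "\<exists>M. \<forall>x. norm (pg \<T> D x) \<le> M"
proof -
  obtain M where M: "M \<ge> 0" "\<And>T x. T \<in> \<T> \<Longrightarrow> x \<in> T \<Longrightarrow> norm (D T x) \<le> M"
    using continuous_elementwise_bounded[of D, OF assms] by blast
  have "norm (pg \<T> D x) \<le> M" for x
  proof (cases "\<exists>T\<in>\<T>. x \<in> interior T")
    case True
    then show ?thesis using M(2) pg_interior interior_subset by (metis subsetD)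
  next
    case False
    then have "pg \<T> D x = 0" unfolding pg_def by (intro sum.neutral) (auto simp: indicator_def)
    then show ?thesis using M(1) by simp
  qed
  then show ?thesis by blast
qed

lemma pw_gradient_continuous: "pw \<T> \<zeta> P D \<Longrightarrow> T \<in> \<T> \<Longrightarrow> continuous_on UNIV (D T)"
  by (intro C1_grad_continuous) (auto simp: pw_def)

lemma pg_measurable: "pw \<T> \<zeta> P D \<Longrightarrow> pg \<T> D \<in> borel_measurable borel"
  by (rule pg_measurable_continuous[OF pw_gradient_continuous])

lemma pg_bounded: "pw \<T> \<zeta> P D \<Longrightarrow> \<exists>M. \<forall>x. norm (pg \<T> D x) \<le> M"
  by (rule pg_bounded_continuous[OF pw_gradient_continuous])

lemma pw_continuous:
  assumes "pw \<T> \<zeta> P D"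
  shows "continuous_on (closure \<Omega>) \<zeta>"
proof -
  have "continuous_on (\<Union>T\<in>\<T>. T) \<zeta>"
  proof (rule continuous_on_closed_Union[OF finite_mesh closed_element])
    fix T assume T: "T \<in> \<T>"
    have "continuous_on T (P T)" using assms T by (intro C1_continuous) (auto simp: pw_def)
    then show "continuous_on T \<zeta>" by (rule continuous_on_eq) (use assms T in \<open>auto simp: pw_def\<close>)
  qed
  then show ?thesis using Union_mesh by simp
qed

lemma pw_bounded:
  assumes "pw \<T> \<zeta> P D"
  shows "\<exists>C. \<forall>x\<in>closure \<Omega>. \<bar>\<zeta> x\<bar> \<le> C"
proof -
  have "bounded (\<zeta> ` closure \<Omega>)"
    using bounded_\<Omega> by (intro compact_imp_bounded compact_continuous_image pw_continuous[OF assms]) auto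
  then show ?thesis unfolding bounded_iff by (metis imageI real_norm_def)
qed

lemma pw_measurable: "pw \<T> \<zeta> P D \<Longrightarrow> \<zeta> \<in> borel_measurable (lebesgue_on \<Omega>)"
  using continuous_on_subset[OF pw_continuous closure_subset]
  by (intro continuous_imp_measurable_on_sets_lebesgue \<Omega>_sets) auto

lemma pw_L2:
  assumes "pw \<T> \<zeta> P D"
  shows "\<zeta> \<in> L2 \<Omega>"
proof -
  obtain C where C: "\<And>x. x \<in> closure \<Omega> \<Longrightarrow> \<bar>\<zeta> x\<bar> \<le> C" using pw_bounded[OF assms] by blast
  have "norm (\<zeta> x) \<le> C" if "x \<in> \<Omega>" for x using C[OF subsetD[OF closure_subset that]] by simp
  then show ?thesis by (rule bounded_L2[OF bounded_\<Omega> \<Omega>_sets pw_measurable[OF assms]])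
qed

lemma pg_L2:
  assumes "pw \<T> \<zeta> P D"
  shows "pg \<T> D \<in> L2 \<Omega>"
proof -
  obtain M where "\<And>x. norm (pg \<T> D x) \<le> M" using pg_bounded[OF assms] by blast
  then show ?thesis
    by (intro bounded_L2[OF bounded_\<Omega> \<Omega>_sets, of _ M] measurable_restrict_space1 measurable_completion)
      (use pg_measurable[OF assms] in auto)
qed

text \<open>The elements together with the complement of the domain are a closed cover of the space, so
  Lipschitz continuity on every piece gives global Lipschitz continuity along segments.\<close>

lemma pw_lipschitz:
  assumes pw: "pw \<T> \<zeta> P D" and z: "\<And>x. x \<notin> \<Omega> \<Longrightarrow> \<zeta> x = 0"
  shows "\<exists>L. \<forall>x y. \<bar>\<zeta> y - \<zeta> x\<bar> \<le> L * norm (y - x)"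
proof -
  obtain M where M: "M \<ge> 0" "\<And>T x. T \<in> \<T> \<Longrightarrow> x \<in> T \<Longrightarrow> norm (D T x) \<le> M"
    using continuous_elementwise_bounded[of D, OF pw_gradient_continuous[OF pw]] by blast
  have onT: "\<bar>\<zeta> y - \<zeta> x\<bar> \<le> M * norm (y - x)" if T: "T \<in> \<T>" "x \<in> T" "y \<in> T" for T x y
    using C1_lipschitz[of "P T" "D T" T M x y] pw T M(2) full_simplex.convex[OF element[OF T(1)]] by (simp add: pw_def)
  have "\<bar>\<zeta> y - \<zeta> x\<bar> \<le> M * norm (y - x)" for x y
  proof -
    define g where "g = (\<lambda>t. x + t *\<^sub>R (y - x))"
    define U where "U = (\<lambda>S. g -` S)"
    have gc: "continuous_on UNIV g" unfolding g_def by (intro continuous_intros)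
    have gd: "norm (g s - g t) = \<bar>s - t\<bar> * norm (y - x)" for s t
    proof -
      have "g s - g t = (s - t) *\<^sub>R (y - x)" by (simp add: g_def algebra_simps)
      then show ?thesis by simp
    qed
    have "(M * norm (y - x))-lipschitz_on {0..1} (\<lambda>t. \<zeta> (g t))"
    proof (rule lipschitz_on_closed_Union[where I = "insert (- \<Omega>) \<T>" and U = U])
      fix S assume S: "S \<in> insert (- \<Omega>) \<T>"
      then have "closed S" using closed_element open_\<Omega> by auto
      then show "closed (U S)" unfolding U_def
        using continuous_closed_vimage[of S g] gc by (metis continuous_on_eq_continuous_at open_UNIV UNIV_I)
      show "(M * norm (y - x))-lipschitz_on (U S) (\<lambda>t. \<zeta> (g t))"
      proof (rule lipschitz_onI)
        fix s t assume st: "s \<in> U S" "t \<in> U S"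
        have "\<bar>\<zeta> (g s) - \<zeta> (g t)\<bar> \<le> M * norm (g s - g t)"
        proof (cases "S = - \<Omega>")
          case True
          then show ?thesis using st z M(1) by (simp add: U_def)
        next
          case False
          then show ?thesis using S st onT[of S "g t" "g s"] by (simp add: U_def)
        qed
        then show "dist (\<zeta> (g s)) (\<zeta> (g t)) \<le> M * norm (y - x) * dist s t"
          unfolding gd by (simp add: dist_real_def mult_ac)
      qed (use M(1) in simp)
    next
      have "g t \<in> - \<Omega> \<or> (\<exists>T\<in>\<T>. g t \<in> T)" for t
        using Union_mesh closure_subset[of \<Omega>] by (metis ComplI UnionE subsetD)
      then show "{0..1} \<subseteq> (\<Union>i\<in>insert (- \<Omega>) \<T>. U i)" by (auto simp: U_def)
    qed (use finite_mesh M(1) in auto)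
    then have "dist (\<zeta> (g 1)) (\<zeta> (g 0)) \<le> M * norm (y - x) * dist 1 (0::real)"
      by (rule lipschitz_onD) auto
    then show ?thesis by (simp add: g_def dist_real_def)
  qed
  then show ?thesis by blast
qed

text \<open>Global Lipschitz continuity lets translation invariance do the work, so no jump terms on
  faces have to be cancelled.\<close>

lemma pw_integral_pg:
  assumes pw: "pw \<T> \<zeta> P D" and z: "\<And>x. x \<notin> \<Omega> \<Longrightarrow> \<zeta> x = 0"
  shows "(LINT x|lebesgue. pg \<T> D x $ i) = 0"
proof -
  obtain L where L: "\<And>x y. \<bar>\<zeta> y - \<zeta> x\<bar> \<le> L * norm (y - x)" using pw_lipschitz[OF assms] by blast
  obtain R where R: "\<And>x. x \<in> \<Omega> \<Longrightarrow> norm x \<le> R" using bounded_\<Omega> unfolding bounded_iff by blast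
  have "(LINT x|lebesgue. pg \<T> D x \<bullet> axis i 1) = 0"
  proof (rule lipschitz_integral_derivative[OF L, of R])
    show "norm x \<le> R" if "\<zeta> x \<noteq> 0" for x using that z R by blast
    show "(\<lambda>x. pg \<T> D x \<bullet> axis i 1) \<in> borel_measurable lebesgue"
      by (intro measurable_completion) (use pg_measurable[OF pw] in simp)
    show "AE x in lebesgue. ((\<lambda>t. (\<zeta> (x + t *\<^sub>R axis i 1) - \<zeta> x) / t) \<longlongrightarrow> pg \<T> D x \<bullet> axis i 1) (at 0)"
      using AE_interior
    proof eventually_elim
      case (elim x)
      have "(\<zeta> has_derivative (\<lambda>h. pg \<T> D x \<bullet> h)) (at x)"
      proof (cases "x \<in> closure \<Omega>")
        case True
        then obtain T where T: "T \<in> \<T>" "x \<in> interior T" using elim by blast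
        have "(P T has_derivative (\<lambda>h. pg \<T> D x \<bullet> h)) (at x)"
          unfolding pg_interior[OF T] using pw T(1) by (intro C1_has_derivative) (auto simp: pw_def)
        then show ?thesis
          by (rule has_derivative_transform_within_open[of _ _ _ _ "interior T"])
            (use T pw_eq[OF pw T(1) subsetD[OF interior_subset]] in auto)
      next
        case False
        have "(\<zeta> has_derivative (\<lambda>h. 0)) (at x)"
          by (rule has_derivative_transform_within_open[of "\<lambda>x. 0" _ _ _ "- closure \<Omega>"])
            (use False z closure_subset in \<open>auto simp: subset_iff\<close>)
        then show ?thesis by (simp add: pg_outside[OF False])
      qed
      then show ?case by (rule difference_quotient)
    qed
  qed
  then show ?thesis by (simp add: inner_axis)
qed

lemma integral_closure:
  fixes f :: "real^'n \<Rightarrow> real"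
  assumes "f \<in> borel_measurable lebesgue" "\<And>x. (\<And>T. T \<in> \<T> \<Longrightarrow> x \<notin> interior T) \<Longrightarrow> f x = 0"
  shows "(LINT x|lebesgue. f x) = (LINT x|lebesgue_on \<Omega>. f x)"
proof -
  have "f x = 0" if "x \<notin> \<Omega>" for x using assms(2) that interior_element by blast
  then have "(\<lambda>x. indicator \<Omega> x * f x) = f" by (auto simp: indicator_def fun_eq_iff)
  then show ?thesis using \<Omega>_sets by (simp add: integral_lebesgue_on)
qed

text \<open>The elementwise gradient of the product integrates to zero. Only the product has to
  vanish off \<open>\<Omega>\<close>, so one factor may be free at the boundary when the other is a
  test function.\<close>

lemma pw_integration_by_parts:
  assumes pw: "pw \<T> \<zeta> P D" "pw \<T> \<xi> Q E" and z: "\<And>x. x \<notin> \<Omega> \<Longrightarrow> \<zeta> x * \<xi> x = 0"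
  shows "(LINT x|lebesgue_on \<Omega>. \<zeta> x * pg \<T> E x $ i) = - (LINT x|lebesgue_on \<Omega>. \<xi> x * pg \<T> D x $ i)"
proof -
  let ?F = "\<lambda>T x. P T x *\<^sub>R E T x + Q T x *\<^sub>R D T x"
  note m = pw_mult[OF pw]
  have "0 = (LINT x|lebesgue. pg \<T> ?F x $ i)" using pw_integral_pg[OF m z] by simp
  also have "\<dots> = (LINT x|lebesgue_on \<Omega>. pg \<T> ?F x $ i)"
  proof (rule integral_closure)
    have "(\<lambda>x. pg \<T> ?F x \<bullet> axis i 1) \<in> borel_measurable lebesgue"
      by (intro measurable_completion) (use pg_measurable[OF m] in simp)
    then show "(\<lambda>x. pg \<T> ?F x $ i) \<in> borel_measurable lebesgue" by (simp add: inner_axis)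
    show "pg \<T> ?F x $ i = 0" if "\<And>T. T \<in> \<T> \<Longrightarrow> x \<notin> interior T" for x
      using that by (simp add: pg_def)
  qed
  also have "\<dots> = (LINT x|lebesgue_on \<Omega>. \<zeta> x * pg \<T> E x $ i + \<xi> x * pg \<T> D x $ i)"
  proof (rule integral_cong_AE_lebesgue_on[OF \<Omega>_sets])
    show "(\<lambda>x. pg \<T> ?F x $ i) \<in> borel_measurable (lebesgue_on \<Omega>)"
      using L2_measurable[OF L2_component[OF pg_L2[OF m]]] .
    show "AE x in lebesgue_on \<Omega>. pg \<T> ?F x $ i = \<zeta> x * pg \<T> E x $ i + \<xi> x * pg \<T> D x $ i"
      using AE_interior_\<Omega>
    proof eventually_elim
      case (elim x)
      then obtain T where T: "T \<in> \<T>" "x \<in> interior T" by blast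
      then have "\<zeta> x = P T x" "\<xi> x = Q T x"
        using pw_eq[OF pw(1) T(1)] pw_eq[OF pw(2) T(1)] subsetD[OF interior_subset T(2)] by auto
      then show ?case by (simp add: pg_interior[OF T])
    qed
  qed
  also have "\<dots> = (LINT x|lebesgue_on \<Omega>. \<zeta> x * pg \<T> E x $ i) + (LINT x|lebesgue_on \<Omega>. \<xi> x * pg \<T> D x $ i)"
    using L2_inner_integrable[OF pw_L2[OF pw(1)] L2_component[OF pg_L2[OF pw(2)]]]
      L2_inner_integrable[OF pw_L2[OF pw(2)] L2_component[OF pg_L2[OF pw(1)]]] by simp
  finally show ?thesis by simp
qed

lemma AE_pg_global: "AE x in lebesgue_on \<Omega>. pg \<T> (\<lambda>T. D) x = D x"
  using AE_interior_\<Omega> by eventually_elim (auto simp: pg_interior)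

lemma pw_has_weak_grad:
  assumes pw: "pw \<T> \<zeta> P D"
  shows "has_weak_grad \<Omega> \<zeta> (pg \<T> D)"
proof -
  have "(LINT x|lebesgue_on \<Omega>. \<zeta> x * grad \<phi> x $ i) = - (LINT x|lebesgue_on \<Omega>. \<phi> x * pg \<T> D x $ i)"
    if \<phi>: "test_function \<Omega> \<phi>" for \<phi> i
  proof -
    have s: "smooth \<phi>" using \<phi> by (simp add: test_function_def)
    note p = pw_C1[OF C1_smooth[OF s], of \<T>]
    have "(LINT x|lebesgue_on \<Omega>. \<zeta> x * grad \<phi> x $ i) = (LINT x|lebesgue_on \<Omega>. \<zeta> x * pg \<T> (\<lambda>T. grad \<phi>) x $ i)"
    proof (rule integral_cong_AE_lebesgue_on[OF \<Omega>_sets])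
      show "(\<lambda>x. \<zeta> x * grad \<phi> x $ i) \<in> borel_measurable (lebesgue_on \<Omega>)"
        by (rule borel_measurable_times[OF pw_measurable[OF pw]])
          (intro lebesgue_on_continuous continuous_intros smooth_grad_continuous[OF s])
      show "AE x in lebesgue_on \<Omega>. \<zeta> x * grad \<phi> x $ i = \<zeta> x * pg \<T> (\<lambda>T. grad \<phi>) x $ i"
        using AE_pg_global[of "grad \<phi>"] by eventually_elim simp
    qed
    also have "\<dots> = - (LINT x|lebesgue_on \<Omega>. \<phi> x * pg \<T> D x $ i)"
      by (rule pw_integration_by_parts[OF pw p]) (use test_function_support[OF \<phi>] in simp)
    finally show ?thesis .
  qed
  then show ?thesis
    unfolding has_weak_grad_iff[OF bounded_\<Omega> \<Omega>_sets] using pw_L2[OF pw] pg_L2[OF pw] by blast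
qed


lemma finite_vert: "T \<in> \<T> \<Longrightarrow> finite (vert T)"
  using full_simplex.finite_vert[OF element] .

lemma mesh_vertices_iff: "z \<in> mesh_vertices \<T> \<longleftrightarrow> (\<exists>T\<in>\<T>. z \<in> vert T)"
  by (simp add: mesh_vertices_def vert_def)

section \<open>The nodal basis\<close>

text \<open>Extended by zero to elements without the vertex z, so that one formula describes the
  nodal basis function on every element.\<close>

definition hat :: "(real^'n) set \<Rightarrow> real^'n \<Rightarrow> real^'n \<Rightarrow> real" where
  "hat T z x = (if z \<in> vert T then bary T z x else 0)"

definition hat_grad :: "(real^'n) set \<Rightarrow> real^'n \<Rightarrow> real^'n" where
  "hat_grad T z = (if z \<in> vert T then bgrad T z else 0)"

lemma hat_affine: "\<exists>a b. \<forall>x. hat T z x = a \<bullet> x + b"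
proof (cases "z \<in> vert T")
  case True
  then show ?thesis by (intro exI[of _ "bgrad T z"] exI[of _ "snd (bary_coeff T z)"]) (simp add: hat_def bary_def)
next
  case False
  then show ?thesis by (intro exI[of _ 0] exI[of _ 0]) (simp add: hat_def)
qed

lemma C1_hat: "C1 (hat T z) (\<lambda>x. hat_grad T z)"
  using C1_bary[of T z] C1_const[of 0] by (cases "z \<in> vert T") (simp_all add: hat_def[abs_def] hat_grad_def)

lemma hat_vert: "T \<in> \<T> \<Longrightarrow> y \<in> vert T \<Longrightarrow> hat T z y = (if y = z then 1 else 0)"
  using full_simplex.bary_vert[OF element] by (auto simp: hat_def)

lemma affine_on_hull:
  assumes "finite C" "x \<in> convex hull C" "\<And>y. y \<in> C \<Longrightarrow> a \<bullet> y + b = a' \<bullet> y + b'"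
  shows "a \<bullet> x + b = a' \<bullet> x + (b'::real)"
proof -
  have "convex {x. (a - a') \<bullet> x = b' - b}" by (rule convex_hyperplane)
  moreover have "C \<subseteq> {x. (a - a') \<bullet> x = b' - b}" using assms(3) by (auto simp: inner_diff_left algebra_simps)
  ultimately have "convex hull C \<subseteq> {x. (a - a') \<bullet> x = b' - b}" by (rule hull_minimal[rotated])
  then show ?thesis using assms(2) by (auto simp: inner_diff_left algebra_simps)
qed

text \<open>The common part of two elements is the hull of vertices that belong to both, and two
  affine functions that agree at these vertices agree on the hull.\<close>

lemma hat_consistent:
  assumes T: "T \<in> \<T>" "T' \<in> \<T>" and x: "x \<in> T" "x \<in> T'"
  shows "hat T z x = hat T' z x"
proof -
  let ?G = "T \<inter> T'"
  have v: "vert ?G \<subseteq> vert T" "vert ?G \<subseteq> vert T'" "convex hull (vert ?G) = ?G"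
    using full_simplex.face_vert[OF element[OF T(1)] inter_face(1)[OF T]]
      full_simplex.face_vert[OF element[OF T(2)] inter_face(2)[OF T]] by auto
  obtain a b where ab: "\<And>x. hat T z x = a \<bullet> x + b" using hat_affine by metis
  obtain a' b' where ab': "\<And>x. hat T' z x = a' \<bullet> x + b'" using hat_affine by metis
  have "a \<bullet> x + b = a' \<bullet> x + b'"
  proof (rule affine_on_hull)
    show "finite (vert ?G)" using v(1) finite_vert[OF T(1)] by (rule finite_subset)
    show "x \<in> convex hull (vert ?G)" using x v(3) by simp
    show "a \<bullet> y + b = a' \<bullet> y + b'" if "y \<in> vert ?G" for y
      using hat_vert[OF T(1), of y z] hat_vert[OF T(2), of y z] v that by (simp add: ab ab' subset_iff)
  qed
  then show ?thesis by (simp add: ab ab')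
qed

lemma affine_eq_on_element:
  assumes T: "T \<in> \<T>" and x: "x \<in> T" and eq: "\<And>y. y \<in> vert T \<Longrightarrow> a \<bullet> y + b = a' \<bullet> y + b'"
  shows "a \<bullet> x + b = a' \<bullet> x + b'"
  by (rule affine_on_hull[OF finite_vert[OF T] _ eq])
    (use x full_simplex.hull_vert[OF element[OF T]] in auto)

text \<open>The definition by \<open>THE\<close> needs existence and uniqueness: gluing works by
  \<open>hat_consistent\<close>, and on each element an affine function is determined by its vertex
  values.\<close>

lemma nodal_basis_properties:
  assumes z: "z \<in> mesh_vertices \<T>"
  shows nodal_basis_element: "\<And>T x. T \<in> \<T> \<Longrightarrow> x \<in> T \<Longrightarrow> nodal_basis \<T> z x = hat T z x"
    and nodal_basis_outside: "\<And>x. x \<notin> closure \<Omega> \<Longrightarrow> nodal_basis \<T> z x = 0"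
proof -
  \<comment> \<open>The element containing x is chosen arbitrarily; consistency makes the choice
    immaterial.\<close>
  define \<phi> where "\<phi> = (\<lambda>x. if x \<in> \<Union>\<T> then hat (SOME T. T \<in> \<T> \<and> x \<in> T) z x else 0)"
  define Q where "Q = (\<lambda>\<phi>. (\<forall>T\<in>\<T>. \<exists>a b. \<forall>x\<in>T. \<phi> x = a \<bullet> x + b) \<and>
     (\<forall>y\<in>mesh_vertices \<T>. \<phi> y = (if y = z then 1 else (0::real))) \<and> (\<forall>x. x \<notin> \<Union>\<T> \<longrightarrow> \<phi> x = 0))"
  have \<phi>T: "\<phi> x = hat T z x" if "T \<in> \<T>" "x \<in> T" for T x
  proof -
    have "(SOME T. T \<in> \<T> \<and> x \<in> T) \<in> \<T> \<and> x \<in> (SOME T. T \<in> \<T> \<and> x \<in> T)"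
      by (rule someI_ex) (use that in blast)
    then have "hat (SOME T. T \<in> \<T> \<and> x \<in> T) z x = hat T z x" using that by (intro hat_consistent) auto
    then show ?thesis using that by (auto simp: \<phi>_def)
  qed
  have Q\<phi>: "Q \<phi>"
    unfolding Q_def
  proof (intro conjI ballI allI impI)
    fix T assume T: "T \<in> \<T>"
    obtain a b where "\<And>x. hat T z x = a \<bullet> x + b" using hat_affine by metis
    then show "\<exists>a b. \<forall>x\<in>T. \<phi> x = a \<bullet> x + b" using \<phi>T[OF T] by auto
  next
    fix y assume "y \<in> mesh_vertices \<T>"
    then obtain T where T: "T \<in> \<T>" "y \<in> vert T" using mesh_vertices_iff by blast
    then have "y \<in> T" using full_simplex.vert_subset[OF element] by blast
    then show "\<phi> y = (if y = z then 1 else 0)" using \<phi>T[OF T(1)] hat_vert[OF T] by simp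
  qed (simp add: \<phi>_def)
  have QE: "\<exists>a b. \<forall>x\<in>T. \<psi> x = a \<bullet> x + b" if "Q \<psi>" "T \<in> \<T>" for \<psi> T
    using that unfolding Q_def by (elim conjE) (erule bspec)
  have Qv: "\<psi> y = (if y = z then 1 else 0)" if "Q \<psi>" "y \<in> mesh_vertices \<T>" for \<psi> y
    using that unfolding Q_def by (elim conjE) (erule bspec)
  have Qo: "\<psi> x = 0" if "Q \<psi>" "x \<notin> \<Union>\<T>" for \<psi> x
    using that unfolding Q_def by simp
  have unique: "\<psi> = \<phi>" if Q\<psi>: "Q \<psi>" for \<psi>
  proof
    fix x
    show "\<psi> x = \<phi> x"
    proof (cases "x \<in> \<Union>\<T>")
      case True
      then obtain T where T: "T \<in> \<T>" "x \<in> T" by blast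
      obtain a b where ab: "\<forall>x\<in>T. \<psi> x = a \<bullet> x + b" using QE[OF Q\<psi> T(1)] by (elim exE)
      obtain a' b' where ab': "\<forall>x\<in>T. \<phi> x = a' \<bullet> x + b'" using QE[OF Q\<phi> T(1)] by (elim exE)
      have "a \<bullet> x + b = a' \<bullet> x + b'"
      proof (rule affine_eq_on_element[OF T])
        fix y assume y: "y \<in> vert T"
        then have yT: "y \<in> T" using full_simplex.vert_subset[OF element[OF T(1)]] by (rule subsetD[rotated])
        have "y \<in> mesh_vertices \<T>" unfolding mesh_vertices_iff using y T(1) by (rule bexI)
        then have "\<psi> y = \<phi> y" using Qv[OF Q\<psi>, of y] Qv[OF Q\<phi>, of y] by simp
        then show "a \<bullet> y + b = a' \<bullet> y + b'"
          using bspec[OF ab yT] bspec[OF ab' yT] by simp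
      qed
      then show ?thesis using bspec[OF ab T(2)] bspec[OF ab' T(2)] by simp
    next
      case False
      then show ?thesis using Qo[OF Q\<psi>] Qo[OF Q\<phi>] by simp
    qed
  qed
  have "nodal_basis \<T> z = \<phi>"
    unfolding nodal_basis_def using the_equality[of Q, OF Q\<phi> unique] unfolding Q_def .
  then show "\<And>T x. T \<in> \<T> \<Longrightarrow> x \<in> T \<Longrightarrow> nodal_basis \<T> z x = hat T z x"
    "\<And>x. x \<notin> closure \<Omega> \<Longrightarrow> nodal_basis \<T> z x = 0"
    using \<phi>T Union_mesh by (auto simp: \<phi>_def)
qed

lemma pw_nodal: "z \<in> mesh_vertices \<T> \<Longrightarrow> pw \<T> (nodal_basis \<T> z) (\<lambda>T. hat T z) (\<lambda>T x. hat_grad T z)"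
  by (simp add: pw_def nodal_basis_element C1_hat)

lemma face_vert_mesh:
  assumes "T \<in> \<T>" "G face_of T"
  shows "vert G \<subseteq> mesh_vertices \<T>" "finite (vert G)"
  using full_simplex.vert_face_subset[OF element[OF assms(1)] assms(2)] assms(1) mesh_vertices_iff finite_vert[OF assms(1)] finite_subset
  by blast+

lemma facet_cases:
  assumes "F \<in> mesh_faces \<T>"
  obtains T a where "T \<in> \<T>" "a \<in> vert T" "F = opp T a"
  using assms full_simplex.facet_iff[OF element] unfolding mesh_faces_def by blast

section \<open>Boundary faces\<close>

text \<open>For x in T these are the vertices of the smallest face of T that contains x.\<close>

definition carrier :: "(real^'n) set \<Rightarrow> real^'n \<Rightarrow> (real^'n) set" where
  "carrier T x = {z \<in> vert T. 0 < bary T z x}"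

text \<open>A point y of both elements has its whole carrier in their common face. A point x carried
  by a subset of these vertices lies in that face too, and \<open>hat_consistent\<close> transports
  the coordinates.\<close>

lemma carrier_in_neighbour:
  assumes T: "T \<in> \<T>" "T' \<in> \<T>" and y: "y \<in> T" "y \<in> T'" and x: "x \<in> T" "carrier T x \<subseteq> carrier T y"
  shows "x \<in> T'" "carrier T y \<subseteq> vert T'"
    "\<And>z. z \<in> vert T' \<Longrightarrow> z \<notin> carrier T y \<Longrightarrow> bary T' z x = 0 \<and> bary T' z y = 0"
    "\<And>z. z \<in> carrier T y \<Longrightarrow> bary T' z x = bary T z x"
proof -
  interpret T: full_simplex T by (rule element[OF T(1)])
  interpret T': full_simplex T' by (rule element[OF T(2)])
  let ?G = "T \<inter> T'"
  note f = inter_face[OF T]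
  have vG: "vert ?G \<subseteq> vert T" "vert ?G \<subseteq> vert T'"
    using T.vert_face_subset[OF f(1)] T'.vert_face_subset[OF f(2)] by auto
  have yG: "y \<in> ?G" using y by blast
  then have c: "carrier T y \<subseteq> vert ?G" using T.face_mem_iff[OF f(1), of y] by (force simp: carrier_def)
  have "bary T z x = 0" if "z \<in> vert T - vert ?G" for z
    using that c x T.mem_iff[of x] by (force simp: carrier_def)
  then have xG: "x \<in> ?G" using T.face_mem_iff[OF f(1), of x] x(1) by blast
  then show "x \<in> T'" by blast
  show cT': "carrier T y \<subseteq> vert T'" using c vG by blast
  have hx: "hat T z x = hat T' z x" and hy: "hat T z y = hat T' z y" for z
    using hat_consistent[OF T] xG yG by auto
  show "bary T' z x = bary T z x" if "z \<in> carrier T y" for z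
    using hx[of z] that cT' by (auto simp: hat_def carrier_def)
  show "bary T' z x = 0 \<and> bary T' z y = 0" if z: "z \<in> vert T'" "z \<notin> carrier T y" for z
  proof -
    have "hat T z w = 0" if "w \<in> T" "carrier T w \<subseteq> carrier T y" for w
    proof (cases "z \<in> vert T")
      case True
      then have "0 \<le> bary T z w" "\<not> 0 < bary T z w" using T.mem_iff that z(2) by (auto simp: carrier_def)
      then show ?thesis by (simp add: hat_def)
    qed (simp add: hat_def)
    then show ?thesis using hx[of z] hy[of z] x y(1) z(1) by (auto simp: hat_def)
  qed
qed

text \<open>Near two points in the relative interior of the same face the mesh looks alike up to
  translation, so either both or none of them belong to the open set covered by the mesh.\<close>

lemma interior_transfer:
  assumes T: "T \<in> \<T>" and y: "y \<in> T" "y \<in> \<Omega>" and x: "x \<in> T" "carrier T x = carrier T y"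
  shows "x \<in> \<Omega>"
proof -
  define N where "N = {T' \<in> \<T>. y \<in> T'}"
  \<comment> \<open>A neighbourhood of x on which the coordinates of the carrier stay positive in
    every element around y.\<close>
  define U where "U = (\<Inter>T'\<in>N. \<Inter>z\<in>carrier T y. {w. 0 < bary T' z w})"
  have finN: "finite N" using finite_mesh by (simp add: N_def)
  have finc: "finite (carrier T y)" using finite_vert[OF T] by (simp add: carrier_def)
  have "open U" unfolding U_def
    by (intro open_INT ballI finN finc open_Collect_less continuous_on_const continuous_on_bary)
  have xU: "x \<in> U"
  proof -
    have "0 < bary T' z x" if "T' \<in> N" "z \<in> carrier T y" for T' z
      using carrier_in_neighbour(4)[OF T _ y(1) _ x(1), of T' z] that x by (auto simp: N_def carrier_def)
    then show ?thesis by (simp add: U_def)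
  qed
  \<comment> \<open>A neighbourhood of y that meets only elements containing y.\<close>
  define V where "V = \<Omega> - \<Union>(\<T> - N)"
  have "open V" unfolding V_def
    using open_\<Omega> finite_mesh closed_element by (intro open_Diff closed_Union) auto
  moreover have "y \<in> V" using y by (auto simp: V_def N_def)
  ultimately obtain \<rho> where \<rho>: "\<rho> > 0" "ball y \<rho> \<subseteq> V" using openE by blast
  have "U \<subseteq> closure \<Omega>"
  proof
    fix w assume w: "w \<in> U"
    define h where "h = w - x"
    define m where "m = norm h + 1"
    have m: "m > 0" using norm_ge_zero[of h] unfolding m_def by linarith
    \<comment> \<open>Shrinks the displacement from x so that it fits into the ball around y; the
      extra 1 in \<open>m\<close> avoids division by zero.\<close>
    define \<sigma> where "\<sigma> = \<rho> / (2 * m)"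
    have \<sigma>: "\<sigma> > 0" using \<rho> m by (simp add: \<sigma>_def)
    have "\<sigma> * norm h < \<rho>"
    proof -
      have "\<sigma> * norm h \<le> \<sigma> * m" using \<sigma> by (simp add: m_def)
      also have "\<dots> = \<rho> / 2" using m by (simp add: \<sigma>_def)
      finally show ?thesis using \<rho>(1) by linarith
    qed
    then have "y + \<sigma> *\<^sub>R h \<in> V" using \<rho>(2) \<sigma> by (auto simp: dist_norm subset_iff)
    then obtain T' where T': "T' \<in> \<T>" "y + \<sigma> *\<^sub>R h \<in> T'" "T' \<in> N"
      using Union_mesh closure_subset[of \<Omega>] unfolding V_def by blast
    have yT': "y \<in> T'" using T'(3) by (simp add: N_def)
    have "0 \<le> bary T' z (x + h)" if z: "z \<in> vert T'" for z
    proof (cases "z \<in> carrier T y")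
      case True
      then have "0 < bary T' z w" using w T'(3) by (simp add: U_def)
      then show ?thesis by (simp add: h_def)
    next
      case False
      \<comment> \<open>This coordinate vanishes at both x and y, so its sign at a displaced point
        depends only on the direction \<open>h\<close> and is unaffected by the scaling.\<close>
      have 0: "bary T' z x = 0" "bary T' z y = 0"
        using carrier_in_neighbour(3)[OF T T'(1) y(1) yT' x(1) _ z False] x(2) by auto
      have "0 \<le> bary T' z (y + \<sigma> *\<^sub>R h)" using T'(2) z full_simplex.mem_iff[OF element[OF T'(1)]] by blast
      then have "0 \<le> \<sigma> * (bgrad T' z \<bullet> h)" by (simp add: bary_add 0)
      then have "0 \<le> bgrad T' z \<bullet> h" using \<sigma> by (simp add: zero_le_mult_iff)
      then show ?thesis by (simp add: bary_add 0)
    qed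
    then have "w \<in> T'" using full_simplex.mem_iff[OF element[OF T'(1)], of w] by (simp add: h_def)
    then show "w \<in> closure \<Omega>" using element_subset T'(1) by blast
  qed
  then have "x \<in> interior (closure \<Omega>)" using \<open>open U\<close> xU by (intro interiorI)
  then show ?thesis by (simp add: interior_closure_\<Omega>)
qed

definition boundary_faces :: "(real^'n) set set" where
  "boundary_faces = {G. G \<noteq> {} \<and> (\<exists>T\<in>\<T>. G face_of T) \<and> G \<subseteq> frontier \<Omega>}"

lemma finite_boundary_faces: "finite boundary_faces"
proof -
  have "finite {G. G face_of T}" if "T \<in> \<T>" for T
    by (intro finite_polytope_faces simplex_imp_polytope[of "int CARD('n)"] full_simplex.simplex[OF element[OF that]])
  then have "finite (\<Union>T\<in>\<T>. {G. G face_of T})" using finite_mesh by blast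
  then show ?thesis by (rule rev_finite_subset) (auto simp: boundary_faces_def)
qed

text \<open>The smallest face containing x lies entirely in the boundary: a point of it inside
  \<open>\<Omega>\<close> would, by \<open>interior_transfer\<close>, force x into
  \<open>\<Omega>\<close>.\<close>

lemma frontier_covered:
  assumes x: "x \<in> frontier \<Omega>"
  shows "\<exists>G\<in>boundary_faces. x \<in> G"
proof -
  obtain T where T: "T \<in> \<T>" "x \<in> T" using x Union_mesh frontier_\<Omega> by blast
  interpret T: full_simplex T by (rule element[OF T(1)])
  define G where "G = convex hull (carrier T x)"
  have sub: "carrier T x \<subseteq> vert T" by (auto simp: carrier_def)
  have G: "G face_of T"
    using face_of_convex_hull_affine_independent[OF T.indep_vert] sub T.hull_vert unfolding G_def by metis
  have vG: "vert G = carrier T x"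
    unfolding G_def by (rule vert_convex_hull) (rule affine_independent_subset[OF T.indep_vert sub])
  have xG: "x \<in> G"
    using T.face_mem_iff[OF G, of x] T(2) T.mem_iff[of x] by (auto simp: vG carrier_def order.order_iff_strict)
  have "y \<notin> \<Omega>" if y: "y \<in> G" for y
  proof
    assume "y \<in> \<Omega>"
    have yT: "y \<in> T" using y G face_of_imp_subset by blast
    \<comment> \<open>Points of the segment close to y are still in \<open>\<Omega>\<close> and
      already have the carrier of x.\<close>
    define g where "g = (\<lambda>t. (1 - t) *\<^sub>R y + t *\<^sub>R x)"
    have "(g \<longlongrightarrow> g 0) (at_right 0)" unfolding g_def by (intro tendsto_eq_intros) auto
    then have "\<forall>\<^sub>F t in at_right 0. g t \<in> \<Omega>"
      using open_\<Omega> \<open>y \<in> \<Omega>\<close> by (intro topological_tendstoD[of g "g 0"]) (auto simp: g_def)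
    then obtain b where b: "b > 0" "\<And>t. 0 < t \<Longrightarrow> t < b \<Longrightarrow> g t \<in> \<Omega>"
      unfolding eventually_at_right_field by blast
    define t where "t = min (b / 2) (1 / 2)"
    have t: "0 < t" "t < b" "t < 1" using b by (auto simp: t_def)
    have bg: "bary T z (g t) = (1 - t) * bary T z y + t * bary T z x" for z
      unfolding g_def by (rule bary_affine) simp
    have nn: "0 \<le> bary T z y" "0 \<le> bary T z x" if "z \<in> vert T" for z using that yT T(2) T.mem_iff by auto
    have gT: "g t \<in> T" unfolding T.mem_iff bg using nn t by auto
    have "carrier T x = carrier T (g t)"
    proof (intro equalityI subsetI)
      fix z assume "z \<in> carrier T x"
      then have "z \<in> vert T" "0 < bary T z x" by (auto simp: carrier_def)
      then have "0 < bary T z (g t)" unfolding bg using nn t by (intro add_nonneg_pos) auto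
      then show "z \<in> carrier T (g t)" using \<open>z \<in> vert T\<close> by (simp add: carrier_def)
    next
      fix z assume "z \<in> carrier T (g t)"
      then have z: "z \<in> vert T" "0 < bary T z (g t)" by (auto simp: carrier_def)
      show "z \<in> carrier T x"
      proof (rule ccontr)
        assume nz: "z \<notin> carrier T x"
        then have "bary T z y = 0" using y T.face_mem_iff[OF G, of y] z(1) vG by blast
        moreover have "bary T z x = 0" using nz nn[OF z(1)] z(1) by (simp add: carrier_def)
        ultimately show False using z(2) by (simp add: bg)
      qed
    qed
    then have "x \<in> \<Omega>" using interior_transfer[OF T(1) gT b(2)[OF t(1,2)] T(2)] by blast
    then show False using x frontier_\<Omega> by blast
  qed
  moreover have "G \<subseteq> closure \<Omega>" using G face_of_imp_subset element_subset[OF T(1)] by blast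
  ultimately have "G \<in> boundary_faces" using G xG T(1) unfolding boundary_faces_def frontier_\<Omega> by blast
  then show ?thesis using xG by blast
qed

text \<open>Two elements on the two sides of a common facet cover a neighbourhood of its centroid, so a
  boundary facet belongs to one element only.\<close>

lemma boundary_facet_unique:
  assumes T: "T \<in> \<T>" "a \<in> vert T" "opp T a \<subseteq> frontier \<Omega>" and T': "T' \<in> \<T>" "opp T a \<subseteq> T'"
  shows "T' = T"
proof (rule ccontr)
  assume ne: "T' \<noteq> T"
  interpret T: full_simplex T by (rule element[OF T(1)])
  interpret T': full_simplex T' by (rule element[OF T'(1)])
  let ?F = "opp T a"
  let ?G = "T \<inter> T'"
  note f = inter_face[OF T(1) T'(1)]
  have FG: "?F \<subseteq> ?G" using T'(2) face_of_imp_subset[OF T.opp_face[OF T(2)]] by blast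
  have vF: "vert T - {a} \<subseteq> ?F" unfolding opp_def by (rule hull_subset)
  have "vert T - {a} \<subseteq> vert ?G"
  proof
    fix z assume z: "z \<in> vert T - {a}"
    then have "z \<in> ?G" using vF FG by blast
    then show "z \<in> vert ?G" using z extreme_point_of_face[OF f(1), of z] by (simp add: vert_def)
  qed
  moreover have "a \<notin> vert ?G"
  proof
    assume "a \<in> vert ?G"
    then have "vert ?G = vert T" using \<open>vert T - {a} \<subseteq> vert ?G\<close> T.vert_face_subset[OF f(1)] T(2) by blast
    then have "?G = T" using T.hull_vert_face[OF f(1)] T.hull_vert by simp
    then have "T \<subseteq> T'" by blast
    then show False using disjoint_interiors[OF T(1) T'(1)] ne T.interior_nonempty interior_subset by blast
  qed
  ultimately have vG: "vert ?G = vert T - {a}" using T.vert_face_subset[OF f(1)] by blast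
  then have GF: "?G = ?F" using T.hull_vert_face[OF f(1)] by (simp add: opp_def)
  have "vert ?G \<subseteq> vert T'" by (rule T'.vert_face_subset[OF f(2)])
  then have sub: "vert T - {a} \<subseteq> vert T'" using vG by simp
  \<comment> \<open>Both simplices have equally many vertices, so T' has exactly one vertex off the
    common facet.\<close>
  have "card (vert T' - (vert T - {a})) = 1"
    using sub T(2) T.card_vert T'.card_vert T.finite_vert by (subst card_Diff_subset) auto
  then obtain a' where a': "vert T' - (vert T - {a}) = {a'}" using card_1_singletonE by blast
  then have a'T: "a' \<in> vert T'" and va': "vert T' - {a'} = vert T - {a}" using sub by auto
  have FF: "opp T' a' = ?F" unfolding opp_def va' by simp
  obtain c where c: "c \<in> ?F" "\<And>z. z \<in> vert T - {a} \<Longrightarrow> 0 < bary T z c" using T.opp_centroid[OF T(2)] by blast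
  have cT: "c \<in> T" "c \<in> T'" using c(1) FG by auto
  have c': "0 < bary T' z c" if "z \<in> vert T - {a}" for z
    using hat_consistent[OF T(1) T'(1) cT, of z] c(2)[OF that] that sub by (auto simp: hat_def split: if_splits)
  have c0: "bary T a c = 0" "bary T' a' c = 0"
    using c(1) FF T.opp_mem_iff[OF T(2)] T'.opp_mem_iff[OF a'T] by auto
  define g where "g = bgrad T a"
  have g0: "g \<noteq> 0" using T.bgrad_nonzero[OF T(2)] by (simp add: g_def)
  have "g \<bullet> (x - y) = 0" if "x \<in> opp T' a'" "y \<in> opp T' a'" for x y
    using that bary_diff[of T a x y] T.opp_mem_iff[OF T(2)] by (simp add: FF g_def)
  \<comment> \<open>Both coordinates vanish on the common hyperplane and are therefore proportional;
    the sign of \<alpha> tells on which side T' lies.\<close>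
  then obtain \<alpha> where \<alpha>: "\<alpha> \<noteq> 0" "bgrad T' a' = \<alpha> *\<^sub>R g" using T'.normal_parallel[OF a'T g0] by blast
  have bb: "bary T' a' w = \<alpha> * bary T a w" for w
    using bary_diff[of T' a' w c] bary_diff[of T a w c] by (simp add: c0 \<alpha>(2) g_def)
  define U where "U = (\<Inter>z\<in>vert T - {a}. {w. 0 < bary T z w} \<inter> {w. 0 < bary T' z w})"
  have "open U" unfolding U_def using T.finite_vert
    by (intro open_INT ballI open_Int open_Collect_less continuous_on_const continuous_on_bary) auto
  have cU: "c \<in> U" using c(2) c' by (auto simp: U_def)
  have inT: "w \<in> T" if "w \<in> U" "0 \<le> bary T a w" for w
  proof -
    have "0 \<le> bary T z w" if "z \<in> vert T" for z
      using that \<open>w \<in> U\<close> \<open>0 \<le> bary T a w\<close> by (cases "z = a") (auto simp: U_def intro: less_imp_le)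
    then show ?thesis unfolding T.mem_iff by blast
  qed
  have inT': "w \<in> T'" if "w \<in> U" "0 \<le> bary T' a' w" for w
  proof -
    have "0 \<le> bary T' z w" if "z \<in> vert T'" for z
      using that \<open>w \<in> U\<close> \<open>0 \<le> bary T' a' w\<close> va' by (cases "z = a'") (auto simp: U_def intro: less_imp_le)
    then show ?thesis unfolding T'.mem_iff by blast
  qed
  show False
  proof (cases "\<alpha> > 0")
    case True
    \<comment> \<open>Same side: a point slightly above the centroid lies in both elements, although
      they meet only in the facet.\<close>
    obtain t where t: "t > 0" "ball c t \<subseteq> U" using \<open>open U\<close> cU openE by blast
    define w where "w = c + (t / (2 * norm g)) *\<^sub>R g"
    have "w \<in> U" using t g0 by (auto simp: w_def dist_norm subset_iff)
    have "bary T a w = (t / (2 * norm g)) * (g \<bullet> g)" unfolding w_def bary_add by (simp add: c0 g_def)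
    then have pos: "0 < bary T a w" using t(1) g0 by simp
    then have "w \<in> T" "w \<in> T'" using inT[OF \<open>w \<in> U\<close>] inT'[OF \<open>w \<in> U\<close>] True by (auto simp: bb)
    then have "w \<in> ?F" using GF by blast
    then show False using pos T.opp_mem_iff[OF T(2)] by simp
  next
    case False
    then have neg: "\<alpha> < 0" using \<alpha>(1) by simp
    \<comment> \<open>Opposite sides: the two elements cover a neighbourhood of the centroid, which
      would be an interior point.\<close>
    have "U \<subseteq> closure \<Omega>"
    proof
      fix w assume w: "w \<in> U"
      show "w \<in> closure \<Omega>"
      proof (cases "0 \<le> bary T a w")
        case True
        then show ?thesis using inT[OF w] element_subset[OF T(1)] by blast
      next
        case False
        then have "0 \<le> bary T' a' w" using neg by (simp add: bb mult_nonpos_nonpos)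
        then show ?thesis using inT'[OF w] element_subset[OF T'(1)] by blast
      qed
    qed
    then have "c \<in> interior (closure \<Omega>)" using \<open>open U\<close> cU by (intro interiorI)
    then show False using c(1) T(3) frontier_\<Omega> interior_closure_\<Omega> by blast
  qed
qed

end

section \<open>Face integrals and one-sided traces\<close>

lemma face_integral_cong:
  assumes "\<And>x. x \<in> F \<Longrightarrow> h x = h' x"
  shows "face_integral F h = face_integral F h'"
  unfolding face_integral_def set_lebesgue_integral_def
  by (rule Bochner_Integration.integral_cong[OF refl]) (auto simp: indicator_def assms)

lemma face_integral_zero: "(\<And>x. x \<in> F \<Longrightarrow> h x = 0) \<Longrightarrow> face_integral F h = 0"
  using face_integral_cong[of F h "\<lambda>x. 0"] by (simp add: face_integral_def)

lemma (in full_simplex) face_integral_sum: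
  assumes a: "a \<in> vert T" and I: "finite I" and h: "\<And>i. i \<in> I \<Longrightarrow> continuous_on UNIV (h i)"
  shows "face_integral (opp T a) (\<lambda>x. \<Sum>i\<in>I. c i * h i x) = (\<Sum>i\<in>I. c i * face_integral (opp T a) (h i))"
proof -
  have i: "integrable lborel (\<lambda>x. indicator (prism a) x * h i (foot T a x))" if "i \<in> I" for i
    by (rule face_integral_lborel(1)[OF a h[OF that]])
  have "face_integral (opp T a) (\<lambda>x. \<Sum>i\<in>I. c i * h i x)
      = (LINT x|lborel. indicator (prism a) x * (\<Sum>i\<in>I. c i * h i (foot T a x)))"
    by (intro face_integral_lborel(2)[OF a] continuous_on_sum continuous_on_mult continuous_on_const h)
  also have "\<dots> = (LINT x|lborel. (\<Sum>i\<in>I. c i * (indicator (prism a) x * h i (foot T a x))))"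
    by (intro Bochner_Integration.integral_cong refl) (simp add: sum_distrib_left mult.left_commute)
  also have "\<dots> = (\<Sum>i\<in>I. LINT x|lborel. c i * (indicator (prism a) x * h i (foot T a x)))"
    using i by (intro Bochner_Integration.integral_sum integrable_mult_right)
  also have "\<dots> = (\<Sum>i\<in>I. c i * face_integral (opp T a) (h i))"
    by (intro sum.cong refl) (simp add: face_integral_lborel(2)[OF a h])
  finally show ?thesis .
qed

lemma L2_inner_self: "L2_inner S h h = (LINT x|lebesgue_on S. (norm (h x))\<^sup>2)"
  by (simp add: L2_inner_def power2_norm_eq_inner)

lemma C1_unique: "C1 P D \<Longrightarrow> C1 P E \<Longrightarrow> D x = E x"
  using grad_eqI[OF C1_has_derivative[of P D x]] grad_eqI[OF C1_has_derivative[of P E x]] by simp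

lemma (in full_simplex) islimpt_interior: "x \<in> T \<Longrightarrow> x islimpt interior T"
  using closure_interior interior_limit_point[of x "interior T"] by (auto simp: closure_def)

text \<open>The limit in \<open>elem_trace\<close> is a proper one: each point of T is a limit point
  of the interior, where v coincides with continuous functions.\<close>

lemma (in full_simplex) elem_trace_eq:
  assumes x: "x \<in> T" and v: "\<And>y i. y \<in> interior T \<Longrightarrow> v y $ i = P i y" and P: "\<And>i. continuous_on UNIV (P i)"
  shows "elem_trace T v x = (\<chi> i. P i x)"
  unfolding elem_trace_def
proof (rule tendsto_Lim)
  show "\<not> trivial_limit (at x within interior T)"
    using islimpt_interior[OF x] by (simp add: trivial_limit_within)
  show "(v \<longlongrightarrow> (\<chi> i. P i x)) (at x within interior T)"
  proof (rule vec_tendstoI)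
    fix i
    have "(P i \<longlongrightarrow> P i x) (at x within interior T)"
      using P[of i] by (meson UNIV_I continuous_on_def subset_UNIV tendsto_within_subset)
    then have "((\<lambda>y. v y $ i) \<longlongrightarrow> P i x) (at x within interior T)"
      by (rule Lim_transform_eventually) (use v in \<open>auto simp: eventually_at_filter\<close>)
    then show "((\<lambda>y. v y $ i) \<longlongrightarrow> (\<chi> i. P i x) $ i) (at x within interior T)" by simp
  qed
qed

context mesh_domain
begin

section \<open>Traces and the velocity space\<close>

definition bubble_poly :: "(real^'n) set \<Rightarrow> (real^'n) set \<Rightarrow> real^'n \<Rightarrow> real" where
  "bubble_poly F T x = (\<Prod>z\<in>vert F. hat T z x)"

definition bubble_grad :: "(real^'n) set \<Rightarrow> (real^'n) set \<Rightarrow> real^'n \<Rightarrow> real^'n" where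
  "bubble_grad F T x = (\<Sum>z\<in>vert F. (\<Prod>y\<in>vert F - {z}. hat T y x) *\<^sub>R hat_grad T z)"

lemma mesh_face_vert:
  assumes "F \<in> mesh_faces \<T>"
  shows "finite (vert F)" "vert F \<subseteq> mesh_vertices \<T>" "card (vert F) = CARD('n)" "convex hull (vert F) = F"
proof -
  obtain T a where T: "T \<in> \<T>" "a \<in> vert T" "F = opp T a" using assms by (rule facet_cases)
  interpret T: full_simplex T by (rule element[OF T(1)])
  show "finite (vert F)" "vert F \<subseteq> mesh_vertices \<T>"
    using face_vert_mesh[OF T(1) T.opp_face[OF T(2)]] T(3) by auto
  show "card (vert F) = CARD('n)" using T(2) T.card_vert T.finite_vert by (simp add: T(3) T.vert_opp)
  show "convex hull (vert F) = F" using T.hull_vert_face[OF T.opp_face[OF T(2)]] T(3) by simp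
qed

lemma pw_bubble:
  assumes "F \<in> mesh_faces \<T>"
  shows "pw \<T> (face_bubble \<T> F) (bubble_poly F) (bubble_grad F)"
  using pw_prod[OF mesh_face_vert(1)[OF assms], of \<T> "nodal_basis \<T>" "\<lambda>z T. hat T z" "\<lambda>z T x. hat_grad T z"]
    pw_nodal mesh_face_vert(2)[OF assms]
  by (auto simp: face_bubble_def[abs_def] bubble_poly_def[abs_def] bubble_grad_def[abs_def] vert_def)

lemma finite_mesh_faces: "finite (mesh_faces \<T>)"
proof -
  have "mesh_faces \<T> \<subseteq> (\<Union>T\<in>\<T>. opp T ` vert T)"
    using facet_cases by blast
  moreover have "finite (\<Union>T\<in>\<T>. opp T ` vert T)" using finite_mesh finite_vert by blast
  ultimately show ?thesis by (rule finite_subset)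
qed

lemma finite_interior_faces: "finite (interior_faces \<Omega> \<T>)"
  using finite_mesh_faces by (simp add: interior_faces_def)

lemma hat_zero_opp: "T \<in> \<T> \<Longrightarrow> a \<in> vert T \<Longrightarrow> x \<in> opp T a \<Longrightarrow> hat T a x = 0"
  using full_simplex.opp_mem_iff[OF element] by (simp add: hat_def)

text \<open>An interior face differs from the boundary facet but has as many vertices, so one of its
  vertices is off the facet, and the hat function of that vertex vanishes on the facet.\<close>

lemma bubble_zero_boundary:
  assumes F: "F \<in> interior_faces \<Omega> \<T>" and T: "T \<in> \<T>" "a \<in> vert T" "opp T a \<subseteq> frontier \<Omega>" and x: "x \<in> opp T a"
  shows "bubble_poly F T x = 0"
proof -
  have Fm: "F \<in> mesh_faces \<T>" and nF: "\<not> F \<subseteq> frontier \<Omega>" using F by (auto simp: interior_faces_def)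
  interpret T: full_simplex T by (rule element[OF T(1)])
  have "\<exists>z\<in>vert F. z \<notin> vert T - {a}"
  proof (rule ccontr)
    assume "\<not> ?thesis"
    then have sub: "vert F \<subseteq> vert T - {a}" by blast
    have "card (vert T - {a}) = CARD('n)" using T(2) T.card_vert T.finite_vert by simp
    then have "vert F = vert T - {a}"
      using sub mesh_face_vert(3)[OF Fm] T.finite_vert by (intro card_subset_eq) auto
    then have "F = opp T a" using mesh_face_vert(4)[OF Fm] by (simp add: opp_def)
    then show False using nF T(3) by simp
  qed
  then obtain z where z: "z \<in> vert F" "z \<notin> vert T - {a}" by blast
  have "hat T z x = 0" using z(2) hat_zero_opp[OF T(1,2) x] by (cases "z = a") (auto simp: hat_def)
  then show ?thesis unfolding bubble_poly_def using z(1) mesh_face_vert(1)[OF Fm] by (intro prod_zero) auto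
qed

text \<open>Passes from the completed measure on \<open>\<Omega>\<close> to \<open>lborel\<close>
  over a closed element, the form in which \<open>simplex_divergence\<close> is stated.\<close>

lemma integral_element:
  fixes f :: "real^'n \<Rightarrow> real"
  assumes T: "T \<in> \<T>" and f: "f \<in> borel_measurable (lebesgue_on \<Omega>)"
    and z: "\<And>T' x. T' \<in> \<T> \<Longrightarrow> T' \<noteq> T \<Longrightarrow> x \<in> interior T' \<Longrightarrow> f x = 0"
    and h: "AE x in lebesgue_on (interior T). f x = h x" "continuous_on UNIV h"
  shows "(LINT x|lebesgue_on \<Omega>. f x) = (LINT x|lborel. indicator T x * h x)"
proof -
  interpret T: full_simplex T by (rule element[OF T])
  have iT: "interior T \<in> sets lebesgue" by (intro sets_completionI_sets) simp
  have ind: "(\<lambda>x. indicator S x * h x) \<in> borel_measurable borel" if "S \<in> sets borel" for S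
    by (rule borel_measurable_times[OF borel_measurable_indicator[OF that] borel_measurable_continuous_onI[OF h(2)]])
  have "(LINT x|lebesgue_on \<Omega>. f x) = (LINT x|lebesgue_on \<Omega>. indicator (interior T) x * h x)"
  proof (rule integral_cong_AE_lebesgue_on[OF \<Omega>_sets f])
    have "AE x in lebesgue_on \<Omega>. x \<in> interior T \<longrightarrow> f x = h x"
      using h(1) unfolding AE_lebesgue_on_iff[OF iT] AE_lebesgue_on_iff[OF \<Omega>_sets] by eventually_elim simp
    then show "AE x in lebesgue_on \<Omega>. f x = indicator (interior T) x * h x"
      using AE_interior_\<Omega>
    proof eventually_elim
      case (elim x)
      then obtain T' where T': "T' \<in> \<T>" "x \<in> interior T'" by blast
      show ?case
      proof (cases "T' = T")
        case False
        then have "x \<notin> interior T" using disjoint_interiors[OF T'(1) T False] T'(2) interior_subset by blast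
        then show ?thesis using z[OF T'(1) False T'(2)] by simp
      qed (use elim T'(2) in simp)
    qed
  qed
  also have "\<dots> = (LINT x|lebesgue. indicator \<Omega> x * (indicator (interior T) x * h x))"
    by (rule integral_lebesgue_on(1)[OF \<Omega>_sets])
  also have "\<dots> = (LINT x|lebesgue. indicator (interior T) x * h x)"
    using interior_element[OF T] by (intro Bochner_Integration.integral_cong) (auto simp: indicator_def)
  also have "\<dots> = (LINT x|lborel. indicator (interior T) x * h x)"
    by (rule integral_completion) (simp only: measurable_lborel2 ind[OF borel_open[OF open_interior]])
  also have "\<dots> = (LINT x|lborel. indicator T x * h x)"
  proof (rule integral_cong_AE)
    have "frontier T \<in> null_sets lborel"
      using negligible_convex_frontier[OF T.convex] by (simp add: negligible_iff_null_sets null_sets_completion_iff)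
    then have "AE x in lborel. x \<notin> frontier T" by (rule AE_not_in)
    then show "AE x in lborel. indicator (interior T) x * h x = indicator T x * h x"
    proof eventually_elim
      case (elim x)
      then show ?case using T.closed interior_subset[of T] by (auto simp: indicator_def frontier_def)
    qed
  qed (simp_all only: measurable_lborel2 ind[OF borel_open[OF open_interior]] ind[OF T.sets_T])
  finally show ?thesis .
qed

text \<open>Testing with \<open>(a \<bullet> x + b)\<close> times the bubble of the facet turns the boundary term of the
  integration by parts into the integral of \<open>(a \<bullet> x + b)\<^sup>2\<close> against the bubble over the facet.\<close>

lemma H10_trace:
  assumes u: "u \<in> H10 \<Omega>" and T: "T \<in> \<T>" "a \<in> vert T" "opp T a \<subseteq> frontier \<Omega>"
    and aff: "\<And>x. x \<in> interior T \<Longrightarrow> u x = \<alpha> \<bullet> x + \<beta>" and x: "x \<in> opp T a"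
  shows "\<alpha> \<bullet> x + \<beta> = 0"
proof -
  interpret T: full_simplex T by (rule element[OF T(1)])
  let ?F = "opp T a"
  define l where "l = (\<lambda>x. \<alpha> \<bullet> x + \<beta>)"
  have Cl: "C1 l (\<lambda>x. \<alpha>)" unfolding l_def by (rule C1_affine)
  have Fm: "?F \<in> mesh_faces \<T>" using T T.opp_facet unfolding mesh_faces_def by blast
  have vF: "vert ?F = vert T - {a}" by (rule T.vert_opp)
  define P where "P = (\<lambda>T x. l x * bubble_poly ?F T x)"
  define D where "D = (\<lambda>T x. l x *\<^sub>R bubble_grad ?F T x + bubble_poly ?F T x *\<^sub>R \<alpha>)"
  define \<Phi> where "\<Phi> = (\<lambda>x. l x * face_bubble \<T> ?F x)"
  have pw: "pw \<T> \<Phi> P D" unfolding \<Phi>_def P_def D_def by (rule pw_mult[OF pw_C1[OF Cl] pw_bubble[OF Fm]])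
  \<comment> \<open>No other element contains the boundary facet, so each of them misses one of its
    vertices and the bubble vanishes there.\<close>
  have other: "P T' y = 0" "D T' y = 0" if T': "T' \<in> \<T>" "T' \<noteq> T" for T' y
  proof -
    have "\<not> vert ?F \<subseteq> vert T'"
    proof
      assume "vert ?F \<subseteq> vert T'"
      then have "?F \<subseteq> T'"
        using hull_mono[of "vert ?F" "vert T'" convex] mesh_face_vert(4)[OF Fm] full_simplex.hull_vert[OF element[OF T'(1)]] by simp
      then show False using boundary_facet_unique[OF T T'(1)] T'(2) by blast
    qed
    then obtain z where z: "z \<in> vert ?F" "z \<notin> vert T'" by blast
    have P0: "P T' = (\<lambda>y. 0)"
    proof
      fix y
      have "bubble_poly ?F T' y = 0"
        unfolding bubble_poly_def using z mesh_face_vert(1)[OF Fm] by (intro prod_zero) (auto simp: hat_def)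
      then show "P T' y = 0" by (simp add: P_def)
    qed
    then show "P T' y = 0" by simp
    have "C1 (\<lambda>y. 0) (D T')" using pw T'(1) P0 by (auto simp: pw_def)
    from C1_unique[OF this C1_const, of y] show "D T' y = 0" .
  qed
  define w where "w = weak_grad \<Omega> u"
  have uH1: "u \<in> H1 \<Omega>" using u by (simp add: H10_def)
  have w: "has_weak_grad \<Omega> u w" unfolding w_def by (rule has_weak_grad_weak_grad[OF uH1])
  have uL2: "u \<in> L2 \<Omega>" and wL2: "w \<in> L2 \<Omega>" using w by (auto simp: has_weak_grad_def)
  obtain \<phi> where \<phi>: "\<And>k::nat. test_function \<Omega> (\<phi> k)"
    "(\<lambda>k. LINT x|lebesgue_on \<Omega>. (norm (\<phi> k x - u x))\<^sup>2) \<longlonglongrightarrow> 0"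
    "(\<lambda>k. LINT x|lebesgue_on \<Omega>. (norm (grad (\<phi> k) x - w x))\<^sup>2) \<longlonglongrightarrow> 0"
    using u unfolding H10_def w_def by blast
  have s: "smooth (\<phi> k)" for k using \<phi>(1) by (simp add: test_function_def)
  have \<phi>L2: "\<phi> k \<in> L2 \<Omega>" "grad (\<phi> k) \<in> L2 \<Omega>" for k
    by (intro continuous_L2 bounded_\<Omega> \<Omega>_sets smooth_continuous smooth_grad_continuous s)+
  \<comment> \<open>For the test functions that approximate u there is no boundary term, and this
    survives in the H1 limit although \<Phi> need not vanish on the boundary.\<close>
  have key: "(LINT x|lebesgue_on \<Omega>. u x * pg \<T> D x $ i + \<Phi> x * w x $ i) = 0" for i
  proof -
    have pgL: "(\<lambda>x. pg \<T> D x $ i) \<in> L2 \<Omega>" by (rule L2_component[OF pg_L2[OF pw]])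
    have \<Phi>L: "\<Phi> \<in> L2 \<Omega>" by (rule pw_L2[OF pw])
    have IBP: "(LINT x|lebesgue_on \<Omega>. \<phi> k x * pg \<T> D x $ i) = - (LINT x|lebesgue_on \<Omega>. \<Phi> x * grad (\<phi> k) x $ i)" for k
    proof -
      have "(LINT x|lebesgue_on \<Omega>. \<phi> k x * pg \<T> D x $ i) = - (LINT x|lebesgue_on \<Omega>. \<Phi> x * pg \<T> (\<lambda>T. grad (\<phi> k)) x $ i)"
        by (rule pw_integration_by_parts[OF pw_C1[OF C1_smooth[OF s]] pw]) (use test_function_support(1)[OF \<phi>(1)] in simp)
      also have "(LINT x|lebesgue_on \<Omega>. \<Phi> x * pg \<T> (\<lambda>T. grad (\<phi> k)) x $ i) = (LINT x|lebesgue_on \<Omega>. \<Phi> x * grad (\<phi> k) x $ i)"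
      proof (rule integral_cong_AE_lebesgue_on[OF \<Omega>_sets, symmetric])
        show "(\<lambda>x. \<Phi> x * grad (\<phi> k) x $ i) \<in> borel_measurable (lebesgue_on \<Omega>)"
          by (rule borel_measurable_times[OF L2_measurable[OF \<Phi>L] L2_measurable[OF L2_component[OF \<phi>L2(2)]]])
        show "AE x in lebesgue_on \<Omega>. \<Phi> x * grad (\<phi> k) x $ i = \<Phi> x * pg \<T> (\<lambda>T. grad (\<phi> k)) x $ i"
          using AE_pg_global[of "grad (\<phi> k)"] by eventually_elim simp
      qed
      finally show ?thesis .
    qed
    have 1: "(\<lambda>k. L2_inner \<Omega> (\<lambda>x. \<phi> k x - u x) (\<lambda>x. pg \<T> D x $ i)) \<longlonglongrightarrow> 0"
      by (rule L2_inner_tendsto_0[OF L2_diff[OF \<phi>L2(1) uL2] pgL])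
        (simp only: L2_inner_self \<phi>(2))
    have \<Phi>ax: "(\<lambda>x. \<Phi> x *\<^sub>R axis i 1 :: real^'n) \<in> L2 \<Omega>"
    proof -
      have "(\<lambda>x. \<chi> j. (if j = i then \<Phi> x else 0)) \<in> L2 \<Omega>"
      proof (rule L2_vec)
        show "(\<lambda>x. if j = i then \<Phi> x else 0) \<in> L2 \<Omega>" for j using \<Phi>L L2_zero by (cases "j = i") simp_all
      qed
      moreover have "(\<chi> j. (if j = i then \<Phi> x else 0)) = \<Phi> x *\<^sub>R axis i 1" for x
        by (auto simp: vec_eq_iff axis_def)
      ultimately show ?thesis by simp
    qed
    have 2: "(\<lambda>k. L2_inner \<Omega> (\<lambda>x. grad (\<phi> k) x - w x) (\<lambda>x. \<Phi> x *\<^sub>R axis i 1)) \<longlonglongrightarrow> 0"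
      by (rule L2_inner_tendsto_0[OF L2_diff[OF \<phi>L2(2) wL2] \<Phi>ax])
        (simp only: L2_inner_self \<phi>(3))
    have inner: "L2_inner \<Omega> h (\<lambda>x. \<Phi> x *\<^sub>R axis i 1) = (LINT x|lebesgue_on \<Omega>. \<Phi> x * h x $ i)" for h :: "real^'n \<Rightarrow> real^'n"
      by (simp add: L2_inner_def inner_axis)
    have i1: "integrable (lebesgue_on \<Omega>) (\<lambda>x. h x * pg \<T> D x $ i)" if "h \<in> L2 \<Omega>" for h
      using L2_inner_integrable[OF that pgL] by simp
    have i2: "integrable (lebesgue_on \<Omega>) (\<lambda>x. \<Phi> x * h x $ i)" if "h \<in> L2 \<Omega>" for h :: "real^'n \<Rightarrow> real^'n"
      using L2_inner_integrable[OF \<Phi>L L2_component[OF that, of i]] by simp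
    have c: "L2_inner \<Omega> (\<lambda>x. \<phi> k x - u x) (\<lambda>x. pg \<T> D x $ i) + L2_inner \<Omega> (\<lambda>x. grad (\<phi> k) x - w x) (\<lambda>x. \<Phi> x *\<^sub>R axis i 1)
        = - (LINT x|lebesgue_on \<Omega>. u x * pg \<T> D x $ i + \<Phi> x * w x $ i)" for k
      unfolding L2_inner_diff_left[OF \<phi>L2(1) uL2 pgL] L2_inner_diff_left[OF \<phi>L2(2) wL2 \<Phi>ax] inner
      using IBP[of k] i1[OF uL2] i2[OF wL2] by (simp add: L2_inner_def)
    have "(\<lambda>k. - (LINT x|lebesgue_on \<Omega>. u x * pg \<T> D x $ i + \<Phi> x * w x $ i)) \<longlonglongrightarrow> 0 + 0"
      using tendsto_add[OF 1 2] unfolding c .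
    then show ?thesis by (simp add: LIMSEQ_const_iff)
  qed
  \<comment> \<open>On T, where u = l and the weak gradient is \<alpha>, the integrand of
    \<open>key\<close> is a partial derivative of Q, which is the square of l times the
    bubble.\<close>
  define Q where "Q = (\<lambda>x. l x * P T x)"
  define E where "E = (\<lambda>x. l x *\<^sub>R D T x + P T x *\<^sub>R \<alpha>)"
  have QE: "C1 Q E" unfolding Q_def E_def using pw T(1) by (intro C1_mult[OF Cl]) (auto simp: pw_def)
  have int0: "(LINT x|lborel. indicator T x * (E x \<bullet> axis i 1)) = 0" for i
  proof -
    have "(LINT x|lebesgue_on \<Omega>. u x * pg \<T> D x $ i + \<Phi> x * w x $ i) = (LINT x|lborel. indicator T x * (E x \<bullet> axis i 1))"
    proof (rule integral_element[OF T(1)])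
      show "(\<lambda>x. u x * pg \<T> D x $ i + \<Phi> x * w x $ i) \<in> borel_measurable (lebesgue_on \<Omega>)"
        by (intro borel_measurable_add borel_measurable_times L2_measurable uL2 L2_component wL2 pw_L2[OF pw] pg_L2[OF pw])
      show "u x * pg \<T> D x $ i + \<Phi> x * w x $ i = 0" if T': "T' \<in> \<T>" "T' \<noteq> T" "x \<in> interior T'" for T' x
        using pw_eq[OF pw T'(1) subsetD[OF interior_subset T'(3)]] other[OF T'(1,2)] by (simp add: pg_interior[OF T'(1,3)])
      have iT: "interior T \<in> sets lebesgue" by (intro sets_completionI_sets) simp
      have "AE x in lebesgue_on (interior T). w x = \<alpha>"
        by (rule weak_grad_local[OF open_\<Omega> bounded_\<Omega> w open_interior interior_element[OF T(1)] Cl])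
          (simp add: aff l_def)
      moreover have "AE x in lebesgue_on (interior T). x \<in> interior T" by (simp add: AE_lebesgue_on_iff[OF iT])
      ultimately show "AE x in lebesgue_on (interior T). u x * pg \<T> D x $ i + \<Phi> x * w x $ i = E x \<bullet> axis i 1"
      proof eventually_elim
        case (elim x)
        then show ?case using pw_eq[OF pw T(1) subsetD[OF interior_subset elim(2)]]
          by (simp add: pg_interior[OF T(1)] E_def inner_axis aff l_def)
      qed
      show "continuous_on UNIV (\<lambda>x. E x \<bullet> axis i 1)" by (intro continuous_intros C1_grad_continuous[OF QE])
    qed
    then show ?thesis using key by simp
  qed
  obtain \<kappa> where \<kappa>: "\<And>z. z \<in> vert T \<Longrightarrow> \<kappa> z > 0" "\<And>P D e. C1 P D \<Longrightarrow>
    (LINT x|lborel. indicator T x * (D x \<bullet> e)) = - (\<Sum>z\<in>vert T. (bgrad T z \<bullet> e) * (\<kappa> z * face_integral (opp T z) P))"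
    using T.simplex_divergence[OF dim] by blast
  \<comment> \<open>The bubble vanishes on every facet of T except \<open>opp T a\<close>, so a
    single boundary term is left.\<close>
  have Fz: "face_integral (opp T z) Q = 0" if z: "z \<in> vert T" "z \<noteq> a" for z
  proof (rule face_integral_zero)
    fix y assume y: "y \<in> opp T z"
    have "hat T z y = 0" by (rule hat_zero_opp[OF T(1) z(1) y])
    then have "bubble_poly ?F T y = 0"
      unfolding bubble_poly_def using z vF mesh_face_vert(1)[OF Fm] by (intro prod_zero) auto
    then show "Q y = 0" by (simp add: Q_def P_def)
  qed
  have "(bgrad T a \<bullet> axis i 1) * (\<kappa> a * face_integral ?F Q) = 0" for i
  proof -
    have "(\<Sum>z\<in>vert T. (bgrad T z \<bullet> axis i 1) * (\<kappa> z * face_integral (opp T z) Q)) = 0"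
      using \<kappa>(2)[OF QE, of "axis i 1"] int0[of i] by simp
    moreover have "(\<Sum>z\<in>vert T - {a}. (bgrad T z \<bullet> axis i 1) * (\<kappa> z * face_integral (opp T z) Q)) = 0"
      by (rule sum.neutral) (use Fz in auto)
    ultimately show ?thesis by (simp add: sum.remove[OF T.finite_vert T(2)])
  qed
  moreover obtain i where "bgrad T a $ i \<noteq> 0" using T.bgrad_nonzero[OF T(2)] by (auto simp: vec_eq_iff)
  ultimately have FQ: "face_integral ?F Q = 0" using \<kappa>(1)[OF T(2)] by (auto simp: inner_axis)
  have Qb: "Q y = (l y)\<^sup>2 * bubble_poly ?F T y" for y by (simp add: Q_def P_def power2_eq_square)
  have bnn: "0 \<le> bubble_poly ?F T y" if "y \<in> ?F" for y
    unfolding bubble_poly_def using that T.opp_mem_iff[OF T(2)] by (intro prod_nonneg) (auto simp: vF hat_def)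
  have l0: "l y = 0" if y: "y \<in> ?F" "\<And>z. z \<in> vert T - {a} \<Longrightarrow> 0 < bary T z y" for y
  proof (rule ccontr)
    assume "l y \<noteq> 0"
    moreover have "0 < bubble_poly ?F T y" unfolding bubble_poly_def using y(2) by (intro prod_pos) (auto simp: vF hat_def)
    ultimately have Qy: "0 < Q y" by (simp add: Qb)
    have "0 \<le> Q x" if "x \<in> ?F" for x using bnn[OF that] by (simp add: Qb)
    from T.face_integral_pos[OF T(2) C1_continuous[OF QE] this y(1) Qy] show False using FQ by simp
  qed
  obtain c where c: "c \<in> ?F" "\<And>z. z \<in> vert T - {a} \<Longrightarrow> 0 < bary T z c" using T.opp_centroid[OF T(2)] by blast
  have "l c = 0" by (rule l0[OF c])
  \<comment> \<open>On the relative boundary the bubble is zero and gives no information. The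
    midpoint of x and the centroid is in the relative interior, and affinity transfers the zero to
    x.\<close>
  moreover have "l ((1/2) *\<^sub>R x + (1/2) *\<^sub>R c) = 0"
  proof (rule l0)
    have b: "bary T z ((1/2) *\<^sub>R x + (1/2) *\<^sub>R c) = (1/2) * bary T z x + (1/2) * bary T z c" for z by (rule bary_affine) simp
    have xx: "bary T a x = 0" "\<And>z. z \<in> vert T - {a} \<Longrightarrow> 0 \<le> bary T z x" using x T.opp_mem_iff[OF T(2)] by auto
    have cc: "bary T a c = 0" using c(1) T.opp_mem_iff[OF T(2)] by auto
    show pos: "0 < bary T z ((1/2) *\<^sub>R x + (1/2) *\<^sub>R c)" if "z \<in> vert T - {a}" for z
      unfolding b using xx(2)[OF that] c(2)[OF that] by linarith
    show "(1/2) *\<^sub>R x + (1/2) *\<^sub>R c \<in> ?F"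
      unfolding T.opp_mem_iff[OF T(2)] using pos less_imp_le by (auto simp: b xx cc) 
  qed
  moreover have "l ((1/2) *\<^sub>R x + (1/2) *\<^sub>R c) = (1/2) * l x + (1/2) * l c"
    by (simp add: l_def inner_add_right field_simps)
  ultimately show ?thesis by (simp add: l_def)
qed

lemma V_h_weak_grad:
  assumes v: "v \<in> V_h \<Omega> \<T> n"
  shows "(\<lambda>x. v x $ i) \<in> H1 \<Omega>"
proof -
  obtain w a where w: "\<And>i. (\<lambda>x. w x $ i) \<in> H10 \<Omega>"
    and v_eq: "v = (\<lambda>x. w x + (\<Sum>F\<in>interior_faces \<Omega> \<T>. a F *\<^sub>R (face_bubble \<T> F x *\<^sub>R n F)))"
    using v unfolding V_h_def by blast
  have 1: "has_weak_grad \<Omega> (\<lambda>x. w x $ i) (weak_grad \<Omega> (\<lambda>x. w x $ i))"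
    using w[of i] by (intro has_weak_grad_weak_grad) (simp add: H10_def)
  have "has_weak_grad \<Omega> (\<lambda>x. \<Sum>F\<in>interior_faces \<Omega> \<T>. (a F * n F $ i) * face_bubble \<T> F x)
      (\<lambda>x. \<Sum>F\<in>interior_faces \<Omega> \<T>. (a F * n F $ i) *\<^sub>R pg \<T> (bubble_grad F) x)"
  proof (rule has_weak_grad_sum[OF bounded_\<Omega> \<Omega>_sets finite_interior_faces])
    fix F assume "F \<in> interior_faces \<Omega> \<T>"
    then have "F \<in> mesh_faces \<T>" by (simp add: interior_faces_def)
    then show "has_weak_grad \<Omega> (\<lambda>x. (a F * n F $ i) * face_bubble \<T> F x) (\<lambda>x. (a F * n F $ i) *\<^sub>R pg \<T> (bubble_grad F) x)"
      by (intro has_weak_grad_scale[OF bounded_\<Omega> \<Omega>_sets] pw_has_weak_grad[OF pw_bubble])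
  qed
  from has_weak_grad_add[OF bounded_\<Omega> \<Omega>_sets 1 this]
  have "has_weak_grad \<Omega> (\<lambda>x. v x $ i) (\<lambda>x. weak_grad \<Omega> (\<lambda>x. w x $ i) x + (\<Sum>F\<in>interior_faces \<Omega> \<T>. (a F * n F $ i) *\<^sub>R pg \<T> (bubble_grad F) x))"
    by (simp add: v_eq sum_component mult_ac)
  then show ?thesis unfolding H1_def by blast
qed

lemma V_h_Hdiv:
  assumes "v \<in> V_h \<Omega> \<T> n"
  shows "v \<in> Hdiv \<Omega>"
  using has_weak_div_of_weak_grads[OF bounded_\<Omega> \<Omega>_sets has_weak_grad_weak_grad[OF V_h_weak_grad[OF assms]]]
  unfolding Hdiv_def by blast

text \<open>On boundary facets the affine part vanishes by \<open>H10_trace\<close> and the interior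
  bubbles by \<open>bubble_zero_boundary\<close>.\<close>

lemma V_h_local:
  assumes v: "v \<in> V_h \<Omega> \<T> n" and T: "T \<in> \<T>"
  shows "\<exists>P D. (\<forall>i. C1 (P i) (D i)) \<and> (\<forall>x\<in>interior T. \<forall>i. v x $ i = P i x) \<and>
    (\<forall>a\<in>vert T. opp T a \<subseteq> frontier \<Omega> \<longrightarrow> (\<forall>x\<in>opp T a. \<forall>i. P i x = 0))"
proof -
  obtain w a where w: "w \<in> P1_vec \<T>" "\<And>i. (\<lambda>x. w x $ i) \<in> H10 \<Omega>"
    and v_eq: "v = (\<lambda>x. w x + (\<Sum>F\<in>interior_faces \<Omega> \<T>. a F *\<^sub>R (face_bubble \<T> F x *\<^sub>R n F)))"
    using v unfolding V_h_def by blast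
  obtain A b where Ab: "\<And>x. x \<in> interior T \<Longrightarrow> w x = A *v x + b" using w(1) T unfolding P1_vec_def by blast
  have wi: "w x $ i = A $ i \<bullet> x + b $ i" if "x \<in> interior T" for x i
    using Ab[OF that] by (simp add: matrix_vector_mul_component)
  define P where "P = (\<lambda>i x. (A $ i \<bullet> x + b $ i) + (\<Sum>F\<in>interior_faces \<Omega> \<T>. (a F * n F $ i) * bubble_poly F T x))"
  define D where "D = (\<lambda>i x. A $ i + (\<Sum>F\<in>interior_faces \<Omega> \<T>. (a F * n F $ i) *\<^sub>R bubble_grad F T x))"
  have bub: "pw \<T> (face_bubble \<T> F) (bubble_poly F) (bubble_grad F)" if "F \<in> interior_faces \<Omega> \<T>" for F
    using that by (intro pw_bubble) (simp add: interior_faces_def)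
  have "C1 (P i) (D i)" for i
    unfolding P_def D_def using bub T
    by (intro C1_add C1_affine C1_sum finite_interior_faces C1_cmult) (auto simp: pw_def)
  moreover have "v x $ i = P i x" if x: "x \<in> interior T" for x i
  proof -
    have "face_bubble \<T> F x = bubble_poly F T x" if "F \<in> interior_faces \<Omega> \<T>" for F
      by (rule pw_eq[OF bub[OF that] T subsetD[OF interior_subset x]])
    then show ?thesis by (simp add: v_eq P_def wi[OF x] sum_component mult_ac)
  qed
  moreover have "P i x = 0" if "z \<in> vert T" "opp T z \<subseteq> frontier \<Omega>" "x \<in> opp T z" for z x i
    using H10_trace[OF w(2) T that(1,2) wi that(3)] bubble_zero_boundary[OF _ T that] by (simp add: P_def)
  ultimately show ?thesis by blast
qed


section \<open>The divergence of the interpolant\<close>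

definition step_fun :: "((real^'n) set \<Rightarrow> real) \<Rightarrow> real^'n \<Rightarrow> real" where
  "step_fun c x = (\<Sum>T\<in>\<T>. indicator (interior T) x * c T)"

lemma step_fun_interior:
  assumes "T \<in> \<T>" "x \<in> interior T"
  shows "step_fun c x = c T"
proof -
  have "indicator (interior T') x * c T' = 0" if "T' \<in> \<T> - {T}" for T'
    using disjoint_interiors[of T T'] assms that interior_subset by (auto simp: indicator_def)
  then have "(\<Sum>T'\<in>\<T> - {T}. indicator (interior T') x * c T') = 0" by (rule sum.neutral[OF ballI])
  then show ?thesis unfolding step_fun_def using assms(2) by (simp add: sum.remove[OF finite_mesh assms(1)])
qed

lemma step_fun_P0: "step_fun c \<in> P0 \<T>"
  unfolding P0_def using step_fun_interior by blast

lemma step_fun_measurable: "step_fun c \<in> borel_measurable borel"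
  unfolding step_fun_def
  by (intro borel_measurable_sum borel_measurable_times borel_measurable_indicator borel_measurable_const) simp

lemma step_fun_bounded: "\<bar>step_fun c x\<bar> \<le> (\<Sum>T\<in>\<T>. \<bar>c T\<bar>)"
proof -
  have "\<bar>step_fun c x\<bar> \<le> (\<Sum>T\<in>\<T>. \<bar>indicator (interior T) x * c T\<bar>)" unfolding step_fun_def by (rule sum_abs)
  also have "\<dots> \<le> (\<Sum>T\<in>\<T>. \<bar>c T\<bar>)" by (intro sum_mono) (auto simp: indicator_def)
  finally show ?thesis .
qed

lemma step_fun_L2: "step_fun c \<in> L2 \<Omega>"
  by (rule bounded_L2[OF bounded_\<Omega> \<Omega>_sets measurable_restrict_space1[OF measurable_completion], of _ "\<Sum>T\<in>\<T>. \<bar>c T\<bar>"])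
    (use step_fun_measurable step_fun_bounded in auto)

lemma P0_step_fun:
  assumes "s \<in> P0 \<T>"
  shows "\<exists>c. AE x in lebesgue_on \<Omega>. step_fun c x = s x"
proof -
  have "\<forall>T\<in>\<T>. \<exists>c. \<forall>x\<in>interior T. s x = c" using assms by (simp add: P0_def)
  then obtain c where c: "\<forall>T\<in>\<T>. \<forall>x\<in>interior T. s x = c T" using bchoice[of \<T> "\<lambda>T c. \<forall>x\<in>interior T. s x = c"] by blast
  have "AE x in lebesgue_on \<Omega>. step_fun c x = s x"
    using AE_interior_\<Omega> by eventually_elim (use c step_fun_interior in auto)
  then show ?thesis by blast
qed

lemma P0_L2:
  assumes "s \<in> P0 \<T>"
  shows "s \<in> L2 \<Omega>"
  using P0_step_fun[OF assms] L2_cong_AE[OF \<Omega>_sets step_fun_L2] by blast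

lemma P0_bounded:
  assumes "s \<in> P0 \<T>"
  shows "\<exists>C. AE x in lebesgue_on \<Omega>. \<bar>s x\<bar> \<le> C"
proof -
  obtain c where c: "AE x in lebesgue_on \<Omega>. step_fun c x = s x" using P0_step_fun[OF assms] by blast
  have "AE x in lebesgue_on \<Omega>. \<bar>s x\<bar> \<le> (\<Sum>T\<in>\<T>. \<bar>c T\<bar>)"
    using c by eventually_elim (metis step_fun_bounded)
  then show ?thesis by blast
qed

lemma indicator_interior_step:
  "T \<in> \<T> \<Longrightarrow> step_fun (\<lambda>T'. if T' = T then 1 else 0) = (indicator (interior T) :: _ \<Rightarrow> real)"
  by (auto simp: step_fun_def if_distrib finite_mesh fun_eq_iff cong: if_cong)

lemma indicator_interior_L2: "T \<in> \<T> \<Longrightarrow> (indicator (interior T) :: _ \<Rightarrow> real) \<in> L2 \<Omega>"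
  using step_fun_L2[of "\<lambda>T'. if T' = T then 1 else 0"] by (simp add: indicator_interior_step)

lemma indicator_interior_P0: "T \<in> \<T> \<Longrightarrow> (indicator (interior T) :: _ \<Rightarrow> real) \<in> P0 \<T>"
  using step_fun_P0[of "\<lambda>T'. if T' = T then 1 else 0"] by (simp add: indicator_interior_step)

lemma integral_on_element:
  assumes T: "T \<in> \<T>" and f: "f \<in> L2 \<Omega>" and h: "AE x in lebesgue_on (interior T). f x = h x" "continuous_on UNIV h"
  shows "L2_inner \<Omega> f (indicator (interior T)) = (LINT x|lborel. indicator T x * h x)"
  unfolding L2_inner_def inner_real_def
proof (rule integral_element[OF T _ _ _ h(2)])
  show "(\<lambda>x. f x * indicator (interior T) x) \<in> borel_measurable (lebesgue_on \<Omega>)"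
    by (rule borel_measurable_times[OF L2_measurable[OF f] L2_measurable[OF indicator_interior_L2[OF T]]])
  show "f x * indicator (interior T) x = 0" if "T' \<in> \<T>" "T' \<noteq> T" "x \<in> interior T'" for T' x
    using disjoint_interiors[OF that(1) T that(2)] that(3) interior_subset[of T] by (auto simp: indicator_def)
  have iT: "interior T \<in> sets lebesgue" by (intro sets_completionI_sets) simp
  have "AE x in lebesgue_on (interior T). x \<in> interior T" by (simp add: AE_lebesgue_on_iff[OF iT])
  then show "AE x in lebesgue_on (interior T). f x * indicator (interior T) x = h x"
    using h(1) by eventually_elim simp
qed

lemma integral_split:
  fixes f :: "real^'n \<Rightarrow> real" and h :: "(real^'n) set \<Rightarrow> real^'n \<Rightarrow> real"
  assumes f: "f \<in> borel_measurable (lebesgue_on \<Omega>)"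
    and h: "\<And>T x. T \<in> \<T> \<Longrightarrow> x \<in> interior T \<Longrightarrow> f x = h T x" "\<And>T. T \<in> \<T> \<Longrightarrow> continuous_on UNIV (h T)"
  shows "(LINT x|lebesgue_on \<Omega>. f x) = (\<Sum>T\<in>\<T>. LINT x|lborel. indicator T x * h T x)"
proof -
  have hL: "h T \<in> L2 \<Omega>" if "T \<in> \<T>" for T by (rule continuous_L2[OF h(2)[OF that] bounded_\<Omega> \<Omega>_sets])
  have "(LINT x|lebesgue_on \<Omega>. f x) = (LINT x|lebesgue_on \<Omega>. (\<Sum>T\<in>\<T>. h T x * indicator (interior T) x))"
  proof (rule integral_cong_AE_lebesgue_on[OF \<Omega>_sets f])
    show "AE x in lebesgue_on \<Omega>. f x = (\<Sum>T\<in>\<T>. h T x * indicator (interior T) x)"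
      using AE_interior_\<Omega>
    proof eventually_elim
      case (elim x)
      then obtain T where T: "T \<in> \<T>" "x \<in> interior T" by blast
      have "(\<Sum>T\<in>\<T>. h T x * indicator (interior T) x) = step_fun (\<lambda>T. h T x) x"
        by (simp add: step_fun_def mult.commute)
      then show ?case using h(1)[OF T] step_fun_interior[OF T, of "\<lambda>T. h T x"] by simp
    qed
  qed
  also have "\<dots> = (\<Sum>T\<in>\<T>. LINT x|lebesgue_on \<Omega>. h T x * indicator (interior T) x)"
    using L2_inner_integrable[OF hL indicator_interior_L2] by (intro Bochner_Integration.integral_sum) simp
  also have "\<dots> = (\<Sum>T\<in>\<T>. LINT x|lborel. indicator T x * h T x)"
    using integral_on_element[OF _ hL _ h(2)] by (intro sum.cong refl) (simp add: L2_inner_def)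
  finally show ?thesis .
qed

text \<open>The step function of the element means is a projection; its existence ensures that the
  choice made by \<open>L2_proj\<close> is one as well.\<close>

lemma L2_projection_P0:
  assumes q: "q \<in> L2 \<Omega>"
  shows "is_L2_projection \<Omega> (P0 \<T>) q (L2_proj \<Omega> (P0 \<T>) q)"
proof -
  let ?I = "\<lambda>T. indicator (interior T) :: real^'n \<Rightarrow> real"
  define V where "V = (\<lambda>T. L2_inner \<Omega> (\<lambda>x. 1) (?I T))"
  \<comment> \<open>The mean of q over the element, the integral divided by the volume
    \<open>V T\<close>.\<close>
  define m where "m = (\<lambda>T. L2_inner \<Omega> q (?I T) / V T)"
  have one: "(\<lambda>x. 1::real) \<in> L2 \<Omega>" by (rule continuous_L2[OF continuous_on_const bounded_\<Omega> \<Omega>_sets])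
  have V: "V T \<noteq> 0" if "T \<in> \<T>" for T
    using integral_on_element[OF that one _ continuous_on_const[of UNIV 1]] full_simplex.integral_T_pos[OF element[OF that]]
    by (simp add: V_def)
  have "is_L2_projection \<Omega> (P0 \<T>) q (step_fun m)"
    unfolding is_L2_projection_def
  proof (intro conjI ballI step_fun_P0)
    fix s assume "s \<in> P0 \<T>"
    then obtain c where c: "AE x in lebesgue_on \<Omega>. step_fun c x = s x" using P0_step_fun by blast
    have dL: "(\<lambda>x. q x - step_fun m x) \<in> L2 \<Omega>" by (rule L2_diff[OF q step_fun_L2])
    have "L2_inner \<Omega> (\<lambda>x. q x - step_fun m x) s = L2_inner \<Omega> (\<lambda>x. q x - step_fun m x) (step_fun c)"
      using L2_inner_cong_AE[OF \<Omega>_sets step_fun_L2 dL c] by (simp add: L2_inner_commute)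
    also have "\<dots> = (LINT x|lebesgue_on \<Omega>. (\<Sum>T\<in>\<T>. c T * ((q x - m T) * ?I T x)))"
      unfolding L2_inner_def inner_real_def
    proof (rule integral_cong_AE_lebesgue_on[OF \<Omega>_sets])
      show "(\<lambda>x. (q x - step_fun m x) * step_fun c x) \<in> borel_measurable (lebesgue_on \<Omega>)"
        by (rule borel_measurable_times[OF L2_measurable[OF dL] L2_measurable[OF step_fun_L2]])
      show "AE x in lebesgue_on \<Omega>. (q x - step_fun m x) * step_fun c x = (\<Sum>T\<in>\<T>. c T * ((q x - m T) * ?I T x))"
        using AE_interior_\<Omega>
      proof eventually_elim
        case (elim x)
        then obtain T where T: "T \<in> \<T>" "x \<in> interior T" by blast
        have "(\<Sum>T\<in>\<T>. c T * ((q x - m T) * ?I T x)) = step_fun (\<lambda>T. c T * (q x - m T)) x"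
          by (simp add: step_fun_def mult_ac)
        then show ?case by (simp add: step_fun_interior[OF T])
      qed
    qed
    also have "\<dots> = (\<Sum>T\<in>\<T>. c T * L2_inner \<Omega> (\<lambda>x. q x - m T) (?I T))"
    proof -
      have mL: "(\<lambda>x. m T) \<in> L2 \<Omega>" for T by (rule continuous_L2[OF continuous_on_const bounded_\<Omega> \<Omega>_sets])
      have "integrable (lebesgue_on \<Omega>) (\<lambda>x. (q x - m T) * ?I T x)" if "T \<in> \<T>" for T
        using L2_inner_integrable[OF L2_diff[OF q mL] indicator_interior_L2[OF that]] by simp
      then show ?thesis unfolding L2_inner_def inner_real_def
        by (subst Bochner_Integration.integral_sum) (auto intro: integrable_mult_right)
    qed
    also have "\<dots> = 0"
    proof (rule sum.neutral, rule ballI)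
      fix T assume T: "T \<in> \<T>"
      have mL: "(\<lambda>x. m T) \<in> L2 \<Omega>" by (rule continuous_L2[OF continuous_on_const bounded_\<Omega> \<Omega>_sets])
      have "L2_inner \<Omega> (\<lambda>x. m T) (?I T) = m T * V T"
        using L2_inner_scale_left[of \<Omega> "m T" "\<lambda>x. 1" "?I T"] by (simp add: V_def)
      moreover have "L2_inner \<Omega> q (?I T) = m T * V T" using V[OF T] by (simp add: m_def)
      ultimately show "c T * L2_inner \<Omega> (\<lambda>x. q x - m T) (?I T) = 0"
        by (simp add: L2_inner_diff_left[OF q mL indicator_interior_L2[OF T]])
    qed
    finally show "L2_inner \<Omega> (\<lambda>x. q x - step_fun m x) s = 0" .
  qed
  then show ?thesis unfolding L2_proj_def by (rule someI[of "is_L2_projection \<Omega> (P0 \<T>) q"])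
qed

text \<open>The discrete divergence vanishes, so the weak divergence is its own projection residual.
  Used with s = p for the pressure term, and with the indicator of an element for the mean of the
  divergence there.\<close>

lemma V_h0_div_orthogonal:
  assumes v: "v \<in> V_h0 \<Omega> \<T> n" and s: "s \<in> P0 \<T>"
  shows "L2_inner \<Omega> (weak_div \<Omega> v) s = 0"
proof -
  have vV: "v \<in> V_h \<Omega> \<T> n" and d0: "AE x in lebesgue_on \<Omega>. div_h \<Omega> \<T> v x = 0" using v by (auto simp: V_h0_def)
  have qL: "weak_div \<Omega> v \<in> L2 \<Omega>"
    using has_weak_div_weak_div[OF V_h_Hdiv[OF vV]] by (simp add: has_weak_div_def)
  have "L2_inner \<Omega> (\<lambda>x. weak_div \<Omega> v x - div_h \<Omega> \<T> v x) s = 0"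
    using L2_projection_P0[OF qL] s unfolding is_L2_projection_def div_h_def by blast
  moreover have "L2_inner \<Omega> (weak_div \<Omega> v) s = L2_inner \<Omega> (\<lambda>x. weak_div \<Omega> v x - div_h \<Omega> \<T> v x) s"
    by (rule L2_inner_cong_AE[OF \<Omega>_sets qL P0_L2[OF s]]) (use d0 in eventually_elim, simp)
  ultimately show ?thesis by simp
qed

text \<open>Replaces the one-sided traces in the moments by functions defined on the whole space, to
  which \<open>simplex_divergence\<close> applies.\<close>

lemma BDM1_flux:
  assumes X: "is_BDM1_interpolant \<Omega> \<T> n v X" and T: "T \<in> \<T>" "a \<in> vert T"
    and XT: "\<And>x. x \<in> interior T \<Longrightarrow> X x = A *v x + b"
    and P: "\<And>i. C1 (P i) (D i)" "\<And>x i. x \<in> interior T \<Longrightarrow> v x $ i = P i x"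
  shows "face_integral (opp T a) (\<lambda>x. (\<alpha> \<bullet> x + \<beta>) * ((A *v x + b - (\<chi> i. P i x)) \<bullet> n (opp T a))) = 0"
proof -
  interpret T: full_simplex T by (rule element[OF T(1)])
  have "face_integral (opp T a) (\<lambda>x. (\<alpha> \<bullet> x + \<beta>) * ((elem_trace T X x - elem_trace T v x) \<bullet> n (opp T a))) = 0"
    using X T(1) T.opp_facet[OF T(2)] unfolding is_BDM1_interpolant_def by blast
  moreover have "elem_trace T X x = A *v x + b" "elem_trace T v x = (\<chi> i. P i x)" if "x \<in> opp T a" for x
  proof -
    have xT: "x \<in> T" using that face_of_imp_subset[OF T.opp_face[OF T(2)]] by blast
    have "elem_trace T X x = (\<chi> i. A $ i \<bullet> x + b $ i)"
      by (rule T.elem_trace_eq[OF xT]) (auto simp: XT matrix_vector_mul_component intro!: continuous_intros)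
    then show "elem_trace T X x = A *v x + b" by (simp add: vec_eq_iff matrix_vector_mul_component)
    show "elem_trace T v x = (\<chi> i. P i x)"
      by (rule T.elem_trace_eq[OF xT P(2) C1_continuous[OF P(1)]])
  qed
  ultimately show ?thesis
    using face_integral_cong[of "opp T a" "\<lambda>x. (\<alpha> \<bullet> x + \<beta>) * ((elem_trace T X x - elem_trace T v x) \<bullet> n (opp T a))"
        "\<lambda>x. (\<alpha> \<bullet> x + \<beta>) * ((A *v x + b - (\<chi> i. P i x)) \<bullet> n (opp T a))"] by simp
qed

lemma bgrad_parallel_normal:
  assumes n: "unit_face_normals \<T> n" and T: "T \<in> \<T>" "a \<in> vert T"
  shows "\<exists>\<alpha>. \<alpha> \<noteq> 0 \<and> bgrad T a = \<alpha> *\<^sub>R n (opp T a)"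
proof -
  interpret T: full_simplex T by (rule element[OF T(1)])
  have "opp T a \<in> mesh_faces \<T>" using T T.opp_facet unfolding mesh_faces_def by blast
  then have "norm (n (opp T a)) = 1" "\<And>x y. x \<in> opp T a \<Longrightarrow> y \<in> opp T a \<Longrightarrow> n (opp T a) \<bullet> (x - y) = 0"
    using n by (auto simp: unit_face_normals_def)
  then show ?thesis by (intro T.normal_parallel[OF T(2)]) auto
qed

lemma BDM1_divergence_free:
  assumes n: "unit_face_normals \<T> n" and v: "v \<in> V_h0 \<Omega> \<T> n" and X: "is_BDM1_interpolant \<Omega> \<T> n v X"
  shows "AE x in lebesgue_on \<Omega>. weak_div \<Omega> X x = 0"
proof -
  have vV: "v \<in> V_h \<Omega> \<T> n" using v by (simp add: V_h0_def)
  have XH: "has_weak_div \<Omega> X (weak_div \<Omega> X)"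
    using X by (intro has_weak_div_weak_div) (simp add: is_BDM1_interpolant_def)
  have vH: "has_weak_div \<Omega> v (weak_div \<Omega> v)" by (rule has_weak_div_weak_div[OF V_h_Hdiv[OF vV]])
  have local: "AE x in lebesgue_on (interior T). weak_div \<Omega> X x = 0" if T: "T \<in> \<T>" for T
  proof -
    interpret T: full_simplex T by (rule element[OF T])
    obtain A b where XT: "\<And>x. x \<in> interior T \<Longrightarrow> X x = A *v x + b"
      using X T unfolding is_BDM1_interpolant_def P1_vec_def by blast
    obtain P D where P: "\<And>i. C1 (P i) (D i)" "\<And>x i. x \<in> interior T \<Longrightarrow> v x $ i = P i x"
      using V_h_local[OF vV T] by blast
    \<comment> \<open>The components of X - v on the element, continued to the whole space.\<close>
    define Y where "Y = (\<lambda>i x. (A $ i \<bullet> x + b $ i) + (- 1) * P i x)"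
    define E where "E = (\<lambda>i x. A $ i + (- 1) *\<^sub>R D i x)"
    have YE: "C1 (Y i) (E i)" for i unfolding Y_def E_def by (intro C1_add C1_affine C1_cmult P)
    have flux: "(\<Sum>i\<in>UNIV. bgrad T a $ i * face_integral (opp T a) (Y i)) = 0" if a: "a \<in> vert T" for a
    proof -
      obtain \<alpha> where \<alpha>: "bgrad T a = \<alpha> *\<^sub>R n (opp T a)" using bgrad_parallel_normal[OF n T a] by blast
      \<comment> \<open>The weight with slope 0 and value 1, so that the moment is the total flux of
        X - v through the facet.\<close>
      have "(\<lambda>x. ((0::real^'n) \<bullet> x + 1) * ((A *v x + b - (\<chi> i. P i x)) \<bullet> n (opp T a))) = (\<lambda>x. \<Sum>i\<in>UNIV. n (opp T a) $ i * Y i x)"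
        by (auto simp: inner_vec_def Y_def matrix_vector_mul_component mult.commute)
      then have "(\<Sum>i\<in>UNIV. n (opp T a) $ i * face_integral (opp T a) (Y i)) = 0"
        using BDM1_flux[OF X T a XT P, of 0 1]
          T.face_integral_sum[where I = UNIV and h = Y and c = "\<lambda>i. n (opp T a) $ i", OF a finite C1_continuous[OF YE]]
        by simp
      then have "\<alpha> * (\<Sum>i\<in>UNIV. n (opp T a) $ i * face_integral (opp T a) (Y i)) = 0" by simp
      then show ?thesis by (simp add: \<alpha> sum_distrib_left mult.assoc)
    qed
    obtain \<kappa> where \<kappa>: "\<And>P D e. C1 P D \<Longrightarrow>
      (LINT x|lborel. indicator T x * (D x \<bullet> e)) = - (\<Sum>z\<in>vert T. (bgrad T z \<bullet> e) * (\<kappa> z * face_integral (opp T z) P))"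
      using T.simplex_divergence[OF dim] by blast
    have "(\<Sum>i\<in>UNIV. LINT x|lborel. indicator T x * (E i x \<bullet> axis i 1))
        = (\<Sum>i\<in>UNIV. - (\<Sum>z\<in>vert T. (bgrad T z \<bullet> axis i 1) * (\<kappa> z * face_integral (opp T z) (Y i))))"
      by (intro sum.cong refl \<kappa> YE)
    also have "\<dots> = - (\<Sum>i\<in>UNIV. \<Sum>z\<in>vert T. \<kappa> z * (bgrad T z $ i * face_integral (opp T z) (Y i)))"
      by (simp add: sum_negf inner_axis mult.left_commute)
    also have "\<dots> = - (\<Sum>z\<in>vert T. \<kappa> z * (\<Sum>i\<in>UNIV. bgrad T z $ i * face_integral (opp T z) (Y i)))"
      by (subst sum.swap) (simp add: sum_distrib_left)
    also have "\<dots> = 0" using flux by simp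
    finally have s0: "(\<Sum>i\<in>UNIV. LINT x|lborel. indicator T x * (E i x \<bullet> axis i 1)) = 0" .
    \<comment> \<open>The divergence of X on T; it is constant, so a vanishing mean makes it
      zero.\<close>
    define tr where "tr = (\<Sum>i\<in>UNIV. A $ i $ i)"
    define dv where "dv = (\<lambda>x. \<Sum>i\<in>UNIV. D i x $ i)"
    have dvc: "continuous_on UNIV dv" unfolding dv_def by (intro continuous_intros C1_grad_continuous[OF P(1)])
    have i1: "integrable lborel (\<lambda>x. indicator T x * (E i x \<bullet> axis i 1))" for i
      by (intro integrable_continuous_compact[OF T.compact] continuous_intros C1_grad_continuous[OF YE])
    have iT: "integrable lborel (\<lambda>x. indicator T x * 1 :: real)" by (rule integrable_continuous_compact[OF T.compact continuous_on_const])
    have id: "integrable lborel (\<lambda>x. indicator T x * dv x)" by (rule integrable_continuous_compact[OF T.compact dvc])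
    have "0 = (LINT x|lborel. (\<Sum>i\<in>UNIV. indicator T x * (E i x \<bullet> axis i 1)))"
      by (subst Bochner_Integration.integral_sum[OF i1]) (rule s0[symmetric])
    also have "\<dots> = (LINT x|lborel. tr * (indicator T x * 1) - indicator T x * dv x)"
      by (intro Bochner_Integration.integral_cong refl)
        (simp add: E_def tr_def dv_def inner_axis sum_subtractf sum_distrib_left[symmetric] right_diff_distrib mult.commute)
    also have "\<dots> = tr * (LINT x|lborel. indicator T x) - (LINT x|lborel. indicator T x * dv x)"
      using iT id by simp
    also have "(LINT x|lborel. indicator T x * dv x) = L2_inner \<Omega> (weak_div \<Omega> v) (indicator (interior T))"
    proof (rule integral_on_element[OF T _ _ dvc, symmetric])
      show "weak_div \<Omega> v \<in> L2 \<Omega>" using vH by (simp add: has_weak_div_def)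
      show "AE x in lebesgue_on (interior T). weak_div \<Omega> v x = dv x"
        unfolding dv_def by (rule weak_div_local[OF open_\<Omega> bounded_\<Omega> vH open_interior interior_element[OF T] P])
    qed
    also have "\<dots> = 0" by (rule V_h0_div_orthogonal[OF v indicator_interior_P0[OF T]])
    finally have "tr = 0" using T.integral_T_pos by simp
    have "AE x in lebesgue_on (interior T). weak_div \<Omega> X x = (\<Sum>i\<in>UNIV. A $ i $ i)"
      by (rule weak_div_local[OF open_\<Omega> bounded_\<Omega> XH open_interior interior_element[OF T] C1_affine[of "A $ _" "b $ _"]])
        (simp add: XT matrix_vector_mul_component)
    then show ?thesis using \<open>tr = 0\<close> by (simp add: tr_def)
  qed
  have "AE x in lebesgue. \<forall>T\<in>\<T>. x \<in> interior T \<longrightarrow> weak_div \<Omega> X x = 0"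
  proof (rule AE_finite_allI[OF finite_mesh])
    fix T assume T: "T \<in> \<T>"
    have iT: "interior T \<in> sets lebesgue" by (intro sets_completionI_sets) simp
    show "AE x in lebesgue. x \<in> interior T \<longrightarrow> weak_div \<Omega> X x = 0"
      using local[OF T] by (simp only: AE_lebesgue_on_iff[OF iT])
  qed
  then have "AE x in lebesgue_on \<Omega>. \<forall>T\<in>\<T>. x \<in> interior T \<longrightarrow> weak_div \<Omega> X x = 0"
    unfolding AE_lebesgue_on_iff[OF \<Omega>_sets] by eventually_elim simp
  then show ?thesis using AE_interior_\<Omega> by eventually_elim blast
qed

text \<open>An affine function that vanishes on a facet is a multiple of the barycentric coordinate
  of the opposite vertex. This linear decay is what \<open>cutoff_flux_bound\<close>
  consumes.\<close>

lemma BDM1_normal_trace: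
  assumes n: "unit_face_normals \<T> n" and v: "v \<in> V_h \<Omega> \<T> n" and X: "is_BDM1_interpolant \<Omega> \<T> n v X"
    and T: "T \<in> \<T>" "a \<in> vert T" "opp T a \<subseteq> frontier \<Omega>" and XT: "\<And>x. x \<in> interior T \<Longrightarrow> X x = A *v x + b"
  shows "\<exists>\<gamma>. \<forall>x. (A *v x + b) \<bullet> bgrad T a = \<gamma> * bary T a x"
proof -
  interpret T: full_simplex T by (rule element[OF T(1)])
  let ?n = "n (opp T a)"
  obtain P D where P: "\<And>i. C1 (P i) (D i)" "\<And>x i. x \<in> interior T \<Longrightarrow> v x $ i = P i x"
    "\<And>x i. x \<in> opp T a \<Longrightarrow> P i x = 0"
    using V_h_local[OF v T(1)] T(2,3) by blast
  \<comment> \<open>Coefficients of the normal component on the element; being affine, it is itself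
    an admissible weight for the moments.\<close>
  define c where "c = (\<Sum>i\<in>UNIV. ?n $ i *\<^sub>R A $ i)"
  define d where "d = b \<bullet> ?n"
  have aff: "(A *v x + b) \<bullet> ?n = c \<bullet> x + d" for x
    unfolding c_def d_def inner_add_left inner_sum_left
    by (simp add: inner_vec_def[of "A *v x"] matrix_vector_mul_component mult.commute)
  define Q where "Q = (\<lambda>x. (c \<bullet> x + d) * (c \<bullet> x + d))"
  have Qc: "continuous_on UNIV Q" unfolding Q_def by (intro continuous_intros)
  have "face_integral (opp T a) Q = face_integral (opp T a) (\<lambda>x. (c \<bullet> x + d) * ((A *v x + b - (\<chi> i. P i x)) \<bullet> ?n))"
  proof (rule face_integral_cong)
    fix x assume "x \<in> opp T a"
    then have "(\<chi> i. P i x) = 0" using P(3) by (simp add: vec_eq_iff)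
    then show "Q x = (c \<bullet> x + d) * ((A *v x + b - (\<chi> i. P i x)) \<bullet> ?n)" by (simp add: Q_def aff)
  qed
  also have "\<dots> = 0" by (rule BDM1_flux[OF X T(1,2) XT P(1,2)])
  finally have FQ: "face_integral (opp T a) Q = 0" .
  have zero: "c \<bullet> x + d = 0" if x: "x \<in> opp T a" for x
  proof (rule ccontr)
    assume "c \<bullet> x + d \<noteq> 0"
    then have "Q x > 0" using not_sum_squares_lt_zero by (auto simp: Q_def zero_less_mult_iff)
    then have "face_integral (opp T a) Q > 0"
      using T.face_integral_pos[OF T(2) Qc _ x] by (simp add: Q_def)
    then show False using FQ by simp
  qed
  obtain \<alpha> where \<alpha>: "bgrad T a = \<alpha> *\<^sub>R ?n" using bgrad_parallel_normal[OF n T(1,2)] by blast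
  have "(A *v x + b) \<bullet> bgrad T a = (\<alpha> * (c \<bullet> a + d)) * bary T a x" for x
  proof -
    have "c \<bullet> x + d = (\<Sum>z\<in>vert T. bary T z x * (c \<bullet> z + d))" by (rule T.affine_expansion)
    also have "\<dots> = bary T a x * (c \<bullet> a + d) + (\<Sum>z\<in>vert T - {a}. bary T z x * (c \<bullet> z + d))"
      by (rule sum.remove[OF T.finite_vert T(2)])
    also have "(\<Sum>z\<in>vert T - {a}. bary T z x * (c \<bullet> z + d)) = 0"
      using zero hull_subset[of "vert T - {a}" convex] by (intro sum.neutral) (auto simp: opp_def)
    finally show ?thesis by (simp add: \<alpha> aff mult_ac)
  qed
  then show ?thesis by blast
qed

end

section \<open>Cutoff functions\<close>

text \<open>Quadratic spline with knots 1, 3/2 and 2, written in truncated squares: continuously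
  differentiable, 0 up to 1 and 1 from 2 on.\<close>

definition smoothstep :: "real \<Rightarrow> real" where
  "smoothstep t = 2 * ((max 0 (t - 1))\<^sup>2 - 2 * (max 0 (t - 3/2))\<^sup>2 + (max 0 (t - 2))\<^sup>2)"

definition smoothstep_deriv :: "real \<Rightarrow> real" where
  "smoothstep_deriv t = 4 * (max 0 (t - 1) - 2 * max 0 (t - 3/2) + max 0 (t - 2))"

text \<open>The remainder of the linearisation is at most (s - t)^2 on either side of the kink, so
  the point t = a needs no separate treatment.\<close>

lemma max_0_square_has_derivative:
  "((\<lambda>t. (max 0 (t - a))\<^sup>2) has_real_derivative 2 * max 0 (t - a)) (at (t::real))"
proof -
  have bound: "\<bar>(max 0 (s - a))\<^sup>2 - (max 0 (t - a))\<^sup>2 - 2 * max 0 (t - a) * (s - t)\<bar> \<le> (s - t)\<^sup>2" for s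
  proof -
    consider "s \<le> a" "t \<le> a" | "s \<le> a" "a \<le> t" | "a \<le> s" "t \<le> a" | "a \<le> s" "a \<le> t" by linarith
    then show ?thesis
    proof cases
      case 2
      have "0 \<le> (t - a) * (a - s)" "0 \<le> (a - s)\<^sup>2" "0 \<le> (t - a)\<^sup>2" using 2 by auto
      moreover have "(s - t)\<^sup>2 = (t - a)\<^sup>2 + 2 * ((t - a) * (a - s)) + (a - s)\<^sup>2"
        by (simp add: power2_eq_square algebra_simps)
      moreover have "(max 0 (s - a))\<^sup>2 - (max 0 (t - a))\<^sup>2 - 2 * max 0 (t - a) * (s - t) = (t - a)\<^sup>2 + 2 * ((t - a) * (a - s))"
      proof -
        have "max 0 (s - a) = 0" "max 0 (t - a) = t - a" using 2 by auto
        then show ?thesis by (simp add: power2_eq_square algebra_simps)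
      qed
      ultimately show ?thesis by linarith
    next
      case 3
      then have "(s - a)\<^sup>2 \<le> (s - t)\<^sup>2" by (intro power_mono) auto
      then show ?thesis using 3 by (simp add: max_def)
    next
      case 4
      then have "max 0 (s - a) = s - a" "max 0 (t - a) = t - a" by auto
      then have "(max 0 (s - a))\<^sup>2 - (max 0 (t - a))\<^sup>2 - 2 * max 0 (t - a) * (s - t) = (s - t)\<^sup>2"
        by (simp add: power2_eq_square algebra_simps)
      then show ?thesis by simp
    qed simp
  qed
  have "\<forall>\<^sub>F s in at t. norm (((max 0 (s - a))\<^sup>2 - (max 0 (t - a))\<^sup>2) / (s - t) - 2 * max 0 (t - a)) \<le> \<bar>s - t\<bar>"
    unfolding eventually_at_filter
  proof (intro always_eventually allI impI)
    fix s assume st: "s \<noteq> t"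
    have "((max 0 (s - a))\<^sup>2 - (max 0 (t - a))\<^sup>2) / (s - t) - 2 * max 0 (t - a)
        = ((max 0 (s - a))\<^sup>2 - (max 0 (t - a))\<^sup>2 - 2 * max 0 (t - a) * (s - t)) / (s - t)"
      using st by (simp add: diff_divide_distrib)
    then have "norm (((max 0 (s - a))\<^sup>2 - (max 0 (t - a))\<^sup>2) / (s - t) - 2 * max 0 (t - a))
        \<le> (s - t)\<^sup>2 / \<bar>s - t\<bar>"
      using bound[of s] by (simp add: abs_divide divide_right_mono)
    also have "(s - t)\<^sup>2 = \<bar>s - t\<bar> * \<bar>s - t\<bar>" by (simp add: power2_eq_square)
    also have "\<bar>s - t\<bar> * \<bar>s - t\<bar> / \<bar>s - t\<bar> = \<bar>s - t\<bar>"
      by (rule nonzero_mult_div_cancel_right) (use st in simp)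
    finally show "norm (((max 0 (s - a))\<^sup>2 - (max 0 (t - a))\<^sup>2) / (s - t) - 2 * max 0 (t - a)) \<le> \<bar>s - t\<bar>" .
  qed
  moreover have "((\<lambda>s. \<bar>s - t\<bar>) \<longlongrightarrow> 0) (at t)" by (rule tendsto_eq_intros | simp)+
  ultimately have "((\<lambda>s. ((max 0 (s - a))\<^sup>2 - (max 0 (t - a))\<^sup>2) / (s - t) - 2 * max 0 (t - a)) \<longlongrightarrow> 0) (at t)"
    by (rule Lim_null_comparison)
  then show ?thesis unfolding has_field_derivative_iff by (rule LIM_zero_cancel)
qed

lemma smoothstep_has_derivative: "(smoothstep has_real_derivative smoothstep_deriv t) (at t)"
proof -
  have "(smoothstep has_real_derivative
      2 * (2 * max 0 (t - 1) - 2 * (2 * max 0 (t - 3/2)) + 2 * max 0 (t - 2))) (at t)"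
    unfolding smoothstep_def[abs_def]
    by (intro DERIV_cmult DERIV_add DERIV_diff max_0_square_has_derivative)
  then show ?thesis by (simp add: smoothstep_deriv_def algebra_simps)
qed

lemma smoothstep_deriv_continuous: "continuous_on UNIV smoothstep_deriv"
  unfolding smoothstep_deriv_def[abs_def] by (intro continuous_intros)

lemma smoothstep_eq_0: "t \<le> 1 \<Longrightarrow> smoothstep t = 0"
  by (simp add: smoothstep_def max_def)

lemma smoothstep_eq_1: "2 \<le> t \<Longrightarrow> smoothstep t = 1"
  by (simp add: smoothstep_def max_def power2_eq_square algebra_simps)

lemma smoothstep_deriv_eq_0: "t \<le> 1 \<or> 2 \<le> t \<Longrightarrow> smoothstep_deriv t = 0"
  by (auto simp: smoothstep_deriv_def max_def)

lemma smoothstep_bounds: "0 \<le> smoothstep t" "smoothstep t \<le> 1"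
proof -
  consider "t \<le> 1" | "1 \<le> t" "t \<le> 3/2" | "3/2 \<le> t" "t \<le> 2" | "2 \<le> t" by linarith
  then have "0 \<le> smoothstep t \<and> smoothstep t \<le> 1"
  proof cases
    case 2
    then have "(t - 1)\<^sup>2 \<le> (1/2)\<^sup>2" by (intro power_mono) auto
    moreover have "max 0 (t - 1) = t - 1" "max 0 (t - 3/2) = 0" "max 0 (t - 2) = 0" using 2 by auto
    ultimately show ?thesis by (simp add: smoothstep_def power2_eq_square)
  next
    case 3
    have "(2 - t)\<^sup>2 \<le> (1/2)\<^sup>2" using 3 by (intro power_mono) auto
    moreover have "smoothstep t = 1 - 2 * (2 - t)\<^sup>2"
      using 3 by (simp add: smoothstep_def max_def power2_eq_square algebra_simps)
    ultimately show ?thesis by (simp add: power2_eq_square)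
  qed (simp_all add: smoothstep_eq_0 smoothstep_eq_1)
  then show "0 \<le> smoothstep t" "smoothstep t \<le> 1" by auto
qed

lemma smoothstep_deriv_abs: "\<bar>smoothstep_deriv t\<bar> \<le> 2"
proof -
  consider "t \<le> 1" | "1 \<le> t" "t \<le> 3/2" | "3/2 \<le> t" "t \<le> 2" | "2 \<le> t" by linarith
  then show ?thesis by cases (auto simp: smoothstep_deriv_def max_def)
qed

context mesh_domain
begin

text \<open>A face \<open>G\<close> of an element is the zero set of the sum of the barycentric coordinates that
  belong to the vertices outside \<open>G\<close>; this sum has a continuous extension to the whole mesh.\<close>

definition face_height :: "(real^'n) set \<Rightarrow> real^'n \<Rightarrow> real" where
  "face_height G x = 1 + (- 1) * (\<Sum>z\<in>vert G. nodal_basis \<T> z x)"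

definition face_height_poly :: "(real^'n) set \<Rightarrow> (real^'n) set \<Rightarrow> real^'n \<Rightarrow> real" where
  "face_height_poly G T x = 1 + (- 1) * (\<Sum>z\<in>vert G. hat T z x)"

definition face_height_grad :: "(real^'n) set \<Rightarrow> (real^'n) set \<Rightarrow> real^'n" where
  "face_height_grad G T = 0 + (- 1) *\<^sub>R (\<Sum>z\<in>vert G. hat_grad T z)"

lemma boundary_face_finite_vert: "G \<in> boundary_faces \<Longrightarrow> finite (vert G)"
  using face_vert_mesh(2) by (auto simp: boundary_faces_def)

lemma C1_face_height: "finite (vert G) \<Longrightarrow> C1 (face_height_poly G T) (\<lambda>x. face_height_grad G T)"
  unfolding face_height_poly_def[abs_def] face_height_grad_def by (intro C1_add C1_const C1_cmult C1_sum C1_hat)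

lemma pw_face_height:
  assumes "G \<in> boundary_faces"
  shows "pw \<T> (face_height G) (face_height_poly G) (\<lambda>T x. face_height_grad G T)"
  unfolding pw_def
proof (intro ballI conjI C1_face_height boundary_face_finite_vert[OF assms])
  fix T x assume T: "T \<in> \<T>" "x \<in> T"
  have "vert G \<subseteq> mesh_vertices \<T>" using assms face_vert_mesh(1) by (auto simp: boundary_faces_def)
  then have "(\<Sum>z\<in>vert G. nodal_basis \<T> z x) = (\<Sum>z\<in>vert G. hat T z x)"
    using nodal_basis_element[OF _ T] by (intro sum.cong) auto
  then show "face_height G x = face_height_poly G T x" by (simp add: face_height_def face_height_poly_def)
qed

text \<open>The coordinates sum to 1 and their gradients to 0, so the complement of a partial sum is
  the sum over the missing vertices. On T the height therefore dominates each missing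
  coordinate.\<close>

lemma face_height_poly_eq:
  assumes T: "T \<in> \<T>" and fin: "finite (vert G)"
  shows "face_height_poly G T x = (\<Sum>z\<in>vert T - vert G. bary T z x)"
    and "face_height_grad G T = (\<Sum>z\<in>vert T - vert G. bgrad T z)"
proof -
  interpret T: full_simplex T by (rule element[OF T])
  have "(\<Sum>z\<in>vert G. hat T z x) = (\<Sum>z\<in>vert T \<inter> vert G. bary T z x)"
    using sum.inter_restrict[OF fin, of "\<lambda>z. bary T z x" "vert T"] by (simp only: hat_def Int_commute)
  moreover have "(\<Sum>z\<in>vert T \<inter> vert G. bary T z x) + (\<Sum>z\<in>vert T - vert G. bary T z x) = 1"
    using T.sum_bary[of x] sum.Int_Diff[OF T.finite_vert, of "\<lambda>z. bary T z x" "vert G"] by simp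
  ultimately show "face_height_poly G T x = (\<Sum>z\<in>vert T - vert G. bary T z x)"
    by (simp add: face_height_poly_def)
  have "(\<Sum>z\<in>vert G. hat_grad T z) = (\<Sum>z\<in>vert T \<inter> vert G. bgrad T z)"
    using sum.inter_restrict[OF fin, of "bgrad T" "vert T"] by (simp only: hat_grad_def Int_commute)
  moreover have "(\<Sum>z\<in>vert T. bgrad T z) \<bullet> (\<Sum>z\<in>vert T. bgrad T z) = 0"
    by (subst inner_sum_left) (rule T.sum_bgrad)
  then have "(\<Sum>z\<in>vert T. bgrad T z) = 0" by (simp only: inner_eq_zero_iff)
  then have "(\<Sum>z\<in>vert T \<inter> vert G. bgrad T z) + (\<Sum>z\<in>vert T - vert G. bgrad T z) = 0"
    using sum.Int_Diff[OF T.finite_vert, of "bgrad T" "vert G"] by simp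
  ultimately show "face_height_grad G T = (\<Sum>z\<in>vert T - vert G. bgrad T z)"
    by (simp add: face_height_grad_def add_eq_0_iff)
qed

text \<open>Otherwise T would lie in G and hence in the boundary. It follows that face heights are
  positive in the interior of every element.\<close>

lemma boundary_face_missing_vertex:
  assumes G: "G \<in> boundary_faces" and T: "T \<in> \<T>"
  shows "vert T - vert G \<noteq> {}"
proof
  interpret T: full_simplex T by (rule element[OF T])
  obtain T' where T': "T' \<in> \<T>" "G face_of T'" "G \<subseteq> frontier \<Omega>" using G by (auto simp: boundary_faces_def)
  assume "vert T - vert G = {}"
  then have "convex hull (vert T) \<subseteq> convex hull (vert G)" by (intro hull_mono) blast
  then have "T \<subseteq> frontier \<Omega>"
    using T.hull_vert full_simplex.hull_vert_face[OF element[OF T'(1)] T'(2)] T'(3) by simp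
  then show False
    using T.interior_nonempty interior_subset[of T] interior_element[OF T] frontier_\<Omega> by blast
qed

lemma face_height_zero:
  assumes G: "G \<in> boundary_faces" "x \<in> G"
  shows "face_height G x = 0"
proof -
  obtain T where T: "T \<in> \<T>" "G face_of T" using G(1) by (auto simp: boundary_faces_def)
  interpret T: full_simplex T by (rule element[OF T(1)])
  have x: "x \<in> T" "\<forall>z\<in>vert T - vert G. bary T z x = 0" using T.face_mem_iff[OF T(2), of x] G(2) by auto
  have "face_height G x = face_height_poly G T x" by (rule pw_eq[OF pw_face_height[OF G(1)] T(1) x(1)])
  then show ?thesis using x(2) by (simp add: face_height_poly_eq(1)[OF T(1) boundary_face_finite_vert[OF G(1)]])
qed

definition cutoff_poly :: "real \<Rightarrow> (real^'n) set \<Rightarrow> real^'n \<Rightarrow> real" where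
  "cutoff_poly m T x = (\<Prod>G\<in>boundary_faces. smoothstep (m * face_height_poly G T x))"

definition cutoff_grad :: "real \<Rightarrow> (real^'n) set \<Rightarrow> real^'n \<Rightarrow> real^'n" where
  "cutoff_grad m T x = (\<Sum>G\<in>boundary_faces. (\<Prod>H\<in>boundary_faces - {G}. smoothstep (m * face_height_poly H T x)) *\<^sub>R
     (smoothstep_deriv (m * face_height_poly G T x) *\<^sub>R (m *\<^sub>R face_height_grad G T)))"

text \<open>One factor per boundary face, with its transition zone at heights between 1/m and
  2/m.\<close>

definition cutoff :: "real \<Rightarrow> real^'n \<Rightarrow> real" where
  "cutoff m x = (if x \<in> closure \<Omega> then \<Prod>G\<in>boundary_faces. smoothstep (m * face_height G x) else 0)"

lemma C1_cutoff: "C1 (cutoff_poly m T) (cutoff_grad m T)"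
  unfolding cutoff_poly_def[abs_def] cutoff_grad_def[abs_def]
  by (intro C1_prod finite_boundary_faces C1_compose[OF _ smoothstep_has_derivative smoothstep_deriv_continuous]
      C1_cmult C1_face_height boundary_face_finite_vert)

lemma pw_cutoff: "pw \<T> (cutoff m) (cutoff_poly m) (cutoff_grad m)"
  unfolding pw_def
proof (intro ballI conjI C1_cutoff)
  fix T x assume T: "T \<in> \<T>" "x \<in> T"
  then have "x \<in> closure \<Omega>" using element_subset by blast
  then show "cutoff m x = cutoff_poly m T x"
    using pw_eq[OF pw_face_height T] by (simp add: cutoff_def cutoff_poly_def)
qed

lemma cutoff_bounds: "0 \<le> cutoff m x" "cutoff m x \<le> 1"
  unfolding cutoff_def by (auto intro!: prod_nonneg prod_le_1 simp: smoothstep_bounds)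

text \<open>A superset of the points where the cutoff is nonzero, described by closed conditions so
  that compactness is immediate.\<close>

definition cutoff_support :: "real \<Rightarrow> (real^'n) set" where
  "cutoff_support m = {x \<in> closure \<Omega>. \<forall>G\<in>boundary_faces. 1 \<le> m * face_height G x}"

lemma cutoff_support: "cutoff m x \<noteq> 0 \<Longrightarrow> x \<in> cutoff_support m"
  using smoothstep_eq_0 finite_boundary_faces
  by (auto simp: cutoff_def cutoff_support_def split: if_splits) (meson linorder_le_cases)

lemma cutoff_support_subset: "cutoff_support m \<subseteq> \<Omega>"
proof
  fix x assume x: "x \<in> cutoff_support m"
  show "x \<in> \<Omega>"
  proof (rule ccontr)
    assume "x \<notin> \<Omega>"
    then have "x \<in> frontier \<Omega>" using x frontier_\<Omega> by (auto simp: cutoff_support_def)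
    then obtain G where "G \<in> boundary_faces" "x \<in> G" using frontier_covered by blast
    then show False using face_height_zero x by (force simp: cutoff_support_def)
  qed
qed

lemma compact_cutoff_support: "compact (cutoff_support m)"
proof -
  have eq: "cutoff_support m = closure \<Omega> \<inter> (\<Inter>G\<in>boundary_faces. closure \<Omega> \<inter> (\<lambda>x. m * face_height G x) -` {1..})"
    by (auto simp: cutoff_support_def)
  have "closed (closure \<Omega> \<inter> (\<lambda>x. m * face_height G x) -` {1..})" if "G \<in> boundary_faces" for G
    by (intro continuous_closed_preimage continuous_on_mult continuous_on_const pw_continuous[OF pw_face_height[OF that]]) auto
  then have "closed (cutoff_support m)" unfolding eq by (intro closed_Int[OF closed_closure closed_INT] ballI)
  moreover have "bounded (cutoff_support m)" using bounded_subset[OF bounded_\<Omega> cutoff_support_subset] .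
  ultimately show ?thesis by (simp add: compact_eq_bounded_closed)
qed

text \<open>Every face height is positive at an interior point of an element, so m times it exceeds
  2 for large m and all factors become constant.\<close>

lemma cutoff_eventually:
  assumes T: "T \<in> \<T>" "x \<in> interior T"
  shows "\<forall>\<^sub>F m in at_top. cutoff m x = 1 \<and> cutoff_grad m T x = 0"
proof -
  interpret T: full_simplex T by (rule element[OF T(1)])
  have xT: "x \<in> T" using T(2) interior_subset by blast
  have "\<forall>\<^sub>F m in at_top. 2 \<le> m * face_height_poly G T x" if G: "G \<in> boundary_faces" for G
  proof -
    have "0 < face_height_poly G T x"
      unfolding face_height_poly_eq(1)[OF T(1) boundary_face_finite_vert[OF G]]
      using boundary_face_missing_vertex[OF G T(1)] T.finite_vert T(2) T.interior_iff by (intro sum_pos) auto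
    then show ?thesis
      using eventually_ge_at_top[of "2 / face_height_poly G T x"] by (auto elim!: eventually_mono simp: field_simps)
  qed
  then have "\<forall>\<^sub>F m in at_top. \<forall>G\<in>boundary_faces. 2 \<le> m * face_height_poly G T x"
    by (simp add: eventually_ball_finite_distrib finite_boundary_faces)
  then show ?thesis
  proof eventually_elim
    case (elim m)
    have "cutoff m x = cutoff_poly m T x" by (rule pw_eq[OF pw_cutoff T(1) xT])
    then show ?case
      using elim by (simp add: cutoff_poly_def cutoff_grad_def smoothstep_eq_1 smoothstep_deriv_eq_0)
  qed
qed

text \<open>If only one vertex of \<open>T\<close> is missing in \<open>G\<close>, the normal trace of \<open>Y\<close> vanishes on the facet and
  compensates the factor \<open>m\<close>. Otherwise the gradient of the cutoff lives on a set of measure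
  \<open>O(m\<^sup>-\<^sup>2)\<close>.\<close>

lemma cutoff_flux_bound:
  assumes T: "T \<in> \<T>" and G: "G \<in> boundary_faces" and Y: "continuous_on UNIV Y"
    and trace: "\<And>a. a \<in> vert T \<Longrightarrow> opp T a \<subseteq> frontier \<Omega> \<Longrightarrow> \<exists>\<gamma>. \<forall>x. Y x \<bullet> bgrad T a = \<gamma> * bary T a x"
  shows "\<exists>C. \<forall>m>6. (LINT x|lborel. indicator T x *
    (smoothstep_deriv (m * face_height_poly G T x) * (m * (Y x \<bullet> face_height_grad G T)))\<^sup>2) \<le> C"
proof -
  interpret T: full_simplex T by (rule element[OF T])
  define N where "N = vert T - vert G"
  have fin: "finite N" using T.finite_vert by (simp add: N_def)
  note eq = face_height_poly_eq[OF T boundary_face_finite_vert[OF G], folded N_def]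
  have iT: "integrable lborel (\<lambda>x. indicator T x * c :: real)" for c
    by (rule integrable_continuous_compact[OF T.compact continuous_on_const])
  obtain a where a: "a \<in> N" using boundary_face_missing_vertex[OF G T] by (auto simp: N_def)
  show ?thesis
  proof (cases "N = {a}")
    case True
    obtain T' where T': "T' \<in> \<T>" "G face_of T'" "G \<subseteq> frontier \<Omega>" using G by (auto simp: boundary_faces_def)
    \<comment> \<open>All vertices of T except a belong to G, so the facet opposite to a lies in G
      and thus in the boundary.\<close>
    have "opp T a \<subseteq> convex hull (vert G)" unfolding opp_def using True by (intro hull_mono) (auto simp: N_def)
    then have "opp T a \<subseteq> frontier \<Omega>"
      using full_simplex.hull_vert_face[OF element[OF T'(1)] T'(2)] T'(3) by simp
    then obtain \<gamma> where \<gamma>: "\<And>x. Y x \<bullet> bgrad T a = \<gamma> * bary T a x" using trace[of a] a by (auto simp: N_def)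
    have "(LINT x|lborel. indicator T x *
        (smoothstep_deriv (m * face_height_poly G T x) * (m * (Y x \<bullet> face_height_grad G T)))\<^sup>2)
        \<le> (LINT x|lborel. indicator T x * (4 * \<bar>\<gamma>\<bar>)\<^sup>2)" for m
    proof (rule integral_mono'[OF iT])
      fix x
      \<comment> \<open>The derivative is at most 2 and vanishes outside 1 < t < 2. With t equal to
        m times the coordinate, this absorbs the factor m.\<close>
      have "\<bar>smoothstep_deriv t * t\<bar> \<le> 4" for t
      proof (cases "t \<le> 1 \<or> 2 \<le> t")
        case False
        then have "\<bar>smoothstep_deriv t\<bar> * \<bar>t\<bar> \<le> 2 * 2" by (intro mult_mono smoothstep_deriv_abs) auto
        then show ?thesis by (simp add: abs_mult)
      qed (simp add: smoothstep_deriv_eq_0)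
      then have "\<bar>smoothstep_deriv (m * bary T a x) * (m * bary T a x)\<bar> * \<bar>\<gamma>\<bar> \<le> 4 * \<bar>\<gamma>\<bar>"
        by (intro mult_right_mono) auto
      then have "\<bar>smoothstep_deriv (m * bary T a x) * (m * (\<gamma> * bary T a x))\<bar> \<le> 4 * \<bar>\<gamma>\<bar>"
        by (simp add: abs_mult mult_ac)
      then have "(smoothstep_deriv (m * face_height_poly G T x) * (m * (Y x \<bullet> face_height_grad G T)))\<^sup>2 \<le> (4 * \<bar>\<gamma>\<bar>)\<^sup>2"
        by (intro abs_le_square_iff[THEN iffD1]) (simp add: eq True \<gamma>)
      then show "indicator T x * (smoothstep_deriv (m * face_height_poly G T x) * (m * (Y x \<bullet> face_height_grad G T)))\<^sup>2
          \<le> indicator T x * (4 * \<bar>\<gamma>\<bar>)\<^sup>2"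
        by (intro mult_left_mono) auto
    qed simp
    then show ?thesis by blast
  next
    case False
    then obtain b where b: "b \<in> N" "b \<noteq> a" using a by blast
    have ab: "a \<in> vert T" "b \<in> vert T" "a \<noteq> b" using a b by (auto simp: N_def)
    have "bounded ((\<lambda>x. Y x \<bullet> face_height_grad G T) ` T)"
      by (intro compact_imp_bounded compact_continuous_image T.compact continuous_intros continuous_on_subset[OF Y]) auto
    then obtain B where B: "\<And>x. x \<in> T \<Longrightarrow> \<bar>Y x \<bullet> face_height_grad G T\<bar> \<le> B" unfolding bounded_iff by force
    \<comment> \<open>The constant is 6 from \<open>corner_measure\<close>, times 3^2 from the width
      3 / m, times 2^2 from the bound on \<open>smoothstep_deriv\<close>; the powers of m cancel.
      The condition m > 6 makes 3 / m smaller than 1 / 2.\<close>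
    have "(LINT x|lborel. indicator T x *
        (smoothstep_deriv (m * face_height_poly G T x) * (m * (Y x \<bullet> face_height_grad G T)))\<^sup>2)
        \<le> 216 * B\<^sup>2 * (LINT x|lborel. indicator T x)" if m: "m > 6" for m
    proof -
      let ?S = "{x \<in> T. bary T a x < 3 / m \<and> bary T b x < 3 / m}"
      have S: "?S = T \<inter> ({x. bary T a x < 3 / m} \<inter> {x. bary T b x < 3 / m})" by auto
      have o: "open {x. bary T z x < 3 / m}" for z
        by (intro open_Collect_less continuous_on_bary continuous_on_const)
      have "?S \<in> sets borel" unfolding S by (intro sets.Int borel_closed T.closed borel_open o)
      moreover have "emeasure lborel ?S < \<infinity>"
        by (rule emeasure_bounded_finite[OF bounded_subset[OF compact_imp_bounded[OF T.compact]]]) auto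
      ultimately have iS: "integrable lborel (\<lambda>x. indicator ?S x * (2 * (m * B))\<^sup>2)"
        by (intro integrable_mult_left integrable_real_indicator) auto
      have "(LINT x|lborel. indicator T x *
          (smoothstep_deriv (m * face_height_poly G T x) * (m * (Y x \<bullet> face_height_grad G T)))\<^sup>2)
          \<le> (LINT x|lborel. indicator ?S x * (2 * (m * B))\<^sup>2)"
      proof (rule integral_mono'[OF iS])
        fix x
        show "indicator T x * (smoothstep_deriv (m * face_height_poly G T x) * (m * (Y x \<bullet> face_height_grad G T)))\<^sup>2
            \<le> indicator ?S x * (2 * (m * B))\<^sup>2"
        proof (cases "x \<in> T \<and> m * face_height_poly G T x < 2")
          case True
          then have nn: "0 \<le> bary T z x" if "z \<in> N" for z using T.mem_iff that by (auto simp: N_def)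
          have "bary T z x < 3 / m" if z: "z \<in> N" for z
          proof -
            have "bary T z x \<le> face_height_poly G T x"
              unfolding eq by (rule member_le_sum[OF z _ fin]) (use nn in auto)
            also have "\<dots> < 2 / m" using True m by (simp add: field_simps)
            also have "\<dots> \<le> 3 / m" using m by (simp add: divide_right_mono)
            finally show ?thesis .
          qed
          then have S: "x \<in> ?S" using True a b by blast
          have "\<bar>smoothstep_deriv (m * face_height_poly G T x)\<bar> * (m * \<bar>Y x \<bullet> face_height_grad G T\<bar>) \<le> 2 * (m * B)"
            using True m B by (intro mult_mono smoothstep_deriv_abs) auto
          then have "\<bar>smoothstep_deriv (m * face_height_poly G T x) * (m * (Y x \<bullet> face_height_grad G T))\<bar> \<le> \<bar>2 * (m * B)\<bar>"
            using m by (simp add: abs_mult)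
          then have "(smoothstep_deriv (m * face_height_poly G T x) * (m * (Y x \<bullet> face_height_grad G T)))\<^sup>2 \<le> (2 * (m * B))\<^sup>2"
            by (rule abs_le_square_iff[THEN iffD1])
          then show ?thesis using True S by simp
        next
          case False
          then have "indicator T x * smoothstep_deriv (m * face_height_poly G T x) = 0"
            by (auto simp: smoothstep_deriv_eq_0 indicator_def)
          then have z: "indicator T x * (smoothstep_deriv (m * face_height_poly G T x) * (m * (Y x \<bullet> face_height_grad G T)))\<^sup>2 = 0"
            by auto
          show ?thesis unfolding z by simp
        qed
      qed simp
      also have "\<dots> = (LINT x|lborel. indicator ?S x) * (2 * (m * B))\<^sup>2" by simp
      also have "\<dots> \<le> (6 * (LINT x|lborel. indicator T x) * (3 / m)\<^sup>2) * (2 * (m * B))\<^sup>2"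
        using m by (intro mult_right_mono T.corner_measure[OF dim ab]) (auto simp: field_simps)
      also have "\<dots> = 216 * B\<^sup>2 * (LINT x|lborel. indicator T x)"
        using m by (simp add: power_mult_distrib power_divide)
      finally show ?thesis .
    qed
    then show ?thesis by blast
  qed
qed

text \<open>The product rule gives one term per boundary face, in which the remaining factors are at
  most 1; squaring the sum costs the number of boundary faces.\<close>

lemma cutoff_flux_L2_bound:
  assumes Y: "\<And>T. T \<in> \<T> \<Longrightarrow> continuous_on UNIV (Y T)"
    and trace: "\<And>T a. T \<in> \<T> \<Longrightarrow> a \<in> vert T \<Longrightarrow> opp T a \<subseteq> frontier \<Omega> \<Longrightarrow> \<exists>\<gamma>. \<forall>x. Y T x \<bullet> bgrad T a = \<gamma> * bary T a x"
  defines "r \<equiv> \<lambda>m x. pg \<T> Y x \<bullet> pg \<T> (cutoff_grad m) x"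
  shows "\<exists>C. \<forall>m>6. L2_inner \<Omega> (r m) (r m) \<le> C"
proof -
  define w where "w = (\<lambda>m T G x. smoothstep_deriv (m * face_height_poly G T x) * (m * (Y T x \<bullet> face_height_grad G T)))"
  \<comment> \<open>A bound for each pair of an element and a boundary face, fixed before m so that
    it is uniform in m.\<close>
  define C where "C = (\<lambda>T G. SOME C. \<forall>m>6. (LINT x|lborel. indicator T x * (w m T G x)\<^sup>2) \<le> C)"
  have "\<forall>m>6. (LINT x|lborel. indicator T x * (w m T G x)\<^sup>2) \<le> C T G" if "T \<in> \<T>" "G \<in> boundary_faces" for T G
    unfolding C_def
    by (rule someI_ex) (unfold w_def, rule cutoff_flux_bound[OF that Y[OF that(1)] trace[OF that(1)]])
  then have C: "\<And>T G m. T \<in> \<T> \<Longrightarrow> G \<in> boundary_faces \<Longrightarrow> m > 6 \<Longrightarrow> (LINT x|lborel. indicator T x * (w m T G x)\<^sup>2) \<le> C T G"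
    by blast
  have wc: "continuous_on UNIV (w m T G)" if "T \<in> \<T>" "G \<in> boundary_faces" for m T G
    unfolding w_def
    by (intro continuous_intros continuous_on_compose2[OF smoothstep_deriv_continuous] Y[OF that(1)]
        C1_continuous[OF C1_face_height[OF boundary_face_finite_vert[OF that(2)]]]) auto
  have "L2_inner \<Omega> (r m) (r m) \<le> (\<Sum>T\<in>\<T>. real (card boundary_faces) * (\<Sum>G\<in>boundary_faces. C T G))" if m: "m > 6" for m
  proof -
    have rm: "r m \<in> borel_measurable (lebesgue_on \<Omega>)"
    proof -
      have "r m \<in> borel_measurable borel" unfolding r_def
        by (intro borel_measurable_inner pg_measurable[OF pw_cutoff] pg_measurable_continuous Y)
      then have "r m \<in> borel_measurable lebesgue" by (simp add: measurable_completion)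
      then show ?thesis by (rule measurable_restrict_space1)
    qed
    have "L2_inner \<Omega> (r m) (r m) = (\<Sum>T\<in>\<T>. LINT x|lborel. indicator T x * (Y T x \<bullet> cutoff_grad m T x)\<^sup>2)"
      unfolding L2_inner_def inner_real_def
    proof (rule integral_split)
      show "(\<lambda>x. r m x * r m x) \<in> borel_measurable (lebesgue_on \<Omega>)" using rm by simp
      show "r m x * r m x = (Y T x \<bullet> cutoff_grad m T x)\<^sup>2" if "T \<in> \<T>" "x \<in> interior T" for T x
        by (simp add: r_def pg_interior[OF that] power2_eq_square)
      show "continuous_on UNIV (\<lambda>x. (Y T x \<bullet> cutoff_grad m T x)\<^sup>2)" if "T \<in> \<T>" for T
        by (intro continuous_intros Y[OF that] C1_grad_continuous[OF C1_cutoff])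
    qed
    also have "\<dots> \<le> (\<Sum>T\<in>\<T>. real (card boundary_faces) * (\<Sum>G\<in>boundary_faces. C T G))"
    proof (rule sum_mono)
      fix T assume T: "T \<in> \<T>"
      have iw: "integrable lborel (\<lambda>x. indicator T x * (w m T G x)\<^sup>2)" if "G \<in> boundary_faces" for G
        by (intro integrable_continuous_compact[OF full_simplex.compact[OF element[OF T]]] continuous_on_power wc[OF T that])
      have "(LINT x|lborel. indicator T x * (Y T x \<bullet> cutoff_grad m T x)\<^sup>2)
          \<le> (LINT x|lborel. real (card boundary_faces) * (\<Sum>G\<in>boundary_faces. indicator T x * (w m T G x)\<^sup>2))"
      proof (rule integral_mono')
        show "integrable lborel (\<lambda>x. real (card boundary_faces) * (\<Sum>G\<in>boundary_faces. indicator T x * (w m T G x)\<^sup>2))"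
          using iw by (intro integrable_mult_right Bochner_Integration.integrable_sum)
        show "0 \<le> real (card boundary_faces) * (\<Sum>G\<in>boundary_faces. indicator T x * (w m T G x)\<^sup>2)" for x
          by (intro mult_nonneg_nonneg sum_nonneg) auto
        fix x
        let ?p = "\<lambda>G. \<Prod>H\<in>boundary_faces - {G}. smoothstep (m * face_height_poly H T x)"
        have p: "0 \<le> ?p G" "?p G \<le> 1" for G by (auto intro!: prod_nonneg prod_le_1 simp: smoothstep_bounds)
        have "Y T x \<bullet> cutoff_grad m T x = (\<Sum>G\<in>boundary_faces. ?p G * w m T G x)"
          by (simp add: cutoff_grad_def w_def inner_sum_right mult.assoc)
        then have "(Y T x \<bullet> cutoff_grad m T x)\<^sup>2 \<le> real (card boundary_faces) * (\<Sum>G\<in>boundary_faces. (?p G * w m T G x)\<^sup>2)"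
          using sum_squared_le_sum_of_squares[of "\<lambda>G. ?p G * w m T G x" boundary_faces] by (simp only: mult.commute)
        also have "\<dots> \<le> real (card boundary_faces) * (\<Sum>G\<in>boundary_faces. (w m T G x)\<^sup>2)"
        proof (intro mult_left_mono sum_mono)
          fix G
          have "\<bar>?p G * w m T G x\<bar> \<le> \<bar>w m T G x\<bar>" using p[of G] by (simp add: abs_mult mult_left_le_one_le)
          then show "(?p G * w m T G x)\<^sup>2 \<le> (w m T G x)\<^sup>2" by (rule abs_le_square_iff[THEN iffD1])
        qed simp
        finally show "indicator T x * (Y T x \<bullet> cutoff_grad m T x)\<^sup>2
            \<le> real (card boundary_faces) * (\<Sum>G\<in>boundary_faces. indicator T x * (w m T G x)\<^sup>2)"
          by (cases "x \<in> T") simp_all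
      qed
      also have "\<dots> = real (card boundary_faces) * (\<Sum>G\<in>boundary_faces. LINT x|lborel. indicator T x * (w m T G x)\<^sup>2)"
        using iw by (simp add: Bochner_Integration.integral_sum)
      also have "\<dots> \<le> real (card boundary_faces) * (\<Sum>G\<in>boundary_faces. C T G)"
        using C[OF T _ m] by (intro mult_left_mono sum_mono) auto
      finally show "(LINT x|lborel. indicator T x * (Y T x \<bullet> cutoff_grad m T x)\<^sup>2)
          \<le> real (card boundary_faces) * (\<Sum>G\<in>boundary_faces. C T G)" .
    qed
    finally show ?thesis .
  qed
  then show ?thesis by blast
qed

end

section \<open>Mollification of piecewise smooth functions\<close>

lemma conv_tendsto:
  fixes u :: "real^'n \<Rightarrow> real" and \<eta> :: "nat \<Rightarrow> real^'n \<Rightarrow> real"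
  assumes u: "u \<in> borel_measurable lebesgue" "\<And>x. \<bar>u x\<bar> \<le> U" "\<And>x. u x \<noteq> 0 \<Longrightarrow> norm x \<le> R"
    and \<eta>: "\<And>k. smooth (\<eta> k)" "\<And>k x. 0 \<le> \<eta> k x" "\<And>k x. \<eta> k x \<noteq> 0 \<Longrightarrow> norm x \<le> r k" "\<And>k. (LINT x|lebesgue. \<eta> k x) = 1"
    and r: "r \<longlonglongrightarrow> 0" and cont: "isCont u x"
  shows "(\<lambda>k. conv u (\<eta> k) x) \<longlonglongrightarrow> u x"
proof (rule tendstoI)
  fix e :: real assume e: "0 < e"
  then obtain d where d: "d > 0" "\<And>y. dist y x < d \<Longrightarrow> dist (u y) (u x) < e / 2"
    using cont unfolding continuous_at_eps_delta by (meson half_gt_zero)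
  have "\<forall>\<^sub>F k in sequentially. r k < d" using order_tendstoD(2)[OF r d(1)] .
  then show "\<forall>\<^sub>F k in sequentially. dist (conv u (\<eta> k) x) (u x) < e"
  proof eventually_elim
    case (elim k)
    have "\<bar>conv u (\<eta> k) x - u x\<bar> \<le> e / 2"
    proof (rule conv_abs_le[OF u \<eta>])
      fix y assume "norm (y - x) \<le> r k"
      then have "dist (u y) (u x) < e / 2" using elim by (intro d(2)) (simp add: dist_norm)
      then show "\<bar>u y - u x\<bar> \<le> e / 2" by (simp add: dist_real_def)
    qed
    then show ?case using e by (simp add: dist_real_def)
  qed
qed

text \<open>Mollifications are bounded by U and converge at continuity points, so dominated
  convergence applies. Continuity almost everywhere is enough, which admits functions that jump
  across faces.\<close>

lemma conv_integral_tendsto: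
  fixes u g :: "real^'n \<Rightarrow> real" and \<eta> :: "nat \<Rightarrow> real^'n \<Rightarrow> real"
  assumes u: "u \<in> borel_measurable lebesgue" "\<And>x. \<bar>u x\<bar> \<le> U" "\<And>x. u x \<noteq> 0 \<Longrightarrow> norm x \<le> R"
    and \<eta>: "\<And>k. smooth (\<eta> k)" "\<And>k x. 0 \<le> \<eta> k x" "\<And>k x. \<eta> k x \<noteq> 0 \<Longrightarrow> norm x \<le> r k" "\<And>k. (LINT x|lebesgue. \<eta> k x) = 1"
    and r: "r \<longlonglongrightarrow> 0" and g: "integrable lebesgue g" and cont: "AE x in lebesgue. g x \<noteq> 0 \<longrightarrow> isCont u x"
  shows "(\<lambda>k. LINT x|lebesgue. g x * conv u (\<eta> k) x) \<longlonglongrightarrow> (LINT x|lebesgue. g x * u x)"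
    and "integrable lebesgue (\<lambda>x. g x * conv u (\<eta> k) x)"
    and "integrable lebesgue (\<lambda>x. g x * u x)"
proof -
  have cm: "conv u (\<eta> k) \<in> borel_measurable lebesgue" for k
    by (rule lebesgue_measurable_continuous[OF smooth_continuous[OF smooth_conv[OF u \<eta>(1,3)]]])
  have cb: "\<bar>conv u (\<eta> k) x\<bar> \<le> U" for k x
  proof -
    have "\<bar>conv u (\<eta> k) x - 0\<bar> \<le> U" by (rule conv_abs_le[OF u \<eta>]) (simp_all add: u(2))
    then show ?thesis by simp
  qed
  have gm: "g \<in> borel_measurable lebesgue" using g by simp
  have w: "integrable lebesgue (\<lambda>x. \<bar>g x\<bar> * U)" using g by simp
  have bound: "norm (g x * conv u (\<eta> k) x) \<le> \<bar>g x\<bar> * U" "norm (g x * u x) \<le> \<bar>g x\<bar> * U" for k x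
    using cb u(2) by (simp_all add: abs_mult mult_left_mono)
  have U: "0 \<le> U" using u(2)[of 0] by linarith
  show "(\<lambda>k. LINT x|lebesgue. g x * conv u (\<eta> k) x) \<longlonglongrightarrow> (LINT x|lebesgue. g x * u x)"
  proof (rule integral_dominated_convergence[where w = "\<lambda>x. \<bar>g x\<bar> * U"])
    show "AE x in lebesgue. (\<lambda>k. g x * conv u (\<eta> k) x) \<longlonglongrightarrow> g x * u x"
      using cont
    proof eventually_elim
      case (elim x)
      show ?case
      proof (cases "g x = 0")
        case False
        then have c: "isCont u x" using elim by blast
        show ?thesis by (intro tendsto_mult tendsto_const) (rule conv_tendsto[OF u \<eta> r c])
      qed simp
    qed
  qed (use bound w gm cm u(1) in auto)
  show "integrable lebesgue (\<lambda>x. g x * conv u (\<eta> k) x)"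
    by (rule Bochner_Integration.integrable_bound[OF w]) (use bound(1) gm cm U in \<open>auto simp: abs_mult\<close>)
  show "integrable lebesgue (\<lambda>x. g x * u x)"
    by (rule Bochner_Integration.integrable_bound[OF w]) (use bound(2) gm u(1) U in \<open>auto simp: abs_mult\<close>)
qed

lemma mollifier_sequence:
  assumes "\<rho> > 0"
  obtains \<eta> :: "nat \<Rightarrow> real^'n \<Rightarrow> real" where "\<And>k. smooth (\<eta> k)" "\<And>k x. 0 \<le> \<eta> k x"
    "\<And>k x. \<eta> k x \<noteq> 0 \<Longrightarrow> norm x \<le> \<rho> / real (Suc k)" "\<And>k. (LINT x|lebesgue. \<eta> k x) = 1"
    "(\<lambda>k. \<rho> / real (Suc k)) \<longlonglongrightarrow> 0"
proof -
  have "\<exists>\<eta>::real^'n \<Rightarrow> real. smooth \<eta> \<and> (\<forall>x. 0 \<le> \<eta> x) \<and> (\<forall>x. \<eta> x \<noteq> 0 \<longrightarrow> norm x \<le> \<rho> / real (Suc k)) \<and> (LINT x|lebesgue. \<eta> x) = 1" for k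
  proof -
    have "0 < \<rho> / real (Suc k)" using assms by simp
    then obtain \<eta> :: "real^'n \<Rightarrow> real" where "smooth \<eta>" "\<And>x. 0 \<le> \<eta> x" "\<And>x. \<eta> x \<noteq> 0 \<Longrightarrow> norm x < \<rho> / real (Suc k)"
      "(LINT x|lebesgue. \<eta> x) = 1" by (rule mollifier_exists) blast
    then show ?thesis by (intro exI[of _ \<eta>]) (auto intro: less_imp_le)
  qed
  then obtain \<eta> :: "nat \<Rightarrow> real^'n \<Rightarrow> real" where "\<forall>k. smooth (\<eta> k) \<and> (\<forall>x. 0 \<le> \<eta> k x) \<and>
      (\<forall>x. \<eta> k x \<noteq> 0 \<longrightarrow> norm x \<le> \<rho> / real (Suc k)) \<and> (LINT x|lebesgue. \<eta> k x) = 1"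
    using choice[of "\<lambda>k \<eta>. smooth \<eta> \<and> (\<forall>x. 0 \<le> \<eta> x) \<and> (\<forall>x. \<eta> x \<noteq> 0 \<longrightarrow> norm x \<le> \<rho> / real (Suc k)) \<and> (LINT x|lebesgue. \<eta> x) = 1"]
    by blast
  moreover have "(\<lambda>k. \<rho> / real (Suc k)) \<longlonglongrightarrow> 0"
    using tendsto_mult_right_zero[OF LIMSEQ_inverse_real_of_nat, of \<rho>] by (simp add: divide_inverse)
  ultimately show ?thesis using that by blast
qed

text \<open>Convolution enlarges the support by at most the radius of the kernel, and the sum of two
  compact sets is compact.\<close>

lemma test_function_conv:
  fixes u \<eta> :: "real^'n \<Rightarrow> real"
  assumes u: "u \<in> borel_measurable lebesgue" "\<And>x. \<bar>u x\<bar> \<le> U" "\<And>x. u x \<noteq> 0 \<Longrightarrow> x \<in> K"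
    and \<eta>: "smooth \<eta>" "\<And>x. \<eta> x \<noteq> 0 \<Longrightarrow> norm x \<le> r"
    and K: "compact K" "(\<Union>x\<in>K. cball x r) \<subseteq> S"
  shows "test_function S (conv u \<eta>)"
proof -
  obtain R where "\<And>x. x \<in> K \<Longrightarrow> norm x \<le> R" using compact_imp_bounded[OF K(1)] unfolding bounded_iff by blast
  then have u3: "\<And>x. u x \<noteq> 0 \<Longrightarrow> norm x \<le> R" using u(3) by blast
  let ?K = "\<Union>x\<in>K. cball x r"
  have "(\<Union>x\<in>K. \<Union>y\<in>cball 0 r. {x + y}) = ?K"
  proof (intro equalityI subsetI)
    fix z assume "z \<in> ?K"
    then obtain x where x: "x \<in> K" "norm (z - x) \<le> r" by (auto simp: dist_norm norm_minus_commute)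
    then show "z \<in> (\<Union>x\<in>K. \<Union>y\<in>cball 0 r. {x + y})" by (intro UN_I[of x] UN_I[of "z - x"]) auto
  next
    fix z assume "z \<in> (\<Union>x\<in>K. \<Union>y\<in>cball 0 r. {x + y})"
    then obtain x y where "x \<in> K" "norm y \<le> r" "z = x + y" by auto
    then show "z \<in> ?K" by (intro UN_I[of x]) (auto simp: dist_norm)
  qed
  then have cK: "compact ?K" using compact_sums'[OF K(1) compact_cball[of 0 r]] by simp
  have "{x. conv u \<eta> x \<noteq> 0} \<subseteq> ?K"
  proof
    fix x assume "x \<in> {x. conv u \<eta> x \<noteq> 0}"
    then obtain y where "y \<in> K" "norm (x - y) \<le> r" using conv_support[of u K \<eta> r x, OF u(3) \<eta>(2)] by blast
    then show "x \<in> ?K" by (auto simp: dist_norm norm_minus_commute)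
  qed
  then have sub: "closure {x. conv u \<eta> x \<noteq> 0} \<subseteq> ?K" by (intro closure_minimal compact_imp_closed cK)
  then have "compact (closure {x. conv u \<eta> x \<noteq> 0})"
    using compact_imp_bounded[OF cK] bounded_subset by (auto simp: compact_eq_bounded_closed)
  then show ?thesis
    unfolding test_function_def using sub K(2) smooth_conv[OF u(1,2) u3 \<eta>] by blast
qed

lemma grad_reflect:
  assumes "smooth \<phi>"
  shows "grad (\<lambda>y. \<phi> (x - y)) y = - grad \<phi> (x - y)"
proof (rule grad_eqI)
  have "((\<lambda>y. \<phi> (x - y)) has_derivative (\<lambda>h. grad \<phi> (x - y) \<bullet> (- h))) (at y)"
    by (rule has_derivative_compose[OF _ smooth_has_derivative[OF assms]]) (auto intro!: derivative_eq_intros)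
  then show "((\<lambda>y. \<phi> (x - y)) has_derivative (\<lambda>h. - grad \<phi> (x - y) \<bullet> h)) (at y)" by simp
qed

context mesh_domain
begin

lemma pw_continuous_UNIV:
  assumes "pw \<T> \<zeta> P D" "\<And>x. x \<notin> \<Omega> \<Longrightarrow> \<zeta> x = 0"
  shows "continuous_on UNIV \<zeta>"
proof -
  obtain L where L: "\<And>x y. \<bar>\<zeta> y - \<zeta> x\<bar> \<le> L * norm (y - x)" using pw_lipschitz[OF assms] by blast
  have "(max L 0)-lipschitz_on UNIV \<zeta>"
  proof (rule lipschitz_onI)
    fix x y :: "real^'n"
    have "L * norm (x - y) \<le> max L 0 * norm (x - y)" by (intro mult_right_mono) auto
    then show "dist (\<zeta> x) (\<zeta> y) \<le> max L 0 * dist x y" using L[of x y] by (simp add: dist_norm)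
  qed simp
  then show ?thesis by (rule lipschitz_on_continuous_on)
qed

lemma pw_bounded_UNIV:
  assumes "pw \<T> \<zeta> P D" "\<And>x. x \<notin> \<Omega> \<Longrightarrow> \<zeta> x = 0"
  shows "\<exists>U. \<forall>x. \<bar>\<zeta> x\<bar> \<le> U"
proof -
  obtain C where C: "\<And>x. x \<in> closure \<Omega> \<Longrightarrow> \<bar>\<zeta> x\<bar> \<le> C" using pw_bounded[OF assms(1)] by blast
  have "\<bar>\<zeta> x\<bar> \<le> max C 0" for x
    using C[of x] assms(2)[of x] closure_subset[of \<Omega>] by (cases "x \<in> \<Omega>") (auto simp: max_def intro: order_trans)
  then show ?thesis by blast
qed

lemma \<Omega>_norm_bound: "\<exists>R. \<forall>x\<in>\<Omega>. norm x \<le> R"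
  using bounded_\<Omega> by (simp add: bounded_iff)

lemma pg_outside_\<Omega>: "x \<notin> \<Omega> \<Longrightarrow> pg \<T> D x = 0"
  unfolding pg_def using interior_element by (intro sum.neutral) (auto simp: indicator_def)

lemma pg_measurable_lebesgue: "pw \<T> \<zeta> P D \<Longrightarrow> pg \<T> D \<in> borel_measurable lebesgue"
  by (drule pg_measurable) (simp add: measurable_completion)

lemma pg_isCont:
  assumes D: "\<And>T. T \<in> \<T> \<Longrightarrow> continuous_on UNIV (D T)" and T: "T \<in> \<T>" "x \<in> interior T"
  shows "isCont (pg \<T> D) x"
proof -
  have "continuous_on (interior T) (pg \<T> D)"
    by (rule continuous_on_eq[OF continuous_on_subset[OF D[OF T(1)]]]) (auto simp: pg_interior[OF T(1)])
  then show ?thesis using T(2) continuous_on_eq_continuous_at open_interior by blast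
qed

lemma AE_pg_isCont:
  assumes "\<And>T. T \<in> \<T> \<Longrightarrow> continuous_on UNIV (D T)"
  shows "AE x in lebesgue. x \<in> \<Omega> \<longrightarrow> isCont (pg \<T> D) x"
  using AE_interior
proof eventually_elim
  case (elim x)
  then show ?case using pg_isCont[of D, OF assms] closure_subset[of \<Omega>] by blast
qed

text \<open>The convolution integrand seen as a piecewise smooth function of y; its elementwise
  gradient contains the two terms that move a derivative from the mollifier to \<zeta>.\<close>

lemma pw_reflect:
  assumes pw: "pw \<T> \<zeta> P D" and z: "\<And>x. x \<notin> \<Omega> \<Longrightarrow> \<zeta> x = 0" and \<eta>: "smooth \<eta>"
  obtains P' D' where "pw \<T> (\<lambda>y. \<zeta> y * \<eta> (x - y)) P' D'"
    "AE y in lebesgue. pg \<T> D' y = \<eta> (x - y) *\<^sub>R pg \<T> D y - \<zeta> y *\<^sub>R grad \<eta> (x - y)"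
proof
  let ?E = "grad (\<lambda>y. \<eta> (x - y))"
  let ?D = "\<lambda>T y. P T y *\<^sub>R ?E y + \<eta> (x - y) *\<^sub>R D T y"
  show "pw \<T> (\<lambda>y. \<zeta> y * \<eta> (x - y)) (\<lambda>T y. P T y * \<eta> (x - y)) ?D"
    by (rule pw_mult[OF pw pw_C1[OF C1_smooth[OF smooth_reflect[OF \<eta>]]]])
  show "AE y in lebesgue. pg \<T> ?D y = \<eta> (x - y) *\<^sub>R pg \<T> D y - \<zeta> y *\<^sub>R grad \<eta> (x - y)"
    using AE_interior
  proof eventually_elim
    case (elim y)
    show ?case
    proof (cases "y \<in> \<Omega>")
      case True
      then obtain T where T: "T \<in> \<T>" "y \<in> interior T" using elim closure_subset[of \<Omega>] by blast
      have "\<zeta> y = P T y" using pw_eq[OF pw T(1)] T(2) interior_subset[of T] by blast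
      then show ?thesis by (simp add: pg_interior[OF T] grad_reflect[OF \<eta>])
    qed (simp add: z pg_outside_\<Omega>)
  qed
qed

text \<open>The gradient of \<zeta> times the reflected mollifier integrates to zero, which moves
  the derivative from the kernel to \<zeta>.\<close>

lemma conv_grad_pw:
  assumes pw: "pw \<T> \<zeta> P D" and z: "\<And>x. x \<notin> \<Omega> \<Longrightarrow> \<zeta> x = 0"
    and \<eta>: "smooth \<eta>" "\<And>x. \<eta> x \<noteq> 0 \<Longrightarrow> norm x \<le> r"
  shows "grad (conv \<zeta> \<eta>) x $ i = conv (\<lambda>y. pg \<T> D y $ i) \<eta> x"
proof -
  obtain R where R: "\<And>x. x \<in> \<Omega> \<Longrightarrow> norm x \<le> R" using \<Omega>_norm_bound by blast
  obtain U where U: "\<And>x. \<bar>\<zeta> x\<bar> \<le> U" using pw_bounded_UNIV[OF pw z] by blast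
  obtain M where M: "\<And>x. norm (pg \<T> D x) \<le> M" using pg_bounded[OF pw] by blast
  obtain C where C: "\<And>x. \<bar>\<eta> x\<bar> \<le> C" using smooth_bounded[OF \<eta>] by blast
  obtain C' where C': "\<And>x. norm (grad \<eta> x) \<le> C'" using grad_bounded[OF \<eta>] by blast
  have zm: "\<zeta> \<in> borel_measurable lebesgue" by (rule lebesgue_measurable_continuous[OF pw_continuous_UNIV[OF pw z]])
  have zR: "\<And>x. \<zeta> x \<noteq> 0 \<Longrightarrow> norm x \<le> R" using z R by blast
  have "(\<lambda>y. pg \<T> D y \<bullet> axis i 1) \<in> borel_measurable lebesgue" using pg_measurable_lebesgue[OF pw] by measurable
  then have pm: "(\<lambda>y. pg \<T> D y $ i) \<in> borel_measurable lebesgue" by (simp add: inner_axis)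
  have pM: "\<bar>pg \<T> D x $ i\<bar> \<le> M" for x using order_trans[OF component_le_norm_cart M] .
  have pR: "\<And>x. pg \<T> D x $ i \<noteq> 0 \<Longrightarrow> norm x \<le> R" using pg_outside_\<Omega> R by force
  have i1: "integrable lebesgue (\<lambda>y. pg \<T> D y $ i * \<eta> (x - y))"
    by (rule integrable_conv[OF pm pM pR smooth_continuous[OF \<eta>(1)] C])
  have i2: "integrable lebesgue (\<lambda>y. \<zeta> y * grad \<eta> (x - y) $ i)"
    by (rule integrable_conv[where \<eta> = "\<lambda>z. grad \<eta> z $ i", OF zm U zR smooth_continuous[OF smooth_grad[OF \<eta>(1)]]])
      (assumption, rule order_trans[OF component_le_norm_cart C'])
  obtain P' D' where D': "pw \<T> (\<lambda>y. \<zeta> y * \<eta> (x - y)) P' D'"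
    "AE y in lebesgue. pg \<T> D' y = \<eta> (x - y) *\<^sub>R pg \<T> D y - \<zeta> y *\<^sub>R grad \<eta> (x - y)"
    by (rule pw_reflect[OF pw z \<eta>(1)])
  have "0 = (LINT y|lebesgue. pg \<T> D' y $ i)" by (rule pw_integral_pg[OF D'(1), symmetric]) (simp add: z)
  also have "\<dots> = (LINT y|lebesgue. pg \<T> D y $ i * \<eta> (x - y) - \<zeta> y * grad \<eta> (x - y) $ i)"
  proof (rule integral_cong_AE)
    have "(\<lambda>y. pg \<T> D' y \<bullet> axis i 1) \<in> borel_measurable lebesgue" using pg_measurable_lebesgue[OF D'(1)] by measurable
    then show "(\<lambda>y. pg \<T> D' y $ i) \<in> borel_measurable lebesgue" by (simp add: inner_axis)
    show "(\<lambda>y. pg \<T> D y $ i * \<eta> (x - y) - \<zeta> y * grad \<eta> (x - y) $ i) \<in> borel_measurable lebesgue"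
      using i1 i2 by (intro borel_measurable_diff borel_measurable_integrable)
    show "AE y in lebesgue. pg \<T> D' y $ i = pg \<T> D y $ i * \<eta> (x - y) - \<zeta> y * grad \<eta> (x - y) $ i"
      using D'(2) by eventually_elim (simp add: mult.commute)
  qed
  also have "\<dots> = conv (\<lambda>y. pg \<T> D y $ i) \<eta> x - conv \<zeta> (\<lambda>x. grad \<eta> x $ i) x"
    unfolding conv_def by (rule Bochner_Integration.integral_diff[OF i1 i2])
  finally show ?thesis using grad_conv[OF zm U zR \<eta>, of x i] by simp
qed

text \<open>A field without distributional divergence is orthogonal to the gradients of piecewise smooth
  functions with compact support, since these are limits of gradients of test functions.\<close>

lemma divergence_free_orthogonal:
  assumes Z: "Z \<in> borel_measurable lebesgue" "\<And>x. norm (Z x) \<le> B" "\<And>x. x \<notin> \<Omega> \<Longrightarrow> Z x = 0"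
    and orth: "\<And>\<phi>. test_function \<Omega> \<phi> \<Longrightarrow> (LINT x|lebesgue. Z x \<bullet> grad \<phi> x) = 0"
    and pw: "pw \<T> \<zeta> P D" and K: "compact K" "K \<subseteq> \<Omega>" "\<And>x. \<zeta> x \<noteq> 0 \<Longrightarrow> x \<in> K"
  shows "(LINT x|lebesgue. Z x \<bullet> pg \<T> D x) = 0"
proof -
  have z: "\<And>x. x \<notin> \<Omega> \<Longrightarrow> \<zeta> x = 0" using K by blast
  obtain R where R: "\<And>x. x \<in> \<Omega> \<Longrightarrow> norm x \<le> R" using \<Omega>_norm_bound by blast
  obtain U where U: "\<And>x. \<bar>\<zeta> x\<bar> \<le> U" using pw_bounded_UNIV[OF pw z] by blast
  obtain M where M: "\<And>x. norm (pg \<T> D x) \<le> M" using pg_bounded[OF pw] by blast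
  obtain \<rho> where \<rho>: "\<rho> > 0" "(\<Union>x\<in>K. cball x \<rho>) \<subseteq> \<Omega>"
    using compact_subset_open_imp_cball_epsilon_subset[OF K(1) open_\<Omega> K(2)] by blast
  obtain \<eta> :: "nat \<Rightarrow> real^'n \<Rightarrow> real" where \<eta>: "\<And>k. smooth (\<eta> k)" "\<And>k x. 0 \<le> \<eta> k x"
    "\<And>k x. \<eta> k x \<noteq> 0 \<Longrightarrow> norm x \<le> \<rho> / real (Suc k)" "\<And>k. (LINT x|lebesgue. \<eta> k x) = 1"
    "(\<lambda>k. \<rho> / real (Suc k)) \<longlonglongrightarrow> 0" by (rule mollifier_sequence[OF \<rho>(1)]) blast
  have \<rho>k: "\<rho> / real (Suc k) \<le> \<rho>" for k using \<rho>(1) by (simp add: field_simps)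
  have \<eta>3: "\<eta> k x \<noteq> 0 \<Longrightarrow> norm x \<le> \<rho>" for k x using \<eta>(3)[of k x] \<rho>k[of k] by linarith
  have zm: "\<zeta> \<in> borel_measurable lebesgue" by (rule lebesgue_measurable_continuous[OF pw_continuous_UNIV[OF pw z]])
  have comp: "(\<lambda>y. V y $ i) \<in> borel_measurable lebesgue" if "V \<in> borel_measurable lebesgue" for V :: "real^'n \<Rightarrow> real^'n" and i
  proof -
    have "(\<lambda>y. V y \<bullet> axis i 1) \<in> borel_measurable lebesgue" using that by measurable
    then show ?thesis by (simp add: inner_axis)
  qed
  have pM: "\<bar>pg \<T> D x $ i\<bar> \<le> M" for x i using order_trans[OF component_le_norm_cart M] .
  have pR: "\<And>x i. pg \<T> D x $ i \<noteq> 0 \<Longrightarrow> norm x \<le> R" using pg_outside_\<Omega> R by force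
  have Zi: "integrable lebesgue (\<lambda>x. Z x $ i)" for i
    by (rule integrable_bounded_support[OF comp[OF Z(1)], of _ B R])
      (use Z(3) R order_trans[OF component_le_norm_cart Z(2)] in force)+
  have "AE x in lebesgue. x \<in> \<Omega> \<longrightarrow> isCont (pg \<T> D) x"
    by (rule AE_pg_isCont[OF pw_gradient_continuous[OF pw]])
  then have cont: "AE x in lebesgue. Z x $ i \<noteq> 0 \<longrightarrow> isCont (\<lambda>x. pg \<T> D x $ i) x" for i
  proof eventually_elim
    case (elim x)
    then show ?case using Z(3)[of x] by (auto intro: isCont_vec_nth)
  qed
  note lim = conv_integral_tendsto[OF comp[OF pg_measurable_lebesgue[OF pw]] pM pR \<eta> Zi cont]
  have "(\<lambda>k. \<Sum>i\<in>UNIV. LINT x|lebesgue. Z x $ i * conv (\<lambda>x. pg \<T> D x $ i) (\<eta> k) x)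
      \<longlonglongrightarrow> (\<Sum>i\<in>UNIV. LINT x|lebesgue. Z x $ i * pg \<T> D x $ i)"
    by (intro tendsto_sum lim(1))
  moreover have "(\<Sum>i\<in>UNIV. LINT x|lebesgue. Z x $ i * conv (\<lambda>x. pg \<T> D x $ i) (\<eta> k) x) = 0" for k
  proof -
    have "(\<Sum>i\<in>UNIV. LINT x|lebesgue. Z x $ i * conv (\<lambda>x. pg \<T> D x $ i) (\<eta> k) x)
        = (LINT x|lebesgue. (\<Sum>i\<in>UNIV. Z x $ i * conv (\<lambda>x. pg \<T> D x $ i) (\<eta> k) x))"
      by (rule Bochner_Integration.integral_sum[symmetric]) (rule lim(2))
    \<comment> \<open>The mollified elementwise gradient is the gradient of a test function, to
      which the hypothesis on Z applies.\<close>
    also have "\<dots> = (LINT x|lebesgue. Z x \<bullet> grad (conv \<zeta> (\<eta> k)) x)"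
      by (simp add: inner_vec_def conv_grad_pw[OF pw z \<eta>(1,3)])
    also have "\<dots> = 0" by (rule orth[OF test_function_conv[OF zm U K(3) \<eta>(1) \<eta>3 K(1) \<rho>(2)]])
    finally show ?thesis .
  qed
  ultimately have "(\<Sum>i\<in>UNIV. LINT x|lebesgue. Z x $ i * pg \<T> D x $ i) = 0"
    by (simp add: LIMSEQ_const_iff)
  then have "(LINT x|lebesgue. (\<Sum>i\<in>UNIV. Z x $ i * pg \<T> D x $ i)) = 0"
    by (subst Bochner_Integration.integral_sum[OF lim(3)])
  then show ?thesis by (simp add: inner_vec_def)
qed

text \<open>The product rule div (\<zeta> Z) = Z . grad \<zeta> for a field without divergence,
  tested with an H1 function. It is proved after mollification, where it is a pointwise identity,
  and then passed to the limit.\<close>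

lemma divergence_free_product_rule:
  assumes Z: "Z \<in> borel_measurable lebesgue" "\<And>x. norm (Z x) \<le> B" "\<And>x. x \<notin> \<Omega> \<Longrightarrow> Z x = 0"
    "AE x in lebesgue. x \<in> \<Omega> \<longrightarrow> isCont Z x"
    and orth: "\<And>\<phi>. test_function \<Omega> \<phi> \<Longrightarrow> (LINT x|lebesgue. Z x \<bullet> grad \<phi> x) = 0"
    and pw: "pw \<T> \<zeta> P D" and K: "compact K" "K \<subseteq> \<Omega>" "\<And>x. \<zeta> x \<noteq> 0 \<Longrightarrow> x \<in> K"
    and w: "has_weak_grad \<Omega> \<phi> w"
  shows "(LINT x|lebesgue_on \<Omega>. \<zeta> x * (Z x \<bullet> w x)) = - (LINT x|lebesgue_on \<Omega>. \<phi> x * (Z x \<bullet> pg \<T> D x))"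
proof -
  have z: "\<And>x. x \<notin> \<Omega> \<Longrightarrow> \<zeta> x = 0" using K by blast
  obtain R where R: "\<And>x. x \<in> \<Omega> \<Longrightarrow> norm x \<le> R" using \<Omega>_norm_bound by blast
  obtain U where U: "\<And>x. \<bar>\<zeta> x\<bar> \<le> U" using pw_bounded_UNIV[OF pw z] by blast
  obtain M where M: "\<And>x. norm (pg \<T> D x) \<le> M" using pg_bounded[OF pw] by blast
  obtain \<rho> where \<rho>: "\<rho> > 0" "(\<Union>x\<in>K. cball x \<rho>) \<subseteq> \<Omega>"
    using compact_subset_open_imp_cball_epsilon_subset[OF K(1) open_\<Omega> K(2)] by blast
  obtain \<eta> :: "nat \<Rightarrow> real^'n \<Rightarrow> real" where \<eta>: "\<And>k. smooth (\<eta> k)" "\<And>k x. 0 \<le> \<eta> k x"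
    "\<And>k x. \<eta> k x \<noteq> 0 \<Longrightarrow> norm x \<le> \<rho> / real (Suc k)" "\<And>k. (LINT x|lebesgue. \<eta> k x) = 1"
    "(\<lambda>k. \<rho> / real (Suc k)) \<longlonglongrightarrow> 0" by (rule mollifier_sequence[OF \<rho>(1)]) blast
  have \<rho>k: "\<rho> / real (Suc k) \<le> \<rho>" for k using \<rho>(1) by (simp add: field_simps)
  have \<eta>3: "\<eta> k x \<noteq> 0 \<Longrightarrow> norm x \<le> \<rho>" for k x using \<eta>(3)[of k x] \<rho>k[of k] by linarith
  have zc: "continuous_on UNIV \<zeta>" by (rule pw_continuous_UNIV[OF pw z])
  have zm: "\<zeta> \<in> borel_measurable lebesgue" by (rule lebesgue_measurable_continuous[OF zc])
  have pm: "pg \<T> D \<in> borel_measurable lebesgue" by (rule pg_measurable_lebesgue[OF pw])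
  have UB: "0 \<le> U" "0 \<le> B" "0 \<le> M" using U[of 0] order_trans[OF norm_ge_zero Z(2)[of 0]] order_trans[OF norm_ge_zero M[of 0]] by auto
  \<comment> \<open>The components of \<zeta> Z, and below the function r that is to be their
    divergence.\<close>
  define u where "u = (\<lambda>i x. \<zeta> x * Z x $ i)"
  define r where "r = (\<lambda>x. Z x \<bullet> pg \<T> D x)"
  have um: "u i \<in> borel_measurable lebesgue" for i
  proof -
    have "(\<lambda>y. \<zeta> y * (Z y \<bullet> axis i 1)) \<in> borel_measurable lebesgue" using Z(1) zm by measurable
    then show ?thesis by (simp add: inner_axis u_def)
  qed
  have uB: "\<bar>u i x\<bar> \<le> U * B" for i x
    unfolding u_def abs_mult using U[of x] order_trans[OF component_le_norm_cart Z(2)] UB by (intro mult_mono) auto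
  have uK: "u i x \<noteq> 0 \<Longrightarrow> x \<in> K" for i x using K(3) by (auto simp: u_def)
  have uR: "u i x \<noteq> 0 \<Longrightarrow> norm x \<le> R" for i x using uK K(2) R by blast
  have rm: "r \<in> borel_measurable lebesgue" unfolding r_def using Z(1) pm by measurable
  have rB: "\<bar>r x\<bar> \<le> B * M" for x
    unfolding r_def using Cauchy_Schwarz_ineq2[of "Z x" "pg \<T> D x"] mult_mono[OF Z(2) M UB(2) norm_ge_zero] by (rule order_trans)
  have rR: "r x \<noteq> 0 \<Longrightarrow> norm x \<le> R" for x using Z(3) R by (force simp: r_def)
  have \<phi>L: "\<phi> \<in> L2 \<Omega>" and wL: "w \<in> L2 \<Omega>"
    and ibp: "\<And>\<psi> i. test_function \<Omega> \<psi> \<Longrightarrow>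
      (LINT x|lebesgue_on \<Omega>. \<phi> x * grad \<psi> x $ i) = - (LINT x|lebesgue_on \<Omega>. \<psi> x * w x $ i)"
    using w unfolding has_weak_grad_iff[OF bounded_\<Omega> \<Omega>_sets] by auto
  have g\<phi>: "integrable lebesgue (\<lambda>x. indicator \<Omega> x * \<phi> x)"
    using L2_integrable[OF bounded_\<Omega> \<Omega>_sets \<phi>L] by (simp add: integral_lebesgue_on(2)[OF \<Omega>_sets])
  have gw: "integrable lebesgue (\<lambda>x. indicator \<Omega> x * w x $ i)" for i
    using L2_integrable[OF bounded_\<Omega> \<Omega>_sets L2_component[OF wL, of i]] by (simp add: integral_lebesgue_on(2)[OF \<Omega>_sets])
  have pgc: "AE x in lebesgue. x \<in> \<Omega> \<longrightarrow> isCont (pg \<T> D) x"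
    by (rule AE_pg_isCont[OF pw_gradient_continuous[OF pw]])
  have rc: "AE x in lebesgue. indicator \<Omega> x * \<phi> x \<noteq> 0 \<longrightarrow> isCont r x"
    using pgc Z(4)
  proof eventually_elim
    case (elim x)
    then show ?case unfolding r_def by (auto simp: indicator_def intro!: continuous_intros)
  qed
  have uc: "AE x in lebesgue. indicator \<Omega> x * w x $ i \<noteq> 0 \<longrightarrow> isCont (u i) x" for i
    using Z(4)
  proof eventually_elim
    case (elim x)
    have "isCont \<zeta> x" using zc by (simp add: continuous_on_eq_continuous_at)
    then show ?case using elim unfolding u_def by (auto simp: indicator_def intro!: continuous_intros isCont_vec_nth)
  qed
  \<comment> \<open>The product of \<zeta> with the reflected mollifier is supported in K, so Z is
    orthogonal to its gradient; the two terms of that gradient are the two convolutions.\<close>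
  have divergence: "(\<Sum>i\<in>UNIV. grad (conv (u i) (\<eta> k)) x $ i) = conv r (\<eta> k) x" for k x
  proof -
    obtain C where C: "\<And>x. \<bar>\<eta> k x\<bar> \<le> C" using smooth_bounded[OF \<eta>(1,3)] by metis
    obtain C' where C': "\<And>x. norm (grad (\<eta> k) x) \<le> C'" using grad_bounded[OF \<eta>(1,3)] by metis
    have i1: "integrable lebesgue (\<lambda>y. r y * \<eta> k (x - y))"
      by (rule integrable_conv[OF rm rB rR smooth_continuous[OF \<eta>(1)] C])
    have i2: "integrable lebesgue (\<lambda>y. u i y * grad (\<eta> k) (x - y) $ i)" for i
      by (rule integrable_conv[where \<eta> = "\<lambda>z. grad (\<eta> k) z $ i", OF um[of i] uB[of i] uR[of i] smooth_continuous[OF smooth_grad[OF \<eta>(1)]]])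
        (assumption, rule order_trans[OF component_le_norm_cart C'])
    obtain P' D' where D': "pw \<T> (\<lambda>y. \<zeta> y * \<eta> k (x - y)) P' D'"
      "AE y in lebesgue. pg \<T> D' y = \<eta> k (x - y) *\<^sub>R pg \<T> D y - \<zeta> y *\<^sub>R grad (\<eta> k) (x - y)"
      by (rule pw_reflect[OF pw z \<eta>(1)])
    have "0 = (LINT y|lebesgue. Z y \<bullet> pg \<T> D' y)"
      by (rule divergence_free_orthogonal[OF Z(1-3) orth D'(1) K(1,2), symmetric]) (use K(3) in auto)
    also have "\<dots> = (LINT y|lebesgue. r y * \<eta> k (x - y) - (\<Sum>i\<in>UNIV. u i y * grad (\<eta> k) (x - y) $ i))"
    proof (rule integral_cong_AE)
      show "(\<lambda>y. Z y \<bullet> pg \<T> D' y) \<in> borel_measurable lebesgue" using Z(1) pg_measurable_lebesgue[OF D'(1)] by measurable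
      show "(\<lambda>y. r y * \<eta> k (x - y) - (\<Sum>i\<in>UNIV. u i y * grad (\<eta> k) (x - y) $ i)) \<in> borel_measurable lebesgue"
        using i1 i2 by (intro borel_measurable_diff borel_measurable_sum borel_measurable_integrable)
      show "AE y in lebesgue. Z y \<bullet> pg \<T> D' y = r y * \<eta> k (x - y) - (\<Sum>i\<in>UNIV. u i y * grad (\<eta> k) (x - y) $ i)"
        using D'(2)
      proof eventually_elim
        case (elim y)
        have "(\<Sum>i\<in>UNIV. u i y * grad (\<eta> k) (x - y) $ i) = \<zeta> y * (Z y \<bullet> grad (\<eta> k) (x - y))"
          by (simp add: u_def inner_vec_def sum_distrib_left mult.assoc)
        then show ?case unfolding elim r_def by (simp add: inner_diff_right mult.commute)
      qed
    qed
    also have "\<dots> = conv r (\<eta> k) x - (\<Sum>i\<in>UNIV. conv (u i) (\<lambda>x. grad (\<eta> k) x $ i) x)"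
      unfolding conv_def using i1 i2
      by (subst Bochner_Integration.integral_diff) (simp_all add: Bochner_Integration.integral_sum)
    finally show ?thesis using grad_conv[OF um uB uR \<eta>(1,3)] by simp
  qed
  note l1 = conv_integral_tendsto[where \<eta> = \<eta>, OF rm rB rR \<eta> g\<phi> rc]
    and l2 = conv_integral_tendsto[where \<eta> = \<eta>, OF um uB uR \<eta> gw uc]
  \<comment> \<open>The components of the mollified field are test functions, so the weak gradient
    of \<phi> can be tested with each of them; \<phi> itself is not smoothed.\<close>
  have eq: "(LINT x|lebesgue. (indicator \<Omega> x * \<phi> x) * conv r (\<eta> k) x)
      = - (\<Sum>i\<in>UNIV. LINT x|lebesgue. (indicator \<Omega> x * w x $ i) * conv (u i) (\<eta> k) x)" for k
  proof -
    note t = test_function_conv[OF um uB uK \<eta>(1) \<eta>3 K(1) \<rho>(2)]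
    have i3: "integrable (lebesgue_on \<Omega>) (\<lambda>x. \<phi> x * grad (conv (u i) (\<eta> k)) x $ i)" for i
    proof -
      have s: "smooth (conv (u i) (\<eta> k))" using t by (simp add: test_function_def)
      have "(\<lambda>x. grad (conv (u i) (\<eta> k)) x $ i) \<in> L2 \<Omega>"
        by (rule continuous_L2[OF smooth_continuous[OF smooth_grad[OF s]] bounded_\<Omega> \<Omega>_sets])
      then show ?thesis using L2_inner_integrable[OF \<phi>L] by force
    qed
    have "(LINT x|lebesgue. (indicator \<Omega> x * \<phi> x) * conv r (\<eta> k) x) = (LINT x|lebesgue_on \<Omega>. \<phi> x * conv r (\<eta> k) x)"
      by (simp add: integral_lebesgue_on(1)[OF \<Omega>_sets] mult.assoc)
    also have "\<dots> = (LINT x|lebesgue_on \<Omega>. (\<Sum>i\<in>UNIV. \<phi> x * grad (conv (u i) (\<eta> k)) x $ i))"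
      by (simp add: divergence[symmetric] sum_distrib_left)
    also have "\<dots> = (\<Sum>i\<in>UNIV. LINT x|lebesgue_on \<Omega>. \<phi> x * grad (conv (u i) (\<eta> k)) x $ i)"
      by (rule Bochner_Integration.integral_sum) (rule i3)
    also have "\<dots> = (\<Sum>i\<in>UNIV. - (LINT x|lebesgue_on \<Omega>. conv (u i) (\<eta> k) x * w x $ i))"
      by (intro sum.cong refl ibp t)
    also have "\<dots> = - (\<Sum>i\<in>UNIV. LINT x|lebesgue. (indicator \<Omega> x * w x $ i) * conv (u i) (\<eta> k) x)"
      unfolding sum_negf by (intro arg_cong[where f = uminus] sum.cong refl) (simp add: integral_lebesgue_on(1)[OF \<Omega>_sets] mult_ac)
    finally show ?thesis .
  qed
  have "(LINT x|lebesgue. (indicator \<Omega> x * \<phi> x) * r x)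
      = - (\<Sum>i\<in>UNIV. LINT x|lebesgue. (indicator \<Omega> x * w x $ i) * u i x)"
  proof (rule LIMSEQ_unique)
    show "(\<lambda>k. LINT x|lebesgue. (indicator \<Omega> x * \<phi> x) * conv r (\<eta> k) x) \<longlonglongrightarrow> (LINT x|lebesgue. (indicator \<Omega> x * \<phi> x) * r x)"
      by (rule l1(1))
    show "(\<lambda>k. LINT x|lebesgue. (indicator \<Omega> x * \<phi> x) * conv r (\<eta> k) x)
        \<longlonglongrightarrow> - (\<Sum>i\<in>UNIV. LINT x|lebesgue. (indicator \<Omega> x * w x $ i) * u i x)"
      unfolding eq by (intro tendsto_minus tendsto_sum l2(1))
  qed
  also have "(\<Sum>i\<in>UNIV. LINT x|lebesgue. (indicator \<Omega> x * w x $ i) * u i x)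
      = (LINT x|lebesgue. (\<Sum>i\<in>UNIV. (indicator \<Omega> x * w x $ i) * u i x))"
    by (rule Bochner_Integration.integral_sum[symmetric]) (rule l2(3))
  also have "\<dots> = (LINT x|lebesgue. indicator \<Omega> x * (\<zeta> x * (Z x \<bullet> w x)))"
    by (intro Bochner_Integration.integral_cong refl) (simp add: u_def inner_vec_def sum_distrib_left mult_ac)
  finally show ?thesis
    by (simp add: integral_lebesgue_on(1)[OF \<Omega>_sets] r_def mult.assoc)
qed

end

section \<open>Solenoidal fields\<close>

context mesh_domain
begin

text \<open>The normal trace of the interpolant vanishes on the boundary only in the weak sense tested by
  functions in \<open>H\<^sup>1\<close>. This is where the cutoffs are needed: their flux is bounded in \<open>L\<^sup>2\<close> and
  tends to zero pointwise, so its product with any \<open>L\<^sup>2\<close> function tends to zero.\<close>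

lemma BDM1_L2_sigma:
  assumes n: "unit_face_normals \<T> n" and v: "v \<in> V_h0 \<Omega> \<T> n" and X: "is_BDM1_interpolant \<Omega> \<T> n v X"
  shows "X \<in> L2_sigma \<Omega>"
proof -
  have vV: "v \<in> V_h \<Omega> \<T> n" using v by (simp add: V_h0_def)
  have q: "has_weak_div \<Omega> X (weak_div \<Omega> X)"
    using X by (intro has_weak_div_weak_div) (simp add: is_BDM1_interpolant_def)
  have q0: "AE x in lebesgue_on \<Omega>. weak_div \<Omega> X x = 0" by (rule BDM1_divergence_free[OF n v X])
  have XL: "X \<in> L2 \<Omega>" and qL: "weak_div \<Omega> X \<in> L2 \<Omega>" using q by (auto simp: has_weak_div_def)
  have "\<forall>T\<in>\<T>. \<exists>c. \<forall>x\<in>interior T. X x = fst c *v x + snd c"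
    using X unfolding is_BDM1_interpolant_def P1_vec_def by fastforce
  then obtain c where c: "\<forall>T\<in>\<T>. \<forall>x\<in>interior T. X x = fst (c T) *v x + snd (c T)"
    using bchoice[of \<T> "\<lambda>T c. \<forall>x\<in>interior T. X x = fst c *v x + snd c"] by blast
  define Y where "Y = (\<lambda>T x. fst (c T) *v x + snd (c T))"
  have XY: "X x = Y T x" if "T \<in> \<T>" "x \<in> interior T" for T x using c that by (simp add: Y_def)
  have Yc: "continuous_on UNIV (Y T)" for T
    unfolding Y_def by (intro continuous_on_add continuous_on_const linear_continuous_on matrix_vector_mul_bounded_linear)
  have trace: "\<exists>\<gamma>. \<forall>x. Y T x \<bullet> bgrad T a = \<gamma> * bary T a x" if "T \<in> \<T>" "a \<in> vert T" "opp T a \<subseteq> frontier \<Omega>" for T a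
    unfolding Y_def by (rule BDM1_normal_trace[OF n vV X that]) (use XY[OF that(1)] in \<open>simp add: Y_def\<close>)
  \<comment> \<open>A bounded Borel representative of X on the whole space, zero outside
    \<open>\<Omega>\<close>; X itself is unconstrained on the skeleton.\<close>
  define Z where "Z = pg \<T> Y"
  have Zb: "Z \<in> borel_measurable borel" unfolding Z_def by (rule pg_measurable_continuous[OF Yc])
  then have Zm: "Z \<in> borel_measurable lebesgue" by (simp add: measurable_completion)
  obtain B where B: "\<And>x. norm (Z x) \<le> B" using pg_bounded_continuous[of Y, OF Yc] unfolding Z_def by blast
  have Z0: "\<And>x. x \<notin> \<Omega> \<Longrightarrow> Z x = 0" unfolding Z_def by (rule pg_outside_\<Omega>)
  have Zc: "AE x in lebesgue. x \<in> \<Omega> \<longrightarrow> isCont Z x" unfolding Z_def by (rule AE_pg_isCont[OF Yc])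
  have XZ: "AE x in lebesgue_on \<Omega>. X x = Z x"
    using AE_interior_\<Omega> by eventually_elim (auto simp: Z_def pg_interior XY)
  have ZL: "Z \<in> L2 \<Omega>" by (rule L2_cong_AE[OF \<Omega>_sets XL XZ])
  have orth: "(LINT x|lebesgue. Z x \<bullet> grad \<phi> x) = 0" if \<phi>: "test_function \<Omega> \<phi>" for \<phi>
  proof -
    have s: "smooth \<phi>" using \<phi> by (simp add: test_function_def)
    have \<phi>L: "\<phi> \<in> L2 \<Omega>" and gL: "grad \<phi> \<in> L2 \<Omega>"
      by (intro continuous_L2[OF _ bounded_\<Omega> \<Omega>_sets] smooth_continuous smooth_grad_continuous s)+
    have "(LINT x|lebesgue. Z x \<bullet> grad \<phi> x) = L2_inner \<Omega> Z (grad \<phi>)"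
      unfolding L2_inner_def integral_lebesgue_on(1)[OF \<Omega>_sets]
    proof (intro Bochner_Integration.integral_cong refl)
      show "Z x \<bullet> grad \<phi> x = indicator \<Omega> x * (Z x \<bullet> grad \<phi> x)" for x using Z0[of x] by (cases "x \<in> \<Omega>") simp_all
    qed
    also have "\<dots> = L2_inner \<Omega> X (grad \<phi>)" by (rule L2_inner_cong_AE[OF \<Omega>_sets XL gL XZ, symmetric])
    also have "\<dots> = - L2_inner \<Omega> (weak_div \<Omega> X) \<phi>" using q \<phi> by (simp add: has_weak_div_def)
    also have "L2_inner \<Omega> (weak_div \<Omega> X) \<phi> = L2_inner \<Omega> (\<lambda>x. 0) \<phi>" by (rule L2_inner_cong_AE[OF \<Omega>_sets qL \<phi>L q0])
    finally show ?thesis by (simp add: L2_inner_def)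
  qed
  \<comment> \<open>The shift keeps all values above 6, where \<open>cutoff_flux_L2_bound\<close> is
    valid.\<close>
  define m where "m = (\<lambda>k::nat. real k + 7)"
  have m6: "m k > 6" for k by (simp add: m_def)
  have mlim: "filterlim m at_top sequentially"
    by (rule filterlim_at_top_mono[OF filterlim_real_sequentially]) (simp add: m_def)
  define r where "r = (\<lambda>k x. Z x \<bullet> pg \<T> (cutoff_grad (m k)) x)"
  have near: "AE x in lebesgue_on \<Omega>. \<forall>\<^sub>F k in sequentially. cutoff (m k) x = 1 \<and> r k x = 0"
    using AE_interior_\<Omega>
  proof eventually_elim
    case (elim x)
    then obtain T where T: "T \<in> \<T>" "x \<in> interior T" by blast
    have "\<forall>\<^sub>F k in sequentially. cutoff (m k) x = 1 \<and> cutoff_grad (m k) T x = 0"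
      using filterlim_iff[THEN iffD1, OF mlim] cutoff_eventually[OF T] by blast
    then show ?case by eventually_elim (simp add: r_def pg_interior[OF T])
  qed
  obtain C where C: "\<And>k. L2_inner \<Omega> (r k) (r k) \<le> C"
    using cutoff_flux_L2_bound[of Y, OF Yc trace] m6 unfolding r_def Z_def by blast
  have rm: "r k \<in> borel_measurable (lebesgue_on \<Omega>)" for k
  proof -
    have "r k \<in> borel_measurable lebesgue"
      unfolding r_def using Zm pg_measurable_lebesgue[OF pw_cutoff] by measurable
    then show ?thesis by (rule measurable_restrict_space1)
  qed
  have rL: "r k \<in> L2 \<Omega>" for k
  proof -
    obtain M where M: "\<And>x. norm (pg \<T> (cutoff_grad (m k)) x) \<le> M" using pg_bounded[OF pw_cutoff] by blast
    have B0: "0 \<le> B" using order_trans[OF norm_ge_zero B[of 0]] .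
    show ?thesis
    proof (rule bounded_L2[OF bounded_\<Omega> \<Omega>_sets rm])
      show "norm (r k x) \<le> B * M" for x
        unfolding r_def real_norm_def
        using Cauchy_Schwarz_ineq2 mult_mono[OF B M B0 norm_ge_zero] by (rule order_trans)
    qed
  qed
  have "L2_inner \<Omega> X (weak_grad \<Omega> \<phi>) = 0" if "\<phi> \<in> H1 \<Omega>" for \<phi>
  proof -
    let ?w = "weak_grad \<Omega> \<phi>"
    have w: "has_weak_grad \<Omega> \<phi> ?w" by (rule has_weak_grad_weak_grad[OF that])
    then have \<phi>L: "\<phi> \<in> L2 \<Omega>" and wL: "?w \<in> L2 \<Omega>" by (auto simp: has_weak_grad_def)
    have iw: "integrable (lebesgue_on \<Omega>) (\<lambda>x. Z x \<bullet> ?w x)" by (rule L2_inner_integrable[OF ZL wL])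
    have "(\<lambda>k. LINT x|lebesgue_on \<Omega>. cutoff (m k) x * (Z x \<bullet> ?w x)) \<longlonglongrightarrow> (LINT x|lebesgue_on \<Omega>. Z x \<bullet> ?w x)"
    proof (rule integral_dominated_convergence[where w = "\<lambda>x. \<bar>Z x \<bullet> ?w x\<bar>"])
      show "(\<lambda>x. Z x \<bullet> ?w x) \<in> borel_measurable (lebesgue_on \<Omega>)" using iw by (rule borel_measurable_integrable)
      then show "(\<lambda>x. cutoff (m k) x * (Z x \<bullet> ?w x)) \<in> borel_measurable (lebesgue_on \<Omega>)" for k
        by (intro borel_measurable_times pw_measurable[OF pw_cutoff])
      show "AE x in lebesgue_on \<Omega>. (\<lambda>k. cutoff (m k) x * (Z x \<bullet> ?w x)) \<longlonglongrightarrow> Z x \<bullet> ?w x"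
        using near
      proof eventually_elim
        case (elim x)
        show ?case by (rule tendsto_eventually) (use elim in eventually_elim, simp)
      qed
      show "AE x in lebesgue_on \<Omega>. norm (cutoff (m k) x * (Z x \<bullet> ?w x)) \<le> \<bar>Z x \<bullet> ?w x\<bar>" for k
        by (intro always_eventually allI) (simp add: abs_mult cutoff_bounds mult_left_le_one_le)
    qed (use iw in simp)
    moreover have "(LINT x|lebesgue_on \<Omega>. cutoff (m k) x * (Z x \<bullet> ?w x)) = - L2_inner \<Omega> \<phi> (r k)" for k
      unfolding L2_inner_def inner_real_def r_def
      by (rule divergence_free_product_rule[OF Zm B Z0 Zc orth pw_cutoff compact_cutoff_support cutoff_support_subset cutoff_support w])
    ultimately have lim: "(\<lambda>k. - L2_inner \<Omega> \<phi> (r k)) \<longlonglongrightarrow> L2_inner \<Omega> Z ?w" by (simp add: L2_inner_def)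
    \<comment> \<open>The restriction of \<phi> to the set where the flux is nonzero. It has the
      same inner product with \<open>r k\<close>, and its norm tends to zero by dominated
      convergence.\<close>
    define h where "h = (\<lambda>k x. (if r k x = 0 then 0 else 1) *\<^sub>R \<phi> x)"
    have hL: "h k \<in> L2 \<Omega>" for k
      unfolding h_def
    proof (rule L2_mult_bounded[OF \<phi>L, of _ 1])
      show "(\<lambda>x. if r k x = 0 then 0 else 1) \<in> borel_measurable (lebesgue_on \<Omega>)" using rm[of k] by measurable
    qed simp
    have h0: "(\<lambda>k. L2_inner \<Omega> (h k) (h k)) \<longlonglongrightarrow> (LINT x|lebesgue_on \<Omega>. 0)"
      unfolding L2_inner_def
    proof (rule integral_dominated_convergence[where w = "\<lambda>x. \<phi> x \<bullet> \<phi> x"])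
      show "AE x in lebesgue_on \<Omega>. (\<lambda>k. h k x \<bullet> h k x) \<longlonglongrightarrow> 0"
        using near
      proof eventually_elim
        case (elim x)
        show ?case by (rule tendsto_eventually) (use elim in eventually_elim, simp add: h_def)
      qed
      show "AE x in lebesgue_on \<Omega>. norm (h k x \<bullet> h k x) \<le> \<phi> x \<bullet> \<phi> x" for k
        by (intro always_eventually allI) (simp add: h_def)
      show "(\<lambda>x. h k x \<bullet> h k x) \<in> borel_measurable (lebesgue_on \<Omega>)" for k
        by (intro borel_measurable_inner L2_measurable[OF hL])
    qed (use L2_inner_integrable[OF \<phi>L \<phi>L] in auto)
    have "(\<lambda>k. L2_inner \<Omega> \<phi> (r k)) \<longlonglongrightarrow> 0"
    proof (rule tendsto_0_if_square)
      fix k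
      have "L2_inner \<Omega> \<phi> (r k) = L2_inner \<Omega> (h k) (r k)"
        unfolding L2_inner_def by (intro Bochner_Integration.integral_cong refl) (simp add: h_def)
      then have "(L2_inner \<Omega> \<phi> (r k))\<^sup>2 \<le> L2_inner \<Omega> (h k) (h k) * L2_inner \<Omega> (r k) (r k)"
        using L2_Cauchy_Schwarz[OF hL rL] by simp
      also have "\<dots> \<le> L2_inner \<Omega> (h k) (h k) * C" by (intro mult_left_mono C L2_inner_self_nonneg)
      finally show "(L2_inner \<Omega> \<phi> (r k))\<^sup>2 \<le> L2_inner \<Omega> (h k) (h k) * C" .
    qed (use h0 in simp)
    then have "(\<lambda>k. - L2_inner \<Omega> \<phi> (r k)) \<longlonglongrightarrow> 0" using tendsto_minus by force
    then have "L2_inner \<Omega> Z ?w = 0" using LIMSEQ_unique lim by blast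
    then show ?thesis using L2_inner_cong_AE[OF \<Omega>_sets XL wL XZ] by simp
  qed
  then show ?thesis using XL by (simp add: L2_sigma_def)
qed

end

text \<open>\<open>L2_sigma\<close> is cut out by orthogonality relations, which pass to limits in
  the L2 seminorm. It is therefore closed, and the choice behind \<open>helmholtz_projector\<close>
  is a genuine projection.\<close>

lemma helmholtz_projection:
  assumes w: "w \<in> L2 \<Omega>"
  shows "is_L2_projection \<Omega> (L2_sigma \<Omega>) w (helmholtz_projector \<Omega> w)"
proof -
  have g: "weak_grad \<Omega> \<phi> \<in> L2 \<Omega>" if "\<phi> \<in> H1 \<Omega>" for \<phi>
    using has_weak_grad_weak_grad[OF that] by (simp add: has_weak_grad_def)
  have "\<exists>z. is_L2_projection \<Omega> (L2_sigma \<Omega>) w z"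
  proof (rule L2_projection_exists[OF _ _ _ _ _ w])
    fix s z assume s: "\<And>k::nat. s k \<in> L2_sigma \<Omega>" and z: "z \<in> L2 \<Omega>"
      and lim: "(\<lambda>k. L2_inner \<Omega> (\<lambda>x. s k x - z x) (\<lambda>x. s k x - z x)) \<longlonglongrightarrow> 0"
    have sL: "s k \<in> L2 \<Omega>" for k using s by (simp add: L2_sigma_def)
    have "L2_inner \<Omega> z (weak_grad \<Omega> \<phi>) = 0" if \<phi>: "\<phi> \<in> H1 \<Omega>" for \<phi>
    proof -
      have "(\<lambda>k. L2_inner \<Omega> (\<lambda>x. s k x - z x) (weak_grad \<Omega> \<phi>)) \<longlonglongrightarrow> 0"
        by (rule L2_inner_tendsto_0[OF L2_diff[OF sL z] g[OF \<phi>] lim])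
      moreover have "L2_inner \<Omega> (\<lambda>x. s k x - z x) (weak_grad \<Omega> \<phi>) = - L2_inner \<Omega> z (weak_grad \<Omega> \<phi>)" for k
        using s[of k] \<phi> by (simp add: L2_inner_diff_left[OF sL z g[OF \<phi>]] L2_sigma_def)
      ultimately show ?thesis by (simp add: LIMSEQ_const_iff)
    qed
    then show "z \<in> L2_sigma \<Omega>" using z by (simp add: L2_sigma_def)
  next
    fix s t assume "s \<in> L2_sigma \<Omega>" "t \<in> L2_sigma \<Omega>"
    then show "(\<lambda>x. s x + t x) \<in> L2_sigma \<Omega>" by (simp add: L2_sigma_def L2_add L2_inner_add_left g)
  next
    fix s and c :: real assume "s \<in> L2_sigma \<Omega>"
    then show "(\<lambda>x. c *\<^sub>R s x) \<in> L2_sigma \<Omega>" by (simp add: L2_sigma_def L2_scale L2_inner_scale_left)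
  qed (auto simp: L2_sigma_def L2_zero L2_inner_def)
  then show ?thesis unfolding helmholtz_projector_def L2_proj_def by (rule someI_ex)
qed

lemma Linfty_L2:
  fixes g :: "real^'n \<Rightarrow> 'b::euclidean_space"
  assumes "g \<in> Linfty S" "bounded S" "S \<in> sets lebesgue"
  shows "g \<in> L2 S"
proof -
  obtain C where m: "g \<in> borel_measurable (lebesgue_on S)" and C: "AE x in lebesgue_on S. norm (g x) \<le> C"
    using assms(1) by (auto simp: Linfty_def)
  have "integrable (lebesgue_on S) (\<lambda>x. (norm (g x))\<^sup>2)"
  proof (rule finite_measure.integrable_const_bound[OF finite_measure_lebesgue_on[OF assms(2,3)], of _ "C\<^sup>2"])
    show "AE x in lebesgue_on S. norm ((norm (g x))\<^sup>2) \<le> C\<^sup>2"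
      using C by eventually_elim (simp add: power_mono)
  qed (use m in measurable)
  then show ?thesis using m by (simp add: L2_def)
qed

section \<open>Additivity of the symmetric gradient and the final identity\<close>

context mesh_domain
begin

lemma sym_grad_L2:
  assumes "v \<in> V_h \<Omega> \<T> n"
  shows "sym_grad \<Omega> v \<in> L2 \<Omega>"
proof -
  have w: "weak_grad \<Omega> (\<lambda>y. v y $ i) \<in> L2 \<Omega>" for i
    using has_weak_grad_weak_grad[OF V_h_weak_grad[OF assms, of i]] by (simp add: has_weak_grad_def)
  have "(\<lambda>x. \<chi> i. weak_grad \<Omega> (\<lambda>y. v y $ i) x) \<in> L2 \<Omega>" by (rule L2_vec[OF w])
  moreover have "(\<lambda>x. \<chi> i. \<chi> j. weak_grad \<Omega> (\<lambda>y. v y $ j) x $ i) \<in> L2 \<Omega>" by (intro L2_vec L2_component w)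
  ultimately show ?thesis
    unfolding sym_grad_def[abs_def] weak_jacobian_def transpose_def by (intro L2_scale L2_add) simp_all
qed

text \<open>\<open>weak_grad\<close> is chosen separately for each function, so additivity has to
  come from uniqueness and holds almost everywhere only.\<close>

lemma sym_grad_add:
  assumes u: "u \<in> V_h \<Omega> \<T> n" "u' \<in> V_h \<Omega> \<T> n" "u'' \<in> V_h \<Omega> \<T> n" and eq: "AE x in lebesgue_on \<Omega>. u x = u' x + u'' x"
  shows "AE x in lebesgue_on \<Omega>. sym_grad \<Omega> u x = sym_grad \<Omega> u' x + sym_grad \<Omega> u'' x"
proof -
  note w = has_weak_grad_weak_grad[OF V_h_weak_grad]
  have "AE x in lebesgue_on \<Omega>. weak_grad \<Omega> (\<lambda>y. u y $ i) x
      = weak_grad \<Omega> (\<lambda>y. u' y $ i) x + weak_grad \<Omega> (\<lambda>y. u'' y $ i) x" for i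
    by (rule weak_grad_unique[OF open_\<Omega> bounded_\<Omega> w[OF u(1)] has_weak_grad_add[OF bounded_\<Omega> \<Omega>_sets w[OF u(2)] w[OF u(3)]]])
      (use eq in eventually_elim, simp)
  then have "AE x in lebesgue_on \<Omega>. \<forall>i. weak_grad \<Omega> (\<lambda>y. u y $ i) x
      = weak_grad \<Omega> (\<lambda>y. u' y $ i) x + weak_grad \<Omega> (\<lambda>y. u'' y $ i) x"
    by (simp add: eventually_all_finite)
  then show ?thesis
    by eventually_elim (simp add: sym_grad_def weak_jacobian_def transpose_def vec_eq_iff algebra_simps)
qed

end

theorem theorem4p1:
  fixes \<Omega> :: "(real^'n) set"
    and \<T> :: "(real^'n) set set"
    and n\<^sub>F :: "(real^'n) set \<Rightarrow> real^'n"
    and Pi_h :: "(real^'n \<Rightarrow> real^'n) \<Rightarrow> (real^'n \<Rightarrow> real^'n)"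
    and f g u u\<^sub>0 u\<^sub>p :: "real^'n \<Rightarrow> real^'n"
    and p \<rho> :: "real^'n \<Rightarrow> real"
    and \<mu> lam lam_min c M \<kappa> :: real
  assumes dim: "CARD('n) \<in> {2, 3}"
    and domain: "polyhedral_lipschitz_domain \<Omega>"
    and f: "f \<in> L2 \<Omega>" and g: "g \<in> Linfty \<Omega>"
    and "\<mu> > 0" and "lam \<ge> lam_min" and "lam_min > - 2 * \<mu>" and "c > 0" and "M > 0"
    and mesh: "mesh_of \<Omega> \<T>" "shape_regular \<kappa> \<T>"
    and normals: "unit_face_normals \<T> n\<^sub>F"
    and BDM1: "\<And>v. v \<in> V_h \<Omega> \<T> n\<^sub>F \<Longrightarrow> is_BDM1_interpolant \<Omega> \<T> n\<^sub>F v (Pi_h v)"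
    and solution: "discrete_solution \<Omega> \<T> n\<^sub>F Pi_h \<mu> lam c M f g u p \<rho>"
    and split: "u\<^sub>0 \<in> V_h0 \<Omega> \<T> n\<^sub>F" "u\<^sub>p \<in> V_h_perp \<Omega> \<T> n\<^sub>F"
      "AE x in lebesgue_on \<Omega>. u x = u\<^sub>0 x + u\<^sub>p x"
  shows "\<forall>v\<in>V_h0 \<Omega> \<T> n\<^sub>F.
           form_a1 \<Omega> \<mu> u\<^sub>0 v = form_F \<Omega> f (Pi_h v) + form_G \<Omega> g \<rho> (Pi_h v) \<and>
           form_F \<Omega> f (Pi_h v) + form_G \<Omega> g \<rho> (Pi_h v)
             = L2_inner \<Omega> (helmholtz_projector \<Omega> (\<lambda>x. f x + \<rho> x *\<^sub>R g x)) (Pi_h v)"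
proof
  interpret mesh_domain \<Omega> \<T> by unfold_locales (fact dim domain mesh(1))+
  have uV: "u \<in> V_h \<Omega> \<T> n\<^sub>F" and pP: "p \<in> P0 \<T>" and \<rho>P: "\<rho> \<in> P0 \<T>"
    and eq: "\<And>v. v \<in> V_h \<Omega> \<T> n\<^sub>F \<Longrightarrow>
      form_a1 \<Omega> \<mu> u v + form_a2 \<Omega> lam (Pi_h u) (Pi_h v) + form_b \<Omega> p v = form_F \<Omega> f (Pi_h v) + form_G \<Omega> g \<rho> (Pi_h v)"
    using solution unfolding discrete_solution_def by blast+
  have u0V: "u\<^sub>0 \<in> V_h \<Omega> \<T> n\<^sub>F" and upV: "u\<^sub>p \<in> V_h \<Omega> \<T> n\<^sub>F" using split by (auto simp: V_h0_def V_h_perp_def)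
  fix v assume v: "v \<in> V_h0 \<Omega> \<T> n\<^sub>F"
  then have vV: "v \<in> V_h \<Omega> \<T> n\<^sub>F" by (simp add: V_h0_def)
  note X = BDM1[OF vV]
  have divL: "weak_div \<Omega> (Pi_h w) \<in> L2 \<Omega>" if "w \<in> V_h \<Omega> \<T> n\<^sub>F" for w
  proof -
    have "Pi_h w \<in> Hdiv \<Omega>" using BDM1[OF that] by (simp add: is_BDM1_interpolant_def)
    then show ?thesis using has_weak_div_weak_div[of "Pi_h w" \<Omega>] by (simp add: has_weak_div_def)
  qed
  have "L2_inner \<Omega> (sym_grad \<Omega> u) (sym_grad \<Omega> v) = L2_inner \<Omega> (\<lambda>x. sym_grad \<Omega> u\<^sub>0 x + sym_grad \<Omega> u\<^sub>p x) (sym_grad \<Omega> v)"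
    by (rule L2_inner_cong_AE[OF \<Omega>_sets sym_grad_L2[OF uV] sym_grad_L2[OF vV] sym_grad_add[OF uV u0V upV split(3)]])
  also have "\<dots> = L2_inner \<Omega> (sym_grad \<Omega> u\<^sub>0) (sym_grad \<Omega> v) + L2_inner \<Omega> (sym_grad \<Omega> u\<^sub>p) (sym_grad \<Omega> v)"
    by (rule L2_inner_add_left[OF sym_grad_L2[OF u0V] sym_grad_L2[OF upV] sym_grad_L2[OF vV]])
  also have "L2_inner \<Omega> (sym_grad \<Omega> u\<^sub>p) (sym_grad \<Omega> v) = 0" using split(2) v by (simp add: V_h_perp_def)
  finally have a1: "form_a1 \<Omega> \<mu> u v = form_a1 \<Omega> \<mu> u\<^sub>0 v" by (simp add: form_a1_def)
  have "L2_inner \<Omega> (weak_div \<Omega> (Pi_h v)) (weak_div \<Omega> (Pi_h u)) = L2_inner \<Omega> (\<lambda>x. 0) (weak_div \<Omega> (Pi_h u))"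
    by (rule L2_inner_cong_AE[OF \<Omega>_sets divL[OF vV] divL[OF uV] BDM1_divergence_free[OF normals v X]])
  then have a2: "form_a2 \<Omega> lam (Pi_h u) (Pi_h v) = 0"
    by (simp add: form_a2_def L2_inner_commute[of \<Omega> "weak_div \<Omega> (Pi_h u)"]) (simp add: L2_inner_def)
  have b: "form_b \<Omega> p v = 0"
    using V_h0_div_orthogonal[OF v pP] by (simp add: form_b_def L2_inner_commute[of \<Omega> p])
  let ?w = "\<lambda>x. f x + \<rho> x *\<^sub>R g x"
  have XS: "Pi_h v \<in> L2_sigma \<Omega>" by (rule BDM1_L2_sigma[OF normals v X])
  then have XL: "Pi_h v \<in> L2 \<Omega>" by (simp add: L2_sigma_def)
  \<comment> \<open>A piecewise constant density is bounded almost everywhere, so its product with g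
    is square-integrable.\<close>
  obtain C where "AE x in lebesgue_on \<Omega>. \<bar>\<rho> x\<bar> \<le> C" using P0_bounded[OF \<rho>P] by blast
  then have \<rho>g: "(\<lambda>x. \<rho> x *\<^sub>R g x) \<in> L2 \<Omega>"
    by (rule L2_mult_bounded[OF Linfty_L2[OF g bounded_\<Omega> \<Omega>_sets] L2_measurable[OF P0_L2[OF \<rho>P]]])
  have wL: "?w \<in> L2 \<Omega>" by (rule L2_add[OF f \<rho>g])
  have proj: "helmholtz_projector \<Omega> ?w \<in> L2 \<Omega>" "L2_inner \<Omega> (\<lambda>x. ?w x - helmholtz_projector \<Omega> ?w x) (Pi_h v) = 0"
    using helmholtz_projection[OF wL] XS by (auto simp: is_L2_projection_def L2_sigma_def)
  have "form_F \<Omega> f (Pi_h v) + form_G \<Omega> g \<rho> (Pi_h v) = L2_inner \<Omega> ?w (Pi_h v)"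
    unfolding form_F_def form_G_def by (rule L2_inner_add_left[OF f \<rho>g XL, symmetric])
  \<comment> \<open>The projection residual is orthogonal to the solenoidal field
    \<open>Pi_h v\<close>.\<close>
  also have "\<dots> = L2_inner \<Omega> (helmholtz_projector \<Omega> ?w) (Pi_h v)"
    using proj(2) L2_inner_diff_left[OF wL proj(1) XL] by simp
  finally show "form_a1 \<Omega> \<mu> u\<^sub>0 v = form_F \<Omega> f (Pi_h v) + form_G \<Omega> g \<rho> (Pi_h v) \<and>
      form_F \<Omega> f (Pi_h v) + form_G \<Omega> g \<rho> (Pi_h v) = L2_inner \<Omega> (helmholtz_projector \<Omega> ?w) (Pi_h v)"
    using eq[OF vV] a1 a2 b by simp
qed

end
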